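(* Let $\Bbbk$ be an algebraically closed field of characteristic $0$, and let $A$, $C$, $\mathcal{A}$, $S_\gamma$, $T_{\alpha,\beta}$ and $A(\lambda)$ be as defined in the context. (1) The set of isomorphism classes of finite-dimensional simple $A$-modules is $$\widehat{A}(\text{fin. dim.})=\{[S_\gamma]\mid\gamma\in\Bbbk^{\times}\}\cup\{[T_{\alpha,\beta}]\mid\alpha,\beta\in\Bbbk^{\times}\},$$ where $S_\gamma:=A/\langle s,x,y,g-\gamma\rangle$ is one-dimensional. (2) A simple $A$-module $M$ is infinite-dimensional if and only if the central element $C$ acts on $M$ as a nonzero scalar. Thus the set of isomorphism classes of infinite-dimensional simple $A$-modules is $$\widehat{A}(\text{infin. dim.})=\bigsqcup_{\lambda\in\Bbbk^{\times}}\widehat{A(\lambda)}.$$ Furthermore, for every $\lambda\in\Bbbk^{\times}$, the category of $A(\lambda)$-modules is equivalent to the category of $\mathcal{A}$-modules. In particular, there is a bijection $\widehat{A(\lambda)}\leftrightarrow\widehat{\mathcal{A}}$.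
   Context: All modules are left modules. $A$ (the bosonization of the super Jordan plane) is the $\Bbbk$-algebra generated by $x,y,g,g^{-1}$ with relations $x^2=0$, $ys-sy-xs=0$ where $s:=xy+yx$, $gg^{-1}=g^{-1}g=1$, $gxg^{-1}=-x$, $gyg^{-1}=-y+x$. Put $C:=(2yx-s)g^{-1}\in A$, a central element, and $A(\lambda):=A/(C-\lambda)A$ for $\lambda\in\Bbbk$. $\langle\cdots\rangle$ denotes the two-sided ideal generated by the listed elements. For an algebra $R$, $\widehat{R}$ denotes the set of isomorphism classes $[M]$ of simple $R$-modules $M$. For $\alpha,\beta\in\Bbbk^{\times}$, $T_{\alpha,\beta}=\Bbbk e_0\oplus\Bbbk e_1$ is the two-dimensional $A$-module with $se_i=xe_i=0$ $(i=0,1)$, $ye_0=\alpha e_0$, $ye_1=-\alpha e_1$, $ge_0=e_1$, $ge_1=\beta e_0$. The element $s$ is normal and regular; $A_s$ is the localization of $A$ at the powers of $s$; with $y':=ys^{-1}\in A_s$, $\mathcal{A}$ is the subalgebra of $A_s$ generated by $y'^2$ and $s^{\pm1}$ (one has $y'^2s-sy'^2=1$, and $\mathcal{A}$ is the localization at the powers of $s$ of the first Weyl algebra generated by $y'^2$ and $s$). *)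

theory Defs
  imports
    "HOL-Algebra.Algebraic_Closure_Type"
    "HOL-Algebra.Generated_Rings"
    "HOL-Library.Poly_Mapping"
    "HOL-Library.Product_Plus"
begin

section \<open>Left modules over a not necessarily commutative ring\<close>

text \<open>The library locale \<^locale>\<open>module\<close> requires a commutative base ring. As for library modules,
  only the additive structure, the carrier and the scalar multiplication of the record matter.\<close>

locale left_module = R?: ring R + M?: abelian_group M for R :: "'r ring" (structure) and M :: "('r, 'v) module" (structure) +
  assumes smult_closed:
      "\<lbrakk>a \<in> carrier R; m \<in> carrier M\<rbrakk> \<Longrightarrow> a \<odot>\<^bsub>M\<^esub> m \<in> carrier M"
    and smult_l_distr:
      "\<lbrakk>a \<in> carrier R; b \<in> carrier R; m \<in> carrier M\<rbrakk> \<Longrightarrow>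
        (a \<oplus>\<^bsub>R\<^esub> b) \<odot>\<^bsub>M\<^esub> m = a \<odot>\<^bsub>M\<^esub> m \<oplus>\<^bsub>M\<^esub> b \<odot>\<^bsub>M\<^esub> m"
    and smult_r_distr:
      "\<lbrakk>a \<in> carrier R; m \<in> carrier M; n \<in> carrier M\<rbrakk> \<Longrightarrow>
        a \<odot>\<^bsub>M\<^esub> (m \<oplus>\<^bsub>M\<^esub> n) = a \<odot>\<^bsub>M\<^esub> m \<oplus>\<^bsub>M\<^esub> a \<odot>\<^bsub>M\<^esub> n"
    and smult_assoc:
      "\<lbrakk>a \<in> carrier R; b \<in> carrier R; m \<in> carrier M\<rbrakk> \<Longrightarrow>
        (a \<otimes>\<^bsub>R\<^esub> b) \<odot>\<^bsub>M\<^esub> m = a \<odot>\<^bsub>M\<^esub> (b \<odot>\<^bsub>M\<^esub> m)"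
    and smult_one:
      "m \<in> carrier M \<Longrightarrow> \<one>\<^bsub>R\<^esub> \<odot>\<^bsub>M\<^esub> m = m"

definition simple_module :: "'r ring \<Rightarrow> ('r, 'v) module \<Rightarrow> bool" where
  "simple_module R M \<longleftrightarrow> left_module R M \<and> carrier M \<noteq> {\<zero>\<^bsub>M\<^esub>} \<and>
     (\<forall>H. submodule H R M \<longrightarrow> H = {\<zero>\<^bsub>M\<^esub>} \<or> H = carrier M)"

text \<open>Homomorphisms are extensional functions, so that equality of functions is equality of
  homomorphisms.\<close>

definition mod_hom :: "'r ring \<Rightarrow> ('r, 'v) module \<Rightarrow> ('r, 'w) module \<Rightarrow> ('v \<Rightarrow> 'w) set" where
  "mod_hom R M N = {f \<in> carrier M \<rightarrow>\<^sub>E carrier N.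
     (\<forall>m\<in>carrier M. \<forall>n\<in>carrier M. f (m \<oplus>\<^bsub>M\<^esub> n) = f m \<oplus>\<^bsub>N\<^esub> f n) \<and>
     (\<forall>a\<in>carrier R. \<forall>m\<in>carrier M. f (a \<odot>\<^bsub>M\<^esub> m) = a \<odot>\<^bsub>N\<^esub> f m)}"

definition mod_isomorphic :: "'r ring \<Rightarrow> ('r, 'v) module \<Rightarrow> ('r, 'w) module \<Rightarrow> bool" where
  "mod_isomorphic R M N \<longleftrightarrow> (\<exists>f \<in> mod_hom R M N. bij_betw f (carrier M) (carrier N))"

text \<open>There is no type of all modules. Isomorphism classes and module categories are therefore
  formed in a universe: the modules whose carrier is a set of elements of a type \<^typ>\<open>'v\<close>. The module
  \<^term>\<open>M\<close> representing the class need not itself lie in that universe.\<close>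

definition iso_class :: "'r ring \<Rightarrow> ('r, 'w) module \<Rightarrow> ('r, 'v) module set" where
  "iso_class R M = {N. left_module R N \<and> mod_isomorphic R M N}"

definition simple_classes :: "'r ring \<Rightarrow> ('r, 'v) module set set" where
  "simple_classes R = {iso_class R M | M :: ('r, 'v) module. simple_module R M}"

definition restrict_scalars :: "('r \<Rightarrow> 's) \<Rightarrow> ('s, 'v) module \<Rightarrow> ('r, 'v) module" where
  "restrict_scalars \<phi> N = \<lparr>carrier = carrier N, monoid.mult = monoid.mult N, one = one N, zero = zero N,
     add = add N, module.smult = (\<lambda>a m. \<phi> a \<odot>\<^bsub>N\<^esub> m)\<rparr>"

definition quotient_module :: "'r ring \<Rightarrow> 'r set \<Rightarrow> ('r, 'r set) module" where
  "quotient_module R I = \<lparr>carrier = carrier (R Quot I), monoid.mult = monoid.mult (R Quot I),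
     one = one (R Quot I), zero = zero (R Quot I), add = add (R Quot I),
     module.smult = (\<lambda>a u. (I +>\<^bsub>R\<^esub> a) \<otimes>\<^bsub>R Quot I\<^esub> u)\<rparr>"

text \<open>The map on isomorphism classes induced by a map \<^term>\<open>F\<close> on modules (which should respect
  isomorphism).\<close>

definition class_map ::
  "'s ring \<Rightarrow> (('r, 'v) module \<Rightarrow> ('s, 'v) module) \<Rightarrow> ('r, 'v) module set \<Rightarrow> ('s, 'v) module set" where
  "class_map S F c = (\<Union>M\<in>c. iso_class S (F M))"

text \<open>Here \<^term>\<open>\<kappa>\<close> is the structure map of a \<open>\<bbbk>\<close>-algebra \<^term>\<open>R\<close>, through which an
  \<^term>\<open>R\<close>-module becomes a vector space over \<open>\<bbbk>\<close>.\<close>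

definition has_dimension :: "('k \<Rightarrow> 'r) \<Rightarrow> ('r, 'v) module \<Rightarrow> nat \<Rightarrow> bool" where
  "has_dimension \<kappa> M n \<longleftrightarrow> (\<exists>B. finite B \<and> card B = n \<and> B \<subseteq> carrier M \<and>
     (\<forall>m\<in>carrier M. \<exists>!c. c \<in> B \<rightarrow>\<^sub>E UNIV \<and> m = (\<Oplus>\<^bsub>M\<^esub>b\<in>B. \<kappa> (c b) \<odot>\<^bsub>M\<^esub> b)))"

definition finite_dim :: "('k \<Rightarrow> 'r) \<Rightarrow> ('r, 'v) module \<Rightarrow> bool" where
  "finite_dim \<kappa> M \<longleftrightarrow> (\<exists>n. has_dimension \<kappa> M n)"

definition fin_dim_simple_classes :: "('k \<Rightarrow> 'r) \<Rightarrow> 'r ring \<Rightarrow> ('r, 'v) module set set" where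
  "fin_dim_simple_classes \<kappa> R =
     {iso_class R M | M :: ('r, 'v) module. simple_module R M \<and> finite_dim \<kappa> M}"

definition inf_dim_simple_classes :: "('k \<Rightarrow> 'r) \<Rightarrow> 'r ring \<Rightarrow> ('r, 'v) module set set" where
  "inf_dim_simple_classes \<kappa> R =
     {iso_class R M | M :: ('r, 'v) module. simple_module R M \<and> \<not> finite_dim \<kappa> M}"

section \<open>Equivalence of categories\<close>

text \<open>\<open>Comp C a b c g f\<close> is the composite of \<open>f : a \<rightarrow> b\<close> and \<open>g : b \<rightarrow> c\<close>.\<close>

record ('o, 'm) cat =
  Ob :: "'o set"
  Hom :: "'o \<Rightarrow> 'o \<Rightarrow> 'm set"
  Ident :: "'o \<Rightarrow> 'm"
  Comp :: "'o \<Rightarrow> 'o \<Rightarrow> 'o \<Rightarrow> 'm \<Rightarrow> 'm \<Rightarrow> 'm"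

locale category =
  fixes C :: "('o, 'm) cat"
  assumes ident_in: "a \<in> Ob C \<Longrightarrow> Ident C a \<in> Hom C a a"
    and comp_in: "\<lbrakk>a \<in> Ob C; b \<in> Ob C; c \<in> Ob C; f \<in> Hom C a b; g \<in> Hom C b c\<rbrakk>
      \<Longrightarrow> Comp C a b c g f \<in> Hom C a c"
    and ident_right: "\<lbrakk>a \<in> Ob C; b \<in> Ob C; f \<in> Hom C a b\<rbrakk> \<Longrightarrow> Comp C a a b f (Ident C a) = f"
    and ident_left: "\<lbrakk>a \<in> Ob C; b \<in> Ob C; f \<in> Hom C a b\<rbrakk> \<Longrightarrow> Comp C a b b (Ident C b) f = f"
    and comp_assoc: "\<lbrakk>a \<in> Ob C; b \<in> Ob C; c \<in> Ob C; d \<in> Ob C;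
        f \<in> Hom C a b; g \<in> Hom C b c; h \<in> Hom C c d\<rbrakk>
      \<Longrightarrow> Comp C a c d h (Comp C a b c g f) = Comp C a b d (Comp C b c d h g) f"

locale cat_functor = C: category C + D: category D
  for C :: "('o, 'm) cat" and D :: "('p, 'n) cat" +
  fixes Fo :: "'o \<Rightarrow> 'p" and Fm :: "'o \<Rightarrow> 'o \<Rightarrow> 'm \<Rightarrow> 'n"
  assumes ob_map: "a \<in> Ob C \<Longrightarrow> Fo a \<in> Ob D"
    and hom_map: "\<lbrakk>a \<in> Ob C; b \<in> Ob C; f \<in> Hom C a b\<rbrakk> \<Longrightarrow> Fm a b f \<in> Hom D (Fo a) (Fo b)"
    and ident_map: "a \<in> Ob C \<Longrightarrow> Fm a a (Ident C a) = Ident D (Fo a)"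
    and comp_map: "\<lbrakk>a \<in> Ob C; b \<in> Ob C; c \<in> Ob C; f \<in> Hom C a b; g \<in> Hom C b c\<rbrakk>
      \<Longrightarrow> Fm a c (Comp C a b c g f) = Comp D (Fo a) (Fo b) (Fo c) (Fm b c g) (Fm a b f)"

definition cat_iso :: "('o, 'm) cat \<Rightarrow> 'o \<Rightarrow> 'o \<Rightarrow> 'm \<Rightarrow> bool" where
  "cat_iso C a b f \<longleftrightarrow> f \<in> Hom C a b \<and>
     (\<exists>g\<in>Hom C b a. Comp C a b a g f = Ident C a \<and> Comp C b a b f g = Ident C b)"

definition naturally_isomorphic ::
  "('o, 'm) cat \<Rightarrow> ('p, 'n) cat \<Rightarrow> ('o \<Rightarrow> 'p) \<Rightarrow> ('o \<Rightarrow> 'o \<Rightarrow> 'm \<Rightarrow> 'n) \<Rightarrow>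
    ('o \<Rightarrow> 'p) \<Rightarrow> ('o \<Rightarrow> 'o \<Rightarrow> 'm \<Rightarrow> 'n) \<Rightarrow> bool" where
  "naturally_isomorphic C D Fo Fm Go Gm \<longleftrightarrow>
     (\<exists>\<eta>. (\<forall>a\<in>Ob C. cat_iso D (Fo a) (Go a) (\<eta> a)) \<and>
       (\<forall>a\<in>Ob C. \<forall>b\<in>Ob C. \<forall>f\<in>Hom C a b.
          Comp D (Fo a) (Fo b) (Go b) (\<eta> b) (Fm a b f) = Comp D (Fo a) (Go a) (Go b) (Gm a b f) (\<eta> a)))"

definition is_equivalence ::
  "('o, 'm) cat \<Rightarrow> ('p, 'n) cat \<Rightarrow> ('o \<Rightarrow> 'p) \<Rightarrow> ('o \<Rightarrow> 'o \<Rightarrow> 'm \<Rightarrow> 'n) \<Rightarrow> bool" where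
  "is_equivalence C D Fo Fm \<longleftrightarrow> cat_functor C D Fo Fm \<and>
     (\<exists>Go Gm. cat_functor D C Go Gm \<and>
        naturally_isomorphic C C (\<lambda>a. Go (Fo a)) (\<lambda>a b f. Gm (Fo a) (Fo b) (Fm a b f))
          (\<lambda>a. a) (\<lambda>a b f. f) \<and>
        naturally_isomorphic D D (\<lambda>a. Fo (Go a)) (\<lambda>a b f. Fm (Go a) (Go b) (Gm a b f))
          (\<lambda>a. a) (\<lambda>a b f. f))"

definition module_cat :: "'r ring \<Rightarrow> (('r, 'v) module, 'v \<Rightarrow> 'v) cat" where
  "module_cat R = \<lparr>Ob = {M. left_module R M}, Hom = mod_hom R, Ident = (\<lambda>M. \<lambda>m\<in>carrier M. m),
     Comp = (\<lambda>L M N g f. compose (carrier L) g f)\<rparr>"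

lemma category_module_cat: "category (module_cat R :: (('r, 'v) module, 'v \<Rightarrow> 'v) cat)"
proof
  fix a :: "('r, 'v) module" assume "a \<in> Ob (module_cat R)"
  then interpret left_module R a by (simp add: module_cat_def)
  show "Ident (module_cat R) a \<in> Hom (module_cat R) a a"
    by (auto simp: module_cat_def mod_hom_def smult_closed)
next
  fix a b c :: "('r, 'v) module" and f g
  assume *: "a \<in> Ob (module_cat R)" "b \<in> Ob (module_cat R)" "c \<in> Ob (module_cat R)"
    "f \<in> Hom (module_cat R) a b" "g \<in> Hom (module_cat R) b c"
  interpret left_module R a using * by (simp add: module_cat_def)
  show "Comp (module_cat R) a b c g f \<in> Hom (module_cat R) a c"
    using * smult_closed by (auto simp: module_cat_def mod_hom_def compose_def PiE_iff)
next
  fix a b :: "('r, 'v) module" and f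
  assume "a \<in> Ob (module_cat R)" "b \<in> Ob (module_cat R)" "f \<in> Hom (module_cat R) a b"
  then show "Comp (module_cat R) a a b f (Ident (module_cat R) a) = f" "Comp (module_cat R) a b b (Ident (module_cat R) b) f = f"
    by (auto simp: module_cat_def mod_hom_def compose_def PiE_iff extensional_def fun_eq_iff)
next
  fix a b c d :: "('r, 'v) module" and f g h
  assume "f \<in> Hom (module_cat R) a b"
  then show "Comp (module_cat R) a c d h (Comp (module_cat R) a b c g f) = Comp (module_cat R) a b d (Comp (module_cat R) b c d h g) f"
    by (auto simp: module_cat_def mod_hom_def compose_def PiE_iff fun_eq_iff)
qed

section \<open>Localization at the powers of an element\<close>

text \<open>The ring of left fractions at the powers of \<^term>\<open>s\<close>, where the pair \<open>(m, a)\<close> stands for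
  \<open>s\<^sup>-\<^sup>m a\<close>. If \<^term>\<open>s\<close> is normal and regular, then the left multiples and the right multiples of
  \<open>s\<^sup>n\<close> are the same elements, so for every \<^term>\<open>a\<close> there is a unique \<open>a'\<close> with
  \<open>s\<^sup>n a = a' s\<^sup>n\<close>; this gives \<open>a s\<^sup>-\<^sup>n = s\<^sup>-\<^sup>n a'\<close> and hence the product
  \<open>(s\<^sup>-\<^sup>m a) (s\<^sup>-\<^sup>n b) = s\<^sup>-\<^sup>(\<^sup>m\<^sup>+\<^sup>n\<^sup>) a' b\<close>.\<close>

definition fraction :: "'r ring \<Rightarrow> 'r \<Rightarrow> nat \<Rightarrow> 'r \<Rightarrow> (nat \<times> 'r) set" where
  "fraction R s m a = {(n, b). b \<in> carrier R \<and>
     (\<exists>j::nat. s [^]\<^bsub>R\<^esub> (j + n) \<otimes>\<^bsub>R\<^esub> a = s [^]\<^bsub>R\<^esub> (j + m) \<otimes>\<^bsub>R\<^esub> b)}"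

definition localization :: "'r ring \<Rightarrow> 'r \<Rightarrow> (nat \<times> 'r) set ring" where
  "localization R s = \<lparr>
     carrier = {fraction R s m a | m a. a \<in> carrier R},
     monoid.mult = (\<lambda>P Q. \<Union>{fraction R s (m + n) (a' \<otimes>\<^bsub>R\<^esub> b) | m a n b a'.
        (m, a) \<in> P \<and> (n, b) \<in> Q \<and> a' \<in> carrier R \<and>
        s [^]\<^bsub>R\<^esub> n \<otimes>\<^bsub>R\<^esub> a = a' \<otimes>\<^bsub>R\<^esub> s [^]\<^bsub>R\<^esub> n}),
     one = fraction R s 0 \<one>\<^bsub>R\<^esub>,
     zero = fraction R s 0 \<zero>\<^bsub>R\<^esub>,
     add = (\<lambda>P Q. \<Union>{fraction R s (m + n) (s [^]\<^bsub>R\<^esub> n \<otimes>\<^bsub>R\<^esub> a \<oplus>\<^bsub>R\<^esub> s [^]\<^bsub>R\<^esub> m \<otimes>\<^bsub>R\<^esub> b) | m a n b.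
        (m, a) \<in> P \<and> (n, b) \<in> Q})\<rparr>"

section \<open>The bosonization of the super Jordan plane\<close>

text \<open>The free algebra is the monoid algebra of the free monoid.\<close>

datatype 'g free_monoid = Word (letters: "'g list")

instantiation free_monoid :: (type) monoid_add
begin

definition zero_free_monoid :: "'a free_monoid" where
  "0 = Word []"

definition plus_free_monoid :: "'a free_monoid \<Rightarrow> 'a free_monoid \<Rightarrow> 'a free_monoid" where
  "u + v = Word (letters u @ letters v)"

instance
  by standard (simp_all add: zero_free_monoid_def plus_free_monoid_def)

end

type_synonym ('g, 'k) free_algebra = "'g free_monoid \<Rightarrow>\<^sub>0 'k"

datatype gen = GenX | GenY | GenG | GenGinv

definition var :: "'g \<Rightarrow> ('g, 'k::field) free_algebra" where
  "var v = Poly_Mapping.single (Word [v]) 1"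

definition const :: "'k::field \<Rightarrow> ('g, 'k) free_algebra" where
  "const c = Poly_Mapping.single 0 c"

definition relators :: "(gen, 'k::field) free_algebra set" where
  "relators = (let x = var GenX; y = var GenY; g = var GenG; gi = var GenGinv; s = x * y + y * x in
     {x * x, y * s - s * y - x * s, g * gi - 1, gi * g - 1, g * x * gi - (- x), g * y * gi - (- y + x)})"

definition relation_ideal :: "(gen, 'k::field) free_algebra set" where
  "relation_ideal = genideal ring_of_type_algebra relators"

type_synonym 'k elt = "(gen, 'k) free_algebra set"

definition A_alg :: "'k::field elt ring" where
  "A_alg = ring_of_type_algebra Quot relation_ideal"

definition A_proj :: "(gen, 'k::field) free_algebra \<Rightarrow> 'k elt" where
  "A_proj p = relation_ideal +>\<^bsub>ring_of_type_algebra\<^esub> p"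

definition A_scalar :: "'k::field \<Rightarrow> 'k elt" where "A_scalar c = A_proj (const c)"
definition elt_x :: "'k::field elt" where "elt_x = A_proj (var GenX)"
definition elt_y :: "'k::field elt" where "elt_y = A_proj (var GenY)"
definition elt_g :: "'k::field elt" where "elt_g = A_proj (var GenG)"
definition elt_ginv :: "'k::field elt" where "elt_ginv = A_proj (var GenGinv)"
definition elt_s :: "'k::field elt" where "elt_s = elt_x \<otimes>\<^bsub>A_alg\<^esub> elt_y \<oplus>\<^bsub>A_alg\<^esub> elt_y \<otimes>\<^bsub>A_alg\<^esub> elt_x"

definition elt_C :: "'k::field elt" where
  "elt_C = (A_scalar 2 \<otimes>\<^bsub>A_alg\<^esub> (elt_y \<otimes>\<^bsub>A_alg\<^esub> elt_x) \<ominus>\<^bsub>A_alg\<^esub> elt_s) \<otimes>\<^bsub>A_alg\<^esub> elt_ginv"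

definition central_ideal :: "'k::field \<Rightarrow> 'k elt set" where
  "central_ideal \<mu> = {(elt_C \<ominus>\<^bsub>A_alg\<^esub> A_scalar \<mu>) \<otimes>\<^bsub>A_alg\<^esub> a | a. a \<in> carrier A_alg}"

definition A_quot :: "'k::field \<Rightarrow> 'k elt set ring" where
  "A_quot \<mu> = A_alg Quot central_ideal \<mu>"

definition A_quot_proj :: "'k::field \<Rightarrow> 'k elt \<Rightarrow> 'k elt set" where
  "A_quot_proj \<mu> a = central_ideal \<mu> +>\<^bsub>A_alg\<^esub> a"

definition inflate ::
  "'k::field \<Rightarrow> ('k elt set, 'v) module set \<Rightarrow> ('k elt, 'v) module set" where
  "inflate \<mu> = class_map A_alg (restrict_scalars (A_quot_proj \<mu>))"

definition A_loc :: "(nat \<times> 'k::field elt) set ring" where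
  "A_loc = localization A_alg elt_s"

definition A_loc_y' :: "(nat \<times> 'k::field elt) set" where
  "A_loc_y' = fraction A_alg elt_s 0 elt_y \<otimes>\<^bsub>A_loc\<^esub> fraction A_alg elt_s 1 \<one>\<^bsub>A_alg\<^esub>"

text \<open>The subalgebra \<open>\<A>\<close> of \<^const>\<open>A_loc\<close>. The scalars are among the generators because
  \<^const>\<open>generate_ring\<close> generates a subring.\<close>

definition A_cal :: "(nat \<times> 'k::field elt) set ring" where
  "A_cal = A_loc\<lparr>carrier := generate_ring A_loc
     (range (\<lambda>c. fraction A_alg elt_s 0 (A_scalar c)) \<union>
      {A_loc_y' \<otimes>\<^bsub>A_loc\<^esub> A_loc_y', fraction A_alg elt_s 0 elt_s, fraction A_alg elt_s 1 \<one>\<^bsub>A_alg\<^esub>})\<rparr>"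

section \<open>The finite-dimensional simple modules\<close>

definition S_module :: "'k::field \<Rightarrow> ('k elt, 'k elt set) module" where
  "S_module \<gamma> = quotient_module A_alg (genideal A_alg {elt_s, elt_x, elt_y, elt_g \<ominus>\<^bsub>A_alg\<^esub> A_scalar \<gamma>})"

text \<open>The pair \<open>(a, b)\<close> stands for \<open>a e\<^sub>0 + b e\<^sub>1\<close>. The generators act by the operators \<open>T_gen\<close> and
  the free algebra by the linear extension \<open>T_act\<close>.\<close>

fun T_gen :: "'k::field \<Rightarrow> 'k \<Rightarrow> gen \<Rightarrow> 'k \<times> 'k \<Rightarrow> 'k \<times> 'k" where
  "T_gen \<alpha> \<beta> GenX (a, b) = (0, 0)"
| "T_gen \<alpha> \<beta> GenY (a, b) = (\<alpha> * a, - \<alpha> * b)"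
| "T_gen \<alpha> \<beta> GenG (a, b) = (\<beta> * b, a)"
| "T_gen \<alpha> \<beta> GenGinv (a, b) = (b, a / \<beta>)"

definition T_act :: "'k::field \<Rightarrow> 'k \<Rightarrow> (gen, 'k) free_algebra \<Rightarrow> 'k \<times> 'k \<Rightarrow> 'k \<times> 'k" where
  "T_act \<alpha> \<beta> p v = (\<Sum>w\<in>Poly_Mapping.keys p.
     map_prod ((*) (Poly_Mapping.lookup p w)) ((*) (Poly_Mapping.lookup p w))
       (foldr (T_gen \<alpha> \<beta>) (letters w) v))"

text \<open>An element of \<^const>\<open>A_alg\<close> is a residue class; its action is the common action of its
  representatives, which exists for \<open>\<beta> \<noteq> 0\<close>.\<close>

definition T_module :: "'k::field \<Rightarrow> 'k \<Rightarrow> ('k elt, 'k \<times> 'k) module" where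
  "T_module \<alpha> \<beta> = \<lparr>carrier = UNIV, monoid.mult = undefined, one = undefined, zero = 0, add = (+),
     module.smult = (\<lambda>a v. THE u. \<forall>p\<in>a. T_act \<alpha> \<beta> p v = u)\<rparr>"

end

theory Submission imports Defs begin

text \<open>On a simple module the normal element \<open>s\<close> is zero or bijective. If \<open>s = 0\<close>, then \<open>x = 0\<close>, and
  \<open>y\<close> and \<open>g\<close> anticommute, which leaves \<open>S\<^sub>\<gamma>\<close> and \<open>T\<^sub>\<alpha>\<^sub>,\<^sub>\<beta>\<close>. If \<open>s\<close> is bijective, then the kernel
  \<open>K\<close> of \<open>x\<close> is a module over the localized Weyl algebra, so it has infinite dimension, and
  \<open>M = K \<oplus> y K\<close> because \<open>x y = s\<close> on \<open>K\<close>.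

  The field may be countable, so Schur's lemma does not by itself make \<open>C\<close> a scalar. Suppose that no
  \<open>C - a\<close> kills \<open>M\<close>; then they are all bijective and commute with the action of the Weyl algebra on
  \<open>K\<close>. But up to inverting one polynomial and its shifts by \<open>s\<close>, \<open>K\<close> is free over the polynomial
  ring generated by \<open>C\<close>, or by \<open>C\<close> and the Euler operator \<open>E\<close>, and there some \<open>C - a\<close> is not
  invertible.

  If \<open>C = \<mu> \<noteq> 0\<close>, then \<open>s\<^sup>2 = \<mu>\<^sup>2 g\<^sup>2\<close> makes \<open>s\<close> bijective, and \<open>g\<close> acts on \<open>K\<close> as \<open>- \<mu>\<^sup>-\<^sup>1 s\<close>. Hence
  the whole action is determined by the \<open>\<A>\<close>-module \<open>K\<close>, and every \<open>\<A>\<close>-module \<open>V\<close> arises from the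
  \<open>A(\<mu>)\<close>-module \<open>V \<oplus> V\<close>. The universe being infinite, \<open>V \<oplus> V\<close> embeds in it.\<close>

section \<open>Left modules\<close>

text \<open>The failure of \<open>C - a\<close> to be invertible is generic freeness made
  elementary. One takes a family \<open>e\<close> that is independent over the coefficient ring, and
  a multiplicative set of denominators none of which is a multiple of \<open>C - a\<close>. The
  vectors that some denominator moves into the span of \<open>e\<close> (\<open>local_span\<close>)
  form a nonzero subspace stable under the whole action, hence are everything. A solution
  \<open>u\<close> of \<open>(C - a) u = e i\<close> would then be a fraction, and comparing
  coefficients makes \<open>C - a\<close> divide a denominator (\<open>lspan_divisor\<close>). The
  number \<open>a\<close> is chosen after the family, off the roots of the one polynomial by which
  the action on \<open>e\<close> has to be divided; this takes the place of an uncountability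
  argument.

  The denominators must also survive \<open>s\<close>, which shifts \<open>E\<close> by one. Since
  \<open>C - a\<close> is constant in \<open>E\<close>, it divides a polynomial if and only if it
  divides the shifted one. With \<open>g\<close>, \<open>y\<close> and \<open>g^2\<close> in place
  of \<open>C\<close>, the same device produces the eigenvectors needed when
  \<open>s = 0\<close>.\<close>

lemma left_moduleI:
  assumes "ring R" "abelian_group M"
    and "\<And>a m. \<lbrakk>a \<in> carrier R; m \<in> carrier M\<rbrakk> \<Longrightarrow> a \<odot>\<^bsub>M\<^esub> m \<in> carrier M"
    and "\<And>a b m. \<lbrakk>a \<in> carrier R; b \<in> carrier R; m \<in> carrier M\<rbrakk> \<Longrightarrow>
        (a \<oplus>\<^bsub>R\<^esub> b) \<odot>\<^bsub>M\<^esub> m = a \<odot>\<^bsub>M\<^esub> m \<oplus>\<^bsub>M\<^esub> b \<odot>\<^bsub>M\<^esub> m"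
    and "\<And>a m n. \<lbrakk>a \<in> carrier R; m \<in> carrier M; n \<in> carrier M\<rbrakk> \<Longrightarrow>
        a \<odot>\<^bsub>M\<^esub> (m \<oplus>\<^bsub>M\<^esub> n) = a \<odot>\<^bsub>M\<^esub> m \<oplus>\<^bsub>M\<^esub> a \<odot>\<^bsub>M\<^esub> n"
    and "\<And>a b m. \<lbrakk>a \<in> carrier R; b \<in> carrier R; m \<in> carrier M\<rbrakk> \<Longrightarrow>
        (a \<otimes>\<^bsub>R\<^esub> b) \<odot>\<^bsub>M\<^esub> m = a \<odot>\<^bsub>M\<^esub> (b \<odot>\<^bsub>M\<^esub> m)"
    and "\<And>m. m \<in> carrier M \<Longrightarrow> \<one>\<^bsub>R\<^esub> \<odot>\<^bsub>M\<^esub> m = m"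
  shows "left_module R M"
  using assms by (intro left_module.intro left_module_axioms.intro) auto

context left_module begin

declare smult_closed [simp]

lemma smult_l_null [simp]: "m \<in> carrier M \<Longrightarrow> \<zero> \<odot>\<^bsub>M\<^esub> m = \<zero>\<^bsub>M\<^esub>"
  using smult_l_distr[of \<zero> \<zero> m] by (metis M.add.r_cancel_one' R.l_zero R.zero_closed smult_closed)

lemma smult_r_null [simp]: "a \<in> carrier R \<Longrightarrow> a \<odot>\<^bsub>M\<^esub> \<zero>\<^bsub>M\<^esub> = \<zero>\<^bsub>M\<^esub>"
  using smult_r_distr[of a "\<zero>\<^bsub>M\<^esub>" "\<zero>\<^bsub>M\<^esub>"] by (metis M.add.r_cancel_one' M.l_zero M.zero_closed smult_closed)

lemma smult_l_minus: "\<lbrakk>a \<in> carrier R; m \<in> carrier M\<rbrakk> \<Longrightarrow> (\<ominus> a) \<odot>\<^bsub>M\<^esub> m = \<ominus>\<^bsub>M\<^esub> (a \<odot>\<^bsub>M\<^esub> m)"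
  using smult_l_distr[of "\<ominus> a" a m] by (metis M.minus_equality R.add.inv_closed R.l_neg smult_closed smult_l_null)

lemma smult_r_minus: "\<lbrakk>a \<in> carrier R; m \<in> carrier M\<rbrakk> \<Longrightarrow> a \<odot>\<^bsub>M\<^esub> (\<ominus>\<^bsub>M\<^esub> m) = \<ominus>\<^bsub>M\<^esub> (a \<odot>\<^bsub>M\<^esub> m)"
  using smult_r_distr[of a "\<ominus>\<^bsub>M\<^esub> m" m] by (metis M.minus_equality M.add.inv_closed M.l_neg smult_closed smult_r_null)

lemma submoduleI:
  assumes "H \<subseteq> carrier M" "\<zero>\<^bsub>M\<^esub> \<in> H"
    and add: "\<And>m n. \<lbrakk>m \<in> H; n \<in> H\<rbrakk> \<Longrightarrow> m \<oplus>\<^bsub>M\<^esub> n \<in> H"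
    and smult: "\<And>a m. \<lbrakk>a \<in> carrier R; m \<in> H\<rbrakk> \<Longrightarrow> a \<odot>\<^bsub>M\<^esub> m \<in> H"
  shows "submodule H R M"
proof -
  have "\<ominus>\<^bsub>M\<^esub> m \<in> H" if "m \<in> H" for m
    using smult[of "\<ominus> \<one>" m] that assms(1) by (auto simp: smult_l_minus smult_one subset_iff)
  then show ?thesis
    using assms by (intro submodule.intro subgroup.intro submodule_axioms.intro) (auto simp: a_inv_def)
qed

lemma submoduleD:
  assumes "submodule H R M"
  shows "H \<subseteq> carrier M" "\<zero>\<^bsub>M\<^esub> \<in> H" "\<And>m n. \<lbrakk>m \<in> H; n \<in> H\<rbrakk> \<Longrightarrow> m \<oplus>\<^bsub>M\<^esub> n \<in> H"
    "\<And>a m. \<lbrakk>a \<in> carrier R; m \<in> H\<rbrakk> \<Longrightarrow> a \<odot>\<^bsub>M\<^esub> m \<in> H"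
    "\<And>m. m \<in> H \<Longrightarrow> \<ominus>\<^bsub>M\<^esub> m \<in> H"
proof -
  interpret H: submodule H R M by fact
  show "H \<subseteq> carrier M" using H.subset by simp
  show "\<zero>\<^bsub>M\<^esub> \<in> H" using H.one_closed by simp
  show "\<And>m n. \<lbrakk>m \<in> H; n \<in> H\<rbrakk> \<Longrightarrow> m \<oplus>\<^bsub>M\<^esub> n \<in> H" using H.m_closed by simp
  show "\<And>a m. \<lbrakk>a \<in> carrier R; m \<in> H\<rbrakk> \<Longrightarrow> a \<odot>\<^bsub>M\<^esub> m \<in> H" by simp
  show "\<And>m. m \<in> H \<Longrightarrow> \<ominus>\<^bsub>M\<^esub> m \<in> H" using H.m_inv_closed by (simp add: a_inv_def)
qed

lemma submodule_left_module:
  assumes "submodule H R M"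
  shows "left_module R (M\<lparr>carrier := H\<rparr>)"
proof (rule left_moduleI)
  note H = submoduleD[OF assms]
  have "\<exists>n\<in>H. n \<oplus>\<^bsub>M\<^esub> m = \<zero>\<^bsub>M\<^esub>" if "m \<in> H" for m
    using that H(1,5) by (metis M.l_neg subsetD)
  then show "abelian_group (M\<lparr>carrier := H\<rparr>)"
    using H by (intro abelian_groupI) (auto simp: M.a_ac subset_iff)
qed (use R.ring_axioms submoduleD[OF assms] in \<open>auto simp: smult_l_distr smult_r_distr smult_assoc smult_one subset_iff\<close>)

lemma subring_left_module:
  assumes "subring K R"
  shows "left_module (R\<lparr>carrier := K\<rparr>) M"
proof (rule left_moduleI)
  show "ring (R\<lparr>carrier := K\<rparr>)" using assms R.subring_is_ring by blast
  show "abelian_group M" ..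
qed (use subringE(1)[OF assms] in \<open>auto simp: smult_l_distr smult_r_distr smult_assoc smult_one subset_iff\<close>)

lemma restrict_scalars_left_module:
  assumes "ring S" "\<phi> \<in> ring_hom S R"
  shows "left_module S (restrict_scalars \<phi> M)"
proof (rule left_moduleI)
  have "\<exists>n\<in>carrier M. n \<oplus>\<^bsub>M\<^esub> m = \<zero>\<^bsub>M\<^esub>" if "m \<in> carrier M" for m
    using that by (metis M.l_neg M.a_inv_closed)
  then show "abelian_group (restrict_scalars \<phi> M)"
    by (intro abelian_groupI) (auto simp: restrict_scalars_def M.a_ac)
qed (use assms in \<open>auto simp: restrict_scalars_def smult_l_distr smult_r_distr smult_assoc smult_one
    ring_hom_closed ring_hom_add ring_hom_mult ring_hom_one\<close>)

end

lemma simple_moduleD: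
  assumes "simple_module R M"
  shows "left_module R M" "carrier M \<noteq> {\<zero>\<^bsub>M\<^esub>}"
    "submodule H R M \<Longrightarrow> H = {\<zero>\<^bsub>M\<^esub>} \<or> H = carrier M"
  using assms by (auto simp: simple_module_def)

lemma simple_module_nonzero:
  assumes "simple_module R M"
  obtains m where "m \<in> carrier M" "m \<noteq> \<zero>\<^bsub>M\<^esub>"
proof -
  interpret left_module R M using assms by (rule simple_moduleD)
  show ?thesis using simple_moduleD(2)[OF assms] that M.zero_closed by blast
qed

section \<open>Homomorphisms\<close>

lemma mod_homD:
  assumes "f \<in> mod_hom R M N"
  shows "m \<in> carrier M \<Longrightarrow> f m \<in> carrier N"
    "\<lbrakk>m \<in> carrier M; n \<in> carrier M\<rbrakk> \<Longrightarrow> f (m \<oplus>\<^bsub>M\<^esub> n) = f m \<oplus>\<^bsub>N\<^esub> f n"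
    "\<lbrakk>a \<in> carrier R; m \<in> carrier M\<rbrakk> \<Longrightarrow> f (a \<odot>\<^bsub>M\<^esub> m) = a \<odot>\<^bsub>N\<^esub> f m"
    "f \<in> extensional (carrier M)"
  using assms by (auto simp: mod_hom_def PiE_def)

lemma restrict_mod_hom:
  assumes "left_module R M" "\<And>m. m \<in> carrier M \<Longrightarrow> f m \<in> carrier N"
    "\<And>m n. \<lbrakk>m \<in> carrier M; n \<in> carrier M\<rbrakk> \<Longrightarrow> f (m \<oplus>\<^bsub>M\<^esub> n) = f m \<oplus>\<^bsub>N\<^esub> f n"
    "\<And>a m. \<lbrakk>a \<in> carrier R; m \<in> carrier M\<rbrakk> \<Longrightarrow> f (a \<odot>\<^bsub>M\<^esub> m) = a \<odot>\<^bsub>N\<^esub> f m"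
  shows "restrict f (carrier M) \<in> mod_hom R M N"
proof -
  interpret left_module R M by fact
  show ?thesis using assms by (auto simp: mod_hom_def)
qed

lemma mod_isomorphicI:
  assumes "left_module R M" "bij_betw f (carrier M) (carrier N)"
    "\<And>m n. \<lbrakk>m \<in> carrier M; n \<in> carrier M\<rbrakk> \<Longrightarrow> f (m \<oplus>\<^bsub>M\<^esub> n) = f m \<oplus>\<^bsub>N\<^esub> f n"
    "\<And>a m. \<lbrakk>a \<in> carrier R; m \<in> carrier M\<rbrakk> \<Longrightarrow> f (a \<odot>\<^bsub>M\<^esub> m) = a \<odot>\<^bsub>N\<^esub> f m"
  shows "mod_isomorphic R M N"
proof -
  have "restrict f (carrier M) \<in> mod_hom R M N"
    using assms by (intro restrict_mod_hom) (auto simp: bij_betw_def)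
  then show ?thesis
    unfolding mod_isomorphic_def using assms(2) by (metis bij_betw_restrict_eq)
qed

lemma mod_isomorphic_refl: "left_module R M \<Longrightarrow> mod_isomorphic R M M"
  by (rule mod_isomorphicI[where f = "\<lambda>m. m"]) (auto simp: bij_betw_def)

lemma inv_into_hom:
  assumes "left_module R M" "f \<in> mod_hom R M N" "bij_betw f (carrier M) (carrier N)"
  shows "\<lbrakk>m \<in> carrier N; n \<in> carrier N\<rbrakk> \<Longrightarrow>
      inv_into (carrier M) f (m \<oplus>\<^bsub>N\<^esub> n) = inv_into (carrier M) f m \<oplus>\<^bsub>M\<^esub> inv_into (carrier M) f n"
    "\<lbrakk>a \<in> carrier R; m \<in> carrier N\<rbrakk> \<Longrightarrow>
      inv_into (carrier M) f (a \<odot>\<^bsub>N\<^esub> m) = a \<odot>\<^bsub>M\<^esub> inv_into (carrier M) f m"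
proof -
  interpret left_module R M by fact
  let ?g = "inv_into (carrier M) f"
  have g: "?g n \<in> carrier M" "f (?g n) = n" if "n \<in> carrier N" for n
    using that assms(3) by (auto simp: bij_betw_def inv_into_into f_inv_into_f)
  have gf: "?g (f m) = m" if "m \<in> carrier M" for m
    using that assms(3) by (simp add: bij_betw_inv_into_left)
  show "?g (m \<oplus>\<^bsub>N\<^esub> n) = ?g m \<oplus>\<^bsub>M\<^esub> ?g n" if "m \<in> carrier N" "n \<in> carrier N"
    using gf[of "?g m \<oplus>\<^bsub>M\<^esub> ?g n"] g that mod_homD(2)[OF assms(2), of "?g m" "?g n"] by simp
  show "?g (a \<odot>\<^bsub>N\<^esub> m) = a \<odot>\<^bsub>M\<^esub> ?g m" if "a \<in> carrier R" "m \<in> carrier N"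
    using gf[of "a \<odot>\<^bsub>M\<^esub> ?g m"] g that mod_homD(3)[OF assms(2), of a "?g m"] by simp
qed

lemma mod_isomorphic_sym:
  assumes "left_module R M" "left_module R N" "mod_isomorphic R M N"
  shows "mod_isomorphic R N M"
proof -
  obtain f where f: "f \<in> mod_hom R M N" "bij_betw f (carrier M) (carrier N)"
    using assms(3) by (auto simp: mod_isomorphic_def)
  show ?thesis
    by (rule mod_isomorphicI[OF assms(2) bij_betw_inv_into[OF f(2)]])
      (use inv_into_hom[OF assms(1) f] in auto)
qed

lemma mod_isomorphic_trans:
  assumes "left_module R L" "mod_isomorphic R L M" "mod_isomorphic R M N"
  shows "mod_isomorphic R L N"
proof -
  obtain f g where f: "f \<in> mod_hom R L M" "bij_betw f (carrier L) (carrier M)"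
    and g: "g \<in> mod_hom R M N" "bij_betw g (carrier M) (carrier N)"
    using assms by (auto simp: mod_isomorphic_def)
  show ?thesis
    by (rule mod_isomorphicI[OF assms(1) bij_betw_trans[OF f(2) g(2)]])
      (auto simp: mod_homD[OF f(1)] mod_homD[OF g(1)])
qed

lemma iso_class_eq:
  assumes "left_module R M" "left_module R N" "mod_isomorphic R M N"
  shows "iso_class R M = iso_class R N"
  unfolding iso_class_def
  using mod_isomorphic_trans[OF assms(1,3)] mod_isomorphic_trans[OF assms(2) mod_isomorphic_sym[OF assms]]
  by (intro Collect_cong conj_cong refl iffI)

text \<open>Both modules live on the type over which the class is formed, so \<open>N\<close> is a
  member of its own class. \<open>iso_class_eq\<close> also admits representatives on other
  types.\<close>

lemma iso_class_eq_iff: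
  fixes M N :: "('r, 'v) module"
  assumes "left_module R M" "left_module R N"
  shows "iso_class R M = (iso_class R N :: ('r, 'v) module set) \<longleftrightarrow> mod_isomorphic R M N"
proof
  assume "iso_class R M = (iso_class R N :: ('r, 'v) module set)"
  then have "N \<in> iso_class R M" using assms by (simp add: iso_class_def mod_isomorphic_refl)
  then show "mod_isomorphic R M N" by (simp add: iso_class_def)
qed (use assms iso_class_eq in blast)

lemma mod_hom_zero:
  assumes "left_module R M" "left_module R N" "f \<in> mod_hom R M N"
  shows "f \<zero>\<^bsub>M\<^esub> = \<zero>\<^bsub>N\<^esub>"
proof -
  interpret M: left_module R M by fact
  interpret N: left_module R N by fact
  show ?thesis
    using mod_homD(2)[OF assms(3), of "\<zero>\<^bsub>M\<^esub>" "\<zero>\<^bsub>M\<^esub>"] mod_homD(1)[OF assms(3), of "\<zero>\<^bsub>M\<^esub>"]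
    by (metis M.M.l_zero M.M.zero_closed N.M.add.r_cancel_one')
qed

lemma mod_hom_kernel:
  assumes "left_module R M" "left_module R N" "f \<in> mod_hom R M N"
  shows "submodule {m \<in> carrier M. f m = \<zero>\<^bsub>N\<^esub>} R M"
proof -
  interpret M: left_module R M by fact
  interpret N: left_module R N by fact
  show ?thesis
    by (rule M.submoduleI) (auto simp: mod_homD[OF assms(3)] mod_hom_zero[OF assms])
qed

lemma mod_hom_vimage:
  assumes "left_module R M" "left_module R N" "f \<in> mod_hom R M N" "submodule H R N"
  shows "submodule {m \<in> carrier M. f m \<in> H} R M"
proof -
  interpret M: left_module R M by fact
  interpret N: left_module R N by fact
  show ?thesis
    by (rule M.submoduleI) (auto simp: mod_homD[OF assms(3)] mod_hom_zero[OF assms(1-3)] N.submoduleD[OF assms(4)])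
qed

lemma mod_hom_image:
  assumes "left_module R M" "left_module R N" "f \<in> mod_hom R M N"
  shows "submodule (f ` carrier M) R N"
proof -
  interpret M: left_module R M by fact
  interpret N: left_module R N by fact
  show ?thesis
  proof (rule N.submoduleI)
    show "\<zero>\<^bsub>N\<^esub> \<in> f ` carrier M" using mod_hom_zero[OF assms] by force
    show "m \<oplus>\<^bsub>N\<^esub> n \<in> f ` carrier M" if "m \<in> f ` carrier M" "n \<in> f ` carrier M" for m n
      using that mod_homD(2)[OF assms(3)] by (force simp flip: mod_homD(2)[OF assms(3)])
    show "a \<odot>\<^bsub>N\<^esub> m \<in> f ` carrier M" if "a \<in> carrier R" "m \<in> f ` carrier M" for a m
      using that by (force simp flip: mod_homD(3)[OF assms(3)])
  qed (use mod_homD[OF assms(3)] in auto)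
qed

lemma mod_hom_inj:
  assumes "left_module R M" "left_module R N" "f \<in> mod_hom R M N"
    and "\<And>m. m \<in> carrier M \<Longrightarrow> f m = \<zero>\<^bsub>N\<^esub> \<Longrightarrow> m = \<zero>\<^bsub>M\<^esub>"
  shows "inj_on f (carrier M)"
proof (rule inj_onI)
  interpret M: left_module R M by fact
  interpret N: left_module R N by fact
  fix m n assume mn: "m \<in> carrier M" "n \<in> carrier M" "f m = f n"
  have "f (m \<ominus>\<^bsub>M\<^esub> n) \<oplus>\<^bsub>N\<^esub> f n = f n"
    using mn mod_homD(2)[OF assms(3), of "m \<ominus>\<^bsub>M\<^esub> n" n]
    by (simp add: M.M.minus_eq M.M.add.m_assoc M.M.l_neg)
  then have "f (m \<ominus>\<^bsub>M\<^esub> n) = \<zero>\<^bsub>N\<^esub>"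
    using mn mod_homD(1)[OF assms(3)] by (metis M.M.minus_closed N.M.add.r_cancel_one)
  then have "m \<ominus>\<^bsub>M\<^esub> n = \<zero>\<^bsub>M\<^esub>" using assms(4) mn by blast
  then have "\<zero>\<^bsub>M\<^esub> \<oplus>\<^bsub>M\<^esub> n = m" using mn by (metis M.M.minus_eq M.M.add.m_assoc M.M.l_neg M.M.r_zero M.M.a_inv_closed)
  then show "m = n" using mn by simp
qed

lemma schur:
  assumes "simple_module R M" "simple_module R N" "f \<in> mod_hom R M N"
    and "m \<in> carrier M" "f m \<noteq> \<zero>\<^bsub>N\<^esub>"
  shows "bij_betw f (carrier M) (carrier N)"
proof -
  note mods = simple_moduleD(1)[OF assms(1)] simple_moduleD(1)[OF assms(2)] assms(3)
  have "f ` carrier M = carrier N"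
    using simple_moduleD(3)[OF assms(2) mod_hom_image[OF mods]] assms(4,5) by blast
  moreover have "{m \<in> carrier M. f m = \<zero>\<^bsub>N\<^esub>} = {\<zero>\<^bsub>M\<^esub>}"
    using simple_moduleD(3)[OF assms(1) mod_hom_kernel[OF mods]] assms(4,5) by blast
  ultimately show ?thesis
    using mod_hom_inj[OF mods] by (auto simp: bij_betw_def)
qed

lemma simple_module_iso:
  assumes "simple_module R M" "left_module R N" "mod_isomorphic R M N"
  shows "simple_module R N"
proof -
  note M = simple_moduleD(1)[OF assms(1)]
  obtain f where f: "f \<in> mod_hom R M N" "bij_betw f (carrier M) (carrier N)"
    using assms(3) by (auto simp: mod_isomorphic_def)
  have fz: "f \<zero>\<^bsub>M\<^esub> = \<zero>\<^bsub>N\<^esub>" by (rule mod_hom_zero[OF M assms(2) f(1)])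
  obtain m where m: "m \<in> carrier M" "m \<noteq> \<zero>\<^bsub>M\<^esub>" using assms(1) by (rule simple_module_nonzero)
  interpret M: left_module R M by fact
  interpret N: left_module R N by fact
  have "f m \<noteq> \<zero>\<^bsub>N\<^esub>" "f m \<in> carrier N"
    using m f fz by (auto simp: bij_betw_def inj_on_def)
  moreover have "H = {\<zero>\<^bsub>N\<^esub>} \<or> H = carrier N" if H: "submodule H R N" for H
  proof -
    let ?K = "{m \<in> carrier M. f m \<in> H}"
    have "H \<subseteq> f ` carrier M" using f(2) N.submoduleD(1)[OF H] by (simp add: bij_betw_def)
    then have HK: "H = f ` ?K" by blast
    have "?K = {\<zero>\<^bsub>M\<^esub>} \<or> ?K = carrier M"
      using simple_moduleD(3)[OF assms(1) mod_hom_vimage[OF M assms(2) f(1) H]] .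
    then show ?thesis using HK f(2) fz by (auto simp: bij_betw_def)
  qed
  ultimately show ?thesis using assms(2) by (auto simp: simple_module_def)
qed

lemma mod_hom_finsum:
  assumes "left_module R M" "left_module R N" "f \<in> mod_hom R M N" "finite I" "g \<in> I \<rightarrow> carrier M"
  shows "f (\<Oplus>\<^bsub>M\<^esub>i\<in>I. g i) = (\<Oplus>\<^bsub>N\<^esub>i\<in>I. f (g i))"
proof -
  interpret M: left_module R M by fact
  interpret N: left_module R N by fact
  show ?thesis using assms(4,5)
    by (induct set: finite) (auto simp: mod_hom_zero[OF assms(1-3)] mod_homD[OF assms(3)] Pi_def)
qed

lemma has_dimension_iso:
  assumes "left_module R M" "left_module R N" "mod_isomorphic R M N" "range \<kappa> \<subseteq> carrier R"
    and "has_dimension \<kappa> M n"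
  shows "has_dimension \<kappa> N n"
proof -
  interpret M: left_module R M by fact
  interpret N: left_module R N by fact
  obtain f where f: "f \<in> mod_hom R M N" "bij_betw f (carrier M) (carrier N)"
    using assms(3) by (auto simp: mod_isomorphic_def)
  obtain B where B: "finite B" "card B = n" "B \<subseteq> carrier M"
    and ex: "\<And>m. m \<in> carrier M \<Longrightarrow> \<exists>!c. c \<in> B \<rightarrow>\<^sub>E UNIV \<and> m = (\<Oplus>\<^bsub>M\<^esub>b\<in>B. \<kappa> (c b) \<odot>\<^bsub>M\<^esub> b)"
    using assms(5) by (auto simp: has_dimension_def)
  have inj: "inj_on f (carrier M)" "inj_on f B" using f B by (auto simp: bij_betw_def inj_on_subset)
  have fs: "f (\<Oplus>\<^bsub>M\<^esub>b\<in>B. \<kappa> (c b) \<odot>\<^bsub>M\<^esub> b) = (\<Oplus>\<^bsub>N\<^esub>b\<in>f ` B. \<kappa> (d b) \<odot>\<^bsub>N\<^esub> b)"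
    if cd: "\<And>b. b \<in> B \<Longrightarrow> c b = d (f b)" for c d
  proof -
    have k: "\<kappa> z \<in> carrier R" for z using assms(4) by blast
    have g: "(\<lambda>b. \<kappa> (c b) \<odot>\<^bsub>M\<^esub> b) \<in> B \<rightarrow> carrier M" using B k by auto
    have h: "(\<lambda>b. \<kappa> (d b) \<odot>\<^bsub>N\<^esub> b) \<in> f ` B \<rightarrow> carrier N" using B k mod_homD(1)[OF f(1)] by (auto simp: subset_iff)
    have k': "\<kappa> z \<odot>\<^bsub>M\<^esub> b \<in> carrier M" if "b \<in> B" for z b using B k that by auto
    have "f (\<Oplus>\<^bsub>M\<^esub>b\<in>B. \<kappa> (c b) \<odot>\<^bsub>M\<^esub> b) = (\<Oplus>\<^bsub>N\<^esub>b\<in>B. f (\<kappa> (c b) \<odot>\<^bsub>M\<^esub> b))"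
      using mod_hom_finsum[OF assms(1,2) f(1) B(1) g] .
    also have "\<dots> = (\<Oplus>\<^bsub>N\<^esub>b\<in>B. \<kappa> (d (f b)) \<odot>\<^bsub>N\<^esub> f b)"
      using B k cd mod_homD[OF f(1)] by (intro N.M.finsum_cong') (auto simp: subset_iff)
    also have "\<dots> = (\<Oplus>\<^bsub>N\<^esub>b\<in>f ` B. \<kappa> (d b) \<odot>\<^bsub>N\<^esub> b)"
      using N.M.finsum_reindex[OF h inj(2)] by simp
    finally show ?thesis .
  qed
  have "\<exists>!c. c \<in> f ` B \<rightarrow>\<^sub>E UNIV \<and> u = (\<Oplus>\<^bsub>N\<^esub>b\<in>f ` B. \<kappa> (c b) \<odot>\<^bsub>N\<^esub> b)" if u: "u \<in> carrier N" for u
  proof -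
    obtain m where m: "m \<in> carrier M" "u = f m" using u f(2) by (auto simp: bij_betw_def)
    obtain c where c: "c \<in> B \<rightarrow>\<^sub>E UNIV" "m = (\<Oplus>\<^bsub>M\<^esub>b\<in>B. \<kappa> (c b) \<odot>\<^bsub>M\<^esub> b)"
      and uniq: "\<And>c'. c' \<in> B \<rightarrow>\<^sub>E UNIV \<Longrightarrow> m = (\<Oplus>\<^bsub>M\<^esub>b\<in>B. \<kappa> (c' b) \<odot>\<^bsub>M\<^esub> b) \<Longrightarrow> c' = c"
      using ex[OF m(1)] by blast
    show ?thesis
    proof (rule ex1I)
      let ?d = "\<lambda>b\<in>f ` B. c (inv_into B f b)"
      show "?d \<in> f ` B \<rightarrow>\<^sub>E UNIV \<and> u = (\<Oplus>\<^bsub>N\<^esub>b\<in>f ` B. \<kappa> (?d b) \<odot>\<^bsub>N\<^esub> b)"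
        using fs[of c ?d] m(2) c(2) inj(2) by auto
    next
      fix d assume d: "d \<in> f ` B \<rightarrow>\<^sub>E UNIV \<and> u = (\<Oplus>\<^bsub>N\<^esub>b\<in>f ` B. \<kappa> (d b) \<odot>\<^bsub>N\<^esub> b)"
      let ?c' = "\<lambda>b\<in>B. d (f b)"
      have "f (\<Oplus>\<^bsub>M\<^esub>b\<in>B. \<kappa> (?c' b) \<odot>\<^bsub>M\<^esub> b) = f m" using fs[of ?c' d] d m(2) by auto
      moreover have "(\<Oplus>\<^bsub>M\<^esub>b\<in>B. \<kappa> (?c' b) \<odot>\<^bsub>M\<^esub> b) \<in> carrier M"
        using B assms(4) by (intro M.M.finsum_closed) (auto simp: subset_iff intro!: M.smult_closed)
      ultimately have "?c' = c" using uniq[of ?c'] inj(1) m(1) by (auto simp: inj_on_def)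
      then have "c b = d (f b)" if "b \<in> B" for b using that by auto
      then show "d = (\<lambda>b\<in>f ` B. c (inv_into B f b))"
        using d inj(2) by (intro extensionalityI[of _ "f ` B"]) (auto simp: PiE_def)
    qed
  qed
  then show ?thesis unfolding has_dimension_def using B inj
    by (intro exI[of _ "f ` B"]) (auto simp: card_image mod_homD(1)[OF f(1)] subset_iff)
qed

section \<open>Constructions of modules\<close>

text \<open>Isomorphism classes are formed inside one type, whereas \<open>S_module\<close>,
  \<open>T_module\<close> and pairs of vectors live on other types. An injection on the carrier
  copies such a module into the universe.\<close>

definition transport_module :: "('w \<Rightarrow> 'v) \<Rightarrow> ('r, 'w) module \<Rightarrow> ('r, 'v) module" where
  "transport_module j M = (let i = inv_into (carrier M) j in
     \<lparr>carrier = j ` carrier M, monoid.mult = undefined, one = undefined, zero = j \<zero>\<^bsub>M\<^esub>,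
      add = (\<lambda>u v. j (i u \<oplus>\<^bsub>M\<^esub> i v)), module.smult = (\<lambda>a u. j (a \<odot>\<^bsub>M\<^esub> i u))\<rparr>)"

lemma transport_module:
  assumes "left_module R M" "inj_on j (carrier M)"
  shows "left_module R (transport_module j M)" "mod_isomorphic R M (transport_module j M)"
    "bij_betw j (carrier M) (carrier (transport_module j M))"
    "\<lbrakk>m \<in> carrier M; n \<in> carrier M\<rbrakk> \<Longrightarrow> j m \<oplus>\<^bsub>transport_module j M\<^esub> j n = j (m \<oplus>\<^bsub>M\<^esub> n)"
    "m \<in> carrier M \<Longrightarrow> a \<odot>\<^bsub>transport_module j M\<^esub> j m = j (a \<odot>\<^bsub>M\<^esub> m)"
proof -
  interpret left_module R M by fact
  have i: "inv_into (carrier M) j (j m) = m" if "m \<in> carrier M" for m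
    using that assms(2) by simp
  show 3: "bij_betw j (carrier M) (carrier (transport_module j M))"
    using assms(2) by (simp add: transport_module_def Let_def bij_betw_def)
  show add: "j m \<oplus>\<^bsub>transport_module j M\<^esub> j n = j (m \<oplus>\<^bsub>M\<^esub> n)" if "m \<in> carrier M" "n \<in> carrier M" for m n
    using that by (simp add: transport_module_def Let_def i)
  show smult: "a \<odot>\<^bsub>transport_module j M\<^esub> j m = j (a \<odot>\<^bsub>M\<^esub> m)" if "m \<in> carrier M" for a m
    using that by (simp add: transport_module_def Let_def i)
  have c: "carrier (transport_module j M) = j ` carrier M" "\<zero>\<^bsub>transport_module j M\<^esub> = j \<zero>\<^bsub>M\<^esub>"
    by (simp_all add: transport_module_def Let_def)
  have "\<exists>n\<in>carrier M. j (n \<oplus>\<^bsub>M\<^esub> m) = j \<zero>\<^bsub>M\<^esub>" if "m \<in> carrier M" for m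
    using that by (metis M.l_neg M.a_inv_closed)
  then show 1: "left_module R (transport_module j M)"
    by (intro left_moduleI abelian_groupI)
      (auto simp: c add smult R.ring_axioms smult_l_distr smult_r_distr smult_assoc smult_one M.a_ac)
  show "mod_isomorphic R M (transport_module j M)"
    by (rule mod_isomorphicI[OF assms(1) 3]) (simp_all add: add smult)
qed

lemma (in ideal) some_coset:
  assumes "a \<in> carrier R"
  shows "(SOME b. b \<in> I +> a) \<in> carrier R" "(SOME b. b \<in> I +> a) \<ominus> a \<in> I"
proof -
  have "(SOME b. b \<in> I +> a) \<in> I +> a" using a_rcos_self[OF assms] by (rule someI)
  then show "(SOME b. b \<in> I +> a) \<in> carrier R" "(SOME b. b \<in> I +> a) \<ominus> a \<in> I"
    using assms a_rcos_module_imp a_elemrcos_carrier by (auto simp: minus_eq)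
qed

lemma (in ideal) carrier_Quot: "carrier (R Quot I) = (\<lambda>a. I +> a) ` carrier R"
  by (auto simp: FactRing_simps)

lemma (in left_module) smult_eqI:
  assumes "a \<in> carrier R" "b \<in> carrier R" "m \<in> carrier M" "(a \<ominus> b) \<odot>\<^bsub>M\<^esub> m = \<zero>\<^bsub>M\<^esub>"
  shows "a \<odot>\<^bsub>M\<^esub> m = b \<odot>\<^bsub>M\<^esub> m"
proof -
  have "a \<odot>\<^bsub>M\<^esub> m = ((a \<ominus> b) \<oplus> b) \<odot>\<^bsub>M\<^esub> m"
    using assms(1-3) by (simp add: R.minus_eq R.add.m_assoc R.l_neg)
  also have "\<dots> = b \<odot>\<^bsub>M\<^esub> m" using assms by (simp add: smult_l_distr del: R.minus_eq)
  finally show ?thesis .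
qed

text \<open>A residue class modulo an ideal annihilating \<^term>\<open>M\<close> acts through any of its representatives.\<close>

definition factor_module :: "('r, 'v) module \<Rightarrow> ('r set, 'v) module" where
  "factor_module M = restrict_scalars (\<lambda>U. SOME a. a \<in> U) M"

lemma factor_module_simps [simp]:
  "carrier (factor_module M) = carrier M" "\<zero>\<^bsub>factor_module M\<^esub> = \<zero>\<^bsub>M\<^esub>" "add (factor_module M) = add M"
  by (simp_all add: factor_module_def restrict_scalars_def)

lemma restrict_scalars_simps [simp]:
  "carrier (restrict_scalars \<phi> M) = carrier M" "\<zero>\<^bsub>restrict_scalars \<phi> M\<^esub> = \<zero>\<^bsub>M\<^esub>"
  "add (restrict_scalars \<phi> M) = add M" "a \<odot>\<^bsub>restrict_scalars \<phi> M\<^esub> m = \<phi> a \<odot>\<^bsub>M\<^esub> m"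
  by (simp_all add: restrict_scalars_def)

lemma factor_module_smult:
  assumes "ideal I R" "left_module R M" "\<And>a m. \<lbrakk>a \<in> I; m \<in> carrier M\<rbrakk> \<Longrightarrow> a \<odot>\<^bsub>M\<^esub> m = \<zero>\<^bsub>M\<^esub>"
    and "a \<in> carrier R" "m \<in> carrier M"
  shows "(I +>\<^bsub>R\<^esub> a) \<odot>\<^bsub>factor_module M\<^esub> m = a \<odot>\<^bsub>M\<^esub> m"
proof -
  interpret left_module R M by fact
  interpret ideal I R by fact
  show ?thesis
    unfolding factor_module_def restrict_scalars_simps
    using assms some_coset[OF assms(4)] by (intro smult_eqI) auto
qed

lemma factor_module_left_module:
  assumes "ideal I R" "left_module R M" "\<And>a m. \<lbrakk>a \<in> I; m \<in> carrier M\<rbrakk> \<Longrightarrow> a \<odot>\<^bsub>M\<^esub> m = \<zero>\<^bsub>M\<^esub>"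
  shows "left_module (R Quot I) (factor_module M)"
proof -
  interpret left_module R M by fact
  interpret I: ideal I R by fact
  note hom = I.rcos_ring_hom
  note s = factor_module_smult[OF assms]
  have "\<exists>n\<in>carrier M. n \<oplus>\<^bsub>M\<^esub> m = \<zero>\<^bsub>M\<^esub>" if "m \<in> carrier M" for m
    using that by (metis M.l_neg M.a_inv_closed)
  then have "abelian_group (factor_module M)"
    by (intro abelian_groupI) (auto simp: M.a_ac)
  then show ?thesis
    by (rule left_moduleI[OF I.quotient_is_ring])
      (auto simp: I.carrier_Quot s smult_l_distr smult_r_distr smult_assoc smult_one
        simp flip: ring_hom_add[OF hom] ring_hom_mult[OF hom] ring_hom_one[OF hom])
qed

lemma quotient_module_simps [simp]:
  "carrier (quotient_module R I) = carrier (R Quot I)" "\<zero>\<^bsub>quotient_module R I\<^esub> = \<zero>\<^bsub>R Quot I\<^esub>"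
  "add (quotient_module R I) = add (R Quot I)"
  "a \<odot>\<^bsub>quotient_module R I\<^esub> u = (I +>\<^bsub>R\<^esub> a) \<otimes>\<^bsub>R Quot I\<^esub> u"
  by (simp_all add: quotient_module_def)

lemma quotient_module_left_module:
  assumes "ideal I R"
  shows "left_module R (quotient_module R I)"
proof -
  interpret ideal I R by fact
  note hom = rcos_ring_hom
  interpret Q: ring "R Quot I" by (rule quotient_is_ring)
  have "abelian_group (quotient_module R I)"
    by (rule abelian_groupI) (use Q.l_neg in \<open>force simp: Q.a_ac \<close>)+
  then show ?thesis
    by (rule left_moduleI[OF ring_axioms])
     (auto simp: ring_hom_closed[OF hom] ring_hom_add[OF hom] ring_hom_mult[OF hom] ring_hom_one[OF hom]
       Q.l_distr Q.r_distr Q.m_assoc)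
qed

lemma quotient_module_lift:
  assumes "ideal I R" "left_module R N" "n \<in> carrier N" "\<And>a. a \<in> I \<Longrightarrow> a \<odot>\<^bsub>N\<^esub> n = \<zero>\<^bsub>N\<^esub>"
  obtains f where "f \<in> mod_hom R (quotient_module R I) N"
    "\<And>a. a \<in> carrier R \<Longrightarrow> f (I +>\<^bsub>R\<^esub> a) = a \<odot>\<^bsub>N\<^esub> n"
proof -
  interpret N: left_module R N by fact
  interpret I: ideal I R by fact
  note hom = I.rcos_ring_hom
  define f where "f = (\<lambda>U. (SOME a. a \<in> U) \<odot>\<^bsub>N\<^esub> n)"
  have f: "f (I +>\<^bsub>R\<^esub> a) = a \<odot>\<^bsub>N\<^esub> n" if "a \<in> carrier R" for a
    unfolding f_def using assms I.some_coset[OF that] that by (intro N.smult_eqI) auto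
  have "restrict f (carrier (quotient_module R I)) \<in> mod_hom R (quotient_module R I) N"
    by (rule restrict_mod_hom[OF quotient_module_left_module[OF assms(1)]])
      (auto simp: I.carrier_Quot f N.smult_l_distr N.smult_assoc assms(3)
        simp flip: ring_hom_add[OF hom] ring_hom_mult[OF hom])
  moreover have "restrict f (carrier (quotient_module R I)) (I +>\<^bsub>R\<^esub> a) = a \<odot>\<^bsub>N\<^esub> n" if "a \<in> carrier R" for a
    using that f by (simp add: I.carrier_Quot)
  ultimately show ?thesis using that by blast
qed

section \<open>Commutative rings of operators\<close>

text \<open>The coefficient ring is a type and the action a function, so that one abelian group can
  in turn be a module over k, over polynomials in \<open>C\<close>, and over polynomials in
  \<open>E\<close> whose coefficients are polynomials in \<open>C\<close>.\<close>

locale scalar_action = abelian_group M for M :: "('v, 'z) ring_scheme" (structure) +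
  fixes act :: "'p::comm_ring_1 \<Rightarrow> 'v \<Rightarrow> 'v"
  assumes act_closed [simp]: "m \<in> carrier M \<Longrightarrow> act p m \<in> carrier M"
    and act_add_left: "m \<in> carrier M \<Longrightarrow> act (p + q) m = act p m \<oplus> act q m"
    and act_add_right: "\<lbrakk>m \<in> carrier M; n \<in> carrier M\<rbrakk> \<Longrightarrow> act p (m \<oplus> n) = act p m \<oplus> act p n"
    and act_mult: "m \<in> carrier M \<Longrightarrow> act (p * q) m = act p (act q m)"
    and act_one [simp]: "m \<in> carrier M \<Longrightarrow> act 1 m = m"

definition additive_op :: "('v, 'z) ring_scheme \<Rightarrow> ('v \<Rightarrow> 'v) \<Rightarrow> bool" where
  "additive_op M T \<longleftrightarrow> (\<forall>m\<in>carrier M. T m \<in> carrier M) \<and>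
     (\<forall>m\<in>carrier M. \<forall>n\<in>carrier M. T (m \<oplus>\<^bsub>M\<^esub> n) = T m \<oplus>\<^bsub>M\<^esub> T n)"

lemma additive_opD:
  assumes "additive_op M T"
  shows "m \<in> carrier M \<Longrightarrow> T m \<in> carrier M"
    "\<lbrakk>m \<in> carrier M; n \<in> carrier M\<rbrakk> \<Longrightarrow> T (m \<oplus>\<^bsub>M\<^esub> n) = T m \<oplus>\<^bsub>M\<^esub> T n"
  using assms by (auto simp: additive_op_def)

lemma (in abelian_group) additive_op_zero:
  assumes "additive_op G T" shows "T \<zero> = \<zero>"
  using additive_opD[OF assms, of \<zero>] additive_opD(1)[OF assms, of \<zero>]
  by (metis l_zero zero_closed add.r_cancel_one')

lemma (in abelian_group) additive_op_minus:
  assumes "additive_op G T" "m \<in> carrier G" shows "T (\<ominus> m) = \<ominus> T m"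
  using additive_opD(2)[OF assms(1), of "\<ominus> m" m] assms(2) additive_op_zero[OF assms(1)]
  by (metis a_inv_closed additive_opD(1) assms(1) l_neg minus_equality)

lemma (in abelian_group) additive_op_finsum:
  assumes "additive_op G T" "finite J" "f \<in> J \<rightarrow> carrier G"
  shows "T (\<Oplus>i\<in>J. f i) = (\<Oplus>i\<in>J. T (f i))"
  using assms(2,3)
  by (induct set: finite) (auto simp: additive_op_zero[OF assms(1)] additive_opD[OF assms(1)] Pi_def)

context scalar_action begin

lemma additive_act: "additive_op M (act p)"
  by (simp add: additive_op_def act_add_right)

lemma act_zero_right [simp]: "act p \<zero> = \<zero>"
  by (rule additive_op_zero[OF additive_act])

lemma act_zero_left [simp]: "m \<in> carrier M \<Longrightarrow> act 0 m = \<zero>"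
  using act_add_left[of m 0 0] by (metis add_0 act_closed add.r_cancel_one')

lemma act_minus_left: "m \<in> carrier M \<Longrightarrow> act (- p) m = \<ominus> act p m"
  using act_add_left[of m "- p" p] by (metis act_closed act_zero_left add.left_inverse minus_equality)

lemma act_minus_right: "m \<in> carrier M \<Longrightarrow> act p (\<ominus> m) = \<ominus> act p m"
  by (rule additive_op_minus[OF additive_act])

lemma act_commute: "m \<in> carrier M \<Longrightarrow> act p (act q m) = act q (act p m)"
  by (metis act_mult mult.commute)

lemma act_diff_left: "m \<in> carrier M \<Longrightarrow> act (p - q) m = act p m \<ominus> act q m"
  using act_add_left[of m p "- q"] by (simp add: act_minus_left minus_eq)

lemma act_finsum:
  "\<lbrakk>finite J; f \<in> J \<rightarrow> carrier M\<rbrakk> \<Longrightarrow> act p (\<Oplus>i\<in>J. f i) = (\<Oplus>i\<in>J. act p (f i))"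
  by (rule additive_op_finsum[OF additive_act])

end

section \<open>Polynomials in an operator that commutes with the scalars\<close>

definition poly_action ::
  "('v, 'z) ring_scheme \<Rightarrow> ('p \<Rightarrow> 'v \<Rightarrow> 'v) \<Rightarrow> ('v \<Rightarrow> 'v) \<Rightarrow> 'p::comm_ring_1 poly \<Rightarrow> 'v \<Rightarrow> 'v" where
  "poly_action M act T p m = fold_coeffs (\<lambda>a u. act a m \<oplus>\<^bsub>M\<^esub> T u) p \<zero>\<^bsub>M\<^esub>"

text \<open>Horner evaluation at \<open>T\<close> is again a scalar action
  (\<open>scalar_action_pact\<close>), so the construction can be iterated: adjoining
  \<open>C\<close> to k and then \<open>E\<close> gives the action of k[C][E].\<close>

locale linear_operator = scalar_action +
  fixes T
  assumes T_add: "additive_op M T"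
    and T_act: "m \<in> carrier M \<Longrightarrow> T (act p m) = act p (T m)"
begin

abbreviation "pact \<equiv> poly_action M act T"

lemmas T_closed [simp] = additive_opD(1)[OF T_add]
lemmas T_zero [simp] = additive_op_zero[OF T_add]

lemma pact_0 [simp]: "pact 0 m = \<zero>"
  by (simp add: poly_action_def)

lemma pact_pCons: "m \<in> carrier M \<Longrightarrow> pact (pCons a p) m = act a m \<oplus> T (pact p m)"
  by (cases "a = 0 \<and> p = 0") (auto simp: poly_action_def)

lemma pact_closed [simp]: "m \<in> carrier M \<Longrightarrow> pact p m \<in> carrier M"
  by (induct p) (auto simp: pact_0 pact_pCons)

lemma pact_const: "m \<in> carrier M \<Longrightarrow> pact [:a:] m = act a m"
  by (simp add: pact_pCons pact_0)

lemma pact_X: "m \<in> carrier M \<Longrightarrow> pact [:0, 1:] m = T m"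
  by (simp add: pact_pCons pact_0)

lemma pact_linear: "m \<in> carrier M \<Longrightarrow> pact [:a, 1:] m = act a m \<oplus> T m"
  by (simp add: pact_pCons pact_0)

lemma pact_add_left: "m \<in> carrier M \<Longrightarrow> pact (p + q) m = pact p m \<oplus> pact q m"
proof (induct p arbitrary: q)
  case (pCons a p)
  obtain b r where q: "q = pCons b r" by (cases q)
  show ?case
    using pCons by (simp add: q pact_pCons act_add_left additive_opD(2)[OF T_add] a_ac)
qed (simp add: pact_0)

lemma pact_add_right:
  "\<lbrakk>m \<in> carrier M; n \<in> carrier M\<rbrakk> \<Longrightarrow> pact p (m \<oplus> n) = pact p m \<oplus> pact p n"
  by (induct p) (auto simp: pact_0 pact_pCons act_add_right additive_opD(2)[OF T_add] a_ac)

lemma pact_smult: "m \<in> carrier M \<Longrightarrow> pact (smult a p) m = act a (pact p m)"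
  by (induct p) (auto simp: pact_0 pact_pCons act_add_right act_mult T_act)

lemma pact_mult: "m \<in> carrier M \<Longrightarrow> pact (p * q) m = pact p (pact q m)"
  by (induct p) (auto simp: pact_0 pact_pCons pact_add_left pact_smult)

lemma scalar_action_pact: "scalar_action M pact"
  by unfold_locales (auto simp: pact_add_left pact_add_right pact_mult pact_pCons pact_0 one_pCons)

text \<open>A rule \<open>U T = r(T) U\<close> propagates to \<open>U p(T) = p(r(T)) U\<close>. It
  is applied to \<open>s\<close> and \<open>s^-1\<close>, which shift \<open>E\<close> by one, and
  to \<open>g\<close>, which turns \<open>y\<close> into \<open>- y\<close> once \<open>x\<close>
  vanishes.\<close>

lemma pact_semilinear:
  assumes U: "additive_op M U" and UT: "\<And>m. m \<in> carrier M \<Longrightarrow> U (T m) = pact r (U m)"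
    and Ua: "\<And>a m. m \<in> carrier M \<Longrightarrow> U (act a m) = act a (U m)" and m: "m \<in> carrier M"
  shows "U (pact p m) = pact (pcompose p r) (U m)"
  using m
proof (induct p)
  case 0 then show ?case by (simp add: pact_0 additive_op_zero[OF U])
next
  case (pCons a p)
  then show ?case
    by (simp add: pact_pCons additive_opD[OF U] UT Ua pcompose_pCons pact_add_left pact_const pact_mult)
qed

lemma pact_commute:
  assumes U: "additive_op M U" and UT: "\<And>m. m \<in> carrier M \<Longrightarrow> U (T m) = T (U m)"
    and Ua: "\<And>a m. m \<in> carrier M \<Longrightarrow> U (act a m) = act a (U m)" and m: "m \<in> carrier M"
  shows "U (pact p m) = pact p (U m)"
  using pact_semilinear[OF U _ Ua m, of "[:0, 1:]" p] UT additive_opD(1)[OF U] by (simp add: pact_X)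

lemma pact_monom: "m \<in> carrier M \<Longrightarrow> pact (monom a n) m = act a ((T ^^ n) m)"
proof (induct n)
  case (Suc n)
  have "(T ^^ n) m \<in> carrier M" using Suc(2) by (induct n) auto
  with Suc show ?case by (simp add: monom_Suc pact_pCons T_act)
qed (simp add: monom_0 pact_const)

lemma T_pow_closed [simp]: "m \<in> carrier M \<Longrightarrow> (T ^^ n) m \<in> carrier M"
  by (induct n) auto

lemma pact_sum_monom:
  "m \<in> carrier M \<Longrightarrow> pact (\<Sum>j<n. monom (b j) j) m = (\<Oplus>j\<in>{..<n}. act (b j) ((T ^^ j) m))"
proof (induct n)
  case (Suc n)
  have "insert n {..<n} = {..<Suc n}" by auto
  with Suc show ?case
    using finsum_insert[of "{..<n}" n "\<lambda>j. act (b j) ((T ^^ j) m)"]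
    by (simp add: pact_add_left pact_monom add.m_comm)
qed (simp add: pact_0)

end

text \<open>The polynomial \<open>f\<close> splits into linear factors. Removing them one at a time,
  one reaches a last nonzero vector \<open>q(T) m\<close>, and this is killed by some
  \<open>T - c\<close>.\<close>

lemma eigenvector:
  fixes act :: "'k::alg_closed_field \<Rightarrow> 'v \<Rightarrow> 'v" and M (structure)
  assumes "linear_operator M act T"
    and "f \<noteq> 0" "m \<in> carrier M" "m \<noteq> \<zero>" "poly_action M act T f m = \<zero>"
  shows "\<exists>c p. poly_action M act T p m \<noteq> \<zero> \<and> T (poly_action M act T p m) = act c (poly_action M act T p m)"
proof -
interpret linear_operator M act T by fact
show ?thesis
  using assms(2-)
proof (induct "degree f" arbitrary: f rule: less_induct)
  case less
  show ?case
  proof (cases "degree f = 0")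
    case True
    then obtain c where c: "f = [:c:]" "c \<noteq> 0" using less.prems(1) by (metis degree_eq_zeroE pCons_0_0)
    then have "m = act (inverse c) (act c m)" using less.prems(2) by (metis act_mult act_one left_inverse)
    also have "\<dots> = \<zero>" using less.prems c by (simp add: pact_const)
    finally show ?thesis using less.prems by simp
  next
    case False
    then obtain c where "poly f c = 0" using alg_closed_imp_poly_has_root by blast
    then obtain q where q: "f = [:- c, 1:] * q" by (metis dvdE poly_eq_0_iff_dvd)
    then have "q \<noteq> 0" using less.prems(1) by auto
    show ?thesis
    proof (cases "pact q m = \<zero>")
      case True
      have "degree q < degree f"
      proof -
        have "f = pCons 0 q - smult c q" by (simp add: q)
        moreover have "degree (smult c q) < degree (pCons 0 q)" using \<open>q \<noteq> 0\<close>
          by (simp add: order.strict_trans1[OF degree_smult_le])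
        ultimately have "degree f = degree (pCons 0 q)" by (metis add_diff_cancel_left' degree_add_eq_right degree_minus diff_conv_add_uminus add.commute)
        then show ?thesis using \<open>q \<noteq> 0\<close> by simp
      qed
      then show ?thesis using less.hyps[of q] \<open>q \<noteq> 0\<close> True less.prems by blast
    next
      case False
      have "pact [:- c, 1:] (pact q m) = \<zero>"
        using less.prems(2,4) q by (metis pact_mult)
      then have "\<ominus> act c (pact q m) \<oplus> T (pact q m) = \<zero>" using less.prems(2) by (simp add: pact_linear act_minus_left)
      then have "T (pact q m) = act c (pact q m)"
        using less.prems(2) by (metis T_closed a_inv_closed act_closed add.inv_inv minus_equality add.m_comm pact_closed)
      then show ?thesis using False by blast
    qed
  qed
qed
qed

section \<open>Linear dependence in finite dimension\<close>

lemma linear_system_solution: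
  fixes a :: "'i \<Rightarrow> 'b \<Rightarrow> 'k::field"
  assumes "finite B" "finite I" "card B < card I"
  shows "\<exists>c. (\<exists>i\<in>I. c i \<noteq> 0) \<and> (\<forall>b\<in>B. (\<Sum>i\<in>I. c i * a i b) = 0)"
  using assms
proof (induct B arbitrary: I a rule: finite_induct)
  case empty
  then obtain i where "i \<in> I" by (metis card.empty card_gt_0_iff ex_in_conv)
  then show ?case by (intro exI[of _ "\<lambda>_. 1"]) auto
next
  case (insert b B)
  show ?case
  proof (cases "\<forall>i\<in>I. a i b = 0")
    case True
    obtain c where "\<exists>i\<in>I. c i \<noteq> 0" "\<forall>b\<in>B. (\<Sum>i\<in>I. c i * a i b) = 0"
      using insert(3)[of I a] insert.prems insert(1,2) by auto
    with True show ?thesis by (intro exI[of _ c]) (auto intro!: sum.neutral)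
  next
    case False
    then obtain j where j: "j \<in> I" "a j b \<noteq> 0" by blast
    let ?I = "I - {j}" and ?a = "\<lambda>i b'. a i b' - a i b / a j b * a j b'"
    obtain c where c: "\<exists>i\<in>?I. c i \<noteq> 0" "\<forall>b'\<in>B. (\<Sum>i\<in>?I. c i * ?a i b') = 0"
    proof -
      have "card B < card ?I" using insert.prems insert(1,2) j by simp
      then show thesis using insert(3)[of ?I ?a] insert.prems that by blast
    qed
    \<comment> \<open>Gaussian elimination: the value at \<open>j\<close> is forced by the equation
      at \<open>b\<close>, and substituting it turns the coefficients \<open>a\<close> into
      \<open>?a\<close> in all other equations.\<close>
    let ?c = "c(j := - (\<Sum>i\<in>?I. c i * (a i b / a j b)))"
    have split: "(\<Sum>i\<in>I. ?c i * a i b') = (\<Sum>i\<in>?I. c i * ?a i b')" for b'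
    proof -
      have "(\<Sum>i\<in>I. ?c i * a i b') = ?c j * a j b' + (\<Sum>i\<in>?I. ?c i * a i b')"
        using sum.remove[OF insert.prems(1) j(1)] by blast
      also have "(\<Sum>i\<in>?I. ?c i * a i b') = (\<Sum>i\<in>?I. c i * a i b')" by (rule sum.cong) auto
      also have "?c j * a j b' + (\<Sum>i\<in>?I. c i * a i b') = (\<Sum>i\<in>?I. c i * ?a i b')"
        by (simp add: sum_distrib_right sum_distrib_left algebra_simps sum_subtractf)
      finally show ?thesis .
    qed
    have "(\<Sum>i\<in>?I. c i * ?a i b) = 0" using j by (intro sum.neutral) auto
    then show ?thesis using split c by (intro exI[of _ ?c]) fastforce
  qed
qed

text \<open>In coordinates, a relation among the \<open>n + 1\<close> vectors \<open>f 0\<close>,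
  ..., \<open>f n\<close> is a solution of \<open>n\<close> linear equations in \<open>n + 1\<close>
  unknowns.\<close>

lemma has_dimension_dependent:
  fixes \<kappa> :: "'k::field \<Rightarrow> 'r" and M :: "('r, 'v) module"
  assumes "has_dimension \<kappa> M n" "scalar_action M (\<lambda>c m. \<kappa> c \<odot>\<^bsub>M\<^esub> m)" "\<And>i. f i \<in> carrier M"
  obtains c :: "nat \<Rightarrow> 'k" where "\<exists>i\<in>{..n}. c i \<noteq> 0" "(\<Oplus>\<^bsub>M\<^esub>i\<in>{..n}. \<kappa> (c i) \<odot>\<^bsub>M\<^esub> f i) = \<zero>\<^bsub>M\<^esub>"
proof -
  interpret scalar_action M "\<lambda>c m. \<kappa> c \<odot>\<^bsub>M\<^esub> m" by fact
  obtain B where B: "finite B" "card B = n" "B \<subseteq> carrier M"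
    and ex: "\<And>m. m \<in> carrier M \<Longrightarrow> \<exists>!c. c \<in> B \<rightarrow>\<^sub>E UNIV \<and> m = (\<Oplus>\<^bsub>M\<^esub>b\<in>B. \<kappa> (c b) \<odot>\<^bsub>M\<^esub> b)"
    using assms(1) by (auto simp: has_dimension_def)
  have "\<forall>i. \<exists>d. f i = (\<Oplus>\<^bsub>M\<^esub>b\<in>B. \<kappa> (d b) \<odot>\<^bsub>M\<^esub> b)" using ex[OF assms(3)] by blast
  then obtain a where a: "\<And>i. f i = (\<Oplus>\<^bsub>M\<^esub>b\<in>B. \<kappa> (a i b) \<odot>\<^bsub>M\<^esub> b)" by metis
  obtain c where c: "\<exists>i\<in>{..n}. c i \<noteq> 0" "\<forall>b\<in>B. (\<Sum>i\<in>{..n}. c i * a i b) = 0"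
    using linear_system_solution[of B "{..n}" a] B by auto
  have Bc: "b \<in> carrier M" if "b \<in> B" for b using B(3) that by auto
  have "(\<Oplus>\<^bsub>M\<^esub>i\<in>J. \<kappa> (c i) \<odot>\<^bsub>M\<^esub> f i) = (\<Oplus>\<^bsub>M\<^esub>b\<in>B. \<kappa> (\<Sum>i\<in>J. c i * a i b) \<odot>\<^bsub>M\<^esub> b)" if "finite J" for J
    using that
  proof (induct J)
    case empty
    then show ?case using Bc by (simp add: add.finprod_one_eqI)
  next
    case (insert i J)
    have "\<kappa> (c i) \<odot>\<^bsub>M\<^esub> f i = (\<Oplus>\<^bsub>M\<^esub>b\<in>B. \<kappa> (c i * a i b) \<odot>\<^bsub>M\<^esub> b)"
      unfolding a by (subst act_finsum) (use B(1) Bc in \<open>auto simp: act_mult intro!: finsum_cong'\<close>)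
    then have "(\<Oplus>\<^bsub>M\<^esub>i\<in>insert i J. \<kappa> (c i) \<odot>\<^bsub>M\<^esub> f i) =
        (\<Oplus>\<^bsub>M\<^esub>b\<in>B. \<kappa> (c i * a i b) \<odot>\<^bsub>M\<^esub> b) \<oplus>\<^bsub>M\<^esub> (\<Oplus>\<^bsub>M\<^esub>b\<in>B. \<kappa> (\<Sum>i\<in>J. c i * a i b) \<odot>\<^bsub>M\<^esub> b)"
      using insert assms(3) Bc by (subst finsum_insert) (auto intro!: finsum_closed)
    also have "\<dots> = (\<Oplus>\<^bsub>M\<^esub>b\<in>B. \<kappa> (c i * a i b) \<odot>\<^bsub>M\<^esub> b \<oplus>\<^bsub>M\<^esub> \<kappa> (\<Sum>i\<in>J. c i * a i b) \<odot>\<^bsub>M\<^esub> b)"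
      by (rule finsum_addf[symmetric]) (use Bc in auto)
    also have "\<dots> = (\<Oplus>\<^bsub>M\<^esub>b\<in>B. \<kappa> (\<Sum>i\<in>insert i J. c i * a i b) \<odot>\<^bsub>M\<^esub> b)"
      by (rule finsum_cong') (use insert(1,2) Bc in \<open>auto simp: act_add_left\<close>)
    finally show ?case .
  qed
  then have "(\<Oplus>\<^bsub>M\<^esub>i\<in>{..n}. \<kappa> (c i) \<odot>\<^bsub>M\<^esub> f i) = \<zero>\<^bsub>M\<^esub>"
    using c(2) Bc by (simp add: add.finprod_one_eqI)
  with c(1) show ?thesis using that by blast
qed

section \<open>Spans and localization\<close>

definition lin_comb :: "('v, 'z) ring_scheme \<Rightarrow> ('p \<Rightarrow> 'v \<Rightarrow> 'v) \<Rightarrow> ('i \<Rightarrow> 'v) \<Rightarrow> 'i set \<Rightarrow> ('i \<Rightarrow> 'p) \<Rightarrow> 'v" where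
  "lin_comb M act e J b = (\<Oplus>\<^bsub>M\<^esub>i\<in>J. act (b i) (e i))"

definition lin_span :: "('v, 'z) ring_scheme \<Rightarrow> ('p \<Rightarrow> 'v \<Rightarrow> 'v) \<Rightarrow> ('i \<Rightarrow> 'v) \<Rightarrow> 'i set \<Rightarrow> 'v set" where
  "lin_span M act e I = {lin_comb M act e J b | J b. finite J \<and> J \<subseteq> I}"

definition lin_indep :: "('v, 'z) ring_scheme \<Rightarrow> ('p::zero \<Rightarrow> 'v \<Rightarrow> 'v) \<Rightarrow> ('i \<Rightarrow> 'v) \<Rightarrow> 'i set \<Rightarrow> bool" where
  "lin_indep M act e I \<longleftrightarrow> (\<forall>J b. finite J \<and> J \<subseteq> I \<and> lin_comb M act e J b = \<zero>\<^bsub>M\<^esub> \<longrightarrow> (\<forall>i\<in>J. b i = 0))"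

locale action_family = scalar_action +
  fixes e
  assumes e_closed [simp]: "e i \<in> carrier M"
begin

abbreviation "comb \<equiv> lin_comb M act e"
abbreviation "spanned \<equiv> lin_span M act e"
abbreviation "indep \<equiv> lin_indep M act e"

lemma comb_closed [simp]: "comb J b \<in> carrier M"
  by (auto simp: lin_comb_def intro!: finsum_closed)

lemma comb_empty [simp]: "comb {} b = \<zero>"
  by (simp add: lin_comb_def)

lemma comb_insert: "\<lbrakk>finite J; i \<notin> J\<rbrakk> \<Longrightarrow> comb (insert i J) b = act (b i) (e i) \<oplus> comb J b"
  by (simp add: lin_comb_def)

lemma comb_cong: "(\<And>i. i \<in> J \<Longrightarrow> b i = c i) \<Longrightarrow> comb J b = comb J c"
  unfolding lin_comb_def by (rule finsum_cong') auto

lemma comb_extend: "\<lbrakk>finite K; J \<subseteq> K\<rbrakk> \<Longrightarrow> comb J b = comb K (\<lambda>i. if i \<in> J then b i else 0)"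
  unfolding lin_comb_def by (rule add.finprod_mono_neutral_cong_left) auto

lemma comb_shrink: "\<lbrakk>finite K; J \<subseteq> K; \<And>i. i \<in> K - J \<Longrightarrow> b i = 0\<rbrakk> \<Longrightarrow> comb K b = comb J b"
  by (subst comb_extend[of K J]) (auto intro!: comb_cong)

lemma comb_add: "comb J b \<oplus> comb J c = comb J (\<lambda>i. b i + c i)"
proof -
  have "comb J b \<oplus> comb J c = (\<Oplus>i\<in>J. act (b i) (e i) \<oplus> act (c i) (e i))"
    unfolding lin_comb_def by (rule finsum_addf[symmetric]) auto
  also have "\<dots> = comb J (\<lambda>i. b i + c i)"
    unfolding lin_comb_def by (rule finsum_cong') (auto simp: act_add_left)
  finally show ?thesis .
qed

lemma comb_act: "finite J \<Longrightarrow> act p (comb J b) = comb J (\<lambda>i. p * b i)"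
  unfolding lin_comb_def by (subst act_finsum) (auto simp: act_mult intro!: finsum_cong')

lemma comb_single: "\<lbrakk>finite J; i \<in> J\<rbrakk> \<Longrightarrow> comb J (\<lambda>j. if j = i then p else 0) = act p (e i)"
  using comb_shrink[of J "{i}" "\<lambda>j. if j = i then p else 0"] comb_insert[of "{}" i] by auto

lemma spanI: "\<lbrakk>finite J; J \<subseteq> I\<rbrakk> \<Longrightarrow> comb J b \<in> spanned I"
  by (auto simp: lin_span_def)

lemma span_closed: "m \<in> spanned I \<Longrightarrow> m \<in> carrier M"
  by (auto simp: lin_span_def)

lemma span_zero [simp]: "\<zero> \<in> spanned I"
  using spanI[of "{}"] by simp

lemma span_act: "m \<in> spanned I \<Longrightarrow> act p m \<in> spanned I"
  using spanI by (fastforce simp: lin_span_def comb_act)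

lemma span_gen: "i \<in> I \<Longrightarrow> e i \<in> spanned I"
  using spanI[of "{i}" I "\<lambda>_. 1"] comb_insert[of "{}" i "\<lambda>_. 1"] by simp

lemma span_add:
  assumes "m \<in> spanned I" "n \<in> spanned I" shows "m \<oplus> n \<in> spanned I"
proof -
  obtain J b K c where *: "finite J" "J \<subseteq> I" "m = comb J b" "finite K" "K \<subseteq> I" "n = comb K c"
    using assms by (auto simp: lin_span_def)
  then have "m \<oplus> n = comb (J \<union> K) (\<lambda>i. if i \<in> J then b i else 0) \<oplus> comb (J \<union> K) (\<lambda>i. if i \<in> K then c i else 0)"
    using comb_extend[of "J \<union> K" J b] comb_extend[of "J \<union> K" K c] by simp
  then show ?thesis using * by (auto simp: comb_add intro!: spanI)
qed

text \<open>The trace on the module of the span localized at \<open>S\<close>, expressed without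
  forming fractions.\<close>

definition local_span where
  "local_span I S = {m \<in> carrier M. \<exists>h\<in>S. act h m \<in> spanned I}"

lemma semilinear_comb_image:
  assumes T: "additive_op M T" "\<And>p m. m \<in> carrier M \<Longrightarrow> T (act p m) = act (\<sigma> p) (T m)" "finite J"
  shows "T (comb J b) = (\<Oplus>i\<in>J. act (\<sigma> (b i)) (T (e i)))"
  unfolding lin_comb_def using T additive_opD[OF T(1)]
  by (subst additive_op_finsum) (auto intro!: finsum_cong')

end

lemma finsum_in:
  assumes "abelian_group M" "finite J" "\<zero>\<^bsub>M\<^esub> \<in> W" "\<And>m n. \<lbrakk>m \<in> W; n \<in> W\<rbrakk> \<Longrightarrow> m \<oplus>\<^bsub>M\<^esub> n \<in> W"
    "\<And>i. i \<in> J \<Longrightarrow> f i \<in> W" "W \<subseteq> carrier M"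
  shows "(\<Oplus>\<^bsub>M\<^esub>i\<in>J. f i) \<in> W"
proof -
  interpret abelian_group M by fact
  show ?thesis using assms(2,5)
    by (induct) (use assms in \<open>auto simp: Pi_def subset_iff\<close>)
qed

locale localized_family = action_family M act e
  for M :: "('v, 'z) ring_scheme" (structure) and act :: "'p::comm_ring_1 \<Rightarrow> 'v \<Rightarrow> 'v" and e :: "'i \<Rightarrow> 'v" +
  fixes S :: "'p set"
  assumes S_one: "1 \<in> S" and S_mult: "\<lbrakk>h \<in> S; k \<in> S\<rbrakk> \<Longrightarrow> h * k \<in> S"
begin

abbreviation "lspan I \<equiv> local_span I S"

lemma lspanI: "\<lbrakk>m \<in> carrier M; h \<in> S; act h m \<in> spanned I\<rbrakk> \<Longrightarrow> m \<in> lspan I"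
  by (auto simp: local_span_def)

lemma lspan_closed: "m \<in> lspan I \<Longrightarrow> m \<in> carrier M"
  by (auto simp: local_span_def)

lemma span_lspan: "m \<in> spanned I \<Longrightarrow> m \<in> lspan I"
  using span_closed S_one by (intro lspanI[of m 1]) auto

lemma lspan_zero [simp]: "\<zero> \<in> lspan I"
  by (simp add: span_lspan)

lemma lspan_add:
  assumes "m \<in> lspan I" "n \<in> lspan I" shows "m \<oplus> n \<in> lspan I"
proof -
  obtain h k where *: "m \<in> carrier M" "n \<in> carrier M" "h \<in> S" "k \<in> S" "act h m \<in> spanned I" "act k n \<in> spanned I"
    using assms by (auto simp: local_span_def)
  have "act (h * k) (m \<oplus> n) = act k (act h m) \<oplus> act h (act k n)"
    using *(1,2) by (simp add: act_add_right act_mult act_commute)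
  then have "act (h * k) (m \<oplus> n) \<in> spanned I" using * by (simp add: span_add span_act)
  then show ?thesis using * by (intro lspanI[of _ "h * k"]) (auto simp: S_mult)
qed

lemma lspan_act: "m \<in> lspan I \<Longrightarrow> act p m \<in> lspan I"
  unfolding local_span_def using act_commute span_act by fastforce

lemma lspan_cancel:
  assumes "m \<in> carrier M" "h \<in> S" "act h m \<in> lspan I" shows "m \<in> lspan I"
proof -
  obtain k where "k \<in> S" "act k (act h m) \<in> spanned I" using assms by (auto simp: local_span_def)
  then show ?thesis using assms by (intro lspanI[of _ "k * h"]) (auto simp: S_mult act_mult)
qed

text \<open>A semilinear operator whose twist preserves the denominators need only be checked on the
  generators. This is how local spans are shown to be stable under the operators of the
  module.\<close>

lemma lspan_semilinear:
  assumes T: "additive_op M T" "\<And>p m. m \<in> carrier M \<Longrightarrow> T (act p m) = act (\<sigma> p) (T m)"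
    and S: "\<And>h. h \<in> S \<Longrightarrow> \<sigma> h \<in> S" and e: "\<And>i. i \<in> I \<Longrightarrow> T (e i) \<in> lspan I" and m: "m \<in> lspan I"
  shows "T m \<in> lspan I"
proof -
  obtain h J b where h: "m \<in> carrier M" "h \<in> S" "finite J" "J \<subseteq> I" "act h m = comb J b"
    using m by (auto simp: local_span_def lin_span_def)
  have "act (\<sigma> h) (T m) = T (comb J b)" using h T by metis
  also have "\<dots> = (\<Oplus>i\<in>J. act (\<sigma> (b i)) (T (e i)))" by (rule semilinear_comb_image[OF T h(3)])
  also have "\<dots> \<in> lspan I"
    by (rule finsum_in) (use h(3,4) in \<open>auto simp: lspan_act e lspan_add lspan_closed abelian_group_axioms subset_iff\<close>)
  finally show ?thesis using lspan_cancel[OF _ S[OF h(2)]] additive_opD(1)[OF T(1)] h(1) by blast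
qed

text \<open>Clear the denominator: \<open>h m\<close> is a combination with coefficients
  \<open>b j\<close>. Multiplying by \<open>t\<close> exhibits \<open>h (e i)\<close> as the
  combination with coefficients \<open>t * b j\<close>, and independence at the index
  \<open>i\<close> says \<open>h = t * b i\<close>. The arguments by contradiction below end here:
  an element that divides no denominator cannot be inverted on the local span.\<close>

lemma lspan_divisor:
  assumes "indep I" "i \<in> I" "m \<in> lspan I" "act t m = e i"
  shows "\<exists>h\<in>S. t dvd h"
proof -
  obtain h K c where h: "m \<in> carrier M" "h \<in> S" "finite K" "K \<subseteq> I" "act h m = comb K c"
    using assms(3) by (auto simp: local_span_def lin_span_def)
  \<comment> \<open>The index \<open>i\<close> may be missing from the combination, so the index set
    is enlarged and padded with zero coefficients.\<close>
  define J where "J = insert i K"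
  define b where "b = (\<lambda>j. if j \<in> K then c j else 0)"
  have J: "finite J" "J \<subseteq> I" "i \<in> J" and hm: "act h m = comb J b"
    using h assms(2) comb_extend[of J K c] by (auto simp: J_def b_def)
  have "comb J (\<lambda>j. t * b j) = act t (act h m)" using J hm by (simp add: comb_act)
  also have "\<dots> = act h (e i)" using h(1) assms(4) by (metis act_commute)
  also have "\<dots> = comb J (\<lambda>j. if j = i then h else 0)" using J comb_single by simp
  finally have "comb J (\<lambda>j. t * b j) \<oplus> act (-1) (comb J (\<lambda>j. if j = i then h else 0)) = \<zero>"
    by (simp add: act_minus_left r_neg)
  then have "comb J (\<lambda>j. t * b j + -1 * (if j = i then h else 0)) = \<zero>"
    by (simp only: comb_act[OF J(1)] comb_add)
  then have "\<forall>j\<in>J. t * b j + -1 * (if j = i then h else 0) = 0"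
    using assms(1) J(1,2) unfolding lin_indep_def by blast
  then have "t * b i + -1 * (if i = i then h else 0) = 0" using J(3) by blast
  then have "h = t * b i" by simp
  then show ?thesis using h(2) by (intro bexI[of _ h]) simp_all
qed

end

section \<open>Integer powers of an invertible operator\<close>

definition op_power :: "('v \<Rightarrow> 'v) \<Rightarrow> ('v \<Rightarrow> 'v) \<Rightarrow> int \<Rightarrow> 'v \<Rightarrow> 'v" where
  "op_power s s' i = (if i \<ge> 0 then s ^^ nat i else s' ^^ nat (- i))"

locale invertible_op = abelian_group M for M (structure) +
  fixes s s'
  assumes s_add: "additive_op M s" and s'_add: "additive_op M s'"
    and ss' [simp]: "m \<in> carrier M \<Longrightarrow> s (s' m) = m" and s's [simp]: "m \<in> carrier M \<Longrightarrow> s' (s m) = m"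
begin

lemmas s_closed [simp] = additive_opD(1)[OF s_add]
lemmas s'_closed [simp] = additive_opD(1)[OF s'_add]

abbreviation "spow \<equiv> op_power s s'"

lemma funpow_closed [simp]: "m \<in> carrier M \<Longrightarrow> (s ^^ n) m \<in> carrier M" "m \<in> carrier M \<Longrightarrow> (s' ^^ n) m \<in> carrier M"
  by (induct n) auto

lemma spow_closed [simp]: "m \<in> carrier M \<Longrightarrow> spow i m \<in> carrier M"
  by (simp add: op_power_def)

lemma spow_0 [simp]: "spow 0 m = m"
  by (simp add: op_power_def)

lemma spow_plus1: "m \<in> carrier M \<Longrightarrow> spow (i + 1) m = s (spow i m)"
proof (cases "i \<ge> 0")
  case True then show ?thesis by (simp add: op_power_def nat_add_distrib)
next
  case False
  assume m: "m \<in> carrier M"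
  have "nat (- i) = Suc (nat (- (i + 1)))" using False by simp
  then show ?thesis using False m by (cases "i = -1") (auto simp: op_power_def)
qed

lemma spow_minus1: "m \<in> carrier M \<Longrightarrow> spow (i - 1) m = s' (spow i m)"
  using spow_plus1[of m "i - 1"] by simp

lemma additive_spow: "additive_op M (spow i)"
  by (induct i rule: int_induct[of _ 0])
    (auto simp: additive_op_def spow_plus1 spow_minus1 additive_opD[OF s_add] additive_opD[OF s'_add])

lemma s_eq_zero: "m \<in> carrier M \<Longrightarrow> s m = \<zero> \<Longrightarrow> m = \<zero>"
  by (metis s's additive_op_zero[OF s'_add])

lemma s'_eq_zero: "m \<in> carrier M \<Longrightarrow> s' m = \<zero> \<Longrightarrow> m = \<zero>"
  by (metis ss' additive_op_zero[OF s_add])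

lemma spow_eq_zero: "m \<in> carrier M \<Longrightarrow> spow i m = \<zero> \<Longrightarrow> m = \<zero>"
proof (induct i rule: int_induct[of _ 0])
  case (step1 i) then show ?case using s_eq_zero[of "spow i m"] by (simp add: spow_plus1)
next
  case (step2 i) then show ?case using s'_eq_zero[of "spow i m"] by (simp add: spow_minus1)
qed simp

end

section \<open>Powers of an invertible semilinear operator\<close>

locale skew_laurent = scalar_action M act + invertible_op M s s'
  for M :: "('v, 'z) ring_scheme" (structure) and act :: "'p::idom \<Rightarrow> 'v \<Rightarrow> 'v" and s s' +
  fixes \<sigma> \<sigma>' :: "'p \<Rightarrow> 'p" and v
  assumes s'_act: "m \<in> carrier M \<Longrightarrow> s' (act p m) = act (\<sigma>' p) (s' m)"
    and \<sigma>'_nonzero: "p \<noteq> 0 \<Longrightarrow> \<sigma>' p \<noteq> 0"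
    and torsion_free: "\<lbrakk>m \<in> carrier M; act p m = \<zero>; m \<noteq> \<zero>\<rbrakk> \<Longrightarrow> p = 0"
    and v_closed: "v \<in> carrier M" and v_nonzero: "v \<noteq> \<zero>"
begin

text \<open>Either all powers \<open>s\<^sup>i v\<close> are independent, or a relation of minimal length has nonzero outer
  coefficients and expresses the next power in either direction, up to denominators.\<close>

lemma power_basis:
  defines "e \<equiv> \<lambda>i. spow i v"
  shows "\<exists>I q. q \<noteq> 0 \<and> I \<noteq> {} \<and> lin_indep M act e I \<and>
    (\<forall>i\<in>I. act q (e (i + 1)) \<in> lin_span M act e I \<and> act q (e (i - 1)) \<in> lin_span M act e I)"
proof -
  interpret action_family M act e
    by unfold_locales (simp add: e_def v_closed)
  show ?thesis
  proof (cases "indep UNIV")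
    case True
    then show ?thesis by (intro exI[of _ UNIV] exI[of _ 1]) (auto simp: span_gen)
  next
    case False
    \<comment> \<open>A nontrivial relation inside a window of \<open>n + 1\<close> consecutive
      powers that may start at any integer. Every finite relation fits into such a window after
      padding with zeros.\<close>
    define rel where "rel n \<longleftrightarrow> (\<exists>k b. comb {k..k + int n} b = \<zero> \<and> (\<exists>i\<in>{k..k + int n}. b i \<noteq> 0))" for n
    obtain J b i where J: "finite J" "comb J b = \<zero>" "i \<in> J" "b i \<noteq> 0"
      using False unfolding lin_indep_def by blast
    have "rel (nat (Max J - Min J))"
    proof -
      have le: "Min J \<le> Max J" using J(1,3) by (meson Max_ge Min_le order_trans)
      then have sub: "J \<subseteq> {Min J..Min J + int (nat (Max J - Min J))}" using J(1) by auto
      show ?thesis unfolding rel_def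
        using comb_extend[OF _ sub, of b] J sub
        by (intro exI[of _ "Min J"] exI[of _ "\<lambda>i. if i \<in> J then b i else 0"]) (auto intro!: bexI[of _ i])
    qed
    define d where "d = (LEAST n. rel n)"
    have "rel d" unfolding d_def by (rule LeastI) fact
    then obtain k c where kc: "comb {k..k + int d} c = \<zero>" "\<exists>i\<in>{k..k + int d}. c i \<noteq> 0"
      by (auto simp: rel_def)
    have min: "c' i = 0" if "comb {k'..k' + int n} c' = \<zero>" "n < d" "i \<in> {k'..k' + int n}" for k' c' n i
      using not_less_Least[of n rel] that unfolding d_def rel_def by blast
    have "d > 0"
    proof (rule ccontr)
      assume "\<not> d > 0"
      then have "act (c k) (e k) = \<zero>" "c k \<noteq> 0" using kc comb_insert[of "{}" k c] by auto
      then have "e k = \<zero>" using torsion_free[of "e k" "c k"] e_closed by blast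
      then show False using spow_eq_zero v_closed v_nonzero by (auto simp: e_def)
    qed
    then obtain d1 where d1: "d = Suc d1" by (metis gr0_conv_Suc)
    define I where "I = {k..k + int d1}"
    have fI: "finite I" by (simp add: I_def)
    \<comment> \<open>Dropping either end of the minimal window of \<open>d + 1\<close> indices
      leaves \<open>d = Suc d1\<close> consecutive powers, which are independent by minimality.
      Hence neither outer coefficient can vanish.\<close>
    have up: "{k..k + int d} = insert (k + int d) I" "k + int d \<notin> I"
      and down: "{k..k + int d} = insert k {k + 1..k + 1 + int d1}" by (auto simp: I_def d1)
    have top: "act (c (k + int d)) (e (k + int d)) = act (-1) (comb I c)"
      using kc(1) comb_insert[OF fI up(2)] up(1)
      by (simp add: act_minus_left add.inv_equality[symmetric])
    have "k \<notin> {k + 1..k + 1 + int d1}" by simp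
    note bot' = comb_insert[OF _ this, of c]
    have bot: "act (c k) (e k) = act (-1) (comb {k + 1..k + 1 + int d1} c)"
      using kc(1) bot' down by (simp add: act_minus_left add.inv_equality[symmetric])
    have topnz: "c (k + int d) \<noteq> 0"
    proof
      assume 0: "c (k + int d) = 0"
      then have "comb I c = \<zero>" using kc(1) comb_insert[OF fI up(2)] up(1) by simp
      then have "c i = 0" if "i \<in> I" for i using min[of k d1 c i] that by (simp add: I_def d1)
      then show False using kc(2) up(1) 0 by auto
    qed
    have botnz: "c k \<noteq> 0"
    proof
      assume 0: "c k = 0"
      then have "comb {k + 1..k + 1 + int d1} c = \<zero>" using kc(1) bot' down by simp
      then have "c i = 0" if "i \<in> {k + 1..k + 1 + int d1}" for i using min[of "k + 1" d1 c i] that by (simp add: d1)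
      then show False using kc(2) down 0 by auto
    qed
    have indep: "indep I"
      unfolding lin_indep_def
    proof (intro allI impI ballI, elim conjE)
      fix J b i assume J: "finite J" "J \<subseteq> I" "comb J b = \<zero>" "i \<in> J"
      have "comb I (\<lambda>i. if i \<in> J then b i else 0) = \<zero>" using comb_extend[OF fI J(2), of b] J(3) by simp
      then show "b i = 0" using min[of k d1 "\<lambda>i. if i \<in> J then b i else 0" i] J by (auto simp: I_def d1)
    qed
    have topin: "act (c (k + int d)) (e (k + int d)) \<in> spanned I"
      unfolding top by (intro span_act spanI fI) simp
    \<comment> \<open>Applying \<open>s'\<close> to the relation moves the window down by one. This
      expresses \<open>e (k - 1)\<close> through the powers indexed by \<open>I\<close>, at the
      price of twisting its coefficient by \<open>\<sigma>'\<close>.\<close>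
    have bot2: "act (\<sigma>' (c k)) (e (k - 1)) = s' (act (c k) (e k))"
      by (simp add: s'_act e_def spow_minus1 v_closed)
    have bot3: "s' (act (c k) (e k)) = act (\<sigma>' (-1)) (s' (comb {k + 1..k + 1 + int d1} c))"
      unfolding bot by (simp add: s'_act)
    have "s' (comb {k + 1..k + 1 + int d1} c) = (\<Oplus>i\<in>{k + 1..k + 1 + int d1}. act (\<sigma>' (c i)) (s' (e i)))"
      by (rule semilinear_comb_image[OF s'_add]) (auto simp: s'_act)
    also have "\<dots> \<in> spanned I"
    proof (rule finsum_in)
      fix i assume i: "i \<in> {k + 1..k + 1 + int d1}"
      then have "i - 1 \<in> I" by (auto simp: I_def)
      moreover have "s' (e i) = e (i - 1)" by (simp add: e_def spow_minus1 v_closed)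
      ultimately show "act (\<sigma>' (c i)) (s' (e i)) \<in> spanned I" by (simp add: span_act span_gen)
    qed (auto simp: span_add span_closed abelian_group_axioms)
    finally have botin: "act (\<sigma>' (c k)) (e (k - 1)) \<in> spanned I"
      unfolding bot2 bot3 by (rule span_act)
    \<comment> \<open>One denominator that serves both ends of the window; the neighbors of an
      interior index lie in \<open>I\<close> already.\<close>
    define q where "q = c (k + int d) * \<sigma>' (c k)"
    have "act q (e (i + 1)) \<in> spanned I \<and> act q (e (i - 1)) \<in> spanned I" if i: "i \<in> I" for i
    proof
      show "act q (e (i + 1)) \<in> spanned I"
      proof (cases "i + 1 \<in> I")
        case False
        then have "i + 1 = k + int d" using i by (auto simp: I_def d1)
        then show ?thesis using topin span_act by (simp add: q_def act_mult act_commute)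
      qed (simp add: span_act span_gen)
      show "act q (e (i - 1)) \<in> spanned I"
      proof (cases "i - 1 \<in> I")
        case False
        then have "i - 1 = k - 1" using i by (auto simp: I_def)
        then show ?thesis using botin span_act by (simp add: q_def act_mult)
      qed (simp add: span_act span_gen)
    qed
    moreover have "q \<noteq> 0" "I \<noteq> {}" using topnz botnz \<sigma>'_nonzero by (auto simp: q_def I_def)
    ultimately show ?thesis using indep by blast
  qed
qed

end

text \<open>A polynomial unchanged by the shift would take the value \<open>poly f 0\<close> at all
  multiples of \<open>\<delta>\<close>, and in characteristic 0 these are infinitely many points.
  The degree drops because a shift keeps the leading coefficient.\<close>

lemma pcompose_shift_diff:
  fixes f :: "'q::{idom, ring_char_0} poly"
  assumes "degree f > 0" "\<delta> \<noteq> 0"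
  shows "pcompose f [:\<delta>, 1:] - f \<noteq> 0" "degree (pcompose f [:\<delta>, 1:] - f) < degree f"
proof -
  show "pcompose f [:\<delta>, 1:] - f \<noteq> 0"
  proof
    assume "pcompose f [:\<delta>, 1:] - f = 0"
    then have eq: "pcompose f [:\<delta>, 1:] = f" by simp
    have shift: "poly f (\<delta> + x) = poly f x" for x
      by (subst (2) eq[symmetric]) (simp add: poly_pcompose)
    have val: "poly f (of_nat n * \<delta>) = poly f 0" for n
    proof (induct n)
      case (Suc n)
      have "of_nat (Suc n) * \<delta> = \<delta> + of_nat n * \<delta>" by (simp add: algebra_simps)
      then show ?case using shift Suc by metis
    qed simp
    define g where "g = f - [:poly f 0:]"
    have "f \<noteq> [:poly f 0:]" using assms(1) by (metis degree_pCons_0 less_irrefl)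
    then have "g \<noteq> 0" by (simp add: g_def)
    then have "finite {x. poly g x = 0}" by (rule poly_roots_finite)
    moreover have "range (\<lambda>n. of_nat n * \<delta>) \<subseteq> {x. poly g x = 0}" using val by (auto simp: g_def)
    moreover have "inj (\<lambda>n::nat. of_nat n * \<delta>)" using assms(2) by (simp add: inj_on_def)
    ultimately show False by (metis finite_subset infinite_UNIV_nat finite_imageD)
  qed
  have "degree (pcompose f [:\<delta>, 1:]) = degree f" by (simp add: degree_pcompose)
  moreover have "lead_coeff (pcompose f [:\<delta>, 1:]) = lead_coeff f" by (subst lead_coeff_comp) auto
  ultimately have "coeff (pcompose f [:\<delta>, 1:] - f) k = 0" if "k \<ge> degree f" for k
    using that by (cases "k = degree f") (auto simp: coeff_eq_0)
  then show "degree (pcompose f [:\<delta>, 1:] - f) < degree f"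
    using assms(1) by (intro degree_lessI) auto
qed

text \<open>A vector killed by a polynomial in \<open>T\<close> of minimal degree. Distinct powers \<open>s\<^sup>i\<close> move it to vectors
  killed by distinct shifts of that polynomial, because \<open>T s = s (T + 1)\<close>.\<close>

locale shifted_torsion = linear_operator M act T + invertible_op M s s'
  for M :: "('v, 'z) ring_scheme" (structure) and act :: "'q::{idom, ring_char_0} \<Rightarrow> 'v \<Rightarrow> 'v" and T s s' +
  fixes v f
  assumes Ts: "m \<in> carrier M \<Longrightarrow> T (s m) = s (T m) \<oplus> s m"
    and s_act: "m \<in> carrier M \<Longrightarrow> s (act p m) = act p (s m)"
    and torsion_free: "\<lbrakk>m \<in> carrier M; act p m = \<zero>; m \<noteq> \<zero>\<rbrakk> \<Longrightarrow> p = 0"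
    and v_closed: "v \<in> carrier M" and v_nonzero: "v \<noteq> \<zero>"
    and f_nonzero: "f \<noteq> 0" and fv: "pact f v = \<zero>"
    and minimal: "\<lbrakk>m \<in> carrier M; m \<noteq> \<zero>; g \<noteq> 0; pact g m = \<zero>\<rbrakk> \<Longrightarrow> degree f \<le> degree g"
begin

lemma s'_act: "m \<in> carrier M \<Longrightarrow> s' (act p m) = act p (s' m)"
  by (metis s_act s's ss' s'_closed act_closed)

lemma Ts': "m \<in> carrier M \<Longrightarrow> T (s' m) = s' (T m) \<ominus> s' m"
proof -
  assume m: "m \<in> carrier M"
  have "T m = s (T (s' m)) \<oplus> m" using Ts[of "s' m"] m by simp
  then have "s' (T m) = s' (s (T (s' m)) \<oplus> m)" by simp
  also have "\<dots> = T (s' m) \<oplus> s' m" using m by (simp add: additive_opD(2)[OF s'_add])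
  finally show ?thesis using m by (simp add: minus_eq a_assoc r_neg)
qed

lemma spow_act: "m \<in> carrier M \<Longrightarrow> spow i (act p m) = act p (spow i m)"
  by (induct i rule: int_induct[of _ 0]) (auto simp: spow_plus1 spow_minus1 s_act s'_act)

lemma T_spow: "m \<in> carrier M \<Longrightarrow> T (spow i m) = spow i (T m) \<oplus> act (of_int i) (spow i m)"
proof (induct i rule: int_induct[of _ 0])
  case base then show ?case by simp
next
  case (step1 i)
  then show ?case
    by (simp add: spow_plus1 Ts additive_opD(2)[OF s_add] s_act act_add_left a_assoc)
next
  case (step2 i)
  then show ?case
    by (simp add: spow_minus1 Ts' additive_opD(2)[OF s'_add] s'_act act_diff_left minus_eq a_assoc)
qed

lemma pact_spow: "m \<in> carrier M \<Longrightarrow> pact g (spow i m) = spow i (pact (pcompose g [:of_int i, 1:]) m)"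
proof (induct g)
  case 0 then show ?case by (simp add: additive_op_zero[OF additive_spow])
next
  case (pCons a g)
  then show ?case
    by (simp add: pact_pCons T_spow pcompose_pCons pact_add_left pact_mult pact_const pact_linear pact_smult
        additive_opD(2)[OF additive_spow] spow_act a_ac)
qed

lemma degree_f: "degree f > 0"
proof (rule ccontr)
  assume "\<not> degree f > 0"
  then obtain c where c: "f = [:c:]" by (auto elim: degree_eq_zeroE)
  then have "act c v = \<zero>" using fv v_closed by (simp add: pact_const)
  then show False using torsion_free v_closed v_nonzero f_nonzero c by auto
qed

text \<open>Induction on \<open>J\<close>. The polynomial \<open>f(X - k)\<close> kills
  \<open>s^k u_k\<close> and turns every other \<open>s^i u_i\<close> into
  \<open>s^i f(T + i - k) u_i\<close>; by induction the vectors \<open>f(T + i - k) u_i\<close>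
  vanish. Then \<open>u_i\<close> is killed by \<open>f(X + i - k) - f(X)\<close>, which is nonzero
  and of smaller degree than \<open>f\<close>, so minimality gives \<open>u_i = 0\<close>.\<close>

lemma spow_sum_zero:
  assumes "finite J" "\<And>i. i \<in> J \<Longrightarrow> u i \<in> carrier M" "\<And>i. i \<in> J \<Longrightarrow> pact f (u i) = \<zero>"
    "(\<Oplus>i\<in>J. spow i (u i)) = \<zero>" "i \<in> J"
  shows "u i = \<zero>"
  using assms
proof (induct J arbitrary: u i rule: finite_induct)
  case empty then show ?case by simp
next
  case (insert k J)
  define F where "F = pcompose f [:- of_int k, 1:]"
  define w where "w i = pact (pcompose f [:of_int i - of_int k, 1:]) (u i)" for i
  have sw: "pact F (spow i (u i)) = spow i (w i)" if "i \<in> insert k J" for i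
    using insert(4)[OF that] by (simp add: pact_spow F_def w_def pcompose_pCons flip: pcompose_assoc)
  have wk: "w k = \<zero>" using insert(5)[of k] by (simp add: w_def)
  interpret P: scalar_action M pact by (rule scalar_action_pact)
  have w: "w i \<in> carrier M" "pact f (w i) = \<zero>" if "i \<in> J" for i
    using that insert(4,5) P.act_commute[of "u i" f] by (auto simp: w_def)
  have "\<zero> = pact F (\<Oplus>i\<in>insert k J. spow i (u i))" using insert(6) by simp
  also have "\<dots> = (\<Oplus>i\<in>insert k J. spow i (w i))"
  proof (subst P.act_finsum)
    show "(\<Oplus>i\<in>insert k J. pact F (spow i (u i))) = (\<Oplus>i\<in>insert k J. spow i (w i))"
      using sw insert(4) by (intro finsum_cong') (auto simp: w_def)
  qed (use insert in auto)
  also have "\<dots> = (\<Oplus>i\<in>J. spow i (w i))"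
    using insert(1,2) w wk by (subst finsum_insert) (auto simp: additive_op_zero[OF additive_spow] intro!: finsum_closed)
  finally have sum0: "(\<Oplus>i\<in>J. spow i (w i)) = \<zero>" by (rule sym)
  have w0: "w i = \<zero>" if "i \<in> J" for i
    by (rule insert(3)[of w, OF _ _ sum0 that]) (use w in auto)
  have uJ: "u i = \<zero>" if i: "i \<in> J" for i
  proof (rule_tac ccontr)
    assume nz: "u i \<noteq> \<zero>"
    let ?\<delta> = "of_int i - of_int k :: 'q"
    have "?\<delta> \<noteq> 0" using i insert(2) by auto
    note sh = pcompose_shift_diff[OF degree_f this]
    have "pact (pcompose f [:?\<delta>, 1:] - f) (u i) = \<zero>"
      using w0[OF i] insert(4,5) i by (simp add: P.act_diff_left w_def minus_eq)
    then show False using minimal[OF _ nz sh(1)] sh(2) insert(4) i by auto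
  qed
  have "spow k (u k) = (\<Oplus>i\<in>insert k J. spow i (u i))"
  proof -
    have "(\<Oplus>i\<in>J. spow i (u i)) = \<zero>"
      using uJ by (intro add.finprod_one_eqI) (simp add: additive_op_zero[OF additive_spow])
    then show ?thesis using insert(1,2,4) by (subst finsum_insert) auto
  qed
  then have "u k = \<zero>" using insert(4,6) spow_eq_zero by simp
  then show ?case using uJ insert(7) by auto
qed

definition "basis = (\<lambda>(i, j). spow i ((T ^^ j) v))"

lemma basis_closed [simp]: "basis x \<in> carrier M"
  by (cases x) (simp add: basis_def v_closed)

sublocale B: action_family M act basis
  by unfold_locales simp

lemma comb_basis_product:
  assumes "finite J"
  shows "B.comb (J \<times> {..<n}) b = (\<Oplus>i\<in>J. spow i (pact (\<Sum>j<n. monom (b (i, j)) j) v))"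
  using assms
proof (induct J)
  case empty then show ?case by simp
next
  case (insert i J)
  have "B.comb (insert i J \<times> {..<n}) b = B.comb ((Pair i ` {..<n}) \<union> (J \<times> {..<n})) b"
    by (rule arg_cong[where f = "\<lambda>K. B.comb K b"]) auto
  also have "\<dots> = B.comb (Pair i ` {..<n}) b \<oplus> B.comb (J \<times> {..<n}) b"
    unfolding lin_comb_def using insert(1,2) by (intro finsum_Un_disjoint) auto
  also have "B.comb (Pair i ` {..<n}) b = (\<Oplus>j\<in>{..<n}. act (b (i, j)) (basis (i, j)))"
    unfolding lin_comb_def by (subst finsum_reindex) (auto simp: inj_on_def)
  also have "\<dots> = (\<Oplus>j\<in>{..<n}. spow i (act (b (i, j)) ((T ^^ j) v)))"
    by (rule finsum_cong') (auto simp: basis_def spow_act v_closed)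
  also have "\<dots> = spow i (pact (\<Sum>j<n. monom (b (i, j)) j) v)"
    by (subst pact_sum_monom[OF v_closed])
      (auto simp: v_closed intro!: additive_op_finsum[OF additive_spow, symmetric])
  finally show ?case using insert v_closed by (subst finsum_insert) auto
qed

text \<open>Grouped by powers of \<open>s\<close>, a relation becomes a vanishing sum of
  \<open>s^i r_i(T) v\<close> with \<open>degree r_i < degree f\<close>. Since \<open>f\<close> also
  kills \<open>r_i(T) v\<close>, \<open>spow_sum_zero\<close> makes each of these vectors zero, and
  minimality makes each \<open>r_i\<close> zero.\<close>

lemma indep_basis: "B.indep (UNIV \<times> {..<degree f})"
  unfolding lin_indep_def
proof (intro allI impI ballI, elim conjE)
  fix K b x assume K: "finite K" "K \<subseteq> UNIV \<times> {..<degree f}" "B.comb K b = \<zero>" "x \<in> K"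
  let ?J = "fst ` K"
  define c where "c = (\<lambda>x. if x \<in> K then b x else 0)"
  define r where "r i = (\<Sum>j<degree f. monom (c (i, j)) j)" for i
  interpret P: scalar_action M pact by (rule scalar_action_pact)
  have sub: "K \<subseteq> ?J \<times> {..<degree f}" using K(2) by force
  have "B.comb (?J \<times> {..<degree f}) c = \<zero>"
    using B.comb_extend[OF _ sub, of b] K(1,3) by (simp add: c_def)
  then have "(\<Oplus>i\<in>?J. spow i (pact (r i) v)) = \<zero>"
    using comb_basis_product[of ?J "degree f" c] K(1) by (simp add: r_def)
  then have "pact (r (fst x)) v = \<zero>"
    using spow_sum_zero[of ?J "\<lambda>i. pact (r i) v" "fst x"] K(1,4) v_closed P.act_commute[of v f] fv by auto
  moreover have cr: "coeff (r i) j = (if j < degree f then c (i, j) else 0)" for i j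
    by (simp add: r_def coeff_sum)
  then have "degree (r (fst x)) < degree f" using degree_f by (intro degree_lessI) auto
  ultimately have "r (fst x) = 0" using minimal[of v "r (fst x)"] v_closed v_nonzero by fastforce
  moreover have "snd x < degree f" using K(2,4) by auto
  ultimately have "c x = 0" using cr[of "fst x" "snd x"] by simp
  then show "b x = 0" using K(4) by (simp add: c_def)
qed

text \<open>Moving \<open>T\<close> past \<open>s^i\<close> only adds a multiple of the same basis
  vector. The exponent \<open>j\<close> leaves its range only at \<open>j = degree f - 1\<close>,
  where \<open>f(T) v = 0\<close> rewrites the top power once it is multiplied by the leading
  coefficient.\<close>

lemma T_basis:
  assumes "x \<in> UNIV \<times> {..<degree f}"
  shows "act (lead_coeff f) (T (basis x)) \<in> B.spanned (UNIV \<times> {..<degree f})" (is "_ \<in> B.spanned ?I")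
proof -
  obtain i j where x: "x = (i, j)" "j < degree f" using assms by auto
  have "T (basis x) = spow i ((T ^^ Suc j) v) \<oplus> act (of_int i) (basis x)"
    by (simp add: x basis_def T_spow v_closed)
  moreover have "act (lead_coeff f) (spow i ((T ^^ Suc j) v)) \<in> B.spanned ?I"
  proof (cases "Suc j < degree f")
    case True
    then have "spow i ((T ^^ Suc j) v) \<in> B.spanned ?I"
      using B.span_gen[of "(i, Suc j)" ?I] by (simp add: basis_def)
    then show ?thesis by (rule B.span_act)
  next
    case False
    then have j: "Suc j = degree f" using x by simp
    let ?r = "\<Sum>j<degree f. monom (coeff f j) j"
    have fr: "?r + monom (lead_coeff f) (degree f) = f"
      using poly_as_sum_of_monoms[of f] by (simp only: lessThan_Suc_atMost[symmetric] sum.lessThan_Suc)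
    have "pact ?r v \<oplus> act (lead_coeff f) ((T ^^ degree f) v) = pact (?r + monom (lead_coeff f) (degree f)) v"
      by (simp only: pact_add_left[OF v_closed] pact_monom[OF v_closed])
    then have "pact ?r v \<oplus> act (lead_coeff f) ((T ^^ degree f) v) = \<zero>" by (simp only: fr fv)
    then have "\<ominus> act (lead_coeff f) ((T ^^ degree f) v) = pact ?r v"
      using v_closed by (intro minus_equality) simp_all
    then have "act (lead_coeff f) ((T ^^ degree f) v) = \<ominus> pact ?r v"
      using v_closed by (metis T_pow_closed act_closed minus_minus)
    then have "spow i (act (lead_coeff f) ((T ^^ degree f) v)) = \<ominus> spow i (pact ?r v)"
      using v_closed by (simp add: additive_op_minus[OF additive_spow])
    then have "act (lead_coeff f) (spow i ((T ^^ degree f) v)) = act (-1) (spow i (pact ?r v))"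
      using v_closed by (simp only: spow_act[OF T_pow_closed] act_minus_left spow_closed pact_closed act_one)
    also have "spow i (pact ?r v) = B.comb ({i} \<times> {..<degree f}) (\<lambda>x. coeff f (snd x))"
      using comb_basis_product[of "{i}" "degree f" "\<lambda>x. coeff f (snd x)"] v_closed by simp
    also have "act (-1) \<dots> \<in> B.spanned ?I" by (intro B.span_act B.spanI) auto
    finally show ?thesis using j by simp
  qed
  ultimately show ?thesis
    using assms by (simp add: act_add_right v_closed B.span_add B.span_act B.span_gen)
qed

end

section \<open>Modules over the free algebra\<close>

lemma ring_of_type_algebra_simps [simp]:
  "carrier ring_of_type_algebra = UNIV" "\<one>\<^bsub>ring_of_type_algebra\<^esub> = 1" "\<zero>\<^bsub>ring_of_type_algebra\<^esub> = 0"
  "p \<otimes>\<^bsub>ring_of_type_algebra\<^esub> q = p * q" "p \<oplus>\<^bsub>ring_of_type_algebra\<^esub> q = p + q"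
  by (simp_all add: ring_of_type_algebra_def)

lemma ring_of_type: "ring (ring_of_type_algebra :: 'a::ring_1 ring)"
proof (rule ringI)
  show "abelian_group (ring_of_type_algebra :: 'a ring)"
    by (rule abelian_groupI) (auto simp: add_ac intro: exI[of _ "- _"])
  show "Group.monoid (ring_of_type_algebra :: 'a ring)"
    by (rule monoidI) (auto simp: mult.assoc)
qed (auto simp: algebra_simps)

lemma a_inv_ring_of_type [simp]: "\<ominus>\<^bsub>ring_of_type_algebra\<^esub> p = - p"
proof -
  interpret ring "ring_of_type_algebra :: 'a ring" by (rule ring_of_type)
  show ?thesis using minus_equality[of "- p" p] by simp
qed

lemma poly_mapping_induct [case_names single add]:
  assumes single: "\<And>w c. P (Poly_Mapping.single w c)" and add: "\<And>p q. P p \<Longrightarrow> P q \<Longrightarrow> P (p + q)"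
  shows "P (p :: 'a \<Rightarrow>\<^sub>0 'b::comm_monoid_add)"
proof -
  have "P (\<Sum>w\<in>K. Poly_Mapping.single w (Poly_Mapping.lookup p w))" if "finite K" for K
    using that
  proof (induct K)
    case empty then show ?case using single[of undefined 0] by simp
  qed (simp add: single add)
  moreover have "p = (\<Sum>w\<in>Poly_Mapping.keys p. Poly_Mapping.single w (Poly_Mapping.lookup p w))"
    by (rule poly_mapping_eqI) (auto simp: lookup_sum lookup_single when_def in_keys_iff)
  ultimately show ?thesis by (metis finite_keys)
qed

locale free_action = scalar_action V sm for V :: "('v, 'z) ring_scheme" (structure) and sm :: "'k::field \<Rightarrow> 'v \<Rightarrow> 'v" +
  fixes f :: "'g \<Rightarrow> 'v \<Rightarrow> 'v"
  assumes f_add: "additive_op V (f x)"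
    and f_sm: "m \<in> carrier V \<Longrightarrow> f x (sm c m) = sm c (f x m)"
begin

definition wact :: "'g free_monoid \<Rightarrow> 'v \<Rightarrow> 'v" where
  "wact w m = foldr f (letters w) m"

definition fact :: "('g, 'k) free_algebra \<Rightarrow> 'v \<Rightarrow> 'v" where
  "fact p m = (\<Oplus>w\<in>Poly_Mapping.keys p. sm (Poly_Mapping.lookup p w) (wact w m))"

lemmas f_closed [simp] = additive_opD(1)[OF f_add]

lemma wact_simps: "wact 0 m = m" "wact (u + w) m = wact u (wact w m)" "wact (Word [x]) m = f x m"
  by (simp_all add: wact_def zero_free_monoid_def plus_free_monoid_def)

lemma wact_closed [simp]: "m \<in> carrier V \<Longrightarrow> wact w m \<in> carrier V"
proof -
  have "m \<in> carrier V \<Longrightarrow> foldr f xs m \<in> carrier V" for xs by (induct xs) auto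
  then show "m \<in> carrier V \<Longrightarrow> wact w m \<in> carrier V" by (simp add: wact_def)
qed

lemma wact_sm: "m \<in> carrier V \<Longrightarrow> wact w (sm c m) = sm c (wact w m)"
proof -
  have "m \<in> carrier V \<Longrightarrow> foldr f xs (sm c m) = sm c (foldr f xs m) \<and> foldr f xs m \<in> carrier V" for xs
    by (induct xs) (auto simp: f_sm)
  then show "m \<in> carrier V \<Longrightarrow> wact w (sm c m) = sm c (wact w m)" by (simp add: wact_def)
qed

lemma wact_add: "\<lbrakk>m \<in> carrier V; n \<in> carrier V\<rbrakk> \<Longrightarrow> wact w (m \<oplus> n) = wact w m \<oplus> wact w n"
proof -
  assume mn: "m \<in> carrier V" "n \<in> carrier V"
  have "foldr f xs (m \<oplus> n) = foldr f xs m \<oplus> foldr f xs n" for xs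
  proof (induct xs)
    case (Cons x xs)
    have "foldr f xs m \<in> carrier V" "foldr f xs n \<in> carrier V"
      using wact_closed[of _ "Word xs"] mn by (simp_all add: wact_def)
    with Cons show ?case by (simp add: additive_opD(2)[OF f_add])
  qed simp
  then show "wact w (m \<oplus> n) = wact w m \<oplus> wact w n" by (simp add: wact_def)
qed

lemma fact_superset:
  assumes "finite K" "Poly_Mapping.keys p \<subseteq> K" "m \<in> carrier V"
  shows "fact p m = (\<Oplus>w\<in>K. sm (Poly_Mapping.lookup p w) (wact w m))"
  unfolding fact_def by (rule add.finprod_mono_neutral_cong_left) (use assms in \<open>auto simp: in_keys_iff\<close>)

lemma fact_closed [simp]: "m \<in> carrier V \<Longrightarrow> fact p m \<in> carrier V"
  by (auto simp: fact_def intro!: finsum_closed)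

lemma fact_single: "m \<in> carrier V \<Longrightarrow> fact (Poly_Mapping.single w c) m = sm c (wact w m)"
  by (cases "c = 0") (auto simp: fact_def)

lemma fact_add_left: "m \<in> carrier V \<Longrightarrow> fact (p + q) m = fact p m \<oplus> fact q m"
proof -
  assume m: "m \<in> carrier V"
  let ?K = "Poly_Mapping.keys p \<union> Poly_Mapping.keys q"
  have "fact (p + q) m = (\<Oplus>w\<in>?K. sm (Poly_Mapping.lookup (p + q) w) (wact w m))"
    using m keys_add[of p q] by (intro fact_superset) auto
  also have "\<dots> = (\<Oplus>w\<in>?K. sm (Poly_Mapping.lookup p w) (wact w m) \<oplus> sm (Poly_Mapping.lookup q w) (wact w m))"
    using m by (intro finsum_cong') (auto simp: lookup_add act_add_left)
  also have "\<dots> = fact p m \<oplus> fact q m"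
    using m fact_superset[of ?K p m] fact_superset[of ?K q m] by (subst finsum_addf) auto
  finally show "fact (p + q) m = fact p m \<oplus> fact q m" .
qed

lemma fact_add_right: "\<lbrakk>m \<in> carrier V; n \<in> carrier V\<rbrakk> \<Longrightarrow> fact p (m \<oplus> n) = fact p m \<oplus> fact p n"
  by (induct p rule: poly_mapping_induct) (auto simp: fact_single wact_add act_add_right fact_add_left a_ac)

lemma fact_mult: "m \<in> carrier V \<Longrightarrow> fact (p * q) m = fact p (fact q m)"
proof (induct p rule: poly_mapping_induct)
  case (single u c)
  from single show ?case
    by (induct q rule: poly_mapping_induct)
      (auto simp: mult_single fact_single wact_simps act_mult wact_sm distrib_left fact_add_left wact_add act_add_right)
next
  case (add p q')
  then show ?case by (simp add: distrib_right fact_add_left)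
qed

lemma fact_minus: "m \<in> carrier V \<Longrightarrow> fact (- p) m = \<ominus> fact p m"
proof -
  assume m: "m \<in> carrier V"
  have "fact (- p) m \<oplus> fact p m = fact 0 m" using m by (simp flip: fact_add_left)
  also have "\<dots> = \<zero>" by (simp add: fact_def)
  finally show "fact (- p) m = \<ominus> fact p m" using m by (metis fact_closed minus_equality)
qed

lemma fact_one: "m \<in> carrier V \<Longrightarrow> fact 1 m = m"
  using fact_single[of m 0 1] by (simp add: wact_simps)

lemma fact_var: "m \<in> carrier V \<Longrightarrow> fact (var x) m = f x m"
  by (simp add: var_def fact_single wact_simps)

lemma fact_const: "m \<in> carrier V \<Longrightarrow> fact (const c) m = sm c m"
  by (simp add: const_def fact_single wact_simps)

definition free_module :: "(('g, 'k) free_algebra, 'v) module" where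
  "free_module = \<lparr>carrier = carrier V, monoid.mult = undefined, one = undefined, zero = \<zero>, add = add V,
     module.smult = fact\<rparr>"

lemma left_module_free: "left_module ring_of_type_algebra free_module"
proof (rule left_moduleI[OF ring_of_type])
  have "\<exists>n\<in>carrier V. n \<oplus> m = \<zero>" if "m \<in> carrier V" for m using that by (metis l_neg a_inv_closed)
  then show "abelian_group free_module"
    by (intro abelian_groupI) (auto simp: free_module_def a_ac)
qed (auto simp: free_module_def fact_add_left fact_add_right fact_mult fact_one)

end

section \<open>The algebra and its representations\<close>

lemma ideal_relation_ideal: "ideal relation_ideal (ring_of_type_algebra :: (gen, 'k::field) free_algebra ring)"
  unfolding relation_ideal_def by (rule ring.genideal_ideal[OF ring_of_type]) simp

lemma A_proj_hom: "A_proj \<in> ring_hom ring_of_type_algebra (A_alg :: 'k::field elt ring)"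
proof -
  have eq: "A_proj = (+>\<^bsub>ring_of_type_algebra\<^esub>) (relation_ideal :: (gen, 'k) free_algebra set)"
    by (simp add: fun_eq_iff A_proj_def)
  show ?thesis unfolding A_alg_def eq by (rule ideal.rcos_ring_hom[OF ideal_relation_ideal])
qed

lemma ring_A: "ring A_alg"
  unfolding A_alg_def by (rule ideal.quotient_is_ring[OF ideal_relation_ideal])

lemma A_proj_add: "A_proj (p + q) = A_proj p \<oplus>\<^bsub>A_alg\<^esub> A_proj q"
  and A_proj_mult: "A_proj (p * q) = A_proj p \<otimes>\<^bsub>A_alg\<^esub> A_proj q"
  and A_proj_one: "A_proj 1 = \<one>\<^bsub>A_alg\<^esub>"
  and A_proj_closed [simp]: "A_proj p \<in> carrier A_alg"
  using ring_hom_add[OF A_proj_hom] ring_hom_mult[OF A_proj_hom] ring_hom_one[OF A_proj_hom]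
    ring_hom_closed[OF A_proj_hom] by simp_all

lemma A_proj_minus: "A_proj (- p) = \<ominus>\<^bsub>A_alg\<^esub> A_proj p"
proof -
  interpret ring_hom_ring ring_of_type_algebra "A_alg :: 'a elt ring" A_proj
    by (rule ring_hom_ringI2[OF ring_of_type ring_A A_proj_hom])
  show ?thesis using hom_a_inv[of p] by simp
qed

lemma A_proj_diff: "A_proj (p - q) = A_proj p \<ominus>\<^bsub>A_alg\<^esub> A_proj q"
  using A_proj_add[of p "- q"] by (simp add: A_proj_minus a_minus_def)

lemma A_proj_zero: "A_proj 0 = \<zero>\<^bsub>A_alg\<^esub>"
proof -
  interpret ring_hom_ring ring_of_type_algebra "A_alg :: 'a elt ring" A_proj
    by (rule ring_hom_ringI2[OF ring_of_type ring_A A_proj_hom])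
  show ?thesis using hom_zero by simp
qed

lemma carrier_A: "carrier A_alg = range A_proj"
  unfolding A_alg_def using ideal.carrier_Quot[OF ideal_relation_ideal] by (auto simp: A_proj_def)

lemma A_proj_relator: "r \<in> relators \<Longrightarrow> A_proj r = \<zero>\<^bsub>A_alg\<^esub>"
proof -
  assume "r \<in> relators"
  then have "r \<in> relation_ideal"
    unfolding relation_ideal_def using ring.genideal_self[OF ring_of_type, of relators] by auto
  then have "relation_ideal +>\<^bsub>ring_of_type_algebra\<^esub> r = relation_ideal"
    using ideal_relation_ideal by (meson abelian_subgroup.a_rcos_const abelian_subgroupI3 additive_subgroup.a_Hcarr ideal.axioms(1) ideal.axioms(2) ring.is_abelian_group)
  then show "A_proj r = \<zero>\<^bsub>A_alg\<^esub>" by (simp add: A_proj_def A_alg_def FactRing_def)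
qed

lemma elts_closed [simp]: "elt_x \<in> carrier A_alg" "elt_y \<in> carrier A_alg" "elt_g \<in> carrier A_alg"
  "elt_ginv \<in> carrier A_alg" "A_scalar c \<in> carrier A_alg"
  by (simp_all add: elt_x_def elt_y_def elt_g_def elt_ginv_def A_scalar_def)

lemma elt_s_closed [simp]: "elt_s \<in> carrier A_alg"
proof -
  interpret ring A_alg by (rule ring_A)
  show ?thesis by (simp add: elt_s_def)
qed

text \<open>Residue classes are sums of scalar multiples of words, so the scalars and the four
  letters generate the algebra as a ring.\<close>

lemma A_induct [consumes 1, case_names scalar x y g ginv add mult]:
  assumes "a \<in> carrier A_alg"
    and sc: "\<And>c. P (A_scalar c)" and gens: "P elt_x" "P elt_y" "P elt_g" "P elt_ginv"
    and add: "\<And>a b. \<lbrakk>a \<in> carrier A_alg; b \<in> carrier A_alg; P a; P b\<rbrakk> \<Longrightarrow> P (a \<oplus>\<^bsub>A_alg\<^esub> b)"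
    and mult: "\<And>a b. \<lbrakk>a \<in> carrier A_alg; b \<in> carrier A_alg; P a; P b\<rbrakk> \<Longrightarrow> P (a \<otimes>\<^bsub>A_alg\<^esub> b)"
  shows "P a"
proof -
  obtain p where "a = A_proj p" using assms(1) by (auto simp: carrier_A)
  moreover have "P (A_proj p)"
  proof (induct p rule: poly_mapping_induct)
    case (single w c)
    have "P (A_proj (Poly_Mapping.single (Word xs) c))" for xs
    proof (induct xs)
      case Nil then show ?case using sc[of c] by (simp add: A_scalar_def const_def zero_free_monoid_def)
    next
      case (Cons v xs)
      have "P (A_proj (var v))"
        using gens by (cases v) (simp_all add: elt_x_def elt_y_def elt_g_def elt_ginv_def)
      moreover have "Poly_Mapping.single (Word (v # xs)) c = var v * Poly_Mapping.single (Word xs) c"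
        by (simp add: var_def mult_single plus_free_monoid_def)
      ultimately show ?case using Cons mult by (simp add: A_proj_mult)
    qed
    then show ?case by (cases w) auto
  qed (simp add: A_proj_add add)
  ultimately show ?thesis by simp
qed

lemma A_scalar_hom:
  "A_scalar (c + d) = A_scalar c \<oplus>\<^bsub>A_alg\<^esub> A_scalar d" "A_scalar (c * d) = A_scalar c \<otimes>\<^bsub>A_alg\<^esub> A_scalar d"
  "A_scalar 1 = \<one>\<^bsub>A_alg\<^esub>"
  by (simp_all add: A_scalar_def const_def single_add mult_single flip: A_proj_add A_proj_mult A_proj_one)

lemma A_scalar_central:
  assumes "a \<in> carrier A_alg" shows "A_scalar c \<otimes>\<^bsub>A_alg\<^esub> a = a \<otimes>\<^bsub>A_alg\<^esub> A_scalar c"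
proof -
  have "const c * p = p * const c" for p :: "(gen, 'a) free_algebra"
    by (induct p rule: poly_mapping_induct) (simp_all add: const_def mult_single mult.commute distrib_left distrib_right)
  then show ?thesis using assms by (auto simp: carrier_A A_scalar_def simp flip: A_proj_mult)
qed

lemma A_proj_eqI:
  assumes "p - q \<in> relators" shows "A_proj p = A_proj q"
proof -
  interpret ring "A_alg :: 'a elt ring" by (rule ring_A)
  show ?thesis using A_proj_relator[OF assms] A_proj_add[of "p - q" q] by simp
qed

lemma A_relations:
  "elt_x \<otimes>\<^bsub>A_alg\<^esub> elt_x = \<zero>\<^bsub>A_alg\<^esub>"
  "elt_y \<otimes>\<^bsub>A_alg\<^esub> elt_s = elt_s \<otimes>\<^bsub>A_alg\<^esub> elt_y \<oplus>\<^bsub>A_alg\<^esub> elt_x \<otimes>\<^bsub>A_alg\<^esub> elt_s"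
  "elt_g \<otimes>\<^bsub>A_alg\<^esub> elt_ginv = \<one>\<^bsub>A_alg\<^esub>" "elt_ginv \<otimes>\<^bsub>A_alg\<^esub> elt_g = \<one>\<^bsub>A_alg\<^esub>"
  "elt_g \<otimes>\<^bsub>A_alg\<^esub> elt_x \<otimes>\<^bsub>A_alg\<^esub> elt_ginv = \<ominus>\<^bsub>A_alg\<^esub> elt_x"
  "elt_g \<otimes>\<^bsub>A_alg\<^esub> elt_y \<otimes>\<^bsub>A_alg\<^esub> elt_ginv = \<ominus>\<^bsub>A_alg\<^esub> elt_y \<oplus>\<^bsub>A_alg\<^esub> elt_x"
proof -
  note eq = A_proj_eqI
  note defs = elt_x_def elt_y_def elt_g_def elt_ginv_def elt_s_def
  note flips = A_proj_mult[symmetric] A_proj_add[symmetric] A_proj_minus[symmetric] A_proj_one[symmetric] A_proj_zero[symmetric]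
  show "elt_x \<otimes>\<^bsub>A_alg\<^esub> elt_x = \<zero>\<^bsub>A_alg\<^esub>"
    unfolding defs flips by (rule eq) (simp add: relators_def Let_def)
  show "elt_y \<otimes>\<^bsub>A_alg\<^esub> elt_s = elt_s \<otimes>\<^bsub>A_alg\<^esub> elt_y \<oplus>\<^bsub>A_alg\<^esub> elt_x \<otimes>\<^bsub>A_alg\<^esub> elt_s"
    unfolding defs flips by (rule eq) (simp add: relators_def Let_def diff_diff_eq)
  show "elt_g \<otimes>\<^bsub>A_alg\<^esub> elt_ginv = \<one>\<^bsub>A_alg\<^esub>"
    unfolding defs flips by (rule eq) (simp add: relators_def Let_def)
  show "elt_ginv \<otimes>\<^bsub>A_alg\<^esub> elt_g = \<one>\<^bsub>A_alg\<^esub>"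
    unfolding defs flips by (rule eq) (simp add: relators_def Let_def)
  show "elt_g \<otimes>\<^bsub>A_alg\<^esub> elt_x \<otimes>\<^bsub>A_alg\<^esub> elt_ginv = \<ominus>\<^bsub>A_alg\<^esub> elt_x"
    unfolding defs flips by (rule eq) (simp add: relators_def Let_def)
  show "elt_g \<otimes>\<^bsub>A_alg\<^esub> elt_y \<otimes>\<^bsub>A_alg\<^esub> elt_ginv = \<ominus>\<^bsub>A_alg\<^esub> elt_y \<oplus>\<^bsub>A_alg\<^esub> elt_x"
    unfolding defs flips by (rule eq) (simp add: relators_def Let_def)
qed

text \<open>Operators satisfying the defining relations, with \<open>s\<close> written out in the second one:
  \<open>y s - s y = x s\<close> is \<open>y\<^sup>2 x = x y\<^sup>2 + x y x\<close> in the presence of \<open>x\<^sup>2 = 0\<close>.\<close>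

locale sjp_rep = scalar_action M sm for M :: "('v, 'z) ring_scheme" (structure) and sm :: "'k::field \<Rightarrow> 'v \<Rightarrow> 'v" +
  fixes xx yy gg gi :: "'v \<Rightarrow> 'v"
  assumes X_add: "additive_op M xx" and Y_add: "additive_op M yy"
    and G_add: "additive_op M gg" and Gi_add: "additive_op M gi"
    and X_sm: "m \<in> carrier M \<Longrightarrow> xx (sm c m) = sm c (xx m)" and Y_sm: "m \<in> carrier M \<Longrightarrow> yy (sm c m) = sm c (yy m)"
    and G_sm: "m \<in> carrier M \<Longrightarrow> gg (sm c m) = sm c (gg m)" and Gi_sm: "m \<in> carrier M \<Longrightarrow> gi (sm c m) = sm c (gi m)"
    and XX: "m \<in> carrier M \<Longrightarrow> xx (xx m) = \<zero>"
    and YYX: "m \<in> carrier M \<Longrightarrow> yy (yy (xx m)) = xx (yy (yy m)) \<oplus> xx (yy (xx m))"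
    and GGi [simp]: "m \<in> carrier M \<Longrightarrow> gg (gi m) = m" and GiG [simp]: "m \<in> carrier M \<Longrightarrow> gi (gg m) = m"
    and GX: "m \<in> carrier M \<Longrightarrow> gg (xx m) = \<ominus> xx (gg m)"
    and GY: "m \<in> carrier M \<Longrightarrow> gg (yy m) = xx (gg m) \<ominus> yy (gg m)"
begin

lemmas op_closed [simp] = additive_opD(1)[OF X_add] additive_opD(1)[OF Y_add] additive_opD(1)[OF G_add] additive_opD(1)[OF Gi_add]
lemmas op_add = additive_opD(2)[OF X_add] additive_opD(2)[OF Y_add] additive_opD(2)[OF G_add] additive_opD(2)[OF Gi_add]
lemmas op_minus = additive_op_minus[OF X_add] additive_op_minus[OF Y_add] additive_op_minus[OF G_add] additive_op_minus[OF Gi_add]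
lemmas op_zero [simp] = additive_op_zero[OF X_add] additive_op_zero[OF Y_add] additive_op_zero[OF G_add] additive_op_zero[OF Gi_add]
lemmas op_sm = X_sm Y_sm G_sm Gi_sm

definition S :: "'v \<Rightarrow> 'v" where "S m = xx (yy m) \<oplus> yy (xx m)"
text \<open>The element \<open>2 y x - s\<close> is \<open>y x - x y\<close>, which removes the
  scalar 2; \<open>C_smult\<close> identifies this operator with the action of
  \<open>elt_C\<close>.\<close>

definition C :: "'v \<Rightarrow> 'v" where "C m = yy (xx (gi m)) \<ominus> xx (yy (gi m))"

lemma GiX: "m \<in> carrier M \<Longrightarrow> gi (xx m) = \<ominus> xx (gi m)"
  using GX[of "gi m"] by (metis GGi GiG a_inv_closed op_closed(1,4) op_minus(1) minus_minus op_minus(4))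

lemma GiY: "m \<in> carrier M \<Longrightarrow> gi (yy m) = \<ominus> xx (gi m) \<ominus> yy (gi m)"
proof -
  assume m: "m \<in> carrier M"
  have "gi (gg (yy (gi m))) = gi (xx m \<ominus> yy m)" using GY[of "gi m"] m by simp
  then have "yy (gi m) = \<ominus> xx (gi m) \<ominus> gi (yy m)" using m by (simp add: minus_eq op_add op_minus GiX)
  then show "gi (yy m) = \<ominus> xx (gi m) \<ominus> yy (gi m)" using m by (simp add: minus_eq minus_add r_neg1)
qed

lemmas op_simps = op_add op_minus XX YYX GX GY GiX GiY minus_eq minus_add a_ac l_neg r_neg r_neg1 r_neg2

lemma S_closed [simp]: "m \<in> carrier M \<Longrightarrow> S m \<in> carrier M" by (simp add: S_def)
lemma C_closed [simp]: "m \<in> carrier M \<Longrightarrow> C m \<in> carrier M" by (simp add: C_def)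

lemma S_add: "additive_op M S" by (simp add: additive_op_def S_def op_add a_ac)
lemma C_add: "additive_op M C" by (simp add: additive_op_def C_def op_add minus_eq minus_add a_ac)
lemma S_sm: "m \<in> carrier M \<Longrightarrow> S (sm c m) = sm c (S m)" by (simp add: S_def op_sm act_add_right)
lemma C_sm: "m \<in> carrier M \<Longrightarrow> C (sm c m) = sm c (C m)" by (simp add: C_def op_sm act_add_right minus_eq act_minus_right)

lemma SX: "m \<in> carrier M \<Longrightarrow> xx (S m) = S (xx m)" by (simp add: S_def op_simps)
lemma SG: "m \<in> carrier M \<Longrightarrow> gg (S m) = S (gg m)" by (simp add: S_def op_simps)
lemma SGi: "m \<in> carrier M \<Longrightarrow> gi (S m) = S (gi m)" by (simp add: S_def op_simps)
lemma YS: "m \<in> carrier M \<Longrightarrow> yy (S m) = S (yy m) \<oplus> S (xx m)" by (simp add: S_def op_simps)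

lemma CX: "m \<in> carrier M \<Longrightarrow> C (xx m) = xx (C m)" by (simp add: C_def op_simps)
lemma CY: "m \<in> carrier M \<Longrightarrow> C (yy m) = yy (C m)" by (simp add: C_def op_simps)
lemma CG: "m \<in> carrier M \<Longrightarrow> C (gg m) = gg (C m)" by (simp add: C_def op_simps)
lemma CGi: "m \<in> carrier M \<Longrightarrow> C (gi m) = gi (C m)" by (simp add: C_def op_simps)
text \<open>Here \<open>C g\<close> is \<open>y x - x y\<close>, and \<open>C\<close> commutes with
  \<open>g\<close>. By \<open>YYX\<close> and \<open>XX\<close> the product \<open>x y^2 x\<close>
  vanishes, and therefore \<open>y x - x y\<close> and \<open>x y + y x\<close> have the same
  square. This relation ties \<open>s\<close> to \<open>C\<close>: it makes \<open>s\<close>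
  bijective when \<open>C\<close> is a nonzero scalar and forbids \<open>C = 0\<close> when
  \<open>s\<close> is bijective.\<close>

lemma CCGG: "m \<in> carrier M \<Longrightarrow> C (C (gg (gg m))) = S (S m)" by (simp add: C_def S_def op_simps)

end

lemma (in left_module) annihilator_ideal:
  "ideal {a \<in> carrier R. \<forall>m\<in>carrier M. a \<odot>\<^bsub>M\<^esub> m = \<zero>\<^bsub>M\<^esub>} R"
proof (rule idealI)
  show "ring R" ..
  show "subgroup {a \<in> carrier R. \<forall>m\<in>carrier M. a \<odot>\<^bsub>M\<^esub> m = \<zero>\<^bsub>M\<^esub>} (add_monoid R)"
    by (rule R.add.subgroupI) (auto simp: smult_l_distr smult_l_minus)
qed (auto simp: smult_assoc)

text \<open>The annihilator of a module is a two-sided ideal, so it contains the ideal generated by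
  any of its subsets.\<close>

lemma (in left_module) genideal_annihilates:
  assumes "I \<subseteq> carrier R" "\<And>a m. \<lbrakk>a \<in> I; m \<in> carrier M\<rbrakk> \<Longrightarrow> a \<odot>\<^bsub>M\<^esub> m = \<zero>\<^bsub>M\<^esub>"
    and "a \<in> genideal R I" "m \<in> carrier M"
  shows "a \<odot>\<^bsub>M\<^esub> m = \<zero>\<^bsub>M\<^esub>"
  using R.genideal_minimal[OF annihilator_ideal, of I] assms by auto

fun gen_op :: "('v \<Rightarrow> 'v) \<Rightarrow> ('v \<Rightarrow> 'v) \<Rightarrow> ('v \<Rightarrow> 'v) \<Rightarrow> ('v \<Rightarrow> 'v) \<Rightarrow> gen \<Rightarrow> 'v \<Rightarrow> 'v" where
  "gen_op xx yy gg gi GenX = xx"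
| "gen_op xx yy gg gi GenY = yy"
| "gen_op xx yy gg gi GenG = gg"
| "gen_op xx yy gg gi GenGinv = gi"

context sjp_rep
begin

sublocale F: free_action M sm "gen_op xx yy gg gi"
proof
  show "additive_op M (gen_op xx yy gg gi v)" for v
    by (cases v) (simp_all add: X_add Y_add G_add Gi_add)
  show "gen_op xx yy gg gi v (sm c m) = sm c (gen_op xx yy gg gi v m)" if "m \<in> carrier M" for v c m
    using that by (cases v) (simp_all add: op_sm)
qed

lemma relators_act_zero:
  assumes "r \<in> relators" "m \<in> carrier M" shows "F.fact r m = \<zero>"
proof -
  have *: "F.fact (p - q) m = F.fact p m \<ominus> F.fact q m" if "m \<in> carrier M" for p q m
    using F.fact_add_left[OF that, of p "- q"] F.fact_minus[OF that] by (simp add: minus_eq)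
  show ?thesis using assms
    by (auto simp: relators_def Let_def * F.fact_add_left F.fact_mult F.fact_var F.fact_minus F.fact_one
        op_simps simp del: minus_diff_eq)
qed

lemma relation_ideal_act_zero:
  assumes "r \<in> relation_ideal" "m \<in> carrier M" shows "F.fact r m = \<zero>"
proof -
  interpret L: left_module ring_of_type_algebra F.free_module by (rule F.left_module_free)
  show ?thesis
    using L.genideal_annihilates[of relators r m] relators_act_zero assms
    by (simp add: F.free_module_def relation_ideal_def)
qed

definition rep_module :: "('k elt, 'v) module" where
  "rep_module = factor_module F.free_module"

lemma rep_module_carrier [simp]: "carrier rep_module = carrier M"
  "\<zero>\<^bsub>rep_module\<^esub> = \<zero>" "add rep_module = add M"
  by (simp_all add: rep_module_def F.free_module_def)

lemma left_module_rep: "left_module A_alg rep_module"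
  unfolding rep_module_def A_alg_def
  by (rule factor_module_left_module[OF ideal_relation_ideal F.left_module_free])
    (simp add: F.free_module_def relation_ideal_act_zero)

lemma rep_smult: "m \<in> carrier M \<Longrightarrow> A_proj p \<odot>\<^bsub>rep_module\<^esub> m = F.fact p m"
  unfolding rep_module_def A_proj_def
  by (subst factor_module_smult[OF ideal_relation_ideal F.left_module_free])
    (auto simp: F.free_module_def relation_ideal_act_zero)

lemma rep_gens:
  assumes "m \<in> carrier M"
  shows "A_scalar c \<odot>\<^bsub>rep_module\<^esub> m = sm c m" "elt_x \<odot>\<^bsub>rep_module\<^esub> m = xx m"
    "elt_y \<odot>\<^bsub>rep_module\<^esub> m = yy m" "elt_g \<odot>\<^bsub>rep_module\<^esub> m = gg m" "elt_ginv \<odot>\<^bsub>rep_module\<^esub> m = gi m"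
  using assms by (simp_all add: A_scalar_def elt_x_def elt_y_def elt_g_def elt_ginv_def rep_smult F.fact_const F.fact_var)

text \<open>Replacing \<open>y\<close> by \<open>y + t x\<close> leaves \<open>x y + y x\<close>
  unchanged because \<open>x^2 = 0\<close>, and it respects the relation between \<open>g\<close>
  and \<open>y\<close> because \<open>g\<close> anticommutes with \<open>x\<close>.\<close>

lemma shifted_rep: "sjp_rep M sm xx (\<lambda>m. yy m \<oplus> sm t (xx m)) gg gi"
proof -
  have 1: "additive_op M (\<lambda>m. yy m \<oplus> sm t (xx m))"
    by (simp add: additive_op_def op_add act_add_right a_ac)
  show ?thesis
  proof
    show "additive_op M (\<lambda>m. yy m \<oplus> sm t (xx m))" by (rule 1)
    show "yy (sm c m) \<oplus> sm t (xx (sm c m)) = sm c (yy m \<oplus> sm t (xx m))" if "m \<in> carrier M" for c m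
      using that act_commute[of "xx m" t c] by (simp add: op_sm act_add_right)
  qed (simp_all add: X_add G_add Gi_add op_sm op_simps act_add_right act_minus_right)
qed

end

lemma elt_C_closed [simp]: "elt_C \<in> carrier A_alg"
proof -
  interpret ring A_alg by (rule ring_A)
  show ?thesis by (simp add: elt_C_def)
qed

locale A_module = left_module "A_alg :: 'k::field elt ring" M for M :: "('k::field elt, 'v) module"
begin

abbreviation "sm c m \<equiv> A_scalar c \<odot>\<^bsub>M\<^esub> m"

lemma scalar_action_A: "scalar_action M sm"
  by unfold_locales (simp_all add: A_scalar_hom smult_l_distr smult_r_distr smult_assoc smult_one)

sublocale sc: scalar_action M sm by (rule scalar_action_A)

lemma additive_smult: "a \<in> carrier A_alg \<Longrightarrow> additive_op M (\<lambda>m. a \<odot>\<^bsub>M\<^esub> m)"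
  by (simp add: additive_op_def smult_r_distr)

lemma smult_sm: "\<lbrakk>a \<in> carrier A_alg; m \<in> carrier M\<rbrakk> \<Longrightarrow> a \<odot>\<^bsub>M\<^esub> sm c m = sm c (a \<odot>\<^bsub>M\<^esub> m)"
  by (metis smult_assoc A_scalar_central elts_closed(5))

sublocale rep: sjp_rep M sm "\<lambda>m. elt_x \<odot>\<^bsub>M\<^esub> m" "\<lambda>m. elt_y \<odot>\<^bsub>M\<^esub> m" "\<lambda>m. elt_g \<odot>\<^bsub>M\<^esub> m" "\<lambda>m. elt_ginv \<odot>\<^bsub>M\<^esub> m"
proof -
  let ?x = "\<lambda>m. elt_x \<odot>\<^bsub>M\<^esub> m" and ?y = "\<lambda>m. elt_y \<odot>\<^bsub>M\<^esub> m" and ?g = "\<lambda>m. elt_g \<odot>\<^bsub>M\<^esub> m" and ?gi = "\<lambda>m. elt_ginv \<odot>\<^bsub>M\<^esub> m"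
  note rel = A_relations[THEN arg_cong[where f = "\<lambda>a. a \<odot>\<^bsub>M\<^esub> _"]]
  have xx: "?x (?x m) = \<zero>\<^bsub>M\<^esub>" if "m \<in> carrier M" for m
    using that rel(1)[of m] by (simp add: smult_assoc)
  have gi: "?g (?gi m) = m" "?gi (?g m) = m" if "m \<in> carrier M" for m
    using that rel(3,4)[of m] by (simp_all add: smult_assoc smult_one)
  have gx: "?g (?x m) = \<ominus>\<^bsub>M\<^esub> ?x (?g m)" if "m \<in> carrier M" for m
    using that rel(5)[of "?g m"] gi by (simp add: smult_assoc smult_l_minus)
  have gy: "?g (?y m) = ?x (?g m) \<ominus>\<^bsub>M\<^esub> ?y (?g m)" if "m \<in> carrier M" for m
    using that rel(6)[of "?g m"] gi by (simp add: smult_assoc smult_l_minus smult_l_distr M.minus_eq M.a_comm)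
  have s: "elt_s \<odot>\<^bsub>M\<^esub> m = ?x (?y m) \<oplus>\<^bsub>M\<^esub> ?y (?x m)" if "m \<in> carrier M" for m
    using that by (simp add: elt_s_def smult_assoc smult_l_distr)
  have yyx: "?y (?y (?x m)) = ?x (?y (?y m)) \<oplus>\<^bsub>M\<^esub> ?x (?y (?x m))" if m: "m \<in> carrier M" for m
  proof -
    have "?y (?x (?y m)) \<oplus>\<^bsub>M\<^esub> ?y (?y (?x m)) =
        ?y (?x (?y m)) \<oplus>\<^bsub>M\<^esub> (?x (?y (?y m)) \<oplus>\<^bsub>M\<^esub> ?x (?y (?x m)))"
      using m rel(2)[of m] xx by (simp add: smult_assoc smult_l_distr smult_r_distr s M.a_ac)
    then show ?thesis using m M.add.l_cancel by simp
  qed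
  show "sjp_rep M sm ?x ?y ?g ?gi"
    by unfold_locales (use xx gi gx gy yyx in \<open>simp_all add: additive_smult smult_sm\<close>)
qed

lemma s_smult: "m \<in> carrier M \<Longrightarrow> elt_s \<odot>\<^bsub>M\<^esub> m = rep.S m"
  by (simp add: elt_s_def rep.S_def smult_assoc smult_l_distr)

lemma C_smult: "m \<in> carrier M \<Longrightarrow> elt_C \<odot>\<^bsub>M\<^esub> m = rep.C m"
proof -
  assume m: "m \<in> carrier M"
  have 2: "A_scalar 2 = A_scalar 1 \<oplus>\<^bsub>A_alg\<^esub> (A_scalar 1 :: 'k elt)"
    using A_scalar_hom(1)[of 1 1] by simp
  show ?thesis
    unfolding elt_C_def 2 using m
    by (simp add: R.minus_eq smult_assoc smult_l_distr smult_l_minus s_smult rep.S_def rep.C_def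
        A_scalar_hom smult_one M.minus_eq M.minus_add M.a_ac M.r_neg M.r_neg1 M.r_neg2)
qed

end

section \<open>The automorphism by which elements move past s\<close>

definition regular_module :: "'r ring \<Rightarrow> ('r, 'r) module" where
  "regular_module R = \<lparr>carrier = carrier R, monoid.mult = monoid.mult R, one = one R, zero = zero R,
     add = add R, module.smult = monoid.mult R\<rparr>"

text \<open>Evaluated at 1 in this module, identities between operators turn into identities in the
  algebra.\<close>

lemma left_module_regular: "ring R \<Longrightarrow> left_module R (regular_module R)"
proof -
  assume "ring R"
  then interpret ring R .
  have "\<exists>n\<in>carrier R. n \<oplus>\<^bsub>R\<^esub> m = \<zero>\<^bsub>R\<^esub>" if "m \<in> carrier R" for m using that by (metis l_neg a_inv_closed)
  then have "abelian_group (regular_module R)"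
    by (intro abelian_groupI) (auto simp: regular_module_def a_ac)
  then show ?thesis
    by (rule left_moduleI[OF ring_axioms]) (auto simp: regular_module_def l_distr r_distr m_assoc)
qed

text \<open>The endomorphism \<open>x \<mapsto> x\<close>, \<open>y \<mapsto> y + t x\<close>, \<open>g \<mapsto> g\<close> of \<^const>\<open>A_alg\<close>, obtained from the regular module with
  modified operators.\<close>

definition shift_module :: "'k::field \<Rightarrow> ('k elt, 'k elt) module" where
  "shift_module t = sjp_rep.rep_module (regular_module A_alg) (\<lambda>c m. A_scalar c \<otimes>\<^bsub>A_alg\<^esub> m)
     (\<lambda>m. elt_x \<otimes>\<^bsub>A_alg\<^esub> m) (\<lambda>m. elt_y \<otimes>\<^bsub>A_alg\<^esub> m \<oplus>\<^bsub>A_alg\<^esub> A_scalar t \<otimes>\<^bsub>A_alg\<^esub> (elt_x \<otimes>\<^bsub>A_alg\<^esub> m))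
     (\<lambda>m. elt_g \<otimes>\<^bsub>A_alg\<^esub> m) (\<lambda>m. elt_ginv \<otimes>\<^bsub>A_alg\<^esub> m)"

definition A_shift :: "'k::field \<Rightarrow> 'k elt \<Rightarrow> 'k elt" where
  "A_shift t a = a \<odot>\<^bsub>shift_module t\<^esub> \<one>\<^bsub>A_alg\<^esub>"

lemma shift_module:
  shows "left_module A_alg (shift_module t)" "carrier (shift_module t) = carrier A_alg"
    "add (shift_module t) = add A_alg"
    "m \<in> carrier A_alg \<Longrightarrow> A_scalar c \<odot>\<^bsub>shift_module t\<^esub> m = A_scalar c \<otimes>\<^bsub>A_alg\<^esub> m"
    "m \<in> carrier A_alg \<Longrightarrow> elt_x \<odot>\<^bsub>shift_module t\<^esub> m = elt_x \<otimes>\<^bsub>A_alg\<^esub> m"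
    "m \<in> carrier A_alg \<Longrightarrow> elt_y \<odot>\<^bsub>shift_module t\<^esub> m =
       (elt_y \<oplus>\<^bsub>A_alg\<^esub> A_scalar t \<otimes>\<^bsub>A_alg\<^esub> elt_x) \<otimes>\<^bsub>A_alg\<^esub> m"
    "m \<in> carrier A_alg \<Longrightarrow> elt_g \<odot>\<^bsub>shift_module t\<^esub> m = elt_g \<otimes>\<^bsub>A_alg\<^esub> m"
    "m \<in> carrier A_alg \<Longrightarrow> elt_ginv \<odot>\<^bsub>shift_module t\<^esub> m = elt_ginv \<otimes>\<^bsub>A_alg\<^esub> m"
proof -
  interpret A: ring "A_alg :: 'a elt ring" by (rule ring_A)
  interpret Rg: A_module "regular_module (A_alg :: 'a elt ring)"
    by (rule A_module.intro[OF left_module_regular[OF ring_A]])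
  have sm [simp]: "a \<odot>\<^bsub>regular_module A_alg\<^esub> m = a \<otimes>\<^bsub>A_alg\<^esub> m"
    and [simp]: "carrier (regular_module A_alg) = carrier A_alg" "add (regular_module A_alg) = add A_alg" for a m :: "'a elt"
    by (simp_all add: regular_module_def)
  interpret T: sjp_rep "regular_module (A_alg :: 'a elt ring)" "\<lambda>c m. A_scalar c \<otimes>\<^bsub>A_alg\<^esub> m"
     "\<lambda>m. elt_x \<otimes>\<^bsub>A_alg\<^esub> m" "\<lambda>m. elt_y \<otimes>\<^bsub>A_alg\<^esub> m \<oplus>\<^bsub>A_alg\<^esub> A_scalar t \<otimes>\<^bsub>A_alg\<^esub> (elt_x \<otimes>\<^bsub>A_alg\<^esub> m)"
     "\<lambda>m. elt_g \<otimes>\<^bsub>A_alg\<^esub> m" "\<lambda>m. elt_ginv \<otimes>\<^bsub>A_alg\<^esub> m"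
    using Rg.rep.shifted_rep[of t] by simp
  have sh: "shift_module t = T.rep_module" by (simp add: shift_module_def)
  show "left_module A_alg (shift_module t)" unfolding sh by (rule T.left_module_rep)
  show "carrier (shift_module t) = carrier A_alg" "add (shift_module t) = add A_alg" unfolding sh by simp_all
  assume m: "m \<in> carrier A_alg"
  show "A_scalar c \<odot>\<^bsub>shift_module t\<^esub> m = A_scalar c \<otimes>\<^bsub>A_alg\<^esub> m"
    "elt_x \<odot>\<^bsub>shift_module t\<^esub> m = elt_x \<otimes>\<^bsub>A_alg\<^esub> m"
    "elt_y \<odot>\<^bsub>shift_module t\<^esub> m = (elt_y \<oplus>\<^bsub>A_alg\<^esub> A_scalar t \<otimes>\<^bsub>A_alg\<^esub> elt_x) \<otimes>\<^bsub>A_alg\<^esub> m"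
    "elt_g \<odot>\<^bsub>shift_module t\<^esub> m = elt_g \<otimes>\<^bsub>A_alg\<^esub> m"
    "elt_ginv \<odot>\<^bsub>shift_module t\<^esub> m = elt_ginv \<otimes>\<^bsub>A_alg\<^esub> m"
    unfolding sh using m by (simp_all add: T.rep_gens A.l_distr A.m_assoc)
qed

lemma A_shift_gens:
  "A_shift t (A_scalar c) = A_scalar c" "A_shift t elt_x = elt_x" "A_shift t elt_g = elt_g"
  "A_shift t elt_ginv = elt_ginv" "A_shift t elt_y = elt_y \<oplus>\<^bsub>A_alg\<^esub> A_scalar t \<otimes>\<^bsub>A_alg\<^esub> elt_x"
proof -
  interpret A: ring "A_alg :: 'a elt ring" by (rule ring_A)
  show "A_shift t (A_scalar c) = A_scalar c" "A_shift t elt_x = elt_x" "A_shift t elt_g = elt_g"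
    "A_shift t elt_ginv = elt_ginv" "A_shift t elt_y = elt_y \<oplus>\<^bsub>A_alg\<^esub> A_scalar t \<otimes>\<^bsub>A_alg\<^esub> elt_x"
    by (simp_all add: A_shift_def shift_module)
qed

text \<open>By induction over the generators, \<open>a\<close> acts on the shifted module as left
  multiplication by \<open>A_shift t a\<close>. The module axioms evaluated at 1 then say that
  \<open>A_shift t\<close> is additive and multiplicative.\<close>

lemma A_shift_hom: "A_shift t \<in> ring_hom A_alg A_alg"
proof -
  interpret A: ring "A_alg :: 'a elt ring" by (rule ring_A)
  interpret T: left_module A_alg "shift_module t" by (rule shift_module)
  note [simp] = shift_module(2,3)
  have cl: "A_shift t a \<in> carrier A_alg" if "a \<in> carrier A_alg" for a
    using that T.smult_closed[of a "\<one>\<^bsub>A_alg\<^esub>"] by (simp add: A_shift_def)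
  have act: "a \<odot>\<^bsub>shift_module t\<^esub> m = A_shift t a \<otimes>\<^bsub>A_alg\<^esub> m" if "a \<in> carrier A_alg" "m \<in> carrier A_alg" for a m
    using that
  proof (induct a arbitrary: m rule: A_induct)
    case (add a b)
    have "A_shift t (a \<oplus>\<^bsub>A_alg\<^esub> b) = A_shift t a \<oplus>\<^bsub>A_alg\<^esub> A_shift t b"
      using add(1,2) T.smult_l_distr[of a b "\<one>\<^bsub>A_alg\<^esub>"] by (simp add: A_shift_def)
    then show ?case using add T.smult_l_distr[of a b m] cl by (simp add: A.l_distr)
  next
    case (mult a b)
    have "A_shift t (a \<otimes>\<^bsub>A_alg\<^esub> b) = a \<odot>\<^bsub>shift_module t\<^esub> A_shift t b"
      using mult(1,2) T.smult_assoc[of a b "\<one>\<^bsub>A_alg\<^esub>"] by (simp add: A_shift_def)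
    then have "A_shift t (a \<otimes>\<^bsub>A_alg\<^esub> b) = A_shift t a \<otimes>\<^bsub>A_alg\<^esub> A_shift t b"
      using mult(3)[OF cl[OF mult(2)]] by simp
    then show ?case using mult T.smult_assoc[of a b m] cl by (simp add: A.m_assoc)
  qed (simp_all add: A_shift_gens shift_module)
  show ?thesis
  proof (rule ring_hom_memI)
    show "A_shift t (a \<otimes>\<^bsub>A_alg\<^esub> b) = A_shift t a \<otimes>\<^bsub>A_alg\<^esub> A_shift t b" if "a \<in> carrier A_alg" "b \<in> carrier A_alg" for a b
      using that T.smult_assoc[of a b "\<one>\<^bsub>A_alg\<^esub>"] act[of a "A_shift t b"] cl[of b] by (metis A.one_closed A_shift_def shift_module(2))
    show "A_shift t (a \<oplus>\<^bsub>A_alg\<^esub> b) = A_shift t a \<oplus>\<^bsub>A_alg\<^esub> A_shift t b" if "a \<in> carrier A_alg" "b \<in> carrier A_alg" for a b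
      using that T.smult_l_distr[of a b "\<one>\<^bsub>A_alg\<^esub>"] by (simp add: A_shift_def)
    show "A_shift t \<one>\<^bsub>A_alg\<^esub> = \<one>\<^bsub>A_alg\<^esub>" using T.smult_one[of "\<one>\<^bsub>A_alg\<^esub>"] by (simp add: A_shift_def)
  qed (rule cl)
qed

lemma A_shift_inverse:
  assumes "a \<in> carrier A_alg" shows "A_shift t (A_shift (- t) a) = a"
proof -
  interpret A: ring "A_alg :: 'a elt ring" by (rule ring_A)
  note hom = ring_hom_add[OF A_shift_hom] ring_hom_mult[OF A_shift_hom] ring_hom_closed[OF A_shift_hom]
  have t: "A_scalar t \<oplus>\<^bsub>A_alg\<^esub> A_scalar (- t) = (\<zero>\<^bsub>A_alg\<^esub> :: 'a elt)"
    unfolding A_scalar_hom(1)[symmetric] by (simp add: A_scalar_def const_def A_proj_zero)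
  have "A_scalar t \<otimes>\<^bsub>A_alg\<^esub> elt_x \<oplus>\<^bsub>A_alg\<^esub> A_scalar (- t) \<otimes>\<^bsub>A_alg\<^esub> elt_x = (\<zero>\<^bsub>A_alg\<^esub> :: 'a elt)"
    by (simp add: t flip: A.l_distr)
  with assms show ?thesis
    by (induct a rule: A_induct) (simp_all add: hom A_shift_gens A.a_assoc)
qed

lemma A_shift_s [simp]: "A_shift t elt_s = elt_s"
proof -
  interpret A: ring "A_alg :: 'a elt ring" by (rule ring_A)
  note hom = ring_hom_add[OF A_shift_hom] ring_hom_mult[OF A_shift_hom] ring_hom_closed[OF A_shift_hom]
  have "elt_x \<otimes>\<^bsub>A_alg\<^esub> (A_scalar t \<otimes>\<^bsub>A_alg\<^esub> elt_x) = \<zero>\<^bsub>A_alg\<^esub>"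
    by (metis A.m_assoc A.r_null A_relations(1) A_scalar_central elts_closed(1,5))
  moreover have "A_scalar t \<otimes>\<^bsub>A_alg\<^esub> elt_x \<otimes>\<^bsub>A_alg\<^esub> elt_x = \<zero>\<^bsub>A_alg\<^esub>"
    by (simp add: A.m_assoc A_relations(1))
  ultimately show ?thesis
    by (simp add: elt_s_def hom A_shift_gens A.l_distr A.r_distr)
qed

text \<open>On generators: \<open>y s = s y + x s = s (y + x)\<close>, while \<open>x\<close>,
  \<open>g\<close>, \<open>g^-1\<close> and the scalars commute with \<open>s\<close>. The rule
  passes to products because \<open>A_shift 1\<close> is multiplicative; with the inverse shift it
  makes \<open>s\<close> normal.\<close>

lemma A_shift_commutation:
  assumes "a \<in> carrier A_alg" shows "a \<otimes>\<^bsub>A_alg\<^esub> elt_s = elt_s \<otimes>\<^bsub>A_alg\<^esub> A_shift 1 a"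
proof -
  interpret A: ring "A_alg :: 'a elt ring" by (rule ring_A)
  note hom = ring_hom_add[OF A_shift_hom] ring_hom_mult[OF A_shift_hom] ring_hom_closed[OF A_shift_hom]
  interpret Rg: A_module "regular_module (A_alg :: 'a elt ring)"
    by (rule A_module.intro[OF left_module_regular[OF ring_A]])
  have [simp]: "a \<odot>\<^bsub>regular_module A_alg\<^esub> m = a \<otimes>\<^bsub>A_alg\<^esub> m"
    and [simp]: "carrier (regular_module A_alg) = carrier A_alg" "add (regular_module A_alg) = add A_alg" for a m :: "'a elt"
    by (simp_all add: regular_module_def)
  note c = Rg.s_smult[symmetric, simplified]
  note ops = Rg.rep.SX[of "\<one>\<^bsub>A_alg\<^esub>"] Rg.rep.SG[of "\<one>\<^bsub>A_alg\<^esub>"] Rg.rep.SGi[of "\<one>\<^bsub>A_alg\<^esub>"] Rg.rep.YS[of "\<one>\<^bsub>A_alg\<^esub>"]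
  show ?thesis using assms
  proof (induct a rule: A_induct)
    case (mult a b)
    have "a \<otimes>\<^bsub>A_alg\<^esub> b \<otimes>\<^bsub>A_alg\<^esub> elt_s = a \<otimes>\<^bsub>A_alg\<^esub> (elt_s \<otimes>\<^bsub>A_alg\<^esub> A_shift 1 b)"
      using mult by (simp add: A.m_assoc)
    also have "\<dots> = (a \<otimes>\<^bsub>A_alg\<^esub> elt_s) \<otimes>\<^bsub>A_alg\<^esub> A_shift 1 b"
      using mult(1,2) by (simp add: A.m_assoc hom)
    also have "\<dots> = elt_s \<otimes>\<^bsub>A_alg\<^esub> A_shift 1 a \<otimes>\<^bsub>A_alg\<^esub> A_shift 1 b" using mult by simp
    finally show ?case using mult(1,2) by (simp add: A.m_assoc hom)
  qed (use ops in \<open>simp_all add: c A_shift_gens A_scalar_central A.l_distr A.r_distr hom A_scalar_hom\<close>)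
qed

section \<open>Localization at a normal element\<close>

text \<open>Normality in usable form: \<open>\<tau>\<close> moves elements past \<open>s\<close> in
  one direction and \<open>\<tau>'\<close> in the other, so that
  \<open>s^n a = (tp n a) s^n\<close>. Thus \<open>tp n a\<close> is a canonical choice for the
  \<open>a'\<close> in the product of fractions.\<close>

locale normal_element = ring R for R :: "'a ring" (structure) +
  fixes s and \<tau> \<tau>' :: "'a \<Rightarrow> 'a"
  assumes s_closed [simp]: "s \<in> carrier R"
    and \<tau>_hom: "\<tau> \<in> ring_hom R R" and \<tau>'_hom: "\<tau>' \<in> ring_hom R R"
    and \<tau>\<tau>' [simp]: "a \<in> carrier R \<Longrightarrow> \<tau> (\<tau>' a) = a" and \<tau>'\<tau> [simp]: "a \<in> carrier R \<Longrightarrow> \<tau>' (\<tau> a) = a"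
    and s_normal: "a \<in> carrier R \<Longrightarrow> a \<otimes> s = s \<otimes> \<tau> a" and \<tau>_s: "\<tau> s = s"
begin

lemmas \<tau>'_simps = ring_hom_closed[OF \<tau>'_hom] ring_hom_add[OF \<tau>'_hom] ring_hom_mult[OF \<tau>'_hom] ring_hom_one[OF \<tau>'_hom]

abbreviation sp :: "nat \<Rightarrow> 'a" where "sp n \<equiv> s [^] n"
abbreviation tp :: "nat \<Rightarrow> 'a \<Rightarrow> 'a" where "tp n \<equiv> \<tau>' ^^ n"

lemma \<tau>'_s: "\<tau>' s = s"
  using \<tau>'\<tau>[of s] \<tau>_s by simp

lemma tp_closed [simp]: "a \<in> carrier R \<Longrightarrow> tp n a \<in> carrier R"
  by (induct n) (auto simp: \<tau>'_simps)

lemma tp_add: "\<lbrakk>a \<in> carrier R; b \<in> carrier R\<rbrakk> \<Longrightarrow> tp n (a \<oplus> b) = tp n a \<oplus> tp n b"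
  and tp_mult: "\<lbrakk>a \<in> carrier R; b \<in> carrier R\<rbrakk> \<Longrightarrow> tp n (a \<otimes> b) = tp n a \<otimes> tp n b"
  by (induct n) (auto simp: \<tau>'_simps)

lemma tp_one [simp]: "tp n \<one> = \<one>"
  by (induct n) (auto simp: \<tau>'_simps)

lemma tp_sp [simp]: "tp n (sp k) = sp k"
proof -
  have "\<tau>' (sp k) = sp k" by (induct k) (auto simp: \<tau>'_simps \<tau>'_s)
  then show ?thesis by (induct n) auto
qed

lemma s_commute: "a \<in> carrier R \<Longrightarrow> s \<otimes> a = \<tau>' a \<otimes> s"
  using s_normal[of "\<tau>' a"] by (simp add: \<tau>'_simps)

lemma sp_commute: "a \<in> carrier R \<Longrightarrow> sp n \<otimes> a = tp n a \<otimes> sp n"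
proof (induct n arbitrary: a)
  case (Suc n)
  have "sp (Suc n) \<otimes> a = sp n \<otimes> (s \<otimes> a)" using Suc(2) by (simp add: m_assoc)
  also have "\<dots> = (sp n \<otimes> \<tau>' a) \<otimes> s" using Suc(2) by (simp add: s_commute m_assoc \<tau>'_simps)
  also have "\<dots> = tp (Suc n) a \<otimes> sp (Suc n)"
    using Suc by (simp add: \<tau>'_simps m_assoc funpow_swap1)
  finally show ?case .
qed simp

lemma sp_plus: "sp (i + j) = sp i \<otimes> sp j"
  by (simp add: nat_pow_mult)

lemma sp_commute': "b \<in> carrier R \<Longrightarrow> a \<in> carrier R \<Longrightarrow> sp n \<otimes> (a \<otimes> b) = tp n a \<otimes> (sp n \<otimes> b)"
  using sp_commute[of a n] by (metis m_assoc nat_pow_closed s_closed tp_closed)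

lemma sp_sp: "a \<in> carrier R \<Longrightarrow> sp i \<otimes> (sp j \<otimes> a) = sp (i + j) \<otimes> a"
  by (simp add: sp_plus m_assoc)

text \<open>Equality of the fractions \<open>s^-m a\<close> and \<open>s^-n b\<close> after clearing
  denominators. The additional power \<open>j\<close> keeps the relation transitive in the presence
  of torsion.\<close>

definition frel :: "nat \<Rightarrow> 'a \<Rightarrow> nat \<Rightarrow> 'a \<Rightarrow> bool" where
  "frel m a n b \<longleftrightarrow> (\<exists>j. sp (j + n) \<otimes> a = sp (j + m) \<otimes> b)"

lemma frel_sym: "frel m a n b \<Longrightarrow> frel n b m a"
  by (auto simp: frel_def intro: sym)

lemma frel_trans:
  assumes "frel m a n b" "frel n b l c" "a \<in> carrier R" "b \<in> carrier R" "c \<in> carrier R"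
  shows "frel m a l c"
proof -
  obtain j k where j: "sp (j + n) \<otimes> a = sp (j + m) \<otimes> b" and k: "sp (k + l) \<otimes> b = sp (k + n) \<otimes> c"
    using assms by (auto simp: frel_def)
  have "sp (j + k + n + l) \<otimes> a = sp (k + l) \<otimes> (sp (j + n) \<otimes> a)" using assms by (simp add: sp_sp ac_simps)
  also have "\<dots> = sp (j + m) \<otimes> (sp (k + l) \<otimes> b)" using assms by (simp add: j sp_sp ac_simps)
  also have "\<dots> = sp (j + k + n + m) \<otimes> c" using assms by (simp add: k sp_sp ac_simps)
  finally show ?thesis unfolding frel_def by (intro exI[of _ "j + k + n"]) (simp add: ac_simps)
qed

abbreviation fr :: "nat \<Rightarrow> 'a \<Rightarrow> (nat \<times> 'a) set" where "fr \<equiv> fraction R s"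
abbreviation L where "L \<equiv> localization R s"

lemma mem_fr: "(n, b) \<in> fr m a \<longleftrightarrow> b \<in> carrier R \<and> frel m a n b"
  by (auto simp: fraction_def frel_def)

lemma fr_self: "a \<in> carrier R \<Longrightarrow> (m, a) \<in> fr m a"
  by (simp add: mem_fr frel_def)

lemma fr_eqI: "\<lbrakk>frel m a n b; a \<in> carrier R; b \<in> carrier R\<rbrakk> \<Longrightarrow> fr m a = fr n b"
proof -
  assume *: "frel m a n b" "a \<in> carrier R" "b \<in> carrier R"
  have "(l, c) \<in> fr m a \<longleftrightarrow> (l, c) \<in> fr n b" for l c
    unfolding mem_fr using frel_trans[OF *(1) _ *(2,3)] frel_trans[OF frel_sym[OF *(1)] _ *(3,2)] by blast
  then show "fr m a = fr n b" by auto
qed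

lemma fr_expand: "a \<in> carrier R \<Longrightarrow> fr (m + k) (sp k \<otimes> a) = fr m a"
  by (rule fr_eqI) (auto simp: frel_def sp_sp intro!: exI[of _ 0])

lemma mult_cong:
  assumes "frel m a m1 a1" "frel n b n1 b1" "a \<in> carrier R" "b \<in> carrier R" "a1 \<in> carrier R" "b1 \<in> carrier R"
  shows "frel (m + n) (tp n a \<otimes> b) (m1 + n1) (tp n1 a1 \<otimes> b1)"
proof -
  obtain j k where j: "sp (j + m1) \<otimes> a = sp (j + m) \<otimes> a1" and k: "sp (k + n1) \<otimes> b = sp (k + n) \<otimes> b1"
    using assms by (auto simp: frel_def)
  \<comment> \<open>Moving the powers of \<open>s\<close> past the twisted numerators produces the
    total twist \<open>k + n1 + n\<close> on one side and \<open>k + n + n1\<close> on the other.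
    That these agree is what lets the two relations be substituted.\<close>
  let ?t = "tp (k + n1 + n)"
  have t: "tp (k + n1) (tp n a) = ?t a" "tp (k + n) (tp n1 a1) = ?t a1"
    by (simp_all add: funpow_add[symmetric, THEN fun_cong, unfolded o_def] ac_simps)
  have "sp (j + k + (m1 + n1)) \<otimes> (tp n a \<otimes> b) = sp (j + m1) \<otimes> (sp (k + n1) \<otimes> (tp n a \<otimes> b))"
    using assms by (simp add: sp_sp ac_simps)
  also have "\<dots> = sp (j + m1) \<otimes> (?t a \<otimes> (sp (k + n1) \<otimes> b))"
    using assms sp_commute'[of b "tp n a" "k + n1"] by (simp only: t tp_closed)
  also have "\<dots> = ?t (sp (j + m1) \<otimes> a) \<otimes> (sp (k + n1) \<otimes> b)"
    using assms by (simp add: tp_mult m_assoc)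
  also have "\<dots> = ?t (sp (j + m) \<otimes> a1) \<otimes> (sp (k + n) \<otimes> b1)" by (simp only: j k)
  also have "\<dots> = sp (j + m) \<otimes> (?t a1 \<otimes> (sp (k + n) \<otimes> b1))"
    using assms by (simp add: tp_mult m_assoc)
  also have "\<dots> = sp (j + m) \<otimes> (sp (k + n) \<otimes> (tp n1 a1 \<otimes> b1))"
    using assms sp_commute'[of b1 "tp n1 a1" "k + n"] by (simp only: t tp_closed)
  also have "\<dots> = sp (j + k + (m + n)) \<otimes> (tp n1 a1 \<otimes> b1)"
    using assms by (simp add: sp_sp ac_simps)
  finally show ?thesis unfolding frel_def by blast
qed

text \<open>No regularity of \<open>s\<close> is needed: two choices of \<open>a'\<close> in \<open>s\<^sup>n a = a' s\<^sup>n\<close> differ by a right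
  torsion element, and \<open>\<tau>\<close> turns right torsion into left torsion.\<close>

lemma twist_cong:
  assumes "sp n \<otimes> a = a' \<otimes> sp n" "a \<in> carrier R" "a' \<in> carrier R" "b \<in> carrier R"
  shows "frel m (a' \<otimes> b) m (tp n a \<otimes> b)"
proof -
  have tinv: "tp n ((\<tau> ^^ n) c) = c \<and> (\<tau> ^^ n) c \<in> carrier R" if "c \<in> carrier R" for c
    using that
  proof (induct n)
    case (Suc n)
    then show ?case using ring_hom_closed[OF \<tau>_hom] by (simp add: funpow_swap1[of \<tau>'])
  qed simp
  let ?c = "(\<tau> ^^ n) a'" and ?d = "(\<tau> ^^ n) (tp n a)"
  have "sp n \<otimes> ?c = a' \<otimes> sp n" "sp n \<otimes> ?d = tp n a \<otimes> sp n"
    using tinv assms sp_commute[of ?c n] sp_commute[of ?d n] by auto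
  then have "sp n \<otimes> ?c = sp n \<otimes> ?d" using assms(1) sp_commute[OF assms(2), of n] by simp
  then have "tp n (sp n \<otimes> ?c) = tp n (sp n \<otimes> ?d)" by simp
  then have "sp n \<otimes> a' = sp n \<otimes> tp n a" using tinv assms by (simp add: tp_mult)
  then have "sp n \<otimes> (a' \<otimes> b) = sp n \<otimes> (tp n a \<otimes> b)" using assms by (simp flip: m_assoc)
  then have "sp (n + m) \<otimes> (a' \<otimes> b) = sp (n + m) \<otimes> (tp n a \<otimes> b)"
    using assms sp_sp[of _ m n] by (metis add.commute m_closed tp_closed)
  then show ?thesis unfolding frel_def by blast
qed

lemma carrier_L: "carrier L = {fr m a | m a. a \<in> carrier R}"
  by (simp add: localization_def)

lemma fr_closed [simp]: "a \<in> carrier R \<Longrightarrow> fr m a \<in> carrier L"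
  by (auto simp: carrier_L)

lemma one_L: "\<one>\<^bsub>L\<^esub> = fr 0 \<one>" and zero_L: "\<zero>\<^bsub>L\<^esub> = fr 0 \<zero>"
  by (simp_all add: localization_def)

lemma Union_const: "\<lbrakk>x \<in> F; \<And>y. y \<in> F \<Longrightarrow> y = x\<rbrakk> \<Longrightarrow> \<Union>F = x"
  by blast

text \<open>The product is a union over all choices of representatives. \<open>twist_cong\<close>
  and \<open>mult_cong\<close> show that all its members are one and the same fraction, and
  \<open>tp n a\<close> shows that there is a member.\<close>

lemma mult_L:
  assumes "a \<in> carrier R" "b \<in> carrier R"
  shows "fr m a \<otimes>\<^bsub>L\<^esub> fr n b = fr (m + n) (tp n a \<otimes> b)"
  unfolding localization_def monoid.simps
proof (rule Union_const, goal_cases)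
  case 1
  show ?case using assms fr_self[of a m] fr_self[of b n] sp_commute[of a n] tp_closed[of a n] by fast
next
  case (2 P)
  then obtain m1 a1 n1 b1 a' where *: "P = fr (m1 + n1) (a' \<otimes> b1)" "(m1, a1) \<in> fr m a" "(n1, b1) \<in> fr n b"
    "a' \<in> carrier R" "sp n1 \<otimes> a1 = a' \<otimes> sp n1" by blast
  then have cl: "a1 \<in> carrier R" "b1 \<in> carrier R" "frel m a m1 a1" "frel n b n1 b1" by (auto simp: mem_fr)
  have "P = fr (m1 + n1) (tp n1 a1 \<otimes> b1)"
    unfolding *(1) using twist_cong[OF *(5)] * cl by (intro fr_eqI) auto
  also have "\<dots> = fr (m + n) (tp n a \<otimes> b)"
    using mult_cong[OF cl(3,4)] cl assms by (intro fr_eqI[symmetric]) auto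
  finally show ?case .
qed

lemma add_L:
  assumes "a \<in> carrier R" "b \<in> carrier R"
  shows "fr m a \<oplus>\<^bsub>L\<^esub> fr n b = fr (m + n) (sp n \<otimes> a \<oplus> sp m \<otimes> b)"
  unfolding localization_def ring.simps
proof (rule Union_const, goal_cases)
  case 1
  show ?case using fr_self[OF assms(1), of m] fr_self[OF assms(2), of n] by blast
next
  case (2 P)
  then obtain m1 a1 n1 b1 where *: "P = fr (m1 + n1) (sp n1 \<otimes> a1 \<oplus> sp m1 \<otimes> b1)"
    "(m1, a1) \<in> fr m a" "(n1, b1) \<in> fr n b" by blast
  then have cl: "a1 \<in> carrier R" "b1 \<in> carrier R" "frel m a m1 a1" "frel n b n1 b1" by (auto simp: mem_fr)
  obtain j k where j: "sp (j + m1) \<otimes> a = sp (j + m) \<otimes> a1" and k: "sp (k + n1) \<otimes> b = sp (k + n) \<otimes> b1"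
    using cl by (auto simp: frel_def)
  have "sp (j + k + (m1 + n1)) \<otimes> (sp n \<otimes> a) = sp (k + n + n1) \<otimes> (sp (j + m1) \<otimes> a)"
    using assms by (simp add: sp_sp ac_simps)
  also have "\<dots> = sp (j + k + (m + n)) \<otimes> (sp n1 \<otimes> a1)" using cl by (simp add: j sp_sp ac_simps)
  finally have A: "sp (j + k + (m1 + n1)) \<otimes> (sp n \<otimes> a) = sp (j + k + (m + n)) \<otimes> (sp n1 \<otimes> a1)" .
  have "sp (j + k + (m1 + n1)) \<otimes> (sp m \<otimes> b) = sp (j + m + m1) \<otimes> (sp (k + n1) \<otimes> b)"
    using assms by (simp add: sp_sp ac_simps)
  also have "\<dots> = sp (j + k + (m + n)) \<otimes> (sp m1 \<otimes> b1)" using cl by (simp add: k sp_sp ac_simps)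
  finally have B: "sp (j + k + (m1 + n1)) \<otimes> (sp m \<otimes> b) = sp (j + k + (m + n)) \<otimes> (sp m1 \<otimes> b1)" .
  have "frel (m + n) (sp n \<otimes> a \<oplus> sp m \<otimes> b) (m1 + n1) (sp n1 \<otimes> a1 \<oplus> sp m1 \<otimes> b1)"
    unfolding frel_def by (rule exI[of _ "j + k"]) (simp add: r_distr A B assms cl)
  then show ?case unfolding *(1) using assms cl by (intro fr_eqI[symmetric]) auto
qed

lemma add_L_same: "\<lbrakk>a \<in> carrier R; b \<in> carrier R\<rbrakk> \<Longrightarrow> fr m a \<oplus>\<^bsub>L\<^esub> fr m b = fr m (a \<oplus> b)"
  using fr_expand[of "a \<oplus> b" m m] by (simp add: add_L r_distr)

lemma zero_fr: "fr m \<zero> = \<zero>\<^bsub>L\<^esub>"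
  unfolding zero_L by (rule fr_eqI) (auto simp: frel_def)

lemma common_denominator2:
  assumes "P \<in> carrier L" "Q \<in> carrier L"
  obtains m a b where "a \<in> carrier R" "b \<in> carrier R" "P = fr m a" "Q = fr m b"
proof -
  obtain m a n b where *: "P = fr m a" "Q = fr n b" "a \<in> carrier R" "b \<in> carrier R"
    using assms by (auto simp: carrier_L)
  then have "P = fr (m + n) (sp n \<otimes> a)" "Q = fr (m + n) (sp m \<otimes> b)"
    using fr_expand[of a m n] fr_expand[of b n m] by (simp_all add: add.commute)
  then show ?thesis by (rule that[rotated 2]) (use * in auto)
qed

lemma common_denominator3:
  assumes "P \<in> carrier L" "Q \<in> carrier L" "T \<in> carrier L"
  obtains m a b c where "a \<in> carrier R" "b \<in> carrier R" "c \<in> carrier R" "P = fr m a" "Q = fr m b" "T = fr m c"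
proof -
  obtain m a b where *: "a \<in> carrier R" "b \<in> carrier R" "P = fr m a" "Q = fr m b"
    by (rule common_denominator2[OF assms(1,2)])
  obtain n c where c: "T = fr n c" "c \<in> carrier R" using assms by (auto simp: carrier_L)
  then have "P = fr (m + n) (sp n \<otimes> a)" "Q = fr (m + n) (sp n \<otimes> b)" "T = fr (m + n) (sp m \<otimes> c)"
    using * fr_expand[of a m n] fr_expand[of b m n] fr_expand[of c n m] by (simp_all add: add.commute)
  then show ?thesis by (rule that[rotated 3]) (use * c in auto)
qed

lemma ring_L: "ring L"
proof (rule ringI)
  show "abelian_group L"
  proof (rule abelian_groupI)
    fix P Q assume PQ: "P \<in> carrier L" "Q \<in> carrier L"
    then obtain m a b where *: "a \<in> carrier R" "b \<in> carrier R" "P = fr m a" "Q = fr m b"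
      by (rule common_denominator2)
    show "P \<oplus>\<^bsub>L\<^esub> Q \<in> carrier L" "P \<oplus>\<^bsub>L\<^esub> Q = Q \<oplus>\<^bsub>L\<^esub> P" using * by (simp_all add: add_L_same a_comm)
    fix T assume "T \<in> carrier L"
    then obtain m a b c where *: "a \<in> carrier R" "b \<in> carrier R" "c \<in> carrier R" "P = fr m a" "Q = fr m b" "T = fr m c"
      by (rule common_denominator3[OF PQ])
    then show "P \<oplus>\<^bsub>L\<^esub> Q \<oplus>\<^bsub>L\<^esub> T = P \<oplus>\<^bsub>L\<^esub> (Q \<oplus>\<^bsub>L\<^esub> T)" by (simp add: add_L_same a_assoc)
  next
    fix P assume "P \<in> carrier L"
    then obtain m a where *: "P = fr m a" "a \<in> carrier R" by (auto simp: carrier_L)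
    show "\<zero>\<^bsub>L\<^esub> \<oplus>\<^bsub>L\<^esub> P = P" using * by (simp add: add_L_same flip: zero_fr[of m])
    show "\<exists>Q\<in>carrier L. Q \<oplus>\<^bsub>L\<^esub> P = \<zero>\<^bsub>L\<^esub>"
      using * by (intro bexI[of _ "fr m (\<ominus> a)"]) (simp_all add: add_L_same l_neg zero_fr)
  qed (simp add: zero_L)
  show "Group.monoid L"
  proof (rule monoidI)
    fix P Q T assume "P \<in> carrier L" "Q \<in> carrier L" "T \<in> carrier L"
    then obtain m a n b l c where *: "P = fr m a" "Q = fr n b" "T = fr l c" "a \<in> carrier R" "b \<in> carrier R" "c \<in> carrier R"
      by (auto simp: carrier_L)
    show "P \<otimes>\<^bsub>L\<^esub> Q \<in> carrier L" using * by (simp add: mult_L)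
    have "tp l (tp n a) = tp (n + l) a" by (metis add.commute comp_apply funpow_add)
    then show "P \<otimes>\<^bsub>L\<^esub> Q \<otimes>\<^bsub>L\<^esub> T = P \<otimes>\<^bsub>L\<^esub> (Q \<otimes>\<^bsub>L\<^esub> T)"
      using * by (simp add: mult_L tp_mult m_assoc add.assoc)
  next
    fix P assume "P \<in> carrier L"
    then obtain m a where *: "P = fr m a" "a \<in> carrier R" by (auto simp: carrier_L)
    show "\<one>\<^bsub>L\<^esub> \<otimes>\<^bsub>L\<^esub> P = P" "P \<otimes>\<^bsub>L\<^esub> \<one>\<^bsub>L\<^esub> = P" using * by (simp_all add: one_L mult_L)
  qed (simp add: one_L)
next
  fix P Q T assume PQT: "P \<in> carrier L" "Q \<in> carrier L" "T \<in> carrier L"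
  obtain m a b where *: "a \<in> carrier R" "b \<in> carrier R" "P = fr m a" "Q = fr m b"
    by (rule common_denominator2[OF PQT(1,2)])
  obtain n c where c: "T = fr n c" "c \<in> carrier R" using PQT by (auto simp: carrier_L)
  show "(P \<oplus>\<^bsub>L\<^esub> Q) \<otimes>\<^bsub>L\<^esub> T = P \<otimes>\<^bsub>L\<^esub> T \<oplus>\<^bsub>L\<^esub> Q \<otimes>\<^bsub>L\<^esub> T"
    "T \<otimes>\<^bsub>L\<^esub> (P \<oplus>\<^bsub>L\<^esub> Q) = T \<otimes>\<^bsub>L\<^esub> P \<oplus>\<^bsub>L\<^esub> T \<otimes>\<^bsub>L\<^esub> Q"
    using * c by (simp_all add: mult_L add_L_same tp_add l_distr r_distr)
qed

lemma fr0_hom: "fr 0 \<in> ring_hom R L"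
  by (rule ring_hom_memI) (simp_all add: mult_L add_L_same one_L)

lemma fr_inverse: "fr 0 s \<otimes>\<^bsub>L\<^esub> fr 1 \<one> = \<one>\<^bsub>L\<^esub>" "fr 1 \<one> \<otimes>\<^bsub>L\<^esub> fr 0 s = \<one>\<^bsub>L\<^esub>"
  using fr_expand[of \<one> 0 1] by (simp_all add: mult_L one_L \<tau>'_s)

end

text \<open>\<open>s\<^sup>-\<^sup>m a\<close> sends \<open>v\<close> to the solution \<open>u\<close> of \<open>s\<^sup>m u = a v\<close>.\<close>

definition loc_module :: "'r ring \<Rightarrow> 'r \<Rightarrow> ('r, 'v) module \<Rightarrow> ((nat \<times> 'r) set, 'v) module" where
  "loc_module R s M = \<lparr>carrier = carrier M, monoid.mult = undefined, one = undefined,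
     zero = \<zero>\<^bsub>M\<^esub>, add = add M,
     module.smult = (\<lambda>P v. THE u. u \<in> carrier M \<and> (\<forall>(m, a)\<in>P. (s [^]\<^bsub>R\<^esub> m) \<odot>\<^bsub>M\<^esub> u = a \<odot>\<^bsub>M\<^esub> v))\<rparr>"

locale localizable_module = normal_element R s \<tau> \<tau>' + left_module R M
  for R :: "'r ring" (structure) and s \<tau> \<tau>' and M :: "('r, 'v) module" +
  assumes s_bij: "bij_betw (\<lambda>m. s \<odot>\<^bsub>M\<^esub> m) (carrier M) (carrier M)"
begin

abbreviation "LM \<equiv> loc_module R s M"

lemma LM_simps [simp]: "carrier LM = carrier M" "add LM = add M" "\<zero>\<^bsub>LM\<^esub> = \<zero>\<^bsub>M\<^esub>"
  by (simp_all add: loc_module_def)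

lemma sp_bij: "bij_betw (\<lambda>m. sp n \<odot>\<^bsub>M\<^esub> m) (carrier M) (carrier M)"
proof (induct n)
  case 0
  have "bij_betw (\<lambda>m. m) (carrier M) (carrier M)" by (simp add: bij_betw_def)
  then show ?case by (rule bij_betw_cong[THEN iffD1, rotated]) (simp add: smult_one)
next
  case (Suc n)
  from bij_betw_trans[OF s_bij Suc] show ?case
    by (rule bij_betw_cong[THEN iffD1, rotated]) (simp add: smult_assoc)
qed

lemma sp_inj: "\<lbrakk>u \<in> carrier M; v \<in> carrier M; sp n \<odot>\<^bsub>M\<^esub> u = sp n \<odot>\<^bsub>M\<^esub> v\<rbrakk> \<Longrightarrow> u = v"
  using sp_bij[of n] by (auto simp: bij_betw_def inj_on_def)

lemma sp_surj: "v \<in> carrier M \<Longrightarrow> \<exists>u\<in>carrier M. sp n \<odot>\<^bsub>M\<^esub> u = v"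
  using sp_bij[of n] unfolding bij_betw_def by (metis imageE)

text \<open>The operator \<open>s^m\<close> is injective, so its equation has at most one solution.
  Multiplied by a suitable power of \<open>s\<close>, the equation of one representative yields that
  of any other.\<close>

lemma LM_smult_eqI:
  assumes "a \<in> carrier R" "v \<in> carrier M" "u \<in> carrier M" "sp m \<odot>\<^bsub>M\<^esub> u = a \<odot>\<^bsub>M\<^esub> v"
  shows "fr m a \<odot>\<^bsub>LM\<^esub> v = u"
proof -
  have "(THE u. u \<in> carrier M \<and> (\<forall>(m, a)\<in>fr m a. sp m \<odot>\<^bsub>M\<^esub> u = a \<odot>\<^bsub>M\<^esub> v)) = u"
  proof (rule the_equality)
    have "sp n \<odot>\<^bsub>M\<^esub> u = b \<odot>\<^bsub>M\<^esub> v" if nb: "(n, b) \<in> fr m a" for n b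
    proof -
      obtain j where j: "b \<in> carrier R" "sp (j + n) \<otimes> a = sp (j + m) \<otimes> b"
        using nb by (auto simp: mem_fr frel_def)
      have "sp (j + m) \<odot>\<^bsub>M\<^esub> (sp n \<odot>\<^bsub>M\<^esub> u) = sp (j + n) \<odot>\<^bsub>M\<^esub> (sp m \<odot>\<^bsub>M\<^esub> u)"
        using assms(3) by (simp add: nat_pow_mult ac_simps flip: smult_assoc)
      also have "\<dots> = sp (j + m) \<odot>\<^bsub>M\<^esub> (b \<odot>\<^bsub>M\<^esub> v)"
        using assms j by (simp flip: smult_assoc)
      finally show ?thesis by (rule sp_inj[rotated 2]) (use assms j in auto)
    qed
    then show "u \<in> carrier M \<and> (\<forall>(m, a)\<in>fr m a. sp m \<odot>\<^bsub>M\<^esub> u = a \<odot>\<^bsub>M\<^esub> v)" using assms by auto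
  next
    fix w assume "w \<in> carrier M \<and> (\<forall>(m, a)\<in>fr m a. sp m \<odot>\<^bsub>M\<^esub> w = a \<odot>\<^bsub>M\<^esub> v)"
    then have "w \<in> carrier M" "sp m \<odot>\<^bsub>M\<^esub> w = sp m \<odot>\<^bsub>M\<^esub> u" using fr_self[OF assms(1), of m] assms(4) by auto
    then show "w = u" using sp_inj assms by blast
  qed
  then show ?thesis by (simp add: loc_module_def)
qed

lemma LM_smult:
  assumes "a \<in> carrier R" "v \<in> carrier M"
  shows "fr m a \<odot>\<^bsub>LM\<^esub> v \<in> carrier M" "sp m \<odot>\<^bsub>M\<^esub> (fr m a \<odot>\<^bsub>LM\<^esub> v) = a \<odot>\<^bsub>M\<^esub> v"
proof -
  obtain u where u: "u \<in> carrier M" "sp m \<odot>\<^bsub>M\<^esub> u = a \<odot>\<^bsub>M\<^esub> v" using sp_surj[of "a \<odot>\<^bsub>M\<^esub> v" m] assms by auto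
  then show "fr m a \<odot>\<^bsub>LM\<^esub> v \<in> carrier M" "sp m \<odot>\<^bsub>M\<^esub> (fr m a \<odot>\<^bsub>LM\<^esub> v) = a \<odot>\<^bsub>M\<^esub> v"
    using LM_smult_eqI[OF assms u] by auto
qed

lemma left_module_LM: "left_module L LM"
proof (rule left_moduleI[OF ring_L])
  have "\<exists>n\<in>carrier M. n \<oplus>\<^bsub>M\<^esub> m = \<zero>\<^bsub>M\<^esub>" if "m \<in> carrier M" for m
    using that by (metis M.l_neg M.a_inv_closed)
  then show "abelian_group LM" by (intro abelian_groupI) (auto simp: M.a_ac)
next
  fix P v assume P: "P \<in> carrier L" and v: "v \<in> carrier LM"
  obtain m a where *: "P = fr m a" "a \<in> carrier R" using P by (auto simp: carrier_L)
  show "P \<odot>\<^bsub>LM\<^esub> v \<in> carrier LM" using * v LM_smult by simp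
  fix w assume w: "w \<in> carrier LM"
  show "P \<odot>\<^bsub>LM\<^esub> (v \<oplus>\<^bsub>LM\<^esub> w) = P \<odot>\<^bsub>LM\<^esub> v \<oplus>\<^bsub>LM\<^esub> P \<odot>\<^bsub>LM\<^esub> w"
    unfolding *(1) using * v w by (intro LM_smult_eqI) (simp_all add: LM_smult smult_r_distr)
next
  fix P Q v assume PQ: "P \<in> carrier L" "Q \<in> carrier L" and v: "v \<in> carrier LM"
  obtain m a b where *: "a \<in> carrier R" "b \<in> carrier R" "P = fr m a" "Q = fr m b"
    by (rule common_denominator2[OF PQ])
  show "(P \<oplus>\<^bsub>L\<^esub> Q) \<odot>\<^bsub>LM\<^esub> v = P \<odot>\<^bsub>LM\<^esub> v \<oplus>\<^bsub>LM\<^esub> Q \<odot>\<^bsub>LM\<^esub> v"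
    using * v by (simp add: add_L_same, intro LM_smult_eqI) (simp_all add: LM_smult smult_r_distr smult_l_distr)
next
  fix P Q v assume PQ: "P \<in> carrier L" "Q \<in> carrier L" and v: "v \<in> carrier LM"
  obtain m a n b where *: "P = fr m a" "Q = fr n b" "a \<in> carrier R" "b \<in> carrier R"
    using PQ by (auto simp: carrier_L)
  let ?w = "fr n b \<odot>\<^bsub>LM\<^esub> v"
  have cl: "?w \<in> carrier M" "fr m a \<odot>\<^bsub>LM\<^esub> ?w \<in> carrier M" using * v LM_smult by simp_all
  have "sp (m + n) \<odot>\<^bsub>M\<^esub> (fr m a \<odot>\<^bsub>LM\<^esub> ?w) = sp n \<odot>\<^bsub>M\<^esub> (sp m \<odot>\<^bsub>M\<^esub> (fr m a \<odot>\<^bsub>LM\<^esub> ?w))"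
    using cl by (simp add: nat_pow_mult add.commute flip: smult_assoc)
  also have "\<dots> = (sp n \<otimes> a) \<odot>\<^bsub>M\<^esub> ?w" using * cl by (simp add: LM_smult smult_assoc)
  also have "\<dots> = (tp n a \<otimes> b) \<odot>\<^bsub>M\<^esub> v" using * v cl by (simp add: sp_commute smult_assoc LM_smult)
  finally show "(P \<otimes>\<^bsub>L\<^esub> Q) \<odot>\<^bsub>LM\<^esub> v = P \<odot>\<^bsub>LM\<^esub> (Q \<odot>\<^bsub>LM\<^esub> v)"
    using * v cl by (simp add: mult_L, intro LM_smult_eqI) simp_all
next
  fix v assume "v \<in> carrier LM"
  then show "\<one>\<^bsub>L\<^esub> \<odot>\<^bsub>LM\<^esub> v = v" unfolding one_L by (intro LM_smult_eqI) (simp_all add: smult_one)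
qed

lemma LM_fr0: "\<lbrakk>a \<in> carrier R; v \<in> carrier M\<rbrakk> \<Longrightarrow> fr 0 a \<odot>\<^bsub>LM\<^esub> v = a \<odot>\<^bsub>M\<^esub> v"
  by (rule LM_smult_eqI) (simp_all add: smult_one)

end

lemma normal_element_s: "normal_element A_alg elt_s (A_shift 1) (A_shift (- 1))"
proof -
  interpret ring A_alg by (rule ring_A)
  show ?thesis
    by unfold_locales
      (simp_all add: A_shift_hom A_shift_inverse A_shift_commutation A_shift_inverse[of _ "-1", simplified])
qed

section \<open>Simple modules\<close>

lemma (in abelian_group) eq_iff_minus_zero: "\<lbrakk>a \<in> carrier G; b \<in> carrier G\<rbrakk> \<Longrightarrow> a \<ominus> b = \<zero> \<longleftrightarrow> a = b"
  by (metis a_inv_closed l_neg minus_eq minus_equality minus_minus)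

lemma (in abelian_group) additive_op_bij:
  assumes "additive_op G T" "\<And>m. m \<in> carrier G \<Longrightarrow> T m = \<zero> \<Longrightarrow> m = \<zero>" "T ` carrier G = carrier G"
  shows "bij_betw T (carrier G) (carrier G)"
proof -
  have "m = n" if mn: "m \<in> carrier G" "n \<in> carrier G" "T m = T n" for m n
  proof -
    have "T (m \<ominus> n) = T m \<ominus> T n"
      using mn additive_opD(2)[OF assms(1)] additive_op_minus[OF assms(1)] by (simp add: minus_eq)
    then have "m \<ominus> n = \<zero>" using mn assms(2)[of "m \<ominus> n"] additive_opD(1)[OF assms(1)] by (simp add: minus_eq r_neg)
    then show ?thesis using mn eq_iff_minus_zero by simp
  qed
  then show ?thesis using assms(3) by (auto simp: bij_betw_def inj_on_def)
qed

lemma (in abelian_group) additive_op_inv: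
  assumes "additive_op G T" "bij_betw T (carrier G) (carrier G)"
  defines "T' \<equiv> inv_into (carrier G) T"
  shows "invertible_op G T T'"
proof
  have *: "T' m \<in> carrier G" "T (T' m) = m" "T' (T m) = m" if "m \<in> carrier G" for m
    using that assms(2) bij_betw_inv_into_right[OF assms(2)] bij_betw_inv_into_left[OF assms(2)]
    by (auto simp: T'_def bij_betw_def inv_into_into)
  show "T (T' m) = m" "T' (T m) = m" if "m \<in> carrier G" for m using * that by auto
  show "additive_op G T" by fact
  have "T' (m \<oplus> n) = T' m \<oplus> T' n" if "m \<in> carrier G" "n \<in> carrier G" for m n
    using *(3)[of "T' m \<oplus> T' n"] * that additive_opD(2)[OF assms(1), of "T' m" "T' n"] by simp
  then show "additive_op G T'" using * by (simp add: additive_op_def)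
qed

lemma abelian_group_restrict:
  assumes "abelian_group M" "K \<subseteq> carrier M" "\<zero>\<^bsub>M\<^esub> \<in> K" "\<And>m n. \<lbrakk>m \<in> K; n \<in> K\<rbrakk> \<Longrightarrow> m \<oplus>\<^bsub>M\<^esub> n \<in> K"
    "\<And>m. m \<in> K \<Longrightarrow> \<ominus>\<^bsub>M\<^esub> m \<in> K"
  shows "abelian_group (M\<lparr>carrier := K\<rparr>)"
proof -
  interpret abelian_group M by fact
  have "\<exists>n\<in>K. n \<oplus>\<^bsub>M\<^esub> m = \<zero>\<^bsub>M\<^esub>" if "m \<in> K" for m
    using that assms(2,5) l_neg by blast
  then show ?thesis
    by (intro abelian_groupI) (use assms in \<open>auto simp: subset_iff a_ac\<close>)
qed

lemma finite_avoid: "finite F \<Longrightarrow> \<exists>a::'k::{field, ring_char_0}. a \<notin> F"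
  by (rule ex_new_if_finite[OF infinite_UNIV_char_0])

text \<open>The number \<open>- a\<close> is avoided along with \<open>a\<close> because
  \<open>g\<close> exchanges \<open>y\<close> and \<open>- y\<close>; the condition
  \<open>a \<noteq> 0\<close> will make \<open>C\<close> itself an admissible denominator.\<close>

lemma exists_non_root:
  assumes "(p :: 'k::{field, ring_char_0} poly) \<noteq> 0" shows "\<exists>a. a \<noteq> 0 \<and> poly p a \<noteq> 0 \<and> poly p (- a) \<noteq> 0"
proof -
  have f: "finite {a. poly p a = 0}" using assms by (rule poly_roots_finite)
  have "{a. poly p (- a) = 0} = uminus ` {a. poly p a = 0}" by (force simp: image_iff)
  then have "finite (insert 0 ({a. poly p a = 0} \<union> {a. poly p (- a) = 0}))" using f by simp
  from finite_avoid[OF this] show ?thesis by auto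
qed

section \<open>Operators on a simple module, and the case s = 0\<close>

locale simple_rep = sjp_rep M sm xx yy gg gi
  for M :: "('v, 'z) ring_scheme" (structure) and sm :: "'k::{alg_closed_field, field_char_0} \<Rightarrow> 'v \<Rightarrow> 'v" and xx yy gg gi +
  assumes nontrivial: "carrier M \<noteq> {\<zero>}"
    and simple: "\<lbrakk>H \<subseteq> carrier M; \<zero> \<in> H; \<And>m n. \<lbrakk>m \<in> H; n \<in> H\<rbrakk> \<Longrightarrow> m \<oplus> n \<in> H;
      \<And>c m. m \<in> H \<Longrightarrow> sm c m \<in> H; \<And>m. m \<in> H \<Longrightarrow> xx m \<in> H; \<And>m. m \<in> H \<Longrightarrow> yy m \<in> H;
      \<And>m. m \<in> H \<Longrightarrow> gg m \<in> H; \<And>m. m \<in> H \<Longrightarrow> gi m \<in> H\<rbrakk> \<Longrightarrow> H = {\<zero>} \<or> H = carrier M"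
begin

lemma nonzero_ex: "\<exists>m\<in>carrier M. m \<noteq> \<zero>"
  using nontrivial zero_closed by blast

lemma simple': "\<lbrakk>H \<subseteq> carrier M; \<zero> \<in> H; \<And>m n. \<lbrakk>m \<in> H; n \<in> H\<rbrakk> \<Longrightarrow> m \<oplus> n \<in> H;
      \<And>c m. m \<in> H \<Longrightarrow> sm c m \<in> H; \<And>m. m \<in> H \<Longrightarrow> xx m \<in> H; \<And>m. m \<in> H \<Longrightarrow> yy m \<in> H;
      \<And>m. m \<in> H \<Longrightarrow> gg m \<in> H; \<And>m. m \<in> H \<Longrightarrow> gi m \<in> H; v \<in> H; v \<noteq> \<zero>\<rbrakk> \<Longrightarrow> H = carrier M"
  using simple[of H] by blast

text \<open>Simplicity is applied to the kernel and the image of \<open>T\<close>. Since only their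
  stability is assumed, the argument covers \<open>s\<close>, \<open>x\<close> and \<open>y\<close>,
  which merely normalize the action, as well as central operators.\<close>

lemma zero_or_bij:
  assumes T: "additive_op M T" "\<And>c m. m \<in> carrier M \<Longrightarrow> T (sm c m) = sm c (T m)"
    and ker: "\<And>m. \<lbrakk>m \<in> carrier M; T m = \<zero>\<rbrakk> \<Longrightarrow> T (xx m) = \<zero> \<and> T (yy m) = \<zero> \<and> T (gg m) = \<zero> \<and> T (gi m) = \<zero>"
    and im: "\<And>m. m \<in> carrier M \<Longrightarrow> xx (T m) \<in> T ` carrier M" "\<And>m. m \<in> carrier M \<Longrightarrow> yy (T m) \<in> T ` carrier M"
      "\<And>m. m \<in> carrier M \<Longrightarrow> gg (T m) \<in> T ` carrier M" "\<And>m. m \<in> carrier M \<Longrightarrow> gi (T m) \<in> T ` carrier M"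
  shows "(\<forall>m\<in>carrier M. T m = \<zero>) \<or> bij_betw T (carrier M) (carrier M)"
proof -
  let ?K = "{m \<in> carrier M. T m = \<zero>}"
  have "?K = {\<zero>} \<or> ?K = carrier M"
    by (rule simple) (use ker T additive_op_zero[OF T(1)] additive_opD[OF T(1)] in auto)
  moreover have "T ` carrier M = {\<zero>} \<or> T ` carrier M = carrier M"
  proof (rule simple)
    show "\<zero> \<in> T ` carrier M" using additive_op_zero[OF T(1)] by (metis image_eqI zero_closed)
    show "m \<oplus> n \<in> T ` carrier M" if "m \<in> T ` carrier M" "n \<in> T ` carrier M" for m n
      using that by (auto simp flip: additive_opD(2)[OF T(1)])
    show "sm c m \<in> T ` carrier M" if "m \<in> T ` carrier M" for c m
      using that by (auto simp flip: T(2))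
  qed (use im additive_opD[OF T(1)] in auto)
  ultimately show ?thesis using additive_op_bij[OF T(1)] by blast
qed

lemma central_zero_or_bij:
  assumes T: "additive_op M T" "\<And>c m. m \<in> carrier M \<Longrightarrow> T (sm c m) = sm c (T m)"
    and comm: "\<And>m. m \<in> carrier M \<Longrightarrow> T (xx m) = xx (T m)" "\<And>m. m \<in> carrier M \<Longrightarrow> T (yy m) = yy (T m)"
      "\<And>m. m \<in> carrier M \<Longrightarrow> T (gg m) = gg (T m)" "\<And>m. m \<in> carrier M \<Longrightarrow> T (gi m) = gi (T m)"
  shows "(\<forall>m\<in>carrier M. T m = \<zero>) \<or> bij_betw T (carrier M) (carrier M)"
proof (rule zero_or_bij[OF T])
  fix m assume m: "m \<in> carrier M"
  note c = comm[OF m]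
  show "xx (T m) \<in> T ` carrier M" "yy (T m) \<in> T ` carrier M" "gg (T m) \<in> T ` carrier M" "gi (T m) \<in> T ` carrier M"
    unfolding c[symmetric] using m by auto
  assume "T m = \<zero>"
  then show "T (xx m) = \<zero> \<and> T (yy m) = \<zero> \<and> T (gg m) = \<zero> \<and> T (gi m) = \<zero>" by (simp add: c)
qed

lemma S_zero_or_bij: "(\<forall>m\<in>carrier M. S m = \<zero>) \<or> bij_betw S (carrier M) (carrier M)"
proof (rule zero_or_bij[OF S_add S_sm])
  fix m assume m: "m \<in> carrier M"
  show "yy (S m) \<in> S ` carrier M"
    using m by (simp add: YS flip: additive_opD(2)[OF S_add])
  show "xx (S m) \<in> S ` carrier M" "gg (S m) \<in> S ` carrier M" "gi (S m) \<in> S ` carrier M"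
    using m by (simp_all add: SX SG SGi)
  assume 0: "S m = \<zero>"
  have "S (xx m) = \<zero>" using SX[OF m] 0 by simp
  moreover have "S (yy m) = \<zero>" using YS[OF m] 0 m \<open>S (xx m) = \<zero>\<close> by simp
  moreover have "S (gg m) = gg (S m)" "S (gi m) = gi (S m)" using m by (simp_all add: SG SGi)
  then have "S (gg m) = \<zero>" "S (gi m) = \<zero>" by (simp_all only: 0 op_zero)
  ultimately show "S (xx m) = \<zero> \<and> S (yy m) = \<zero> \<and> S (gg m) = \<zero> \<and> S (gi m) = \<zero>" by simp
qed

lemma C_minus_zero_or_bij: "(\<forall>m\<in>carrier M. C m = sm a m) \<or> bij_betw (\<lambda>m. C m \<ominus> sm a m) (carrier M) (carrier M)"
proof -
  have "(\<forall>m\<in>carrier M. C m \<ominus> sm a m = \<zero>) \<or> bij_betw (\<lambda>m. C m \<ominus> sm a m) (carrier M) (carrier M)"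
    by (rule central_zero_or_bij)
      (auto simp: additive_op_def additive_opD(2)[OF C_add] act_add_right minus_eq minus_add a_ac C_sm
        act_minus_right CX CY CG CGi op_add op_minus op_sm act_commute)
  then show ?thesis by (auto simp: eq_iff_minus_zero)
qed

text \<open>With \<open>s = 0\<close> the operators \<open>x\<close> and \<open>y\<close>
  anticommute, so kernel and image of \<open>x\<close> are submodules; then \<open>x^2 = 0\<close>
  leaves only \<open>x = 0\<close>.\<close>

lemma S_zero_imp_x_zero:
  assumes S0: "\<And>m. m \<in> carrier M \<Longrightarrow> S m = \<zero>" and m: "m \<in> carrier M"
  shows "xx m = \<zero>"
proof -
  have YX: "yy (xx m) = xx (\<ominus> yy m)" if "m \<in> carrier M" for m
  proof -
    have "yy (xx m) \<oplus> xx (yy m) = \<zero>" using S0[OF that] that by (simp add: S_def a_comm)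
    then show ?thesis using that by (metis minus_equality op_closed(1,2) op_minus(1) minus_minus)
  qed
  have "(\<forall>m\<in>carrier M. xx m = \<zero>) \<or> bij_betw xx (carrier M) (carrier M)"
  proof (rule zero_or_bij[OF X_add X_sm])
    fix m assume m: "m \<in> carrier M"
    have "gg (xx m) = xx (\<ominus> gg m)" "gi (xx m) = xx (\<ominus> gi m)" using m by (simp_all add: GX GiX op_minus)
    moreover have "\<zero> \<in> xx ` carrier M" using op_zero(1) by (metis image_eqI zero_closed)
    ultimately show "xx (xx m) \<in> xx ` carrier M" "yy (xx m) \<in> xx ` carrier M"
      "gg (xx m) \<in> xx ` carrier M" "gi (xx m) \<in> xx ` carrier M"
      using YX[OF m] XX[OF m] m by auto
    assume 0: "xx m = \<zero>"
    have "\<ominus> xx (yy m) = \<zero>" using YX[OF m] 0 m by (simp add: op_minus)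
    moreover have "\<ominus> xx (gg m) = gg (xx m)" "\<ominus> xx (gi m) = gi (xx m)" using m by (simp_all add: GX GiX)
    then have "\<ominus> xx (gg m) = \<zero>" "\<ominus> xx (gi m) = \<zero>" by (simp_all only: 0 op_zero)
    ultimately show "xx (xx m) = \<zero> \<and> xx (yy m) = \<zero> \<and> xx (gg m) = \<zero> \<and> xx (gi m) = \<zero>"
      using m XX[OF m] by simp
  qed
  then show ?thesis
  proof
    assume b: "bij_betw xx (carrier M) (carrier M)"
    then obtain n where "n \<in> carrier M" "xx n = m" using m by (metis bij_betw_def imageE)
    then show ?thesis using XX by auto
  qed (use m in blast)
qed

text \<open>If \<open>g - 1\<close> were bijective without \<open>g\<close> having an eigenvector, then
  \<open>(g - 1)\<^sup>-\<^sup>1 v\<close> would be a Laurent polynomial in \<open>g\<close> applied to \<open>v\<close>.\<close>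

lemma g_scalar:
  assumes x0: "\<And>m. m \<in> carrier M \<Longrightarrow> xx m = \<zero>" and y0: "\<And>m. m \<in> carrier M \<Longrightarrow> yy m = \<zero>"
  shows "\<exists>\<gamma>. \<gamma> \<noteq> 0 \<and> (\<forall>m\<in>carrier M. gg m = sm \<gamma> m)"
proof -
  interpret L: linear_operator M sm gg by unfold_locales (simp_all add: G_add op_sm)
  interpret P: scalar_action M L.pact by (rule L.scalar_action_pact)
  have eig: "\<exists>\<gamma> v. v \<in> carrier M \<and> v \<noteq> \<zero> \<and> gg v = sm \<gamma> v"
  proof (rule ccontr)
    assume no: "\<not> ?thesis"
    obtain v where v: "v \<in> carrier M" "v \<noteq> \<zero>" using nonzero_ex by blast
    have tf: "p = 0" if "L.pact p v = \<zero>" for p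
      using eigenvector[OF L.linear_operator_axioms _ v that] no v L.pact_closed by blast
    have S1: "1 \<in> {h :: 'k poly. poly h 1 \<noteq> 0}" by simp
    \<comment> \<open>The denominators are the polynomials that are not multiples of
      \<open>X - 1\<close>. Among them is \<open>X\<close>, which makes the local span stable under
      \<open>g^-1\<close>.\<close>
    interpret F: localized_family M L.pact "\<lambda>_::unit. v" "{h. poly h 1 \<noteq> 0}"
      by unfold_locales (auto simp: v)
    have e: "v \<in> F.lspan {()}" using F.span_lspan[OF F.span_gen[of "()" "{()}"]] by simp
    have gen: "gg m \<in> F.lspan {()}" "sm c m \<in> F.lspan {()}" if "m \<in> F.lspan {()}" for m c
      using F.lspan_act[OF that, of "[:0, 1:]"] F.lspan_act[OF that, of "[:c:]"] F.lspan_closed[OF that]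
      by (simp_all add: L.pact_X L.pact_const)
    have giv: "gi v \<in> F.lspan {()}"
      by (rule F.lspan_cancel[of _ "[:0, 1:]"]) (use v e in \<open>simp_all add: L.pact_X\<close>)
    have gipact: "gi (L.pact p m) = L.pact p (gi m)" if "m \<in> carrier M" for p m
      by (rule L.pact_commute) (use that in \<open>simp_all add: Gi_add op_sm\<close>)
    have gi: "gi m \<in> F.lspan {()}" if "m \<in> F.lspan {()}" for m
      by (rule F.lspan_semilinear[OF Gi_add, of "\<lambda>p. p"]) (use gipact giv that in auto)
    have full: "F.lspan {()} = carrier M"
      by (rule simple'[OF _ _ _ _ _ _ _ _ e v(2)])
        (use F.lspan_closed F.lspan_add gen gi F.lspan_zero x0 y0 in auto)
    have "(\<forall>m\<in>carrier M. gg m \<ominus> m = \<zero>) \<or> bij_betw (\<lambda>m. gg m \<ominus> m) (carrier M) (carrier M)"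
      by (rule central_zero_or_bij)
        (auto simp: additive_op_def op_add minus_eq minus_add a_ac op_sm act_add_right act_minus_right x0 y0 op_minus)
    then have "bij_betw (\<lambda>m. gg m \<ominus> m) (carrier M) (carrier M)"
    proof
      assume "\<forall>m\<in>carrier M. gg m \<ominus> m = \<zero>"
      then have "gg v = sm 1 v" using v by (simp add: eq_iff_minus_zero)
      then show ?thesis using no v by blast
    qed
    then obtain u where u: "u \<in> carrier M" "gg u \<ominus> u = v" using v(1) by (metis (no_types, lifting) bij_betw_def imageE)
    then have "L.pact [:-1, 1:] u = v" by (simp add: L.pact_linear act_minus_left minus_eq a_comm)
    moreover have "F.indep {()}"
      unfolding lin_indep_def
    proof (intro allI impI ballI, elim conjE)
      fix J b i assume "finite J" "J \<subseteq> {()}" "F.comb J b = \<zero>" "i \<in> J"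
      moreover from this have "J = insert () {}" by auto
      ultimately have "F.comb (insert () {}) b = \<zero>" by (simp only:)
      then show "b i = 0" using tf[of "b ()"] v by (subst (asm) F.comb_insert) auto
    qed
    ultimately obtain h :: "'k poly" where "poly h 1 \<noteq> 0" "[:-1, 1:] dvd h"
      using F.lspan_divisor[of "{()}" "()" u "[:-1, 1:]"] full u by auto
    then show False by (simp add: poly_eq_0_iff_dvd)
  qed
  then obtain \<gamma> v where v: "v \<in> carrier M" "v \<noteq> \<zero>" "gg v = sm \<gamma> v" by blast
  have comm: "gi m = sm (inverse \<gamma>) m" "\<gamma> \<noteq> 0" if "m \<in> carrier M" "m \<noteq> \<zero>" "gg m = sm \<gamma> m" for m
  proof -
    have gm: "m = sm \<gamma> (gi m)" using that by (metis GiG Gi_sm)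
    show "\<gamma> \<noteq> 0" using gm that by auto
    then show "gi m = sm (inverse \<gamma>) m" using gm that by (metis act_mult act_one left_inverse op_closed(4))
  qed
  have "{m \<in> carrier M. gg m = sm \<gamma> m} = carrier M"
    by (rule simple'[where v = v])
      (use v in \<open>auto simp: op_add act_add_right op_sm x0 y0 act_commute\<close>, metis GGi GiG Gi_sm)
  then show ?thesis using comm(2)[OF v] by blast
qed

lemma y_zero_or_bij:
  assumes x0: "\<And>m. m \<in> carrier M \<Longrightarrow> xx m = \<zero>"
  shows "(\<forall>m\<in>carrier M. yy m = \<zero>) \<or> bij_betw yy (carrier M) (carrier M)"
proof (rule zero_or_bij[OF Y_add Y_sm])
  fix m assume m: "m \<in> carrier M"
  have "gg (yy m) = yy (\<ominus> gg m)" "gi (yy m) = yy (\<ominus> gi m)" using m by (simp_all add: GY GiY op_minus x0 minus_eq)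
  moreover have "\<zero> \<in> yy ` carrier M" using op_zero(2) by (metis image_eqI zero_closed)
  ultimately show "xx (yy m) \<in> yy ` carrier M" "yy (yy m) \<in> yy ` carrier M"
    "gg (yy m) \<in> yy ` carrier M" "gi (yy m) \<in> yy ` carrier M"
    using m x0 by auto
  assume 0: "yy m = \<zero>"
  have "\<ominus> yy (gg m) = gg (yy m)" "\<ominus> yy (gi m) = gi (yy m)" using m by (simp_all add: GY GiY x0 minus_eq)
  then have "\<ominus> yy (gg m) = \<zero>" "\<ominus> yy (gi m) = \<zero>" by (simp_all only: 0 op_zero)
  then show "yy (xx m) = \<zero> \<and> yy (yy m) = \<zero> \<and> yy (gg m) = \<zero> \<and> yy (gi m) = \<zero>"
    using m 0 x0[OF m] by simp
qed

text \<open>Without an eigenvector of \<open>y\<close>, the module would be torsion-free over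
  polynomials in \<open>y\<close>, with \<open>g\<close> semilinear over the substitution of
  \<open>- y\<close> for \<open>y\<close>, so \<open>power_basis\<close> applies. The resulting
  local span is all of \<open>M\<close>, and a vector \<open>u\<close> with
  \<open>(y - a) (y + a) u = e i\<close> contradicts \<open>lspan_divisor\<close>. Bijectivity of
  \<open>y\<close> excludes the eigenvalue 0.\<close>

lemma y_eigenvector:
  assumes x0: "\<And>m. m \<in> carrier M \<Longrightarrow> xx m = \<zero>" and y: "bij_betw yy (carrier M) (carrier M)"
  shows "\<exists>\<alpha> v. \<alpha> \<noteq> 0 \<and> v \<in> carrier M \<and> v \<noteq> \<zero> \<and> yy v = sm \<alpha> v"
proof -
  interpret L: linear_operator M sm yy by unfold_locales (simp_all add: Y_add op_sm)
  interpret P: scalar_action M L.pact by (rule L.scalar_action_pact)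
  have eig: "\<exists>\<alpha> v. v \<in> carrier M \<and> v \<noteq> \<zero> \<and> yy v = sm \<alpha> v"
  proof (rule ccontr)
    assume no: "\<not> ?thesis"
    obtain v where v: "v \<in> carrier M" "v \<noteq> \<zero>" using nonzero_ex by blast
    have tf: "p = 0" if "m \<in> carrier M" "L.pact p m = \<zero>" "m \<noteq> \<zero>" for p m
      using eigenvector[OF L.linear_operator_axioms _ that(1,3,2)] no that L.pact_closed by blast
    let ?\<sigma> = "\<lambda>p. pcompose p [:0, -1:]"
    have sl: "gg (L.pact p m) = L.pact (?\<sigma> p) (gg m)" "gi (L.pact p m) = L.pact (?\<sigma> p) (gi m)"
      if "m \<in> carrier M" for p m
      by (rule L.pact_semilinear; use that in \<open>simp add: G_add Gi_add op_sm L.pact_pCons GY GiY x0 minus_eq op_minus act_minus_left\<close>)+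
    interpret K: skew_laurent M L.pact gg gi ?\<sigma> ?\<sigma> v
      by unfold_locales (use v tf in \<open>auto simp: G_add Gi_add sl pcompose_eq_0_iff\<close>)
    define e where "e i = K.spow i v" for i
    obtain I q where q: "q \<noteq> 0" "I \<noteq> {}" and ind: "lin_indep M L.pact e I"
      and step: "\<forall>i\<in>I. L.pact q (e (i + 1)) \<in> lin_span M L.pact e I \<and> L.pact q (e (i - 1)) \<in> lin_span M L.pact e I"
      using K.power_basis unfolding e_def by blast
    \<comment> \<open>The only denominator that \<open>g\<close> and \<open>g^-1\<close> introduce
      is \<open>q\<close>. Asking for nonzero values at both \<open>a\<close> and \<open>- a\<close>
      gives a set of denominators that is stable under the sign change.\<close>
    obtain a where a: "poly q a \<noteq> 0" "poly q (- a) \<noteq> 0" using exists_non_root[OF q(1)] by blast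
    interpret F: localized_family M L.pact e "{h. poly h a \<noteq> 0 \<and> poly h (- a) \<noteq> 0}"
      by unfold_locales (auto simp: e_def v)
    have gg_e: "gg (e i) \<in> F.lspan I" "gi (e i) \<in> F.lspan I" if "i \<in> I" for i
    proof -
      have "e (i + 1) \<in> F.lspan I" "e (i - 1) \<in> F.lspan I"
        using step that a by (auto intro!: F.lspanI[of _ q])
      then show "gg (e i) \<in> F.lspan I" "gi (e i) \<in> F.lspan I" by (simp_all add: e_def K.spow_plus1 K.spow_minus1 v)
    qed
    have ggi: "gg m \<in> F.lspan I" "gi m \<in> F.lspan I" if "m \<in> F.lspan I" for m
      by (rule F.lspan_semilinear[OF G_add sl(1) _ gg_e(1) that] F.lspan_semilinear[OF Gi_add sl(2) _ gg_e(2) that];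
          simp add: poly_pcompose)+
    have gen: "yy m \<in> F.lspan I" "sm c m \<in> F.lspan I" if "m \<in> F.lspan I" for m c
      using F.lspan_act[OF that, of "[:0, 1:]"] F.lspan_act[OF that, of "[:c:]"] F.lspan_closed[OF that]
      by (simp_all add: L.pact_X L.pact_const)
    obtain i where i: "i \<in> I" using q(2) by blast
    have e0: "e i \<in> F.lspan I" "e i \<noteq> \<zero>"
      using F.span_lspan[OF F.span_gen[OF i]] K.spow_eq_zero v by (auto simp: e_def)
    have full: "F.lspan I = carrier M"
      by (rule simple'[OF _ _ _ _ _ _ _ _ e0])
        (use F.lspan_closed F.lspan_add gen ggi F.lspan_zero x0 in auto)
    \<comment> \<open>The operator \<open>y - a\<close> does not commute with \<open>g\<close>, but
      \<open>y^2 - a^2\<close> is central once \<open>x = 0\<close>, so the dichotomy for central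
      operators applies to it.\<close>
    let ?T = "\<lambda>m. yy (yy m) \<ominus> sm (a * a) m"
    have "(\<forall>m\<in>carrier M. ?T m = \<zero>) \<or> bij_betw ?T (carrier M) (carrier M)"
      by (rule central_zero_or_bij)
        (auto simp: additive_op_def op_add minus_eq minus_add a_ac op_sm act_add_right act_minus_right x0 op_minus GY GiY act_commute)
    then show False
    proof
      assume "\<forall>m\<in>carrier M. ?T m = \<zero>"
      then have "L.pact [:- (a * a), 0, 1:] v = \<zero>"
        using v by (simp add: L.pact_pCons act_minus_left minus_eq a_comm)
      then have "[:- (a * a), 0, 1:] = 0" by (rule tf[OF v(1) _ v(2)])
      then show False by simp
    next
      assume "bij_betw ?T (carrier M) (carrier M)"
      then obtain u where u: "u \<in> carrier M" "?T u = e i"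
        using v by (metis (no_types, lifting) bij_betw_def imageE F.e_closed)
      have "[:- a, 1:] * [:a, 1:] = [:- (a * a), 0, 1:]" by simp
      then have "L.pact [:- a, 1:] (L.pact [:a, 1:] u) = L.pact [:- (a * a), 0, 1:] u"
        using u(1) by (metis L.pact_mult)
      also have "\<dots> = e i" using u by (simp add: L.pact_pCons act_minus_left minus_eq a_comm)
      finally obtain h where "poly h a \<noteq> 0" "[:- a, 1:] dvd h"
        using F.lspan_divisor[OF ind i, of "L.pact [:a, 1:] u" "[:- a, 1:]"] full u by auto
      then show False by (simp add: poly_eq_0_iff_dvd)
    qed
  qed
  then obtain \<alpha> v where v: "v \<in> carrier M" "v \<noteq> \<zero>" "yy v = sm \<alpha> v" by blast
  have "\<alpha> \<noteq> 0"
  proof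
    assume "\<alpha> = 0"
    then have "yy v = yy \<zero>" using v by simp
    then show False using y v(1,2) by (meson bij_betw_def inj_onD zero_closed)
  qed
  then show ?thesis using v by blast
qed

text \<open>Once \<open>x = 0\<close>, the square of \<open>g\<close> commutes with everything. If
  it had no eigenvector, \<open>v\<close> and \<open>g v\<close> would be independent over
  polynomials in \<open>g^2\<close>, being eigenvectors of \<open>y\<close> for
  \<open>\<alpha>\<close> and \<open>- \<alpha>\<close>, and up to denominators prime to
  \<open>X - 1\<close> they would span \<open>M\<close>. Then \<open>v\<close> could not be in the
  image of \<open>g^2 - 1\<close>.\<close>

lemma g_square_scalar:
  assumes x0: "\<And>m. m \<in> carrier M \<Longrightarrow> xx m = \<zero>" and v: "v \<in> carrier M" "v \<noteq> \<zero>" "yy v = sm \<alpha> v" and \<alpha>: "\<alpha> \<noteq> 0"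
  shows "\<exists>\<beta>. \<beta> \<noteq> 0 \<and> (\<forall>m\<in>carrier M. gg (gg m) = sm \<beta> m)"
proof -
  let ?w = "\<lambda>m. gg (gg m)"
  interpret L: linear_operator M sm ?w by unfold_locales (simp_all add: additive_op_def op_add op_sm)
  interpret P: scalar_action M L.pact by (rule L.scalar_action_pact)
  have comm: "gg (L.pact p m) = L.pact p (gg m)" "gi (L.pact p m) = L.pact p (gi m)" "yy (L.pact p m) = L.pact p (yy m)"
    if "m \<in> carrier M" for p m
    by (rule L.pact_commute; use that in \<open>simp add: G_add Gi_add Y_add op_sm GY x0 minus_eq op_minus\<close>)+
  have eig: "\<exists>\<beta> u. u \<in> carrier M \<and> u \<noteq> \<zero> \<and> ?w u = sm \<beta> u"
  proof (rule ccontr)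
    assume no: "\<not> ?thesis"
    have tf: "p = 0" if "m \<in> carrier M" "L.pact p m = \<zero>" "m \<noteq> \<zero>" for p m
      using eigenvector[OF L.linear_operator_axioms _ that(1,3,2)] no that L.pact_closed by blast
    define e where "e b = (if b then gg v else v)" for b
    interpret F: localized_family M L.pact e "{h. poly h 1 \<noteq> 0}"
      by unfold_locales (auto simp: v e_def)
    have e: "v \<in> F.lspan UNIV" "gg v \<in> F.lspan UNIV"
      using F.span_lspan[OF F.span_gen[of False UNIV]] F.span_lspan[OF F.span_gen[of True UNIV]] by (auto simp: e_def)
    have gen: "sm c m \<in> F.lspan UNIV" "?w m \<in> F.lspan UNIV" if "m \<in> F.lspan UNIV" for m c
      using F.lspan_act[OF that, of "[:c:]"] F.lspan_act[OF that, of "[:0, 1:]"] F.lspan_closed[OF that]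
      by (simp_all add: L.pact_const L.pact_X)
    have "gg (e b) \<in> F.lspan UNIV" for b using e gen by (auto simp: e_def)
    then have gg: "gg m \<in> F.lspan UNIV" if "m \<in> F.lspan UNIV" for m
      using F.lspan_semilinear[OF G_add, of "\<lambda>p. p" UNIV m] that comm by auto
    have "gi v \<in> F.lspan UNIV"
      by (rule F.lspan_cancel[of _ "[:0, 1:]"]) (use v e in \<open>simp_all add: L.pact_X\<close>)
    then have "gi (e b) \<in> F.lspan UNIV" for b using e v by (auto simp: e_def)
    then have gi: "gi m \<in> F.lspan UNIV" if "m \<in> F.lspan UNIV" for m
      using F.lspan_semilinear[OF Gi_add, of "\<lambda>p. p" UNIV m] that comm by auto
    have yg: "yy (gg v) = sm (- \<alpha>) (gg v)"
    proof -
      have "sm \<alpha> (gg v) = \<ominus> yy (gg v)" using GY[OF v(1)] v by (simp add: x0 minus_eq op_sm)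
      then show ?thesis using v by (simp add: act_minus_left)
    qed
    have "yy (e b) \<in> F.lspan UNIV" for b using e gen v yg by (auto simp: e_def)
    then have yy: "yy m \<in> F.lspan UNIV" if "m \<in> F.lspan UNIV" for m
      using F.lspan_semilinear[OF Y_add, of "\<lambda>p. p" UNIV m] that comm by auto
    have full: "F.lspan UNIV = carrier M"
      by (rule simple'[OF _ _ _ _ _ _ _ _ e(1) v(2)])
        (use F.lspan_closed F.lspan_add gen gg gi yy F.lspan_zero x0 in auto)
    have ind: "F.indep UNIV"
      unfolding lin_indep_def
    proof (intro allI impI ballI, elim conjE)
      fix J b i assume J: "finite J" "F.comb J b = \<zero>" "i \<in> J"
      define c where "c = (\<lambda>i. if i \<in> J then b i else 0)"
      have "F.comb UNIV c = \<zero>" using F.comb_extend[of UNIV J b] J by (simp add: c_def)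
      moreover have "F.comb UNIV c = L.pact (c False) v \<oplus> L.pact (c True) (gg v)"
        using F.comb_insert[of "{True}" False c] F.comb_insert[of "{}" True c] v by (simp add: UNIV_bool e_def)
      ultimately have 0: "L.pact (c False) v \<oplus> L.pact (c True) (gg v) = \<zero>" by simp
      \<comment> \<open>Applying \<open>y\<close> changes the relative sign of the two terms. They
        are therefore equal as well as opposite, hence zero in characteristic 0.\<close>
      then have "yy (L.pact (c False) v \<oplus> L.pact (c True) (gg v)) = \<zero>" by simp
      then have "sm \<alpha> (L.pact (c False) v) \<oplus> sm (- \<alpha>) (L.pact (c True) (gg v)) = \<zero>"
        using v by (simp add: op_add comm yg L.pact_smult[symmetric] L.pact_mult[symmetric] flip: L.pact_const)
      then have "sm \<alpha> (L.pact (c False) v) = sm \<alpha> (L.pact (c True) (gg v))"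
        using v by (simp add: act_minus_left eq_iff_minus_zero flip: minus_eq)
      then have "sm (inverse \<alpha>) (sm \<alpha> (L.pact (c False) v)) = sm (inverse \<alpha>) (sm \<alpha> (L.pact (c True) (gg v)))" by simp
      then have eq: "L.pact (c False) v = L.pact (c True) (gg v)" using v \<alpha> by (simp flip: act_mult)
      then have "sm 2 (L.pact (c False) v) = \<zero>"
        using 0 v act_add_left[of "L.pact (c False) v" 1 1] by simp
      then have "sm (inverse 2) (sm 2 (L.pact (c False) v)) = \<zero>" by simp
      then have F0: "L.pact (c False) v = \<zero>" using v by (simp flip: act_mult)
      have "gg v \<noteq> \<zero>" using v by (metis GiG op_zero(4))
      then have "c False = 0" "c True = 0" using tf[OF v(1) F0 v(2)] tf[of "gg v" "c True"] F0 eq v by auto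
      then have "c i = 0" by (cases i) auto
      then show "b i = 0" using J(3) by (simp add: c_def)
    qed
    have "(\<forall>m\<in>carrier M. ?w m \<ominus> m = \<zero>) \<or> bij_betw (\<lambda>m. ?w m \<ominus> m) (carrier M) (carrier M)"
      by (rule central_zero_or_bij)
        (auto simp: additive_op_def op_add minus_eq minus_add a_ac op_sm act_add_right act_minus_right x0 op_minus GY)
    then have "bij_betw (\<lambda>m. ?w m \<ominus> m) (carrier M) (carrier M)"
    proof
      assume "\<forall>m\<in>carrier M. ?w m \<ominus> m = \<zero>"
      then have "?w v = sm 1 v" using v by (simp add: eq_iff_minus_zero)
      then show ?thesis using no v by blast
    qed
    then obtain u where u: "u \<in> carrier M" "?w u \<ominus> u = v" using v(1) by (metis (no_types, lifting) bij_betw_def imageE)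
    then have "L.pact [:-1, 1:] u = e False" by (simp add: L.pact_linear act_minus_left minus_eq a_comm e_def)
    then obtain h :: "'k poly" where "poly h 1 \<noteq> 0" "[:-1, 1:] dvd h"
      using F.lspan_divisor[OF ind UNIV_I, of u "[:-1, 1:]" False] full u by auto
    then show False by (simp add: poly_eq_0_iff_dvd)
  qed
  then obtain \<beta> u where u: "u \<in> carrier M" "u \<noteq> \<zero>" "?w u = sm \<beta> u" by blast
  have inv: "gg (gg (gi m)) = sm \<beta> (gi m)" if "m \<in> carrier M" "?w m = sm \<beta> m" for m
    using that by (metis GGi GiG Gi_sm op_closed(3,4))
  have "{m \<in> carrier M. ?w m = sm \<beta> m} = carrier M"
    by (rule simple'[where v = u])
      (use u inv in \<open>auto simp: op_add act_add_right op_sm x0 act_commute GY op_minus act_minus_right minus_eq\<close>)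
  moreover have "\<beta> \<noteq> 0"
  proof
    assume "\<beta> = 0"
    then have "?w u = \<zero>" using u by simp
    then show False using u by (metis GiG op_closed(3) op_zero(4))
  qed
  ultimately show ?thesis by blast
qed

end

section \<open>Representations in which s is bijective, and the kernel of x\<close>

locale bijective_rep = sjp_rep M sm xx yy gg gi
  for M :: "('v, 'z) ring_scheme" (structure) and sm :: "'k::{alg_closed_field, field_char_0} \<Rightarrow> 'v \<Rightarrow> 'v" and xx yy gg gi +
  assumes S_bij: "bij_betw S (carrier M) (carrier M)"
begin

definition "si = inv_into (carrier M) S"

sublocale SI: invertible_op M S si
  unfolding si_def by (rule additive_op_inv[OF S_add S_bij])

lemma si_commute:
  assumes "\<And>m. m \<in> carrier M \<Longrightarrow> U m \<in> carrier M" "\<And>m. m \<in> carrier M \<Longrightarrow> U (S m) = S (U m)" "m \<in> carrier M"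
  shows "U (si m) = si (U m)"
  using assms SI.s's[of "U (si m)"] by (metis SI.s'_closed SI.ss')

lemma si_x: "m \<in> carrier M \<Longrightarrow> xx (si m) = si (xx m)" by (rule si_commute) (simp_all add: SX)
lemma si_sm: "m \<in> carrier M \<Longrightarrow> sm c (si m) = si (sm c m)" by (rule si_commute) (simp_all add: S_sm)

lemma CS: "m \<in> carrier M \<Longrightarrow> C (S m) = S (C m)"
  by (simp add: S_def additive_opD(2)[OF C_add] CX CY)

lemma si_C: "m \<in> carrier M \<Longrightarrow> C (si m) = si (C m)" by (rule si_commute) (simp_all add: CS)

lemma si_eq_zero: "\<lbrakk>m \<in> carrier M; S m = \<zero>\<rbrakk> \<Longrightarrow> m = \<zero>"
  by (rule SI.s_eq_zero)

text \<open>\<open>E = y s\<^sup>-\<^sup>1 y\<close> is \<open>y'\<^sup>2 s\<close>; on the kernel of \<open>x\<close> it acts like the Euler operator of the Weyl algebra.\<close>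

definition E :: "'v \<Rightarrow> 'v" where "E m = yy (si (yy m))"

lemma E_closed [simp]: "m \<in> carrier M \<Longrightarrow> E m \<in> carrier M" by (simp add: E_def)
lemma E_add: "additive_op M E" by (simp add: additive_op_def E_def op_add additive_opD(2)[OF SI.s'_add])
lemma E_sm: "m \<in> carrier M \<Longrightarrow> E (sm c m) = sm c (E m)" by (simp add: E_def op_sm flip: si_sm)
lemma E_C: "m \<in> carrier M \<Longrightarrow> C (E m) = E (C m)" by (simp add: E_def CY si_C)

text \<open>From \<open>y s = s y + s x\<close> one gets \<open>E s = y^2 + y x\<close>. The same
  relation at the vector \<open>s^-1 y m\<close> gives \<open>s E + x y = y^2\<close>. Together they
  leave \<open>E s - s E = x y + y x = s\<close>.\<close>

lemma E_S: "m \<in> carrier M \<Longrightarrow> E (S m) = S (E m) \<oplus> S m"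
proof -
  assume m: "m \<in> carrier M"
  let ?n = "si (yy m)"
  have "E (S m) = yy (yy m) \<oplus> yy (xx m)"
    using m by (simp add: E_def YS additive_opD(2)[OF SI.s'_add] op_add)
  moreover have "S (E m) \<oplus> xx (yy m) = yy (yy m)"
    using YS[of ?n] SX[of ?n] m by (simp add: E_def)
  ultimately show ?thesis using m by (simp add: S_def a_ac flip: \<open>S (E m) \<oplus> xx (yy m) = yy (yy m)\<close>)
qed

definition K where "K = {m \<in> carrier M. xx m = \<zero>}"

lemma K_carrier: "m \<in> K \<Longrightarrow> m \<in> carrier M" by (simp add: K_def)
lemma K_x: "m \<in> K \<Longrightarrow> xx m = \<zero>" by (simp add: K_def)

lemma K_closed:
  "\<zero> \<in> K" "\<lbrakk>m \<in> K; n \<in> K\<rbrakk> \<Longrightarrow> m \<oplus> n \<in> K" "m \<in> K \<Longrightarrow> \<ominus> m \<in> K" "m \<in> K \<Longrightarrow> sm c m \<in> K"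
  "m \<in> K \<Longrightarrow> S m \<in> K" "m \<in> K \<Longrightarrow> si m \<in> K" "m \<in> K \<Longrightarrow> C m \<in> K"
  by (auto simp: K_def op_add op_minus op_sm SX si_x additive_op_zero[OF S_add] additive_op_zero[OF SI.s'_add]
      additive_op_zero[OF C_add] simp flip: CX)

lemma xyK: "m \<in> K \<Longrightarrow> xx (yy m) = S m"
  by (simp add: K_def S_def)

text \<open>Put \<open>n = s^-1 y m\<close>. On the kernel \<open>x y = s\<close>, so
  \<open>x n = m\<close>. Expanding \<open>s n = y m\<close> as
  \<open>x y n + y x n = x y n + y m\<close> leaves \<open>x y n = 0\<close>, and \<open>y n\<close>
  is \<open>E m\<close>.\<close>

lemma K_E: "m \<in> K \<Longrightarrow> E m \<in> K"
proof -
  assume m: "m \<in> K"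
  then have mc: "m \<in> carrier M" by (rule K_carrier)
  let ?n = "si (yy m)"
  have "xx ?n = m" using mc xyK[OF m] by (simp add: si_x)
  moreover have "S ?n = yy m" using mc by simp
  ultimately have "xx (yy ?n) \<oplus> yy m = yy m" using mc unfolding S_def by simp
  then have "xx (yy ?n) = \<zero>" using mc by (metis add.l_cancel_one op_closed(1,2) SI.s'_closed add.r_cancel_one)
  then show "E m \<in> K" using mc by (simp add: K_def E_def)
qed

lemma yyK: "m \<in> K \<Longrightarrow> yy (yy m) = E (S m)"
  by (simp add: E_def YS K_x K_carrier additive_op_zero[OF S_add] SI.s's)

text \<open>On the kernel of \<open>x\<close>, the operator \<open>C g = y x - x y\<close> reduces
  to \<open>- x y = - s\<close>. So \<open>g\<close> is determined by \<open>s\<close> and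
  \<open>C\<close> as soon as \<open>C\<close> is injective, and \<open>g^-1\<close> is
  \<open>- s^-1 C\<close>.\<close>

lemma K_g: "m \<in> K \<Longrightarrow> C (gg m) = \<ominus> S m" "m \<in> K \<Longrightarrow> gi m = \<ominus> si (C m)" "m \<in> K \<Longrightarrow> gg m \<in> K" "m \<in> K \<Longrightarrow> gi m \<in> K"
proof -
  assume m: "m \<in> K"
  then have mc: "m \<in> carrier M" by (rule K_carrier)
  show "C (gg m) = \<ominus> S m" using m mc by (simp add: C_def K_x xyK minus_eq)
  have "\<ominus> xx (gg m) = gg (xx m)" "\<ominus> xx (gi m) = gi (xx m)" using mc by (simp_all add: GX GiX)
  then have "\<ominus> xx (gg m) = \<zero>" "\<ominus> xx (gi m) = \<zero>" by (simp_all only: K_x[OF m] op_zero)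
  then show K: "gg m \<in> K" "gi m \<in> K" using mc by (simp_all add: K_def)
  have "C m = \<ominus> S (gi m)" using mc by (simp add: C_def K_x[OF K(2)] xyK[OF K(2)] minus_eq)
  then show "gi m = \<ominus> si (C m)"
    using mc by (simp add: additive_op_minus[OF SI.s'_add])
qed

lemma abelian_group_K: "abelian_group (M\<lparr>carrier := K\<rparr>)"
  by (rule abelian_group_restrict) (auto simp: K_closed abelian_group_axioms K_carrier)

end

section \<open>Simple modules with s bijective: C acts as a scalar\<close>

locale simple_bijective_rep = simple_rep M sm xx yy gg gi + bijective_rep M sm xx yy gg gi
  for M :: "('v, 'z) ring_scheme" (structure) and sm :: "'k::{alg_closed_field, field_char_0} \<Rightarrow> 'v \<Rightarrow> 'v" and xx yy gg gi
begin

lemma K_nonzero: "\<exists>v\<in>K. v \<noteq> \<zero>"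
proof (rule ccontr)
  assume no: "\<not> ?thesis"
  have "xx m = \<zero>" if "m \<in> carrier M" for m
    using no that XX[OF that] by (auto simp: K_def)
  then have "S m = \<zero>" if "m \<in> carrier M" for m using that by (simp add: S_def)
  then show False using nonzero_ex si_eq_zero by blast
qed

text \<open>The sum of \<open>W\<close> and \<open>y W\<close> is a submodule, hence all of
  \<open>M\<close>; stability under \<open>g\<close> comes from \<open>C g = - s\<close> together
  with the inverse of \<open>C\<close> on \<open>W\<close>. If \<open>m + y n\<close> lies in
  \<open>K\<close>, applying \<open>x\<close> gives \<open>s n = 0\<close>, so \<open>n = 0\<close>
  and the vector was in \<open>W\<close>.\<close>

lemma K_irreducible:
  assumes W: "W \<subseteq> K" "\<zero> \<in> W" "\<And>m n. \<lbrakk>m \<in> W; n \<in> W\<rbrakk> \<Longrightarrow> m \<oplus> n \<in> W" "\<And>c m. m \<in> W \<Longrightarrow> sm c m \<in> W"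
    "\<And>m. m \<in> W \<Longrightarrow> S m \<in> W" "\<And>m. m \<in> W \<Longrightarrow> si m \<in> W" "\<And>m. m \<in> W \<Longrightarrow> E m \<in> W" "\<And>m. m \<in> W \<Longrightarrow> C m \<in> W"
    and Ci: "\<And>m. m \<in> W \<Longrightarrow> \<exists>n\<in>W. C n = m"
    and C_inj: "inj_on C (carrier M)" and v: "v \<in> W" "v \<noteq> \<zero>"
  shows "W = K"
proof -
  have Wc: "m \<in> carrier M" "xx m = \<zero>" "m \<in> K" if "m \<in> W" for m using that W(1) by (auto simp: K_def)
  have Wm: "\<ominus> m \<in> W" if "m \<in> W" for m using W(4)[OF that, of "-1"] Wc[OF that] by (simp add: act_minus_left)
  have gW: "gg m \<in> W" if m: "m \<in> W" for m
  proof -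
    obtain n where n: "n \<in> W" "C n = \<ominus> S m" using Ci[OF Wm[OF W(5)[OF m]]] by blast
    then have "gg m = n" using C_inj K_g(1)[OF Wc(3)[OF m]] Wc(1)[OF m] Wc(1)[OF n(1)] by (auto simp: inj_on_def)
    then show ?thesis using n by simp
  qed
  have giW: "gi m \<in> W" if m: "m \<in> W" for m
    using K_g(2)[OF Wc(3)[OF m]] Wm W(6,8) m by simp
  have yW: "yy (yy m) \<in> W" if m: "m \<in> W" for m
    using yyK[OF Wc(3)[OF m]] W(5,7) m by simp
  define N where "N = {m \<oplus> yy n | m n. m \<in> W \<and> n \<in> W}"
  have NI: "m \<oplus> yy n \<in> N" if "m \<in> W" "n \<in> W" for m n using that by (auto simp: N_def)
  have N: "N = carrier M"
  proof (rule simple'[where v = v])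
    show "\<zero> \<in> N" using NI[OF W(2,2)] by simp
    show "v \<in> N" using NI[OF v(1) W(2)] Wc[OF v(1)] by simp
    show "N \<subseteq> carrier M" using Wc by (auto simp: N_def)
  next
    fix k l assume "k \<in> N" "l \<in> N"
    then obtain m n m' n' where *: "k = m \<oplus> yy n" "l = m' \<oplus> yy n'" "m \<in> W" "n \<in> W" "m' \<in> W" "n' \<in> W"
      by (auto simp: N_def)
    then have "k \<oplus> l = (m \<oplus> m') \<oplus> yy (n \<oplus> n')" by (simp add: op_add a_ac Wc)
    then show "k \<oplus> l \<in> N" using NI W(3) * by simp
  next
    fix k assume "k \<in> N"
    then obtain m n where *: "k = m \<oplus> yy n" "m \<in> W" "n \<in> W" by (auto simp: N_def)
    note c = Wc[OF *(2)] Wc[OF *(3)]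
    show "sm a k \<in> N" for a using NI[OF W(4)[OF *(2)] W(4)[OF *(3)], of a a] * c by (simp add: act_add_right op_sm)
    have "xx k = S n \<oplus> yy \<zero>" using * c by (simp add: op_add xyK)
    then show "xx k \<in> N" using NI[OF W(5)[OF *(3)] W(2)] by simp
    have "yy k = yy (yy n) \<oplus> yy m" using * c by (simp add: op_add a_comm)
    then show "yy k \<in> N" using NI[OF yW[OF *(3)] *(2)] by simp
    have "gg k = gg m \<oplus> yy (\<ominus> gg n)" using * c Wc(2)[OF gW[OF *(3)]] by (simp add: op_add GY op_minus minus_eq)
    then show "gg k \<in> N" using NI[OF gW[OF *(2)] Wm[OF gW[OF *(3)]]] by simp
    have "gi k = gi m \<oplus> yy (\<ominus> gi n)" using * c Wc(2)[OF giW[OF *(3)]] by (simp add: op_add GiY op_minus minus_eq)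
    then show "gi k \<in> N" using NI[OF giW[OF *(2)] Wm[OF giW[OF *(3)]]] by simp
  qed (rule v(2))
  have "k \<in> W" if k: "k \<in> K" for k
  proof -
    have "k \<in> N" using N K_carrier[OF k] by blast
    then obtain m n where *: "k = m \<oplus> yy n" "m \<in> W" "n \<in> W" by (auto simp: N_def)
    then have "xx k = S n" using Wc by (simp add: op_add xyK)
    then have "n = \<zero>" using K_x[OF k] si_eq_zero Wc(1)[OF *(3)] by simp
    then show ?thesis using * Wc by simp
  qed
  then show ?thesis using W(1) by blast
qed

text \<open>Otherwise \<open>C\<close> has no eigenvector, all \<open>C - a\<close> are invertible
  on \<open>K\<close>, and \<open>K\<close> is torsion-free over k[C]. The proof divides according
  to whether some nonzero polynomial in \<open>E\<close> over k[C] kills a nonzero vector of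
  \<open>K\<close>: the independent family is taken over k[C] in the first case and over k[C][E] in
  the second.\<close>

lemma C_scalar: "\<exists>\<mu>. \<mu> \<noteq> 0 \<and> (\<forall>m\<in>carrier M. C m = sm \<mu> m)"
proof -
  have "\<exists>\<mu>. \<forall>m\<in>carrier M. C m = sm \<mu> m"
  proof (rule ccontr)
    assume no: "\<not> ?thesis"
    then have bij: "bij_betw (\<lambda>m. C m \<ominus> sm a m) (carrier M) (carrier M)" for a
      using C_minus_zero_or_bij[of a] by blast
    have eig: "\<not> (m \<in> carrier M \<and> m \<noteq> \<zero> \<and> C m = sm a m)" for m a
    proof
      assume m: "m \<in> carrier M \<and> m \<noteq> \<zero> \<and> C m = sm a m"
      then have "C m \<ominus> sm a m = C \<zero> \<ominus> sm a \<zero>" by (simp add: minus_eq r_neg additive_op_zero[OF C_add])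
      moreover have "inj_on (\<lambda>m. C m \<ominus> sm a m) (carrier M)" using bij[of a] by (rule bij_betw_imp_inj_on)
      ultimately show False using m by (metis (mono_tags, lifting) inj_onD zero_closed)
    qed
    \<comment> \<open>The inverse of \<open>C - a\<close> preserves \<open>K\<close>: if
      \<open>(C - a) u\<close> lies in \<open>K\<close>, then \<open>C - a\<close> kills
      \<open>x u\<close>, and so \<open>x u = 0\<close>.\<close>
    have surj: "\<exists>u\<in>K. C u \<ominus> sm a u = w" if w: "w \<in> K" for w a
    proof -
      obtain u where u: "u \<in> carrier M" "C u \<ominus> sm a u = w"
        using bij[of a] K_carrier[OF w] by (metis (no_types, lifting) bij_betw_def imageE)
      have "C (xx u) \<ominus> sm a (xx u) = \<zero>"
        using u K_x[OF w] by (auto simp: CX op_add op_minus op_sm minus_eq)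
      then have "xx u = \<zero>" using eig[of "xx u" a] u by (simp add: eq_iff_minus_zero)
      then show ?thesis using u by (auto simp: K_def)
    qed
    have C_inj: "inj_on C (carrier M)"
      using bij[of 0] by (auto simp: bij_betw_def inj_on_def minus_eq)
    define KM where "KM = M\<lparr>carrier := K\<rparr>"
    have KM [simp]: "carrier KM = K" "\<zero>\<^bsub>KM\<^esub> = \<zero>" "m \<oplus>\<^bsub>KM\<^esub> n = m \<oplus> n" for m n by (simp_all add: KM_def)
    interpret KM: abelian_group KM unfolding KM_def by (rule abelian_group_K)
    have KM_minus: "\<ominus>\<^bsub>KM\<^esub> m = \<ominus> m" if "m \<in> K" for m
      using that by (intro KM.minus_equality) (simp_all add: K_closed K_carrier l_neg)
    interpret KA: scalar_action KM sm
      by unfold_locales (simp_all add: K_closed K_carrier act_add_left act_add_right act_mult)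
    interpret L: linear_operator KM sm C
      by unfold_locales (simp_all add: additive_op_def K_closed K_carrier additive_opD(2)[OF C_add] C_sm)
    interpret P: scalar_action KM L.pact by (rule L.scalar_action_pact)
    have tfC: "p = 0" if "m \<in> K" "L.pact p m = \<zero>" "m \<noteq> \<zero>" for p m
    proof (rule ccontr)
      assume "p \<noteq> 0"
      from eigenvector[OF L.linear_operator_axioms this, of m] that
      obtain c q where "L.pact q m \<noteq> \<zero>" "C (L.pact q m) = sm c (L.pact q m)" by auto
      moreover have "L.pact q m \<in> carrier M" using L.pact_closed[of m q] that by (simp add: K_carrier)
      ultimately show False using eig by blast
    qed
    have commC: "U (L.pact p m) = L.pact p (U m)"
      if "additive_op KM U" "\<And>m. m \<in> K \<Longrightarrow> U (C m) = C (U m)" "\<And>c m. m \<in> K \<Longrightarrow> U (sm c m) = sm c (U m)" "m \<in> K" for U p m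
      by (rule L.pact_commute) (use that in auto)
    have addKM: "additive_op KM S" "additive_op KM si" "additive_op KM E" "additive_op KM C"
      by (auto simp: additive_op_def K_closed K_E K_carrier additive_opD(2)[OF S_add] additive_opD(2)[OF SI.s'_add]
          additive_opD(2)[OF E_add] additive_opD(2)[OF C_add])
    interpret EL: linear_operator KM L.pact E
      by unfold_locales (use addKM in \<open>simp_all add: commC E_C E_sm K_carrier\<close>)
    interpret EP: scalar_action KM EL.pact by (rule EL.scalar_action_pact)
    interpret SK: invertible_op KM S si
      by unfold_locales (use addKM in \<open>simp_all add: K_carrier\<close>)
    have Spact: "S (L.pact p m) = L.pact p (S m)" "si (L.pact p m) = L.pact p (si m)" if "m \<in> K" for p m
      using that addKM by (simp_all add: commC CS si_C S_sm si_sm K_carrier)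
    show False
    proof (cases "\<exists>f v. f \<noteq> 0 \<and> v \<in> K \<and> v \<noteq> \<zero> \<and> EL.pact f v = \<zero>")
      case True
      define Q where "Q f \<longleftrightarrow> f \<noteq> 0 \<and> (\<exists>v. v \<in> K \<and> v \<noteq> \<zero> \<and> EL.pact f v = \<zero>)" for f
      \<comment> \<open>The degree is minimal over all nonzero vectors of \<open>K\<close>, not only
        for one of them, since \<open>shifted_torsion\<close> compares annihilators of different
        vectors.\<close>
      obtain f where f: "Q f" and min: "\<And>g. Q g \<Longrightarrow> degree f \<le> degree g"
        using True ex_has_least_nat[of Q _ degree] unfolding Q_def by metis
      obtain v where v: "v \<in> K" "v \<noteq> \<zero>" "EL.pact f v = \<zero>" "f \<noteq> 0" using f by (auto simp: Q_def)
      interpret T: shifted_torsion KM L.pact E S si v f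
        by unfold_locales (use v tfC min in \<open>auto simp: E_S K_carrier Spact Q_def\<close>)
      let ?I = "UNIV \<times> {..<degree f}"
      \<comment> \<open>The powers of \<open>s\<close> permute the basis up to nothing at all, and
        \<open>E\<close> introduces only the denominator \<open>lead_coeff f\<close>, a polynomial
        in \<open>C\<close>. With \<open>a \<noteq> 0\<close>, \<open>C\<close> is a denominator
        too, so \<open>C^-1\<close> preserves the local span.\<close>
      obtain a where a: "a \<noteq> 0" "poly (lead_coeff f) a \<noteq> 0"
        using exists_non_root[of "lead_coeff f"] v(4) by auto
      interpret F: localized_family KM L.pact T.basis "{h. poly h a \<noteq> 0}"
        by unfold_locales auto
      have b: "T.basis x \<in> F.lspan ?I" if "x \<in> ?I" for x by (rule F.span_lspan[OF T.B.span_gen[OF that]])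
      have bs: "S (T.basis x) = T.basis (fst x + 1, snd x)" "si (T.basis x) = T.basis (fst x - 1, snd x)" for x
      proof -
        obtain i j where x: "x = (i, j)" by (cases x)
        have c: "(E ^^ j) v \<in> carrier KM" using EL.T_pow_closed[of v j] v by simp
        show "S (T.basis x) = T.basis (fst x + 1, snd x)" "si (T.basis x) = T.basis (fst x - 1, snd x)"
          using SK.spow_plus1[OF c, of i] SK.spow_minus1[OF c, of i] by (simp_all only: x T.basis_def split fst_conv snd_conv)
      qed
      have cl: "S m \<in> F.lspan ?I" "si m \<in> F.lspan ?I" "E m \<in> F.lspan ?I" if "m \<in> F.lspan ?I" for m
      proof -
        show "S m \<in> F.lspan ?I"
          by (rule F.lspan_semilinear[OF addKM(1), of "\<lambda>p. p"]) (use that b in \<open>auto simp: Spact bs\<close>)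
        show "si m \<in> F.lspan ?I"
          by (rule F.lspan_semilinear[OF addKM(2), of "\<lambda>p. p"]) (use that b in \<open>auto simp: Spact bs\<close>)
        have Eb: "E (T.basis x) \<in> F.lspan ?I" if "x \<in> ?I" for x
          by (rule F.lspan_cancel[of _ "lead_coeff f"]) (use T.T_basis[OF that] a F.span_lspan K_E T.basis_closed in auto)
        show "E m \<in> F.lspan ?I"
          by (rule F.lspan_semilinear[OF addKM(3), where \<sigma> = "\<lambda>p. p", OF EL.T_act _ Eb that])
      qed
      have cl2: "C m \<in> F.lspan ?I" "sm c m \<in> F.lspan ?I" if "m \<in> F.lspan ?I" for m c
        using F.lspan_act[OF that, of "[:0, 1:]"] F.lspan_act[OF that, of "[:c:]"] F.lspan_closed[OF that]
        by (simp_all add: L.pact_X L.pact_const)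
      have lK: "m \<in> K" if "m \<in> F.lspan ?I" for m using F.lspan_closed[OF that] by simp
      have Ci: "\<exists>n\<in>F.lspan ?I. C n = m" if m: "m \<in> F.lspan ?I" for m
      proof -
        obtain n where n: "n \<in> K" "C n \<ominus> sm 0 n = m" using surj[OF lK[OF m]] by blast
        have "C n \<ominus> \<zero> = C n" using K_carrier[OF n(1)] by (simp add: minus_eq add.inv_one)
        then have Cn: "C n = m" using n K_carrier by simp
        have "n \<in> F.lspan ?I"
          by (rule F.lspan_cancel[of _ "[:0, 1:]"]) (use n Cn m a in \<open>auto simp: L.pact_X\<close>)
        then show ?thesis using Cn by blast
      qed
      have i: "(0, 0) \<in> ?I" using T.degree_f by simp
      have v0: "v \<in> F.lspan ?I" using b[OF i] by (simp add: T.basis_def)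
      have full: "F.lspan ?I = K"
        by (rule K_irreducible[OF _ _ _ _ _ _ _ _ Ci C_inj v0 v(2)])
          (use lK cl cl2 F.lspan_zero F.lspan_add in auto)
      obtain u where u: "u \<in> K" "C u \<ominus> sm a u = v" using surj[OF v(1)] by blast
      then have "L.pact [:- a, 1:] u = T.basis (0, 0)"
        by (simp add: L.pact_linear T.basis_def KA.act_minus_left K_carrier KM_minus K_closed minus_eq a_comm)
      then obtain h where "poly h a \<noteq> 0" "[:- a, 1:] dvd h"
        using F.lspan_divisor[OF T.indep_basis i, of u "[:- a, 1:]"] full u by auto
      then show False by (simp add: poly_eq_0_iff_dvd)
    next
      case False
      obtain v where v: "v \<in> K" "v \<noteq> \<zero>" using K_nonzero by blast
      have SE: "S (EL.pact p m) = EL.pact (pcompose p [:-1, 1:]) (S m)" if "m \<in> K" for p m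
      proof (rule EL.pact_semilinear[OF addKM(1)])
        show "S (E n) = EL.pact [:- 1, 1:] (S n)" if "n \<in> carrier KM" for n
          using that by (simp add: EL.pact_linear P.act_minus_left E_S K_carrier K_closed K_E KM_minus a_ac r_neg1 r_neg2)
      qed (use that Spact in auto)
      have siE: "si (EL.pact p m) = EL.pact (pcompose p [:1, 1:]) (si m)" if "m \<in> K" for p m
      proof (rule EL.pact_semilinear[OF addKM(2)])
        show "si (E n) = EL.pact [:1, 1:] (si n)" if "n \<in> carrier KM" for n
        proof -
          have n: "n \<in> carrier M" "n \<in> K" using that K_carrier by auto
          have "si (E n) = si (S (E (si n)) \<oplus> n)" using E_S[of "si n"] n by simp
          also have "\<dots> = E (si n) \<oplus> si n" using n by (simp add: additive_opD(2)[OF SI.s'_add])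
          finally show ?thesis using n by (simp add: EL.pact_linear K_closed a_comm)
        qed
      qed (use that Spact in auto)
      have tf: "p = 0" if "m \<in> K" "EL.pact p m = \<zero>" "m \<noteq> \<zero>" for p m
        using False that by blast
      interpret J: skew_laurent KM EL.pact S si "\<lambda>p. pcompose p [:-1, 1:]" "\<lambda>p. pcompose p [:1, 1:]" v
        by unfold_locales (use v tf siE in \<open>auto simp: pcompose_eq_0_iff\<close>)
      define e where "e i = SK.spow i v" for i
      obtain I q where q: "q \<noteq> 0" "I \<noteq> {}" and ind: "lin_indep KM EL.pact e I"
        and step: "\<forall>i\<in>I. EL.pact q (e (i + 1)) \<in> lin_span KM EL.pact e I \<and> EL.pact q (e (i - 1)) \<in> lin_span KM EL.pact e I"
        using J.power_basis unfolding e_def by blast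
      \<comment> \<open>Here \<open>q\<close> is a polynomial in \<open>E\<close> over k[C]. It is
        not a multiple of \<open>C - a\<close> as soon as one of its coefficients does not vanish at
        \<open>a\<close>.\<close>
      obtain n where n: "coeff q n \<noteq> 0" using q(1) by (metis leading_coeff_0_iff)
      obtain a where a: "a \<noteq> 0" "poly (coeff q n) a \<noteq> 0" using exists_non_root[OF n] by blast
      let ?t = "[:[:- a, 1:]:]"
      have dvd_iff: "?t dvd p \<longleftrightarrow> (\<forall>n. poly (coeff p n) a = 0)" for p
        by (simp add: const_poly_dvd_iff poly_eq_0_iff_dvd)
      \<comment> \<open>A prime of k[C] stays prime in k[C][E], so its non-multiples are closed
        under products and can serve as denominators.\<close>
      have prime: "prime_elem ?t"
        by (rule prime_elem_const_poly_iff[THEN iffD2]) (rule prime_elem_linear_field_poly, simp)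
      \<comment> \<open>Shifting \<open>E\<close> back fixes the constant factor
        \<open>C - a\<close>. Thus the shifts caused by \<open>s\<close> and \<open>s^-1\<close>
        send denominators to denominators.\<close>
      have shift_dvd: "?t dvd p" if d: "?t dvd pcompose p [:c, 1:]" for p c
      proof -
        obtain r where "pcompose p [:c, 1:] = ?t * r" using d by (elim dvdE)
        then have "pcompose (pcompose p [:c, 1:]) [:- c, 1:] = ?t * pcompose r [:- c, 1:]"
          by (simp add: pcompose_smult)
        then have "p = ?t * pcompose r [:- c, 1:]" by (simp add: pcompose_pCons flip: pcompose_assoc)
        then show ?thesis by (rule dvdI)
      qed
      have eK: "e i \<in> K" for i using SK.spow_closed[of v i] v by (simp add: e_def)
      have es: "S (e i) = e (i + 1)" "si (e i) = e (i - 1)" for i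
        using SK.spow_plus1[of v i] SK.spow_minus1[of v i] v by (simp_all only: e_def KM)
      interpret F: localized_family KM EL.pact e "{h. \<not> ?t dvd h}"
      proof unfold_locales
        show "e i \<in> carrier KM" for i using eK by simp
        show "1 \<in> {h. \<not> ?t dvd h}" using prime by (simp add: prime_elem_def)
        show "h * k \<in> {h. \<not> ?t dvd h}" if "h \<in> {h. \<not> ?t dvd h}" "k \<in> {h. \<not> ?t dvd h}" for h k
          using that prime_elem_dvd_multD[OF prime] by blast
      qed
      have qS: "\<not> ?t dvd q" using a dvd_iff by blast
      have Se: "S (e i) \<in> F.lspan I" "si (e i) \<in> F.lspan I" if "i \<in> I" for i
      proof -
        have "e (i + 1) \<in> F.lspan I" "e (i - 1) \<in> F.lspan I"
          using step that qS eK by (auto intro!: F.lspanI[of _ q])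
        then show "S (e i) \<in> F.lspan I" "si (e i) \<in> F.lspan I" by (simp_all only: es)
      qed
      have cl: "S m \<in> F.lspan I" "si m \<in> F.lspan I" if "m \<in> F.lspan I" for m
      proof -
        show "S m \<in> F.lspan I"
          by (rule F.lspan_semilinear[OF addKM(1) SE _ Se(1) that]) (use shift_dvd in auto)
        show "si m \<in> F.lspan I"
          by (rule F.lspan_semilinear[OF addKM(2) siE _ Se(2) that]) (use shift_dvd in auto)
      qed
      have lK: "m \<in> K" if "m \<in> F.lspan I" for m using F.lspan_closed[OF that] by simp
      have cl2: "E m \<in> F.lspan I" "C m \<in> F.lspan I" "sm c m \<in> F.lspan I" if "m \<in> F.lspan I" for m c
        using F.lspan_act[OF that, of "[:0, 1:]"] F.lspan_act[OF that, of "[:[:0, 1:]:]"] F.lspan_act[OF that, of "[:[:c:]:]"] lK[OF that]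
        by (simp_all add: EL.pact_X EL.pact_const L.pact_X L.pact_const)
      have Ci: "\<exists>n\<in>F.lspan I. C n = m" if m: "m \<in> F.lspan I" for m
      proof -
        obtain n where n: "n \<in> K" "C n \<ominus> sm 0 n = m" using surj[OF lK[OF m]] by blast
        have "C n \<ominus> \<zero> = C n" using K_carrier[OF n(1)] by (simp add: minus_eq add.inv_one)
        then have Cn: "C n = m" using n K_carrier by simp
        have nd: "\<not> ?t dvd [:[:0, 1:]:]" unfolding dvd_iff using a by (intro notI) (drule spec[of _ 0], simp)
        have "n \<in> F.lspan I"
          by (rule F.lspan_cancel[of _ "[:[:0, 1:]:]"]) (use n Cn m nd in \<open>auto simp: L.pact_X EL.pact_const\<close>)
        then show ?thesis using Cn by blast
      qed
      obtain i where i: "i \<in> I" using q(2) by blast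
      have ei: "e i \<in> F.lspan I" "e i \<noteq> \<zero>" "e i \<in> K"
        using F.span_lspan[OF F.span_gen[OF i]] SK.spow_eq_zero[of v i] v lK by (auto simp: e_def)
      have full: "F.lspan I = K"
        by (rule K_irreducible[OF _ _ _ _ _ _ _ _ Ci C_inj ei(1,2)])
          (use lK cl cl2 F.lspan_zero F.lspan_add in auto)
      obtain u where u: "u \<in> K" "C u \<ominus> sm a u = e i" using surj[OF ei(3)] by blast
      then have "EL.pact ?t u = e i"
        by (simp add: EL.pact_const L.pact_linear KA.act_minus_left K_carrier KM_minus K_closed minus_eq a_comm)
      then show False using F.lspan_divisor[OF ind i, of u ?t] full u by auto
    qed
  qed
  then obtain \<mu> where \<mu>: "\<forall>m\<in>carrier M. C m = sm \<mu> m" by blast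
  \<comment> \<open>For \<open>C = 0\<close> the relation \<open>C^2 g^2 = s^2\<close> would give
    \<open>s^2 = 0\<close>.\<close>
  moreover have "\<mu> \<noteq> 0"
  proof
    assume "\<mu> = 0"
    then have "S (S m) = \<zero>" if "m \<in> carrier M" for m using \<mu> CCGG[OF that] that by simp
    then show False using nonzero_ex si_eq_zero S_closed by blast
  qed
  ultimately show ?thesis by blast
qed

end

section \<open>Finite-dimensional simple modules\<close>

lemma (in A_module) smult_subset:
  assumes "a \<in> carrier A_alg" "\<And>m n. \<lbrakk>m \<in> H; n \<in> H\<rbrakk> \<Longrightarrow> m \<oplus>\<^bsub>M\<^esub> n \<in> H" "\<And>c m. m \<in> H \<Longrightarrow> sm c m \<in> H"
    "\<And>m. m \<in> H \<Longrightarrow> elt_x \<odot>\<^bsub>M\<^esub> m \<in> H" "\<And>m. m \<in> H \<Longrightarrow> elt_y \<odot>\<^bsub>M\<^esub> m \<in> H"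
    "\<And>m. m \<in> H \<Longrightarrow> elt_g \<odot>\<^bsub>M\<^esub> m \<in> H" "\<And>m. m \<in> H \<Longrightarrow> elt_ginv \<odot>\<^bsub>M\<^esub> m \<in> H"
    and "H \<subseteq> carrier M" "m \<in> H"
  shows "a \<odot>\<^bsub>M\<^esub> m \<in> H"
  using assms(1,9)
proof (induct a arbitrary: m rule: A_induct)
  case (add a b)
  have "m \<in> carrier M" using add assms(8) by blast
  then show ?case using add assms(2) by (simp add: smult_l_distr)
next
  case (mult a b)
  have "m \<in> carrier M" using mult assms(8) by blast
  then show ?case using mult by (simp add: smult_assoc)
qed (use assms in auto)

lemma A_hom_eq:
  assumes "A_module M" "A_module N" "a \<in> carrier A_alg" "\<And>m. m \<in> carrier M \<Longrightarrow> f m \<in> carrier N"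
    "\<And>m n. \<lbrakk>m \<in> carrier M; n \<in> carrier M\<rbrakk> \<Longrightarrow> f (m \<oplus>\<^bsub>M\<^esub> n) = f m \<oplus>\<^bsub>N\<^esub> f n"
    "\<And>c m. m \<in> carrier M \<Longrightarrow> f (A_scalar c \<odot>\<^bsub>M\<^esub> m) = A_scalar c \<odot>\<^bsub>N\<^esub> f m"
    "\<And>m. m \<in> carrier M \<Longrightarrow> f (elt_x \<odot>\<^bsub>M\<^esub> m) = elt_x \<odot>\<^bsub>N\<^esub> f m"
    "\<And>m. m \<in> carrier M \<Longrightarrow> f (elt_y \<odot>\<^bsub>M\<^esub> m) = elt_y \<odot>\<^bsub>N\<^esub> f m"
    "\<And>m. m \<in> carrier M \<Longrightarrow> f (elt_g \<odot>\<^bsub>M\<^esub> m) = elt_g \<odot>\<^bsub>N\<^esub> f m"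
    "\<And>m. m \<in> carrier M \<Longrightarrow> f (elt_ginv \<odot>\<^bsub>M\<^esub> m) = elt_ginv \<odot>\<^bsub>N\<^esub> f m"
    and m: "m \<in> carrier M"
  shows "f (a \<odot>\<^bsub>M\<^esub> m) = a \<odot>\<^bsub>N\<^esub> f m"
proof -
  interpret M: A_module M by fact
  interpret N: A_module N by fact
  show ?thesis using assms(3) m
  proof (induct a arbitrary: m rule: A_induct)
    case (add a b) then show ?case by (simp add: M.smult_l_distr N.smult_l_distr assms(4,5))
  next
    case (mult a b) then show ?case by (simp add: M.smult_assoc N.smult_assoc assms(4))
  qed (use assms in auto)
qed

lemma simple_rep_A:
  assumes "simple_module A_alg M"
  shows "simple_rep M (\<lambda>c m. A_scalar c \<odot>\<^bsub>M\<^esub> m) (\<lambda>m. elt_x \<odot>\<^bsub>M\<^esub> m) (\<lambda>m. elt_y \<odot>\<^bsub>M\<^esub> m)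
    (\<lambda>m. elt_g \<odot>\<^bsub>M\<^esub> m) (\<lambda>m. elt_ginv \<odot>\<^bsub>M\<^esub> m)"
proof -
  interpret A_module M using simple_moduleD(1)[OF assms] by (rule A_module.intro)
  show ?thesis
  proof unfold_locales
    show "carrier M \<noteq> {\<zero>\<^bsub>M\<^esub>}" by (rule simple_moduleD(2)[OF assms])
    fix H assume H: "H \<subseteq> carrier M" "\<zero>\<^bsub>M\<^esub> \<in> H" "\<And>m n. \<lbrakk>m \<in> H; n \<in> H\<rbrakk> \<Longrightarrow> m \<oplus>\<^bsub>M\<^esub> n \<in> H"
      "\<And>c m. m \<in> H \<Longrightarrow> sm c m \<in> H" "\<And>m. m \<in> H \<Longrightarrow> elt_x \<odot>\<^bsub>M\<^esub> m \<in> H" "\<And>m. m \<in> H \<Longrightarrow> elt_y \<odot>\<^bsub>M\<^esub> m \<in> H"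
      "\<And>m. m \<in> H \<Longrightarrow> elt_g \<odot>\<^bsub>M\<^esub> m \<in> H" "\<And>m. m \<in> H \<Longrightarrow> elt_ginv \<odot>\<^bsub>M\<^esub> m \<in> H"
    have "submodule H A_alg M"
      by (rule submoduleI[OF H(1-3)]) (auto intro: smult_subset[OF _ H(3-8,1)])
    then show "H = {\<zero>\<^bsub>M\<^esub>} \<or> H = carrier M" by (rule simple_moduleD(3)[OF assms])
  qed
qed

lemma finite_dim_iso:
  assumes "left_module A_alg M" "left_module A_alg N" "mod_isomorphic A_alg M N" "finite_dim A_scalar M"
  shows "finite_dim A_scalar N"
  using assms has_dimension_iso[OF assms(1-3), of A_scalar] unfolding finite_dim_def by fastforce

text \<open>In finite dimension every vector is killed by a nonzero polynomial in \<open>E\<close>.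
  Take one of least degree and a nonzero \<open>v\<close> that it kills: by
  \<open>spow_sum_zero\<close> the vectors \<open>s^i v\<close> are independent, and
  \<open>n + 1\<close> of them contradict dimension \<open>n\<close>. Characteristic 0 enters
  through the shifts in \<open>E s = s E + s\<close>.\<close>

lemma bijective_infinite:
  fixes M :: "('k::{alg_closed_field, field_char_0} elt, 'v) module"
  assumes "A_module M" "bij_betw (\<lambda>m. elt_s \<odot>\<^bsub>M\<^esub> m) (carrier M) (carrier M)" "carrier M \<noteq> {\<zero>\<^bsub>M\<^esub>}"
  shows "\<not> finite_dim A_scalar M"
proof
  assume "finite_dim A_scalar M"
  then obtain n where n: "has_dimension A_scalar M n" by (auto simp: finite_dim_def)
  interpret A_module M by fact
  have "bij_betw rep.S (carrier M) (carrier M)"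
    using assms(2) by (rule bij_betw_cong[THEN iffD1, rotated]) (simp add: s_smult)
  then interpret R: bijective_rep M sm "\<lambda>m. elt_x \<odot>\<^bsub>M\<^esub> m" "\<lambda>m. elt_y \<odot>\<^bsub>M\<^esub> m" "\<lambda>m. elt_g \<odot>\<^bsub>M\<^esub> m" "\<lambda>m. elt_ginv \<odot>\<^bsub>M\<^esub> m"
    by unfold_locales
  interpret L: linear_operator M sm R.E
    by unfold_locales (simp_all add: R.E_add R.E_sm)
  have tf: "c = 0" if "m \<in> carrier M" "sm c m = \<zero>\<^bsub>M\<^esub>" "m \<noteq> \<zero>\<^bsub>M\<^esub>" for c m
  proof (rule ccontr)
    assume "c \<noteq> 0"
    then have "m = sm (inverse c) (sm c m)" using that(1) by (simp flip: sc.act_mult)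
    then show False using that by (simp add: sc.act_zero_right)
  qed
  obtain v0 where v0: "v0 \<in> carrier M" "v0 \<noteq> \<zero>\<^bsub>M\<^esub>" using assms(3) M.zero_closed by blast
  define Q where "Q f \<longleftrightarrow> f \<noteq> 0 \<and> (\<exists>v. v \<in> carrier M \<and> v \<noteq> \<zero>\<^bsub>M\<^esub> \<and> L.pact f v = \<zero>\<^bsub>M\<^esub>)" for f
  obtain c :: "nat \<Rightarrow> 'k" where c: "\<exists>i\<in>{..n}. c i \<noteq> 0" "(\<Oplus>\<^bsub>M\<^esub>i\<in>{..n}. sm (c i) ((R.E ^^ i) v0)) = \<zero>\<^bsub>M\<^esub>"
    using has_dimension_dependent[OF n scalar_action_A, of "\<lambda>i. (R.E ^^ i) v0"] v0 by auto
  have "Q (\<Sum>j<Suc n. Polynomial.monom (c j) j)"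
    unfolding Q_def
  proof (intro conjI exI[of _ v0])
    obtain i where "i \<le> n" "c i \<noteq> 0" using c(1) by auto
    then have "Polynomial.coeff (\<Sum>j<Suc n. Polynomial.monom (c j) j) i \<noteq> 0" by (simp add: coeff_sum del: sum.lessThan_Suc)
    then show "(\<Sum>j<Suc n. Polynomial.monom (c j) j) \<noteq> 0" by (metis coeff_0)
    show "L.pact (\<Sum>j<Suc n. Polynomial.monom (c j) j) v0 = \<zero>\<^bsub>M\<^esub>"
      using c(2) L.pact_sum_monom[OF v0(1), of c "Suc n"] by (simp only: lessThan_Suc_atMost)
  qed (use v0 in auto)
  then obtain f where f: "Q f" and min: "\<And>g. Q g \<Longrightarrow> degree f \<le> degree g"
    using ex_has_least_nat[of Q _ degree] by metis
  obtain v where v: "v \<in> carrier M" "v \<noteq> \<zero>\<^bsub>M\<^esub>" "L.pact f v = \<zero>\<^bsub>M\<^esub>" "f \<noteq> 0" using f by (auto simp: Q_def)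
  interpret T: shifted_torsion M sm R.E rep.S R.si v f
    by unfold_locales (use v tf min in \<open>auto simp: R.E_S rep.S_sm Q_def\<close>)
  obtain c :: "nat \<Rightarrow> 'k" where c: "\<exists>i\<in>{..n}. c i \<noteq> 0" "(\<Oplus>\<^bsub>M\<^esub>i\<in>{..n}. sm (c i) (R.SI.spow (int i) v)) = \<zero>\<^bsub>M\<^esub>"
    using has_dimension_dependent[OF n scalar_action_A, of "\<lambda>i. R.SI.spow (int i) v"] v by auto
  have "(\<Oplus>\<^bsub>M\<^esub>i\<in>int ` {..n}. R.SI.spow i (sm (c (nat i)) v)) = (\<Oplus>\<^bsub>M\<^esub>i\<in>{..n}. R.SI.spow (int i) (sm (c i) v))"
    by (subst M.finsum_reindex) (auto simp: v inj_on_def)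
  also have "\<dots> = \<zero>\<^bsub>M\<^esub>"
    unfolding c(2)[symmetric] by (rule M.finsum_cong') (auto simp: v T.spow_act)
  finally have z: "(\<Oplus>\<^bsub>M\<^esub>i\<in>int ` {..n}. R.SI.spow i (sm (c (nat i)) v)) = \<zero>\<^bsub>M\<^esub>" .
  have "c i = 0" if "i \<le> n" for i
  proof -
    interpret P: scalar_action M L.pact by (rule L.scalar_action_pact)
    have "L.pact f (sm d v) = \<zero>\<^bsub>M\<^esub>" for d
      using P.act_commute[OF v(1), of f "[:d:]"] v by (simp add: L.pact_const)
    then have "sm (c (nat (int i))) v = \<zero>\<^bsub>M\<^esub>"
      using T.spow_sum_zero[of "int ` {..n}" "\<lambda>i. sm (c (nat i)) v" "int i", OF _ _ _ z] v that by auto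
    then show ?thesis using tf v by simp
  qed
  then show False using c(1) by auto
qed

subsection \<open>The modules \<open>S\<^sub>\<gamma>\<close>\<close>

text \<open>A model of \<open>S_module \<gamma>\<close> on the field itself. It serves to show that
  the ideal defining \<open>S_module \<gamma>\<close> is proper.\<close>

definition one_dim_module :: "'k::field \<Rightarrow> ('k elt, 'k) module" where
  "one_dim_module \<gamma> = sjp_rep.rep_module ring_of_type_algebra (*) (\<lambda>m. 0 * m) (\<lambda>m. 0 * m) (\<lambda>m. \<gamma> * m) (\<lambda>m. inverse \<gamma> * m)"

lemma one_dim_module:
  assumes "\<gamma> \<noteq> 0"
  shows "left_module A_alg (one_dim_module \<gamma>)" "carrier (one_dim_module \<gamma>) = UNIV"
    "A_scalar c \<odot>\<^bsub>one_dim_module \<gamma>\<^esub> m = c * m" "\<zero>\<^bsub>one_dim_module \<gamma>\<^esub> = 0"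
    "elt_x \<odot>\<^bsub>one_dim_module \<gamma>\<^esub> m = 0" "elt_y \<odot>\<^bsub>one_dim_module \<gamma>\<^esub> m = 0" "elt_g \<odot>\<^bsub>one_dim_module \<gamma>\<^esub> m = \<gamma> * m"
proof -
  interpret ring "ring_of_type_algebra :: 'a ring" by (rule ring_of_type)
  interpret one_dim: sjp_rep "ring_of_type_algebra :: 'a ring" "(*)" "\<lambda>m. 0 * m" "\<lambda>m. 0 * m" "\<lambda>m. \<gamma> * m" "\<lambda>m. inverse \<gamma> * m"
    by unfold_locales (use assms in \<open>auto simp: additive_op_def algebra_simps a_minus_def\<close>)
  show "left_module A_alg (one_dim_module \<gamma>)" "carrier (one_dim_module \<gamma>) = UNIV"
    "A_scalar c \<odot>\<^bsub>one_dim_module \<gamma>\<^esub> m = c * m" "\<zero>\<^bsub>one_dim_module \<gamma>\<^esub> = 0"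
    "elt_x \<odot>\<^bsub>one_dim_module \<gamma>\<^esub> m = 0" "elt_y \<odot>\<^bsub>one_dim_module \<gamma>\<^esub> m = 0" "elt_g \<odot>\<^bsub>one_dim_module \<gamma>\<^esub> m = \<gamma> * m"
    unfolding one_dim_module_def
    by (rule one_dim.left_module_rep,
        simp_all only: one_dim.rep_gens one_dim.rep_module_carrier ring_of_type_algebra_simps UNIV_I mult_zero_left)
qed

locale S_setup =
  fixes \<gamma> :: "'k::{alg_closed_field, field_char_0}"
  assumes \<gamma>: "\<gamma> \<noteq> 0"
begin

definition gens :: "'k elt set" where "gens = {elt_s, elt_x, elt_y, elt_g \<ominus>\<^bsub>A_alg\<^esub> A_scalar \<gamma>}"
definition I :: "'k elt set" where "I = genideal A_alg gens"

sublocale A: ring "A_alg :: 'k elt ring" by (rule ring_A)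

lemma gens_carrier: "gens \<subseteq> carrier A_alg" by (auto simp: gens_def)

lemma ideal_I: "ideal I A_alg" unfolding I_def by (rule A.genideal_ideal[OF gens_carrier])

lemma gens_I: "gens \<subseteq> I" unfolding I_def by (rule A.genideal_self[OF gens_carrier])

lemma S_module_eq: "S_module \<gamma> = quotient_module A_alg I"
  by (simp add: S_module_def I_def gens_def)

lemma annihilates:
  assumes "A_module M" "\<And>m. m \<in> carrier M \<Longrightarrow> elt_x \<odot>\<^bsub>M\<^esub> m = \<zero>\<^bsub>M\<^esub>"
    "\<And>m. m \<in> carrier M \<Longrightarrow> elt_y \<odot>\<^bsub>M\<^esub> m = \<zero>\<^bsub>M\<^esub>" "\<And>m. m \<in> carrier M \<Longrightarrow> elt_g \<odot>\<^bsub>M\<^esub> m = A_scalar \<gamma> \<odot>\<^bsub>M\<^esub> m"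
    "a \<in> I" "m \<in> carrier M"
  shows "a \<odot>\<^bsub>M\<^esub> m = \<zero>\<^bsub>M\<^esub>"
proof -
  interpret A_module M by fact
  show ?thesis
  proof (rule genideal_annihilates[OF gens_carrier _ assms(5)[unfolded I_def] assms(6)])
    fix b n assume "b \<in> gens" "n \<in> carrier M"
    then show "b \<odot>\<^bsub>M\<^esub> n = \<zero>\<^bsub>M\<^esub>"
      using assms(2-4) by (auto simp: gens_def s_smult rep.S_def A.minus_eq smult_l_distr smult_l_minus M.r_neg)
  qed
qed

abbreviation "model \<equiv> one_dim_module \<gamma>"

lemmas model = one_dim_module[OF \<gamma>]

text \<open>The ideal acts as zero on \<open>model\<close>, where the scalar \<open>c\<close> sends
  1 to \<open>c\<close>.\<close>

lemma scalar_in_I: "A_scalar c \<in> I \<longleftrightarrow> c = 0"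
proof
  assume "A_scalar c \<in> I"
  then have "A_scalar c \<odot>\<^bsub>model\<^esub> 1 = \<zero>\<^bsub>model\<^esub>"
    by (rule annihilates[OF A_module.intro[OF model(1)], rotated 3]) (simp_all add: model)
  then show "c = 0" by (simp add: model)
next
  assume "c = 0"
  then show "A_scalar c \<in> I"
    using additive_subgroup.zero_closed[OF ideal.axioms(1)[OF ideal_I]] by (simp add: A_scalar_def const_def A_proj_zero)
qed

text \<open>The elements congruent to a scalar modulo \<open>I\<close> are closed under sums and
  products. Among the generators only \<open>g^-1\<close> needs an argument, since the ideal
  prescribes the residue of \<open>g\<close> and not of its inverse.\<close>

lemma scalar_rep: "a \<in> carrier A_alg \<Longrightarrow> \<exists>c. a \<ominus>\<^bsub>A_alg\<^esub> A_scalar c \<in> I"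
proof -
  interpret I: ideal I A_alg by (rule ideal_I)
  have I0: "a \<ominus>\<^bsub>A_alg\<^esub> A_scalar 0 \<in> I" if "a \<in> I" for a
    using that scalar_in_I[of 0] by (auto simp: A.minus_eq I.a_closed I.a_inv_closed)
  have gi: "A_scalar (inverse \<gamma>) \<otimes>\<^bsub>A_alg\<^esub> A_scalar \<gamma> = (\<one>\<^bsub>A_alg\<^esub> :: 'k elt)"
    using \<gamma> by (simp flip: A_scalar_hom)
  assume "a \<in> carrier A_alg"
  then show ?thesis
  proof (induct a rule: A_induct)
    case (scalar c)
    then show ?case using scalar_in_I[of 0] I.zero_closed by (intro exI[of _ c]) (simp add: A.minus_eq A.r_neg)
  next
    case ginv
    have "elt_ginv \<ominus>\<^bsub>A_alg\<^esub> A_scalar (inverse \<gamma>) =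
        \<ominus>\<^bsub>A_alg\<^esub> (A_scalar (inverse \<gamma>) \<otimes>\<^bsub>A_alg\<^esub> (elt_g \<ominus>\<^bsub>A_alg\<^esub> A_scalar \<gamma>) \<otimes>\<^bsub>A_alg\<^esub> elt_ginv)"
      by (simp add: A.minus_eq A.r_distr A.l_distr A.r_minus A.l_minus gi A.m_assoc A_relations A.minus_add A.a_comm flip: A.m_assoc[of _ "A_scalar \<gamma>"])
    moreover have "elt_g \<ominus>\<^bsub>A_alg\<^esub> A_scalar \<gamma> \<in> I" using gens_I by (auto simp: gens_def)
    ultimately show ?case
      by (intro exI[of _ "inverse \<gamma>"]) (simp add: I.a_inv_closed I.I_l_closed I.I_r_closed)
  next
    case (add a b)
    then obtain c d where "a \<ominus>\<^bsub>A_alg\<^esub> A_scalar c \<in> I" "b \<ominus>\<^bsub>A_alg\<^esub> A_scalar d \<in> I" by blast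
    then have "(a \<ominus>\<^bsub>A_alg\<^esub> A_scalar c) \<oplus>\<^bsub>A_alg\<^esub> (b \<ominus>\<^bsub>A_alg\<^esub> A_scalar d) \<in> I" by (rule I.a_closed)
    then show ?case using add(1,2)
      by (intro exI[of _ "c + d"]) (simp add: A_scalar_hom A.minus_eq A.minus_add A.a_ac)
  next
    case (mult a b)
    then obtain c d where *: "a \<ominus>\<^bsub>A_alg\<^esub> A_scalar c \<in> I" "b \<ominus>\<^bsub>A_alg\<^esub> A_scalar d \<in> I" by blast
    then have "(a \<ominus>\<^bsub>A_alg\<^esub> A_scalar c) \<otimes>\<^bsub>A_alg\<^esub> b \<oplus>\<^bsub>A_alg\<^esub> A_scalar c \<otimes>\<^bsub>A_alg\<^esub> (b \<ominus>\<^bsub>A_alg\<^esub> A_scalar d) \<in> I"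
      using mult(1,2) by (intro I.a_closed I.I_l_closed I.I_r_closed) auto
    then show ?case using mult(1,2)
      by (intro exI[of _ "c * d"])
        (simp add: A_scalar_hom A.minus_eq A.l_distr A.r_distr A.l_minus A.r_minus A.a_assoc A.r_neg1 A.r_neg2)
  qed (use I0 gens_I in \<open>auto simp: gens_def\<close>)
qed

lemma coset_scalar: "a \<in> carrier A_alg \<Longrightarrow> \<exists>c. I +>\<^bsub>A_alg\<^esub> a = I +>\<^bsub>A_alg\<^esub> A_scalar c"
proof -
  assume a: "a \<in> carrier A_alg"
  interpret I: ideal I A_alg by (rule ideal_I)
  obtain c where "a \<ominus>\<^bsub>A_alg\<^esub> A_scalar c \<in> I" using scalar_rep[OF a] by blast
  then have "I +>\<^bsub>A_alg\<^esub> a = I +>\<^bsub>A_alg\<^esub> A_scalar c"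
    using A.quotient_eq_iff_same_a_r_cos[OF ideal_I a, of "A_scalar c"] by simp
  then show ?thesis by blast
qed

lemma coset_scalar_eq: "I +>\<^bsub>A_alg\<^esub> A_scalar c = I +>\<^bsub>A_alg\<^esub> A_scalar d \<longleftrightarrow> c = d"
proof -
  have "A_scalar c \<ominus>\<^bsub>A_alg\<^esub> A_scalar d = (A_scalar (c - d) :: 'k elt)"
    by (simp add: A_scalar_def const_def single_diff flip: A_proj_diff)
  then show ?thesis
    using A.quotient_eq_iff_same_a_r_cos[OF ideal_I, of "A_scalar c" "A_scalar d"] scalar_in_I[of "c - d"] by simp
qed

lemma left_module_S: "left_module A_alg (S_module \<gamma>)"
  unfolding S_module_eq by (rule quotient_module_left_module[OF ideal_I])

lemma carrier_S: "carrier (S_module \<gamma>) = range (\<lambda>c. I +>\<^bsub>A_alg\<^esub> A_scalar c)"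
  unfolding S_module_eq quotient_module_simps ideal.carrier_Quot[OF ideal_I] by (auto dest!: coset_scalar)

lemma S_smult: "a \<in> carrier A_alg \<Longrightarrow> b \<in> carrier A_alg \<Longrightarrow> a \<odot>\<^bsub>S_module \<gamma>\<^esub> (I +>\<^bsub>A_alg\<^esub> b) = I +>\<^bsub>A_alg\<^esub> (a \<otimes>\<^bsub>A_alg\<^esub> b)"
  unfolding S_module_eq quotient_module_simps by (rule ring_hom_mult[OF ideal.rcos_ring_hom[OF ideal_I], symmetric])

lemma dimension_S: "has_dimension A_scalar (S_module \<gamma>) 1"
proof -
  interpret S: left_module A_alg "S_module \<gamma>" by (rule left_module_S)
  let ?e = "I +>\<^bsub>A_alg\<^esub> \<one>\<^bsub>A_alg\<^esub>"
  have e: "?e \<in> carrier (S_module \<gamma>)" unfolding carrier_S A_scalar_hom(3)[symmetric] by blast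
  have ce: "A_scalar c \<odot>\<^bsub>S_module \<gamma>\<^esub> ?e = I +>\<^bsub>A_alg\<^esub> A_scalar c" for c by (simp add: S_smult)
  have sum: "(\<Oplus>\<^bsub>S_module \<gamma>\<^esub>b\<in>{?e}. A_scalar (c b) \<odot>\<^bsub>S_module \<gamma>\<^esub> b) = I +>\<^bsub>A_alg\<^esub> A_scalar (c ?e)" for c
    using e ce S.smult_closed[OF _ e] by (subst S.M.finsum_insert) (auto simp flip: ce)
  have "\<exists>!c. c \<in> {?e} \<rightarrow>\<^sub>E UNIV \<and> m = (\<Oplus>\<^bsub>S_module \<gamma>\<^esub>b\<in>{?e}. A_scalar (c b) \<odot>\<^bsub>S_module \<gamma>\<^esub> b)"
    if m: "m \<in> carrier (S_module \<gamma>)" for m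
  proof -
    obtain c where c: "m = I +>\<^bsub>A_alg\<^esub> A_scalar c" using m by (auto simp: carrier_S)
    show ?thesis unfolding sum c coset_scalar_eq
      by (rule ex1I[of _ "\<lambda>b\<in>{?e}. c"]) (auto simp: fun_eq_iff PiE_def extensional_def)
  qed
  then show ?thesis unfolding has_dimension_def using e by (intro exI[of _ "{?e}"]) simp
qed

lemma simple_S: "simple_module A_alg (S_module \<gamma>)"
proof -
  interpret S: left_module A_alg "S_module \<gamma>" by (rule left_module_S)
  interpret I: ideal I A_alg by (rule ideal_I)
  have zero: "\<zero>\<^bsub>S_module \<gamma>\<^esub> = I +>\<^bsub>A_alg\<^esub> A_scalar 0"
    using ring_hom_zero[OF I.rcos_ring_hom A.ring_axioms I.quotient_is_ring]
    unfolding S_module_eq quotient_module_simps by (simp add: A_scalar_def const_def A_proj_zero)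
  have "I +>\<^bsub>A_alg\<^esub> A_scalar 1 \<noteq> I +>\<^bsub>A_alg\<^esub> (A_scalar 0 :: 'k elt)" by (simp add: coset_scalar_eq)
  then have nontriv: "carrier (S_module \<gamma>) \<noteq> {\<zero>\<^bsub>S_module \<gamma>\<^esub>}" unfolding carrier_S zero by blast
  have "H = {\<zero>\<^bsub>S_module \<gamma>\<^esub>} \<or> H = carrier (S_module \<gamma>)" if H: "submodule H A_alg (S_module \<gamma>)" for H
  proof (rule disjCI)
    note HD = S.submoduleD[OF H]
    assume "H \<noteq> carrier (S_module \<gamma>)"
    have "u = \<zero>\<^bsub>S_module \<gamma>\<^esub>" if u: "u \<in> H" for u
    proof (rule ccontr)
      assume nz: "u \<noteq> \<zero>\<^bsub>S_module \<gamma>\<^esub>"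
      obtain c where c: "u = I +>\<^bsub>A_alg\<^esub> A_scalar c" using HD(1) u by (auto simp: carrier_S)
      then have "c \<noteq> 0" using nz by (auto simp: zero)
      have "I +>\<^bsub>A_alg\<^esub> A_scalar d \<in> H" for d
      proof -
        have "A_scalar (d / c) \<odot>\<^bsub>S_module \<gamma>\<^esub> u = I +>\<^bsub>A_alg\<^esub> A_scalar d"
          unfolding c using \<open>c \<noteq> 0\<close> by (simp add: S_smult flip: A_scalar_hom)
        then show ?thesis using HD(4)[OF _ u, of "A_scalar (d / c)"] by simp
      qed
      then show False using HD(1) \<open>H \<noteq> _\<close> by (auto simp: carrier_S)
    qed
    then show "H = {\<zero>\<^bsub>S_module \<gamma>\<^esub>}" using HD(2) by blast
  qed
  then show ?thesis using nontriv left_module_S by (auto simp: simple_module_def)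
qed

lemma iso_S:
  assumes "simple_module A_alg M" "\<And>m. m \<in> carrier M \<Longrightarrow> elt_x \<odot>\<^bsub>M\<^esub> m = \<zero>\<^bsub>M\<^esub>"
    "\<And>m. m \<in> carrier M \<Longrightarrow> elt_y \<odot>\<^bsub>M\<^esub> m = \<zero>\<^bsub>M\<^esub>" "\<And>m. m \<in> carrier M \<Longrightarrow> elt_g \<odot>\<^bsub>M\<^esub> m = A_scalar \<gamma> \<odot>\<^bsub>M\<^esub> m"
  shows "mod_isomorphic A_alg (S_module \<gamma>) M"
proof -
  note M = simple_moduleD(1)[OF assms(1)]
  interpret left_module A_alg M by (rule M)
  obtain v where v: "v \<in> carrier M" "v \<noteq> \<zero>\<^bsub>M\<^esub>" using assms(1) by (rule simple_module_nonzero)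
  obtain f where f: "f \<in> mod_hom A_alg (S_module \<gamma>) M" "\<And>a. a \<in> carrier A_alg \<Longrightarrow> f (I +>\<^bsub>A_alg\<^esub> a) = a \<odot>\<^bsub>M\<^esub> v"
    using quotient_module_lift[OF ideal_I M v(1) annihilates[OF A_module.intro[OF M] assms(2-4) _ v(1)]]
    unfolding S_module_eq by blast
  have "I +>\<^bsub>A_alg\<^esub> \<one>\<^bsub>A_alg\<^esub> \<in> carrier (S_module \<gamma>)" unfolding carrier_S A_scalar_hom(3)[symmetric] by blast
  moreover have "f (I +>\<^bsub>A_alg\<^esub> \<one>\<^bsub>A_alg\<^esub>) \<noteq> \<zero>\<^bsub>M\<^esub>" using f(2)[of "\<one>\<^bsub>A_alg\<^esub>"] v by (simp add: smult_one)
  ultimately have "bij_betw f (carrier (S_module \<gamma>)) (carrier M)" by (rule schur[OF simple_S assms(1) f(1)])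
  then show ?thesis using f(1) by (auto simp: mod_isomorphic_def)
qed

end

subsection \<open>The modules \<open>T\<^sub>\<alpha>\<^sub>,\<^sub>\<beta>\<close>\<close>

lemma left_module_cong:
  assumes "left_module R M" "carrier N = carrier M" "\<zero>\<^bsub>N\<^esub> = \<zero>\<^bsub>M\<^esub>" "add N = add M"
    "\<And>a m. \<lbrakk>a \<in> carrier R; m \<in> carrier M\<rbrakk> \<Longrightarrow> a \<odot>\<^bsub>N\<^esub> m = a \<odot>\<^bsub>M\<^esub> m"
  shows "left_module R N"
proof -
  interpret left_module R M by fact
  have "\<exists>n\<in>carrier M. n \<oplus>\<^bsub>M\<^esub> m = \<zero>\<^bsub>M\<^esub>" if "m \<in> carrier M" for m
    using that by (metis M.l_neg M.a_inv_closed)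
  then have "abelian_group N" by (intro abelian_groupI) (auto simp: assms(2-4) M.a_ac)
  then show ?thesis
    by (rule left_moduleI[OF R.ring_axioms]) (simp_all add: assms(2-5) smult_l_distr smult_r_distr smult_assoc smult_one)
qed

lemma A_proj_coset: "p' \<in> A_proj p \<Longrightarrow> A_proj p' = A_proj p" "p \<in> A_proj p"
proof -
  interpret ideal relation_ideal "ring_of_type_algebra :: (gen, 'a) free_algebra ring" by (rule ideal_relation_ideal)
  show "p \<in> A_proj p" unfolding A_proj_def by (rule a_rcos_self) simp
  show "A_proj p' = A_proj p" if "p' \<in> A_proj p"
    using a_repr_independence'[of p' p] that by (simp add: A_proj_def)
qed

locale T_setup =
  fixes \<alpha> \<beta> :: "'k::{alg_closed_field, field_char_0}"
  assumes \<alpha>: "\<alpha> \<noteq> 0" and \<beta>: "\<beta> \<noteq> 0"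
begin

abbreviation "T \<equiv> T_module \<alpha> \<beta>"
abbreviation "smT \<equiv> \<lambda>c::'k. map_prod ((*) c) ((*) c)"

lemma T_simps [simp]: "carrier T = UNIV" "\<zero>\<^bsub>T\<^esub> = 0" "u \<oplus>\<^bsub>T\<^esub> v = u + v"
  by (simp_all add: T_module_def)

lemma abelian_group_T: "abelian_group T"
proof (rule abelian_groupI)
  show "\<exists>v\<in>carrier T. v \<oplus>\<^bsub>T\<^esub> u = \<zero>\<^bsub>T\<^esub>" for u by (rule bexI[of _ "- u"]) simp_all
qed (simp_all add: add_ac)

lemma T_minus [simp]: "\<ominus>\<^bsub>T\<^esub> v = - v"
proof -
  interpret abelian_group T by (rule abelian_group_T)
  show ?thesis by (rule minus_equality) auto
qed

lemma T_rep: "sjp_rep T smT (T_gen \<alpha> \<beta> GenX) (T_gen \<alpha> \<beta> GenY) (T_gen \<alpha> \<beta> GenG) (T_gen \<alpha> \<beta> GenGinv)"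
proof -
  interpret abelian_group T by (rule abelian_group_T)
  show ?thesis
    by unfold_locales
      (use \<beta> in \<open>auto simp: additive_op_def plus_prod_def zero_prod_def uminus_prod_def a_minus_def field_simps\<close>)
qed

lemma gen_op_T: "gen_op (T_gen \<alpha> \<beta> GenX) (T_gen \<alpha> \<beta> GenY) (T_gen \<alpha> \<beta> GenG) (T_gen \<alpha> \<beta> GenGinv) = T_gen \<alpha> \<beta>"
proof
  show "gen_op (T_gen \<alpha> \<beta> GenX) (T_gen \<alpha> \<beta> GenY) (T_gen \<alpha> \<beta> GenG) (T_gen \<alpha> \<beta> GenGinv) x = T_gen \<alpha> \<beta> x" for x
    by (cases x) simp_all
qed

lemma finsum_T: "finite J \<Longrightarrow> (\<Oplus>\<^bsub>T\<^esub>i\<in>J. f i) = (\<Sum>i\<in>J. f i)"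
proof -
  interpret abelian_group T by (rule abelian_group_T)
  show "finite J \<Longrightarrow> (\<Oplus>\<^bsub>T\<^esub>i\<in>J. f i) = (\<Sum>i\<in>J. f i)"
    by (induct J rule: finite_induct) auto
qed

text \<open>The four operators satisfy the defining relations, so the representatives of a residue
  class all act alike. The description in \<open>T_module\<close> therefore picks this common
  action, which is that of \<open>rep_module\<close>.\<close>

lemma left_module_T: "left_module A_alg T"
  and T_smult: "A_scalar c \<odot>\<^bsub>T\<^esub> v = smT c v" "elt_x \<odot>\<^bsub>T\<^esub> v = T_gen \<alpha> \<beta> GenX v" "elt_y \<odot>\<^bsub>T\<^esub> v = T_gen \<alpha> \<beta> GenY v"
    "elt_g \<odot>\<^bsub>T\<^esub> v = T_gen \<alpha> \<beta> GenG v" "elt_ginv \<odot>\<^bsub>T\<^esub> v = T_gen \<alpha> \<beta> GenGinv v"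
proof -
  interpret R: sjp_rep T smT "T_gen \<alpha> \<beta> GenX" "T_gen \<alpha> \<beta> GenY" "T_gen \<alpha> \<beta> GenG" "T_gen \<alpha> \<beta> GenGinv"
    by (rule T_rep)
  have act: "R.F.fact p v = T_act \<alpha> \<beta> p v" for p v
    unfolding R.F.fact_def R.F.wact_def unfolding gen_op_T T_act_def by (rule finsum_T) simp
  have eq: "a \<odot>\<^bsub>T\<^esub> v = a \<odot>\<^bsub>R.rep_module\<^esub> v" if a: "a \<in> carrier A_alg" for a v
  proof -
    obtain p where p: "a = A_proj p" using a by (auto simp: carrier_A)
    have rep: "T_act \<alpha> \<beta> p' v = a \<odot>\<^bsub>R.rep_module\<^esub> v" if "p' \<in> a" for p'
      using R.rep_smult[of v p'] A_proj_coset(1)[of p' p] that by (simp add: p act)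
    have "(THE u. \<forall>p\<in>a. T_act \<alpha> \<beta> p v = u) = a \<odot>\<^bsub>R.rep_module\<^esub> v"
    proof (rule the_equality)
      show "u = a \<odot>\<^bsub>R.rep_module\<^esub> v" if "\<forall>p\<in>a. T_act \<alpha> \<beta> p v = u" for u
        using that rep[of p] A_proj_coset(2)[of p] by (simp add: p)
    qed (use rep in blast)
    then show ?thesis by (simp add: T_module_def)
  qed
  show "left_module A_alg T"
    by (rule left_module_cong[OF R.left_module_rep]) (simp_all add: eq fun_eq_iff)
  show "A_scalar c \<odot>\<^bsub>T\<^esub> v = smT c v" "elt_x \<odot>\<^bsub>T\<^esub> v = T_gen \<alpha> \<beta> GenX v" "elt_y \<odot>\<^bsub>T\<^esub> v = T_gen \<alpha> \<beta> GenY v"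
    "elt_g \<odot>\<^bsub>T\<^esub> v = T_gen \<alpha> \<beta> GenG v" "elt_ginv \<odot>\<^bsub>T\<^esub> v = T_gen \<alpha> \<beta> GenGinv v"
    by (simp_all only: eq elts_closed R.rep_gens T_simps UNIV_I)
qed

lemma dimension_T: "has_dimension A_scalar T 2"
proof -
  let ?B = "{(1, 0), (0, 1)} :: ('k \<times> 'k) set"
  have sum: "(\<Oplus>\<^bsub>T\<^esub>b\<in>?B. A_scalar (c b) \<odot>\<^bsub>T\<^esub> b) = (c (1, 0), c (0, 1))" for c
    by (subst finsum_T) (auto simp: T_smult)
  have "\<exists>!c. c \<in> ?B \<rightarrow>\<^sub>E UNIV \<and> m = (\<Oplus>\<^bsub>T\<^esub>b\<in>?B. A_scalar (c b) \<odot>\<^bsub>T\<^esub> b)" for m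
    unfolding sum
  proof (rule ex1I)
    show "(\<lambda>b\<in>?B. if b = (1, 0) then fst m else snd m) \<in> ?B \<rightarrow>\<^sub>E UNIV \<and>
        m = ((\<lambda>b\<in>?B. if b = (1, 0) then fst m else snd m) (1, 0), (\<lambda>b\<in>?B. if b = (1, 0) then fst m else snd m) (0, 1))"
      by auto
    fix c assume "c \<in> ?B \<rightarrow>\<^sub>E UNIV \<and> m = (c (1, 0), c (0, 1))"
    then show "c = (\<lambda>b\<in>?B. if b = (1, 0) then fst m else snd m)"
      by (intro extensionalityI[of _ ?B]) (auto simp: PiE_def)
  qed
  then show ?thesis unfolding has_dimension_def by (intro exI[of _ ?B]) auto
qed

text \<open>Up to nonzero factors, \<open>y + \<alpha>\<close> and \<open>y - \<alpha>\<close>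
  project a vector to the two eigenlines of \<open>y\<close>, as
  \<open>2 \<alpha> \<noteq> 0\<close>. A nonzero submodule thus contains a vector on one line, and
  \<open>g\<close> carries each line onto the other.\<close>

lemma simple_T: "simple_module A_alg T"
proof -
  interpret M: A_module T by (rule A_module.intro[OF left_module_T])
  have "H = UNIV" if H: "submodule H A_alg T" and u: "u \<in> H" "u \<noteq> 0" for H u
  proof -
    note HD = M.submoduleD[OF H, simplified]
    obtain a b where ab: "u = (a, b)" by (cases u)
    have sm: "(c * p, c * q) \<in> H" if "(p, q) \<in> H" for c p q
      using HD(4)[OF _ that, of "A_scalar c"] by (simp add: T_smult)
    have y: "(\<alpha> * p, - \<alpha> * q) \<in> H" if "(p, q) \<in> H" for p q
      using HD(4)[OF _ that, of elt_y] by (simp add: T_smult)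
    have g: "(\<beta> * q, p) \<in> H" if "(p, q) \<in> H" for p q
      using HD(4)[OF _ that, of elt_g] by (simp add: T_smult)
    have "(\<alpha> * a, - \<alpha> * b) + (\<alpha> * a, \<alpha> * b) \<in> H" "(\<alpha> * a, - \<alpha> * b) + (- \<alpha> * a, - \<alpha> * b) \<in> H"
      using HD(3)[OF y[of a b] sm[of a b \<alpha>]] HD(3)[OF y[of a b] sm[of a b "- \<alpha>"]] u ab by simp_all
    then have 1: "(2 * \<alpha> * a, 0) \<in> H" "(0, - 2 * \<alpha> * b) \<in> H" by (simp_all add: algebra_simps)
    have "(\<beta> * (- 2 * \<alpha> * b), 0) \<in> H" using g[OF 1(2)] by simp
    moreover have "a \<noteq> 0 \<or> b \<noteq> 0" using u ab by (auto simp: zero_prod_def)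
    ultimately obtain d where d: "(d, 0) \<in> H" "d \<noteq> 0" using 1(1) \<alpha> \<beta> by fastforce
    have e0: "(p, 0) \<in> H" for p using sm[OF d(1), of "p / d"] d(2) by simp
    have e1: "(0, q) \<in> H" for q using g[OF e0[of q]] by simp
    have "(p, q) \<in> H" for p q using HD(3)[OF e0[of p] e1[of q]] by simp
    then show ?thesis by auto
  qed
  moreover have "UNIV \<noteq> {0 :: 'k \<times> 'k}" 
  proof
    assume "UNIV = {0 :: 'k \<times> 'k}"
    then have "(1, 0) \<in> {0 :: 'k \<times> 'k}" by blast
    then show False by (simp add: zero_prod_def)
  qed
  ultimately show ?thesis
    using M.submoduleD(2) left_module_T unfolding simple_module_def by (auto simp: set_eq_iff) blast
qed

lemma iso_T:
  assumes "simple_module A_alg M" "\<And>m. m \<in> carrier M \<Longrightarrow> elt_x \<odot>\<^bsub>M\<^esub> m = \<zero>\<^bsub>M\<^esub>"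
    and v: "v \<in> carrier M" "v \<noteq> \<zero>\<^bsub>M\<^esub>" "elt_y \<odot>\<^bsub>M\<^esub> v = A_scalar \<alpha> \<odot>\<^bsub>M\<^esub> v"
    and g2: "\<And>m. m \<in> carrier M \<Longrightarrow> elt_g \<odot>\<^bsub>M\<^esub> (elt_g \<odot>\<^bsub>M\<^esub> m) = A_scalar \<beta> \<odot>\<^bsub>M\<^esub> m"
  shows "mod_isomorphic A_alg T M"
proof -
  note M = simple_moduleD(1)[OF assms(1)]
  interpret M: A_module M by (rule A_module.intro[OF M])
  interpret TM: A_module T by (rule A_module.intro[OF left_module_T])
  let ?g = "\<lambda>m. elt_g \<odot>\<^bsub>M\<^esub> m"
  \<comment> \<open>The basis vector \<open>e_0\<close> goes to the eigenvector \<open>v\<close> of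
    \<open>y\<close>, hence \<open>e_1 = g e_0\<close> must go to \<open>g v\<close>.\<close>
  define f where "f u = A_scalar (fst u) \<odot>\<^bsub>M\<^esub> v \<oplus>\<^bsub>M\<^esub> A_scalar (snd u) \<odot>\<^bsub>M\<^esub> ?g v" for u
  have yg: "elt_y \<odot>\<^bsub>M\<^esub> ?g v = A_scalar (- \<alpha>) \<odot>\<^bsub>M\<^esub> ?g v"
  proof -
    have "A_scalar \<alpha> \<odot>\<^bsub>M\<^esub> ?g v = \<ominus>\<^bsub>M\<^esub> (elt_y \<odot>\<^bsub>M\<^esub> ?g v)"
      using M.rep.GY[OF v(1)] v by (simp add: assms(2) M.M.minus_eq M.smult_sm)
    then show ?thesis using v by (simp add: M.sc.act_minus_left)
  qed
  have gi: "elt_ginv \<odot>\<^bsub>M\<^esub> v = A_scalar (inverse \<beta>) \<odot>\<^bsub>M\<^esub> ?g v"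
  proof -
    have "?g v = A_scalar \<beta> \<odot>\<^bsub>M\<^esub> (elt_ginv \<odot>\<^bsub>M\<^esub> v)" using g2[of "elt_ginv \<odot>\<^bsub>M\<^esub> v"] v by simp
    then have "A_scalar (inverse \<beta>) \<odot>\<^bsub>M\<^esub> ?g v = A_scalar (inverse \<beta> * \<beta>) \<odot>\<^bsub>M\<^esub> (elt_ginv \<odot>\<^bsub>M\<^esub> v)"
      using v by (simp only: M.sc.act_mult M.rep.op_closed)
    then show ?thesis using v \<beta> by simp
  qed
  have gig: "elt_ginv \<odot>\<^bsub>M\<^esub> ?g v = v" using v by simp
  have fc: "f u \<in> carrier M" for u using v by (simp add: f_def)
  have f0: "f (0, 0) = \<zero>\<^bsub>M\<^esub>" using v by (simp add: f_def)
  have sm_smult: "a \<odot>\<^bsub>M\<^esub> f u = A_scalar (fst u) \<odot>\<^bsub>M\<^esub> (a \<odot>\<^bsub>M\<^esub> v) \<oplus>\<^bsub>M\<^esub> A_scalar (snd u) \<odot>\<^bsub>M\<^esub> (a \<odot>\<^bsub>M\<^esub> ?g v)"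
    if "a \<in> carrier A_alg" for a u using that v by (simp add: f_def M.smult_r_distr M.smult_sm)
  have "f (a \<odot>\<^bsub>T\<^esub> u) = a \<odot>\<^bsub>M\<^esub> f u" if a: "a \<in> carrier A_alg" for a u
  proof (rule A_hom_eq[OF TM.A_module_axioms M.A_module_axioms a])
    fix u w c
    show "f (u \<oplus>\<^bsub>T\<^esub> w) = f u \<oplus>\<^bsub>M\<^esub> f w"
      using v by (simp add: f_def A_scalar_hom M.smult_l_distr M.M.a_ac)
    show "f (A_scalar c \<odot>\<^bsub>T\<^esub> u) = A_scalar c \<odot>\<^bsub>M\<^esub> f u"
      using v by (cases u) (simp add: f_def T_smult M.sc.act_add_right M.sc.act_mult)
    show "f (elt_x \<odot>\<^bsub>T\<^esub> u) = elt_x \<odot>\<^bsub>M\<^esub> f u"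
      using assms(2)[OF fc[of u]] by (cases u) (simp add: f0 T_smult)
    show "f (elt_y \<odot>\<^bsub>T\<^esub> u) = elt_y \<odot>\<^bsub>M\<^esub> f u"
      using v by (cases u) (simp add: sm_smult yg v(3) T_smult, simp add: f_def mult.commute flip: M.sc.act_mult)
    show "f (elt_g \<odot>\<^bsub>T\<^esub> u) = elt_g \<odot>\<^bsub>M\<^esub> f u"
      using v by (cases u) (simp add: sm_smult g2 T_smult, simp add: f_def mult.commute M.M.a_comm flip: M.sc.act_mult)
    show "f (elt_ginv \<odot>\<^bsub>T\<^esub> u) = elt_ginv \<odot>\<^bsub>M\<^esub> f u"
      using v by (cases u) (simp add: sm_smult gi gig T_smult, simp add: f_def divide_inverse M.M.a_comm flip: M.sc.act_mult)
  qed (use fc in auto)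
  moreover have "f (u \<oplus>\<^bsub>T\<^esub> w) = f u \<oplus>\<^bsub>M\<^esub> f w" for u w
    using v by (simp add: f_def A_scalar_hom M.smult_l_distr M.M.a_ac)
  ultimately have hom: "restrict f (carrier T) \<in> mod_hom A_alg T M"
    by (intro restrict_mod_hom left_module_T) (use fc in auto)
  have "restrict f (carrier T) (1, 0) \<noteq> \<zero>\<^bsub>M\<^esub>" using v by (simp add: f_def)
  then have "bij_betw (restrict f (carrier T)) (carrier T) (carrier M)"
    by (rule schur[OF simple_T assms(1) hom, rotated]) simp
  then show ?thesis unfolding mod_isomorphic_def by (rule bexI[OF _ hom])
qed

end

subsection \<open>Classification\<close>

lemma simple_s_cases:
  fixes M :: "('k::{alg_closed_field, field_char_0} elt, 'v) module"
  assumes "simple_module A_alg M"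
  shows "(\<exists>\<gamma>. \<gamma> \<noteq> 0 \<and> mod_isomorphic A_alg (S_module \<gamma>) M) \<or>
    (\<exists>\<alpha> \<beta>. \<alpha> \<noteq> 0 \<and> \<beta> \<noteq> 0 \<and> mod_isomorphic A_alg (T_module \<alpha> \<beta>) M) \<or>
    bij_betw (\<lambda>m. elt_s \<odot>\<^bsub>M\<^esub> m) (carrier M) (carrier M)"
proof -
  interpret A_module M using simple_moduleD(1)[OF assms] by (rule A_module.intro)
  interpret R: simple_rep M sm "\<lambda>m. elt_x \<odot>\<^bsub>M\<^esub> m" "\<lambda>m. elt_y \<odot>\<^bsub>M\<^esub> m" "\<lambda>m. elt_g \<odot>\<^bsub>M\<^esub> m" "\<lambda>m. elt_ginv \<odot>\<^bsub>M\<^esub> m"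
    by (rule simple_rep_A[OF assms])
  from R.S_zero_or_bij show ?thesis
  proof
    assume "bij_betw rep.S (carrier M) (carrier M)"
    then have "bij_betw (\<lambda>m. elt_s \<odot>\<^bsub>M\<^esub> m) (carrier M) (carrier M)"
      by (rule bij_betw_cong[THEN iffD1, rotated]) (simp add: s_smult)
    then show ?thesis by blast
  next
    assume "\<forall>m\<in>carrier M. rep.S m = \<zero>\<^bsub>M\<^esub>"
    then have x0: "elt_x \<odot>\<^bsub>M\<^esub> m = \<zero>\<^bsub>M\<^esub>" if "m \<in> carrier M" for m
      using R.S_zero_imp_x_zero that by blast
    from R.y_zero_or_bij[OF x0] show ?thesis
    proof
      assume y0: "\<forall>m\<in>carrier M. elt_y \<odot>\<^bsub>M\<^esub> m = \<zero>\<^bsub>M\<^esub>"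
      obtain \<gamma> where \<gamma>: "\<gamma> \<noteq> 0" "\<forall>m\<in>carrier M. elt_g \<odot>\<^bsub>M\<^esub> m = sm \<gamma> m"
        using R.g_scalar[OF x0] y0 by blast
      interpret S: S_setup \<gamma> by unfold_locales (rule \<gamma>)
      show ?thesis using S.iso_S[OF assms x0] y0 \<gamma> by blast
    next
      assume y: "bij_betw (\<lambda>m. elt_y \<odot>\<^bsub>M\<^esub> m) (carrier M) (carrier M)"
      obtain \<alpha> v where v: "\<alpha> \<noteq> 0" "v \<in> carrier M" "v \<noteq> \<zero>\<^bsub>M\<^esub>" "elt_y \<odot>\<^bsub>M\<^esub> v = sm \<alpha> v"
        using R.y_eigenvector[OF x0 y] by blast
      obtain \<beta> where \<beta>: "\<beta> \<noteq> 0" "\<forall>m\<in>carrier M. elt_g \<odot>\<^bsub>M\<^esub> (elt_g \<odot>\<^bsub>M\<^esub> m) = sm \<beta> m"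
        using R.g_square_scalar[OF x0 v(2-4,1)] by blast
      interpret T: T_setup \<alpha> \<beta> by unfold_locales (use v \<beta> in auto)
      show ?thesis using T.iso_T[OF assms x0 v(2-4)] v \<beta> by blast
    qed
  qed
qed

lemma finite_dim_S:
  fixes \<gamma> :: "'k::{alg_closed_field, field_char_0}"
  assumes "\<gamma> \<noteq> 0" shows "simple_module A_alg (S_module \<gamma>)" "finite_dim A_scalar (S_module \<gamma>)"
proof -
  interpret S_setup \<gamma> by unfold_locales (rule assms)
  show "simple_module A_alg (S_module \<gamma>)" "finite_dim A_scalar (S_module \<gamma>)"
    using simple_S dimension_S by (auto simp: finite_dim_def)
qed

lemma finite_dim_T:
  fixes \<alpha> \<beta> :: "'k::{alg_closed_field, field_char_0}"
  assumes "\<alpha> \<noteq> 0" "\<beta> \<noteq> 0"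
  shows "simple_module A_alg (T_module \<alpha> \<beta>)" "finite_dim A_scalar (T_module \<alpha> \<beta>)"
proof -
  interpret T_setup \<alpha> \<beta> by unfold_locales (use assms in auto)
  show "simple_module A_alg (T_module \<alpha> \<beta>)" "finite_dim A_scalar (T_module \<alpha> \<beta>)"
    using simple_T dimension_T by (auto simp: finite_dim_def)
qed

lemma simple_infinite_iff_s_bij:
  fixes M :: "('k::{alg_closed_field, field_char_0} elt, 'v) module"
  assumes "simple_module A_alg M"
  shows "\<not> finite_dim A_scalar M \<longleftrightarrow> bij_betw (\<lambda>m. elt_s \<odot>\<^bsub>M\<^esub> m) (carrier M) (carrier M)"
proof
  note M = simple_moduleD(1)[OF assms]
  show "\<not> finite_dim A_scalar M" if "bij_betw (\<lambda>m. elt_s \<odot>\<^bsub>M\<^esub> m) (carrier M) (carrier M)"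
    using bijective_infinite[OF A_module.intro[OF M] that simple_moduleD(2)[OF assms]] .
  assume inf: "\<not> finite_dim A_scalar M"
  have "\<not> mod_isomorphic A_alg (S_module \<gamma>) M" if "\<gamma> \<noteq> 0" for \<gamma>
    using finite_dim_iso[OF simple_moduleD(1)[OF finite_dim_S(1)[OF that]] M _ finite_dim_S(2)[OF that]] inf by blast
  moreover have "\<not> mod_isomorphic A_alg (T_module \<alpha> \<beta>) M" if "\<alpha> \<noteq> 0" "\<beta> \<noteq> 0" for \<alpha> \<beta>
    using finite_dim_iso[OF simple_moduleD(1)[OF finite_dim_T(1)[OF that]] M _ finite_dim_T(2)[OF that]] inf by blast
  ultimately show "bij_betw (\<lambda>m. elt_s \<odot>\<^bsub>M\<^esub> m) (carrier M) (carrier M)"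
    using simple_s_cases[OF assms] by blast
qed

text \<open>With \<open>C = \<mu>\<close> the relation \<open>C^2 g^2 = s^2\<close> reads
  \<open>s^2 = \<mu>^2 g^2\<close>, and the right-hand side is invertible. This holds on arbitrary
  modules, so it applies to every module over \<open>A_quot \<mu>\<close>.\<close>

lemma C_scalar_imp_s_bij:
  fixes M :: "('k::field elt, 'v) module"
  assumes "A_module M" "\<mu> \<noteq> 0" "\<And>m. m \<in> carrier M \<Longrightarrow> elt_C \<odot>\<^bsub>M\<^esub> m = A_scalar \<mu> \<odot>\<^bsub>M\<^esub> m"
  shows "bij_betw (\<lambda>m. elt_s \<odot>\<^bsub>M\<^esub> m) (carrier M) (carrier M)"
proof -
  interpret A_module M by fact
  let ?g = "\<lambda>m. elt_g \<odot>\<^bsub>M\<^esub> m" and ?gi = "\<lambda>m. elt_ginv \<odot>\<^bsub>M\<^esub> m"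
  have C: "rep.C m = sm \<mu> m" if "m \<in> carrier M" for m using assms(3)[OF that] C_smult[OF that] by simp
  have SS: "rep.S (rep.S m) = sm (\<mu> * \<mu>) (?g (?g m))" if "m \<in> carrier M" for m
    using rep.CCGG[OF that] that by (simp add: C sc.act_mult)
  let ?r = "\<lambda>m. sm (inverse (\<mu> * \<mu>)) (?gi (?gi m))"
  have r: "rep.S (rep.S (?r m)) = m" "?r (rep.S (rep.S m)) = m" if m: "m \<in> carrier M" for m
  proof -
    have i: "sm (\<mu> * \<mu>) (sm (inverse (\<mu> * \<mu>)) n) = n" "sm (inverse (\<mu> * \<mu>)) (sm (\<mu> * \<mu>) n) = n" if "n \<in> carrier M" for n
      using that assms(2) by (simp_all del: inverse_mult_distrib flip: sc.act_mult)
    show "rep.S (rep.S (?r m)) = m" using m SS[of "?r m"] i by (simp add: rep.op_sm)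
    show "?r (rep.S (rep.S m)) = m" using m SS[OF m] i by (simp add: rep.op_sm)
  qed
  have "bij_betw rep.S (carrier M) (carrier M)"
  proof (rule M.additive_op_bij[OF rep.S_add])
    show "m = \<zero>\<^bsub>M\<^esub>" if "m \<in> carrier M" "rep.S m = \<zero>\<^bsub>M\<^esub>" for m
      using r(2)[OF that(1)] that by (simp add: M.additive_op_zero[OF rep.S_add])
    show "rep.S ` carrier M = carrier M"
    proof
      show "carrier M \<subseteq> rep.S ` carrier M"
      proof
        fix m assume m: "m \<in> carrier M"
        then have "m = rep.S (rep.S (?r m))" "rep.S (?r m) \<in> carrier M" using r(1) by simp_all
        then show "m \<in> rep.S ` carrier M" by blast
      qed
    qed auto
  qed
  then show ?thesis by (rule bij_betw_cong[THEN iffD1, rotated]) (simp add: s_smult)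
qed

lemma s_bij_imp_C_scalar:
  fixes M :: "('k::{alg_closed_field, field_char_0} elt, 'v) module"
  assumes "simple_module A_alg M" "bij_betw (\<lambda>m. elt_s \<odot>\<^bsub>M\<^esub> m) (carrier M) (carrier M)"
  shows "\<exists>\<mu>. \<mu> \<noteq> 0 \<and> (\<forall>m\<in>carrier M. elt_C \<odot>\<^bsub>M\<^esub> m = A_scalar \<mu> \<odot>\<^bsub>M\<^esub> m)"
proof -
  interpret A_module M using simple_moduleD(1)[OF assms(1)] by (rule A_module.intro)
  interpret R: simple_rep M sm "\<lambda>m. elt_x \<odot>\<^bsub>M\<^esub> m" "\<lambda>m. elt_y \<odot>\<^bsub>M\<^esub> m" "\<lambda>m. elt_g \<odot>\<^bsub>M\<^esub> m" "\<lambda>m. elt_ginv \<odot>\<^bsub>M\<^esub> m"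
    by (rule simple_rep_A[OF assms(1)])
  have "bij_betw rep.S (carrier M) (carrier M)"
    using assms(2) by (rule bij_betw_cong[THEN iffD1, rotated]) (simp add: s_smult)
  then interpret R: simple_bijective_rep M sm "\<lambda>m. elt_x \<odot>\<^bsub>M\<^esub> m" "\<lambda>m. elt_y \<odot>\<^bsub>M\<^esub> m" "\<lambda>m. elt_g \<odot>\<^bsub>M\<^esub> m" "\<lambda>m. elt_ginv \<odot>\<^bsub>M\<^esub> m"
    by unfold_locales
  show ?thesis using R.C_scalar C_smult by auto
qed

lemma simple_infinite_iff:
  fixes M :: "('k::{alg_closed_field, field_char_0} elt, 'v) module"
  assumes "simple_module A_alg M"
  shows "\<not> finite_dim A_scalar M \<longleftrightarrow> (\<exists>\<mu>. \<mu> \<noteq> 0 \<and> (\<forall>m\<in>carrier M. elt_C \<odot>\<^bsub>M\<^esub> m = A_scalar \<mu> \<odot>\<^bsub>M\<^esub> m))"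
  unfolding simple_infinite_iff_s_bij[OF assms]
  using s_bij_imp_C_scalar[OF assms] C_scalar_imp_s_bij[OF A_module.intro[OF simple_moduleD(1)[OF assms]]] by blast

lemma inj_infinite:
  fixes emb :: "'k::ring_char_0 \<Rightarrow> 'v"
  assumes "inj emb" shows "infinite (UNIV :: 'v set)"
proof -
  have "infinite (range emb)" using finite_imageD[OF _ assms] infinite_UNIV_char_0 by blast
  then show ?thesis by (rule infinite_super[rotated]) simp
qed

lemma exists_pairing:
  assumes "infinite (UNIV :: 'v set)" shows "\<exists>\<iota> :: 'v \<times> 'v \<Rightarrow> 'v. inj \<iota>"
proof -
  from card_of_Times_same_infinite[OF assms, THEN ordIso_imp_ordLeq]
  have "\<exists>f :: 'v \<times> 'v \<Rightarrow> 'v. inj_on f (UNIV \<times> UNIV)"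
    unfolding card_of_ordLeq[symmetric] by blast
  then show ?thesis by simp
qed

text \<open>The classes consist of modules on the type \<open>'v\<close>, while
  \<open>S_module \<gamma>\<close> and \<open>T_module \<alpha> \<beta>\<close> live elsewhere. The
  injection \<open>emb\<close> guarantees room for copies of k and of its square, so that these
  classes are represented in the universe.\<close>

lemma fin_dim_simple_classes_A:
  fixes emb :: "'k::{alg_closed_field, field_char_0} \<Rightarrow> 'v"
  assumes emb: "inj emb"
  shows "(fin_dim_simple_classes A_scalar A_alg :: ('k elt, 'v) module set set) =
    {iso_class A_alg (S_module \<gamma>) | \<gamma>. \<gamma> \<noteq> 0} \<union>
    {iso_class A_alg (T_module \<alpha> \<beta>) | \<alpha> \<beta>. \<alpha> \<noteq> 0 \<and> \<beta> \<noteq> 0}"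
proof (intro equalityI subsetI)
  fix c :: "('k elt, 'v) module set"
  assume "c \<in> fin_dim_simple_classes A_scalar A_alg"
  then obtain M :: "('k elt, 'v) module" where M: "c = iso_class A_alg M" "simple_module A_alg M" "finite_dim A_scalar M"
    by (auto simp: fin_dim_simple_classes_def)
  note lM = simple_moduleD(1)[OF M(2)]
  consider \<gamma> where "\<gamma> \<noteq> 0" "mod_isomorphic A_alg (S_module \<gamma>) M"
    | \<alpha> \<beta> where "\<alpha> \<noteq> 0" "\<beta> \<noteq> 0" "mod_isomorphic A_alg (T_module \<alpha> \<beta>) M"
    using simple_s_cases[OF M(2)] simple_infinite_iff_s_bij[OF M(2)] M(3) by blast
  then show "c \<in> {iso_class A_alg (S_module \<gamma>) | \<gamma>. \<gamma> \<noteq> 0} \<union>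
      {iso_class A_alg (T_module \<alpha> \<beta>) | \<alpha> \<beta>. \<alpha> \<noteq> 0 \<and> \<beta> \<noteq> 0}"
  proof cases
    case 1
    then have "c = iso_class A_alg (S_module \<gamma>)"
      using iso_class_eq[OF simple_moduleD(1)[OF finite_dim_S(1)] lM] M(1) by blast
    then show ?thesis using 1 by blast
  next
    case 2
    then have "c = iso_class A_alg (T_module \<alpha> \<beta>)"
      using iso_class_eq[OF simple_moduleD(1)[OF finite_dim_T(1)] lM] M(1) by blast
    then show ?thesis using 2 by blast
  qed
next
  have transport: "iso_class A_alg M \<in> (fin_dim_simple_classes A_scalar A_alg :: ('k elt, 'v) module set set)"
    if M: "simple_module A_alg M" "finite_dim A_scalar M" and j: "inj_on j (carrier M)"
    for M :: "('k elt, 'w) module" and j :: "'w \<Rightarrow> 'v"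
  proof -
    note lM = simple_moduleD(1)[OF M(1)]
    note t = transport_module[OF lM j]
    show ?thesis
      unfolding fin_dim_simple_classes_def iso_class_eq[OF lM t(1,2)]
      using simple_module_iso[OF M(1) t(1,2)] finite_dim_iso[OF lM t(1,2) M(2)] by blast
  qed
  fix c :: "('k elt, 'v) module set"
  assume "c \<in> {iso_class A_alg (S_module \<gamma>) | \<gamma>. \<gamma> \<noteq> 0} \<union>
      {iso_class A_alg (T_module \<alpha> \<beta>) | \<alpha> \<beta>. \<alpha> \<noteq> 0 \<and> \<beta> \<noteq> 0}"
  then consider \<gamma> :: 'k where "\<gamma> \<noteq> 0" "c = iso_class A_alg (S_module \<gamma>)"
    | \<alpha> \<beta> :: 'k where "\<alpha> \<noteq> 0" "\<beta> \<noteq> 0" "c = iso_class A_alg (T_module \<alpha> \<beta>)" by blast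
  then show "c \<in> fin_dim_simple_classes A_scalar A_alg"
  proof cases
    case 1
    interpret S: S_setup \<gamma> by unfold_locales (rule 1)
    \<comment> \<open>Every coset contains exactly one scalar (\<open>carrier_S\<close>,
      \<open>coset_scalar_eq\<close>), so a coset can be named by an element of the field and then
      sent along \<open>emb\<close>.\<close>
    define j where "j U = emb (SOME d. U = S.I +>\<^bsub>A_alg\<^esub> A_scalar d)" for U
    have "j (S.I +>\<^bsub>A_alg\<^esub> A_scalar d) = emb d" for d by (simp add: j_def S.coset_scalar_eq)
    then have "inj_on j (carrier (S_module \<gamma>))" using emb by (auto simp: inj_on_def S.carrier_S)
    then show ?thesis using transport[OF finite_dim_S[OF 1(1)]] 1(2) by simp
  next
    case 2
    have "infinite (UNIV :: 'v set)" using inj_infinite[OF emb] .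
    then obtain \<iota> :: "'v \<times> 'v \<Rightarrow> 'v" where \<iota>: "inj \<iota>" using exists_pairing by blast
    have "inj (map_prod emb emb)" by (rule prod.inj_map[OF emb emb])
    then have "inj (\<iota> \<circ> map_prod emb emb)" using \<iota> by (simp add: inj_compose)
    then have "inj_on (\<iota> \<circ> map_prod emb emb) (carrier (T_module \<alpha> \<beta>))" by (rule inj_on_subset) simp
    then show ?thesis using transport[OF finite_dim_T[OF 2(1,2)]] 2(3) by simp
  qed
qed

section \<open>The quotients \<open>A(\<mu>)\<close>\<close>

text \<open>The commutation of the operator \<open>C\<close> with the generators, read in the
  regular module at 1, gives the generators; products follow by induction.\<close>

lemma elt_C_central:
  assumes "a \<in> carrier A_alg" shows "elt_C \<otimes>\<^bsub>A_alg\<^esub> a = a \<otimes>\<^bsub>A_alg\<^esub> elt_C"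
proof -
  interpret A: ring "A_alg :: 'a elt ring" by (rule ring_A)
  interpret Rg: A_module "regular_module (A_alg :: 'a elt ring)"
    by (rule A_module.intro[OF left_module_regular[OF ring_A]])
  have [simp]: "a \<odot>\<^bsub>regular_module A_alg\<^esub> m = a \<otimes>\<^bsub>A_alg\<^esub> m"
    and [simp]: "carrier (regular_module A_alg) = carrier A_alg" for a m :: "'a elt"
    by (simp_all add: regular_module_def)
  note c = Rg.C_smult[symmetric, simplified]
  note ops = Rg.rep.CX[of "\<one>\<^bsub>A_alg\<^esub>"] Rg.rep.CY[of "\<one>\<^bsub>A_alg\<^esub>"] Rg.rep.CG[of "\<one>\<^bsub>A_alg\<^esub>"] Rg.rep.CGi[of "\<one>\<^bsub>A_alg\<^esub>"]
  show ?thesis using assms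
  proof (induct a rule: A_induct)
    case (scalar c) show ?case by (rule A_scalar_central[OF elt_C_closed, symmetric])
  next
    case (mult a b)
    have "elt_C \<otimes>\<^bsub>A_alg\<^esub> (a \<otimes>\<^bsub>A_alg\<^esub> b) = a \<otimes>\<^bsub>A_alg\<^esub> (elt_C \<otimes>\<^bsub>A_alg\<^esub> b)"
      using mult(1-3) by (simp flip: A.m_assoc)
    then show ?case using mult by (simp add: A.m_assoc)
  qed (use ops in \<open>simp_all add: c A.l_distr A.r_distr\<close>)
qed

lemma ideal_central_ideal:
  fixes \<mu> :: "'k::field" shows "ideal (central_ideal \<mu>) A_alg"
proof -
  interpret A: ring "A_alg :: 'k elt ring" by (rule ring_A)
  define d where "d = elt_C \<ominus>\<^bsub>A_alg\<^esub> (A_scalar \<mu> :: 'k elt)"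
  have d: "d \<in> carrier A_alg" by (simp add: d_def)
  have central: "d \<otimes>\<^bsub>A_alg\<^esub> a = a \<otimes>\<^bsub>A_alg\<^esub> d" if "a \<in> carrier A_alg" for a
    using that by (simp add: d_def A.minus_eq A.l_distr A.r_distr A.l_minus A.r_minus elt_C_central A_scalar_central)
  have I: "central_ideal \<mu> = {d \<otimes>\<^bsub>A_alg\<^esub> a | a. a \<in> carrier A_alg}" by (simp add: central_ideal_def d_def)
  show ?thesis
  proof (rule idealI[OF ring_A])
    show "subgroup (central_ideal \<mu>) (add_monoid A_alg)"
    proof (rule A.add.subgroupI)
      show "central_ideal \<mu> \<subseteq> carrier A_alg" using d by (auto simp: I)
      show "central_ideal \<mu> \<noteq> {}" using A.zero_closed by (auto simp: I)
      show "\<ominus>\<^bsub>A_alg\<^esub> a \<in> central_ideal \<mu>" if "a \<in> central_ideal \<mu>" for a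
        using that d by (auto simp: I A.r_minus[symmetric])
      show "a \<oplus>\<^bsub>A_alg\<^esub> b \<in> central_ideal \<mu>" if "a \<in> central_ideal \<mu>" "b \<in> central_ideal \<mu>" for a b
        using that d by (auto simp: I A.r_distr[symmetric])
    qed
  next
    fix a x :: "'k elt" assume a: "a \<in> central_ideal \<mu>" "x \<in> carrier A_alg"
    then obtain b where b: "a = d \<otimes>\<^bsub>A_alg\<^esub> b" "b \<in> carrier A_alg" by (auto simp: I)
    show "a \<otimes>\<^bsub>A_alg\<^esub> x \<in> central_ideal \<mu>" using a b d by (auto simp: I A.m_assoc)
    have "x \<otimes>\<^bsub>A_alg\<^esub> a = (x \<otimes>\<^bsub>A_alg\<^esub> d) \<otimes>\<^bsub>A_alg\<^esub> b" using a b d by (simp add: A.m_assoc)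
    also have "\<dots> = d \<otimes>\<^bsub>A_alg\<^esub> x \<otimes>\<^bsub>A_alg\<^esub> b" by (simp only: central[OF a(2)])
    finally have "x \<otimes>\<^bsub>A_alg\<^esub> a = d \<otimes>\<^bsub>A_alg\<^esub> (x \<otimes>\<^bsub>A_alg\<^esub> b)" using a b d by (simp add: A.m_assoc)
    then show "x \<otimes>\<^bsub>A_alg\<^esub> a \<in> central_ideal \<mu>" using a b d by (auto simp: I)
  qed
qed

lemma A_quot_proj_hom: "A_quot_proj \<mu> \<in> ring_hom A_alg (A_quot \<mu>)"
proof -
  have eq: "A_quot_proj \<mu> = (+>\<^bsub>A_alg\<^esub>) (central_ideal \<mu>)" by (simp add: fun_eq_iff A_quot_proj_def)
  show ?thesis unfolding A_quot_def eq by (rule ideal.rcos_ring_hom[OF ideal_central_ideal])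
qed

lemma carrier_A_quot: "carrier (A_quot \<mu>) = A_quot_proj \<mu> ` carrier A_alg"
  unfolding A_quot_def ideal.carrier_Quot[OF ideal_central_ideal] by (simp add: A_quot_proj_def)

section \<open>Modules over A(mu) as modules over A on which C is mu\<close>

abbreviation pull where "pull \<mu> \<equiv> restrict_scalars (A_quot_proj \<mu>)"

lemma pull_A_module:
  assumes "left_module (A_quot \<mu>) M"
  shows "A_module (pull \<mu> M)"
  by (rule A_module.intro[OF left_module.restrict_scalars_left_module[OF assms ring_A A_quot_proj_hom]])

lemma pull_C:
  assumes "left_module (A_quot \<mu>) M" "m \<in> carrier M"
  shows "elt_C \<odot>\<^bsub>pull \<mu> M\<^esub> m = A_scalar \<mu> \<odot>\<^bsub>pull \<mu> M\<^esub> m"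
proof -
  interpret M: left_module "A_quot \<mu>" M by fact
  interpret A: ring "A_alg :: 'a elt ring" by (rule ring_A)
  have "elt_C \<ominus>\<^bsub>A_alg\<^esub> A_scalar \<mu> \<in> central_ideal \<mu>"
    unfolding central_ideal_def by (auto intro!: exI[of _ "\<one>\<^bsub>A_alg\<^esub>"])
  then have "A_quot_proj \<mu> elt_C = A_quot_proj \<mu> (A_scalar \<mu>)"
    unfolding A_quot_proj_def using A.quotient_eq_iff_same_a_r_cos[OF ideal_central_ideal, of elt_C "A_scalar \<mu>" \<mu>] by simp
  then show ?thesis by simp
qed

lemma mod_hom_pull: "mod_hom (A_quot \<mu>) M N = mod_hom A_alg (pull \<mu> M) (pull \<mu> N)"
  by (auto simp: mod_hom_def carrier_A_quot)

lemma mod_isomorphic_pull: "mod_isomorphic (A_quot \<mu>) M N \<longleftrightarrow> mod_isomorphic A_alg (pull \<mu> M) (pull \<mu> N)"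
  by (simp add: mod_isomorphic_def mod_hom_pull)

lemma submodule_pull:
  assumes "left_module (A_quot \<mu>) M"
  shows "submodule H (A_quot \<mu>) M \<longleftrightarrow> submodule H A_alg (pull \<mu> M)"
proof
  interpret M: left_module "A_quot \<mu>" M by fact
  interpret P: A_module "pull \<mu> M" by (rule pull_A_module[OF assms])
  show "submodule H A_alg (pull \<mu> M)" if H: "submodule H (A_quot \<mu>) M"
    by (rule P.submoduleI) (use M.submoduleD[OF H] in \<open>auto simp: carrier_A_quot\<close>)
  show "submodule H (A_quot \<mu>) M" if H: "submodule H A_alg (pull \<mu> M)"
    by (rule M.submoduleI) (use P.submoduleD[OF H] in \<open>auto simp: carrier_A_quot\<close>)
qed

lemma simple_pull:
  assumes "left_module (A_quot \<mu>) M"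
  shows "simple_module A_alg (pull \<mu> M) \<longleftrightarrow> simple_module (A_quot \<mu>) M"
  using assms A_module.axioms[OF pull_A_module[OF assms]] by (simp add: simple_module_def submodule_pull)

lemma factor_central:
  assumes "A_module M" "\<And>m. m \<in> carrier M \<Longrightarrow> elt_C \<odot>\<^bsub>M\<^esub> m = A_scalar \<mu> \<odot>\<^bsub>M\<^esub> m"
  shows "left_module (A_quot \<mu>) (factor_module M)"
    "\<lbrakk>a \<in> carrier A_alg; m \<in> carrier M\<rbrakk> \<Longrightarrow> A_quot_proj \<mu> a \<odot>\<^bsub>factor_module M\<^esub> m = a \<odot>\<^bsub>M\<^esub> m"
proof -
  interpret A_module M by fact
  have z: "a \<odot>\<^bsub>M\<^esub> m = \<zero>\<^bsub>M\<^esub>" if am: "a \<in> central_ideal \<mu>" "m \<in> carrier M" for a m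
  proof -
    obtain b where b: "a = (elt_C \<ominus>\<^bsub>A_alg\<^esub> A_scalar \<mu>) \<otimes>\<^bsub>A_alg\<^esub> b" "b \<in> carrier A_alg"
      using am by (auto simp: central_ideal_def)
    then show ?thesis using am assms(2)[of "b \<odot>\<^bsub>M\<^esub> m"]
      by (simp add: smult_assoc R.minus_eq smult_l_distr smult_l_minus M.r_neg)
  qed
  show "left_module (A_quot \<mu>) (factor_module M)"
    unfolding A_quot_def by (rule factor_module_left_module[OF ideal_central_ideal left_module_axioms z])
  show "\<lbrakk>a \<in> carrier A_alg; m \<in> carrier M\<rbrakk> \<Longrightarrow> A_quot_proj \<mu> a \<odot>\<^bsub>factor_module M\<^esub> m = a \<odot>\<^bsub>M\<^esub> m"
    unfolding A_quot_proj_def by (rule factor_module_smult[OF ideal_central_ideal left_module_axioms z])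
qed

section \<open>The algebra \<open>\<A>\<close>\<close>

interpretation NE: normal_element A_alg elt_s "A_shift 1" "A_shift (- 1)"
  by (rule normal_element_s)

abbreviation cal_scalar :: "'k::field \<Rightarrow> (nat \<times> 'k elt) set" where "cal_scalar c \<equiv> fraction A_alg elt_s 0 (A_scalar c)"
abbreviation cal_p :: "(nat \<times> 'k::field elt) set" where "cal_p \<equiv> A_loc_y' \<otimes>\<^bsub>A_loc\<^esub> A_loc_y'"
abbreviation cal_s :: "(nat \<times> 'k::field elt) set" where "cal_s \<equiv> fraction A_alg elt_s 0 elt_s"
text \<open>This is \<open>s^-1\<close>, as \<open>cal_p\<close> above is the square of
  \<open>y'\<close>.\<close>

definition cal_t :: "(nat \<times> 'k::field elt) set" where "cal_t = fraction A_alg elt_s 1 \<one>\<^bsub>A_alg\<^esub>"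
abbreviation cal_gens :: "(nat \<times> 'k::field elt) set set" where "cal_gens \<equiv> range cal_scalar \<union> {cal_p, cal_s, cal_t}"

lemma ring_A_loc: "ring A_loc"
  unfolding A_loc_def by (rule NE.ring_L)

lemma fr_A_loc [simp]: "a \<in> carrier A_alg \<Longrightarrow> fraction A_alg elt_s m a \<in> carrier A_loc"
  unfolding A_loc_def by (rule NE.fr_closed)

lemma A_loc_y'_closed [simp]: "A_loc_y' \<in> carrier A_loc"
proof -
  interpret ring A_loc by (rule ring_A_loc)
  interpret A: ring A_alg by (rule ring_A)
  show ?thesis unfolding A_loc_y'_def by (intro m_closed) simp_all
qed

lemma cal_t_closed [simp]: "cal_t \<in> carrier A_loc"
proof -
  interpret A: ring A_alg by (rule ring_A)
  show ?thesis unfolding cal_t_def by (rule fr_A_loc) simp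
qed

lemma carrier_A_cal: "carrier A_cal = generate_ring A_loc cal_gens"
  by (simp add: A_cal_def cal_t_def)

lemma cal_gens_closed: "cal_gens \<subseteq> carrier A_loc"
proof -
  interpret ring A_loc by (rule ring_A_loc)
  interpret A: ring A_alg by (rule ring_A)
  show ?thesis by auto
qed

lemma subring_A_cal: "subring (carrier A_cal) A_loc"
  unfolding carrier_A_cal by (rule ring.generate_ring_is_subring[OF ring_A_loc cal_gens_closed])

lemma A_cal_simps: "\<one>\<^bsub>A_cal\<^esub> = \<one>\<^bsub>A_loc\<^esub>" "\<zero>\<^bsub>A_cal\<^esub> = \<zero>\<^bsub>A_loc\<^esub>" "add A_cal = add A_loc" "monoid.mult A_cal = monoid.mult A_loc"
  by (simp_all add: A_cal_def)

lemma A_cal_eq: "A_cal = A_loc\<lparr>carrier := carrier A_cal\<rparr>"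
  by (simp add: A_cal_def)

lemma cal_gens_in [simp]: "cal_scalar c \<in> carrier A_cal" "cal_p \<in> carrier A_cal" "cal_s \<in> carrier A_cal" "cal_t \<in> carrier A_cal"
  by (auto simp: carrier_A_cal intro!: generate_ring.incl)

lemma A_loc_relations:
  "cal_s \<otimes>\<^bsub>A_loc\<^esub> cal_t = \<one>\<^bsub>A_loc\<^esub>" "cal_t \<otimes>\<^bsub>A_loc\<^esub> cal_s = \<one>\<^bsub>A_loc\<^esub>"
  unfolding A_loc_def cal_t_def by (rule NE.fr_inverse)+

lemma fr0_A_loc: "fraction A_alg elt_s 0 \<in> ring_hom A_alg A_loc"
  unfolding A_loc_def by (rule NE.fr0_hom)

lemma cal_t_commute:
  assumes "u \<in> carrier A_loc" "cal_s \<otimes>\<^bsub>A_loc\<^esub> u = u \<otimes>\<^bsub>A_loc\<^esub> cal_s"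
  shows "cal_t \<otimes>\<^bsub>A_loc\<^esub> u = u \<otimes>\<^bsub>A_loc\<^esub> cal_t"
proof -
  interpret ring A_loc by (rule ring_A_loc)
  interpret A: ring A_alg by (rule ring_A)
  have "cal_t \<otimes>\<^bsub>A_loc\<^esub> u = cal_t \<otimes>\<^bsub>A_loc\<^esub> (u \<otimes>\<^bsub>A_loc\<^esub> cal_s) \<otimes>\<^bsub>A_loc\<^esub> cal_t"
    using assms(1) by (simp add: m_assoc A_loc_relations)
  also have "\<dots> = (cal_t \<otimes>\<^bsub>A_loc\<^esub> cal_s) \<otimes>\<^bsub>A_loc\<^esub> u \<otimes>\<^bsub>A_loc\<^esub> cal_t"
    using assms(1) by (simp add: m_assoc flip: assms(2))
  also have "\<dots> = u \<otimes>\<^bsub>A_loc\<^esub> cal_t" using assms(1) by (simp add: A_loc_relations)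
  finally show ?thesis .
qed

lemma cal_scalar_commute:
  "cal_s \<otimes>\<^bsub>A_loc\<^esub> cal_scalar c = cal_scalar c \<otimes>\<^bsub>A_loc\<^esub> cal_s"
  "cal_t \<otimes>\<^bsub>A_loc\<^esub> cal_scalar c = cal_scalar c \<otimes>\<^bsub>A_loc\<^esub> cal_t"
  "cal_p \<otimes>\<^bsub>A_loc\<^esub> cal_scalar c = cal_scalar c \<otimes>\<^bsub>A_loc\<^esub> cal_p"
proof -
  interpret ring "A_loc :: (nat \<times> 'a elt) set ring" by (rule ring_A_loc)
  interpret A: ring "A_alg :: 'a elt ring" by (rule ring_A)
  let ?c = "cal_scalar c"
  have 0: "fraction A_alg elt_s 0 a \<otimes>\<^bsub>A_loc\<^esub> ?c = ?c \<otimes>\<^bsub>A_loc\<^esub> fraction A_alg elt_s 0 a" if "a \<in> carrier A_alg" for a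
    using that A_scalar_central[OF that, of c] by (simp flip: ring_hom_mult[OF fr0_A_loc])
  show s: "cal_s \<otimes>\<^bsub>A_loc\<^esub> ?c = ?c \<otimes>\<^bsub>A_loc\<^esub> cal_s" by (rule 0) simp
  show t: "cal_t \<otimes>\<^bsub>A_loc\<^esub> ?c = ?c \<otimes>\<^bsub>A_loc\<^esub> cal_t" by (rule cal_t_commute) (simp_all add: s)
  have y: "A_loc_y' \<otimes>\<^bsub>A_loc\<^esub> ?c = ?c \<otimes>\<^bsub>A_loc\<^esub> A_loc_y'"
  proof -
    have "A_loc_y' \<otimes>\<^bsub>A_loc\<^esub> ?c = (fraction A_alg elt_s 0 elt_y \<otimes>\<^bsub>A_loc\<^esub> ?c) \<otimes>\<^bsub>A_loc\<^esub> cal_t"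
      unfolding A_loc_y'_def cal_t_def[symmetric] by (simp add: m_assoc t)
    then show ?thesis unfolding A_loc_y'_def cal_t_def[symmetric] by (simp add: m_assoc flip: 0) (simp add: 0 flip: m_assoc)
  qed
  have "cal_p \<otimes>\<^bsub>A_loc\<^esub> ?c = (A_loc_y' \<otimes>\<^bsub>A_loc\<^esub> ?c) \<otimes>\<^bsub>A_loc\<^esub> A_loc_y'"
    by (simp add: m_assoc flip: y)
  also have "\<dots> = (?c \<otimes>\<^bsub>A_loc\<^esub> A_loc_y') \<otimes>\<^bsub>A_loc\<^esub> A_loc_y'" by (simp only: y)
  finally show "cal_p \<otimes>\<^bsub>A_loc\<^esub> ?c = ?c \<otimes>\<^bsub>A_loc\<^esub> cal_p" by (simp add: m_assoc)
qed

text \<open>From \<open>y s = s y + x s\<close> one gets \<open>s^-1 y = y s^-1 + x s^-1\<close>.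
  Expanding \<open>p s\<close> and \<open>s p\<close>, where \<open>p = y s^-1 y s^-1\<close>,
  leaves the difference \<open>(x y + y x) s^-1 = s s^-1 = 1\<close>.\<close>

lemma weyl_relation: "cal_p \<otimes>\<^bsub>A_loc\<^esub> cal_s = cal_s \<otimes>\<^bsub>A_loc\<^esub> cal_p \<oplus>\<^bsub>A_loc\<^esub> (\<one>\<^bsub>A_loc\<^esub> :: (nat \<times> 'k::field elt) set)"
proof -
  interpret L: ring "A_loc :: (nat \<times> 'k elt) set ring" by (rule ring_A_loc)
  interpret A: ring "A_alg :: 'k elt ring" by (rule ring_A)
  let ?f = "fraction A_alg elt_s 0 :: 'k elt \<Rightarrow> _"
  define Y where "Y = ?f elt_y"
  define U where "U = ?f elt_x"
  define S where "S = ?f elt_s"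
  define T where "T = (cal_t :: (nat \<times> 'k elt) set)"
  note hom = ring_hom_mult[OF fr0_A_loc] ring_hom_add[OF fr0_A_loc]
  have cl [simp]: "Y \<in> carrier A_loc" "U \<in> carrier A_loc" "S \<in> carrier A_loc" "T \<in> carrier A_loc"
    by (simp_all add: Y_def U_def S_def T_def)
  have ST: "S \<otimes>\<^bsub>A_loc\<^esub> T = \<one>\<^bsub>A_loc\<^esub>" "T \<otimes>\<^bsub>A_loc\<^esub> S = \<one>\<^bsub>A_loc\<^esub>" using A_loc_relations by (simp_all add: S_def T_def)
  have ST': "S \<otimes>\<^bsub>A_loc\<^esub> (T \<otimes>\<^bsub>A_loc\<^esub> w) = w" "T \<otimes>\<^bsub>A_loc\<^esub> (S \<otimes>\<^bsub>A_loc\<^esub> w) = w" if "w \<in> carrier A_loc" for w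
    using that ST by (simp_all flip: L.m_assoc)
  have YS: "Y \<otimes>\<^bsub>A_loc\<^esub> S = S \<otimes>\<^bsub>A_loc\<^esub> Y \<oplus>\<^bsub>A_loc\<^esub> U \<otimes>\<^bsub>A_loc\<^esub> S"
    using A_relations(2)[THEN arg_cong[where f = ?f]] by (simp add: hom Y_def S_def U_def)
  have Sdef: "S = U \<otimes>\<^bsub>A_loc\<^esub> Y \<oplus>\<^bsub>A_loc\<^esub> Y \<otimes>\<^bsub>A_loc\<^esub> U"
    unfolding S_def U_def Y_def by (subst (2) elt_s_def) (simp add: hom)
  have "elt_x \<otimes>\<^bsub>A_alg\<^esub> elt_s = elt_s \<otimes>\<^bsub>A_alg\<^esub> (elt_x :: 'k elt)"
    using A_shift_commutation[of "elt_x :: 'k elt"] by (simp add: A_shift_gens)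
  then have "S \<otimes>\<^bsub>A_loc\<^esub> U = U \<otimes>\<^bsub>A_loc\<^esub> S"
    unfolding S_def U_def by (simp flip: hom)
  then have TU: "T \<otimes>\<^bsub>A_loc\<^esub> U = U \<otimes>\<^bsub>A_loc\<^esub> T"
    unfolding S_def T_def by (intro cal_t_commute) simp_all
  have TY: "T \<otimes>\<^bsub>A_loc\<^esub> Y = Y \<otimes>\<^bsub>A_loc\<^esub> T \<oplus>\<^bsub>A_loc\<^esub> U \<otimes>\<^bsub>A_loc\<^esub> T"
  proof -
    have "T \<otimes>\<^bsub>A_loc\<^esub> Y = T \<otimes>\<^bsub>A_loc\<^esub> (Y \<otimes>\<^bsub>A_loc\<^esub> S) \<otimes>\<^bsub>A_loc\<^esub> T" by (simp add: L.m_assoc ST)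
    also have "\<dots> = Y \<otimes>\<^bsub>A_loc\<^esub> T \<oplus>\<^bsub>A_loc\<^esub> T \<otimes>\<^bsub>A_loc\<^esub> U"
      unfolding YS by (simp add: L.r_distr L.l_distr L.m_assoc ST ST')
    finally show ?thesis by (simp only: TU)
  qed
  have p: "cal_p = Y \<otimes>\<^bsub>A_loc\<^esub> (T \<otimes>\<^bsub>A_loc\<^esub> (Y \<otimes>\<^bsub>A_loc\<^esub> T))"
    unfolding A_loc_y'_def cal_t_def[symmetric] Y_def[symmetric] T_def[symmetric] by (simp add: L.m_assoc)
  have pS: "cal_p \<otimes>\<^bsub>A_loc\<^esub> S = Y \<otimes>\<^bsub>A_loc\<^esub> (Y \<otimes>\<^bsub>A_loc\<^esub> T) \<oplus>\<^bsub>A_loc\<^esub> Y \<otimes>\<^bsub>A_loc\<^esub> (U \<otimes>\<^bsub>A_loc\<^esub> T)"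
    unfolding p by (simp add: L.m_assoc ST TY L.r_distr)
  have "Y \<otimes>\<^bsub>A_loc\<^esub> (Y \<otimes>\<^bsub>A_loc\<^esub> T) = (Y \<otimes>\<^bsub>A_loc\<^esub> S) \<otimes>\<^bsub>A_loc\<^esub> (T \<otimes>\<^bsub>A_loc\<^esub> (Y \<otimes>\<^bsub>A_loc\<^esub> T))"
    by (simp add: L.m_assoc ST')
  also have "\<dots> = S \<otimes>\<^bsub>A_loc\<^esub> cal_p \<oplus>\<^bsub>A_loc\<^esub> U \<otimes>\<^bsub>A_loc\<^esub> (Y \<otimes>\<^bsub>A_loc\<^esub> T)"
    unfolding YS p by (simp add: L.l_distr L.m_assoc ST')
  finally have Sp: "Y \<otimes>\<^bsub>A_loc\<^esub> (Y \<otimes>\<^bsub>A_loc\<^esub> T) = S \<otimes>\<^bsub>A_loc\<^esub> cal_p \<oplus>\<^bsub>A_loc\<^esub> U \<otimes>\<^bsub>A_loc\<^esub> (Y \<otimes>\<^bsub>A_loc\<^esub> T)" .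
  have one: "U \<otimes>\<^bsub>A_loc\<^esub> (Y \<otimes>\<^bsub>A_loc\<^esub> T) \<oplus>\<^bsub>A_loc\<^esub> Y \<otimes>\<^bsub>A_loc\<^esub> (U \<otimes>\<^bsub>A_loc\<^esub> T) = \<one>\<^bsub>A_loc\<^esub>"
    using ST(1) unfolding Sdef by (simp add: L.l_distr L.m_assoc)
  have "cal_p \<otimes>\<^bsub>A_loc\<^esub> S = S \<otimes>\<^bsub>A_loc\<^esub> cal_p \<oplus>\<^bsub>A_loc\<^esub> \<one>\<^bsub>A_loc\<^esub>"
    unfolding pS Sp one[symmetric] by (simp add: L.a_assoc)
  then show ?thesis by (simp add: S_def)
qed

section \<open>Modules over the localized Weyl algebra\<close>

locale cal_module = left_module "A_cal :: (nat \<times> 'k::field elt) set ring" V for V :: "((nat \<times> 'k::field elt) set, 'v) module"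
begin

abbreviation "sc c v \<equiv> cal_scalar c \<odot>\<^bsub>V\<^esub> v"
abbreviation "pp v \<equiv> cal_p \<odot>\<^bsub>V\<^esub> v"
abbreviation "ss v \<equiv> cal_s \<odot>\<^bsub>V\<^esub> v"
abbreviation "tt v \<equiv> cal_t \<odot>\<^bsub>V\<^esub> v"

lemma scalar_action_V: "scalar_action V sc"
proof
  note hom = ring_hom_add[OF fr0_A_loc] ring_hom_mult[OF fr0_A_loc] ring_hom_one[OF fr0_A_loc]
  show "sc (c + d) m = sc c m \<oplus>\<^bsub>V\<^esub> sc d m" "sc (c * d) m = sc c (sc d m)" "sc 1 m = m" if "m \<in> carrier V" for c d m
    using that smult_l_distr[of "cal_scalar c" "cal_scalar d" m] smult_assoc[of "cal_scalar c" "cal_scalar d" m] smult_one[of m]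
    by (simp_all add: A_scalar_hom hom A_cal_simps)
qed (simp_all add: smult_r_distr)

sublocale V: scalar_action V sc by (rule scalar_action_V)

lemma st [simp]: "v \<in> carrier V \<Longrightarrow> ss (tt v) = v" "v \<in> carrier V \<Longrightarrow> tt (ss v) = v"
  using smult_assoc[of cal_s cal_t v] smult_assoc[of cal_t cal_s v] smult_one[of v]
  by (simp_all add: A_cal_simps A_loc_relations)

lemma weyl: "v \<in> carrier V \<Longrightarrow> pp (ss v) = ss (pp v) \<oplus>\<^bsub>V\<^esub> v"
proof -
  assume v: "v \<in> carrier V"
  have "pp (ss v) = (cal_p \<otimes>\<^bsub>A_cal\<^esub> cal_s) \<odot>\<^bsub>V\<^esub> v" using v by (simp add: smult_assoc)
  also have "cal_p \<otimes>\<^bsub>A_cal\<^esub> cal_s = cal_s \<otimes>\<^bsub>A_cal\<^esub> cal_p \<oplus>\<^bsub>A_cal\<^esub> (\<one>\<^bsub>A_cal\<^esub> :: (nat \<times> 'k elt) set)"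
    unfolding A_cal_simps by (rule weyl_relation)
  also have "\<dots> \<odot>\<^bsub>V\<^esub> v = ss (pp v) \<oplus>\<^bsub>V\<^esub> v" using v by (simp add: smult_l_distr smult_assoc smult_one)
  finally show ?thesis .
qed

lemma sc_commute: "v \<in> carrier V \<Longrightarrow> ss (sc c v) = sc c (ss v)" "v \<in> carrier V \<Longrightarrow> tt (sc c v) = sc c (tt v)"
  "v \<in> carrier V \<Longrightarrow> pp (sc c v) = sc c (pp v)"
  by (simp_all add: A_cal_simps cal_scalar_commute flip: smult_assoc)

end

text \<open>The localized generator \<open>p = y'\<^sup>2\<close> enters only through \<open>p s\<^sup>2\<close>, which acts as \<open>y\<^sup>2\<close> on the kernel of \<open>x\<close>.\<close>

lemma cal_hom_eq:
  fixes V :: "((nat \<times> 'k::field elt) set, 'v) module" and W :: "((nat \<times> 'k elt) set, 'w) module"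
  assumes "cal_module V" "cal_module W" "a \<in> carrier A_cal" "\<And>v. v \<in> carrier V \<Longrightarrow> f v \<in> carrier W"
    and add: "\<And>v w. \<lbrakk>v \<in> carrier V; w \<in> carrier V\<rbrakk> \<Longrightarrow> f (v \<oplus>\<^bsub>V\<^esub> w) = f v \<oplus>\<^bsub>W\<^esub> f w"
    and sc: "\<And>c v. v \<in> carrier V \<Longrightarrow> f (cal_scalar c \<odot>\<^bsub>V\<^esub> v) = cal_scalar c \<odot>\<^bsub>W\<^esub> f v"
    and s: "\<And>v. v \<in> carrier V \<Longrightarrow> f (cal_s \<odot>\<^bsub>V\<^esub> v) = cal_s \<odot>\<^bsub>W\<^esub> f v"
    and pss: "\<And>v. v \<in> carrier V \<Longrightarrow> f (cal_p \<odot>\<^bsub>V\<^esub> (cal_s \<odot>\<^bsub>V\<^esub> (cal_s \<odot>\<^bsub>V\<^esub> v))) = cal_p \<odot>\<^bsub>W\<^esub> (cal_s \<odot>\<^bsub>W\<^esub> (cal_s \<odot>\<^bsub>W\<^esub> f v))"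
    and v: "v \<in> carrier V"
  shows "f (a \<odot>\<^bsub>V\<^esub> v) = a \<odot>\<^bsub>W\<^esub> f v"
proof -
  interpret V: cal_module V by fact
  interpret W: cal_module W by fact
  have t: "f (V.tt v) = W.tt (f v)" if "v \<in> carrier V" for v
    using that s[of "V.tt v"] assms(4) W.st(2)[of "f (V.tt v)"] by simp
  \<comment> \<open>Compatibility with \<open>p\<close> itself is recovered by evaluating the one
    with \<open>p s^2\<close> at \<open>s^-2 v\<close>.\<close>
  have p: "f (V.pp v) = W.pp (f v)" if "v \<in> carrier V" for v
    using pss[of "V.tt (V.tt v)"] that t assms(4) by simp
  have "a \<in> generate_ring A_loc cal_gens" using assms(3) by (simp add: carrier_A_cal)
  then have "\<forall>v\<in>carrier V. f (a \<odot>\<^bsub>V\<^esub> v) = a \<odot>\<^bsub>W\<^esub> f v"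
  proof (induct a rule: generate_ring.induct)
    case one
    then show ?case using V.smult_one W.smult_one assms(4) by (simp add: A_cal_simps)
  next
    case (incl h)
    then show ?case using sc s t p by auto
  next
    case (a_inv h)
    have h: "h \<in> carrier A_cal" using a_inv(1) by (simp add: carrier_A_cal)
    \<comment> \<open>\<open>generate_ring\<close> takes negatives in \<open>A_loc\<close>, whereas
      the module axioms take them in the subring.\<close>
    have i: "\<ominus>\<^bsub>A_loc\<^esub> h = \<ominus>\<^bsub>A_cal\<^esub> h"
    proof -
      interpret L: ring "A_loc :: (nat \<times> 'k elt) set ring" by (rule ring_A_loc)
      have "\<ominus>\<^bsub>A_loc\<^esub> h \<in> carrier A_cal" using generate_ring.a_inv[OF a_inv(1)] by (simp add: carrier_A_cal)
      moreover have "\<ominus>\<^bsub>A_loc\<^esub> h \<oplus>\<^bsub>A_cal\<^esub> h = \<zero>\<^bsub>A_cal\<^esub>"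
        using h subringE(1)[OF subring_A_cal] by (auto simp: A_cal_simps L.l_neg subset_iff)
      ultimately show ?thesis using h V.R.minus_equality[of "\<ominus>\<^bsub>A_loc\<^esub> h" h] by simp
    qed
    have fm: "f (\<ominus>\<^bsub>V\<^esub> v) = \<ominus>\<^bsub>W\<^esub> f v" if "v \<in> carrier V" for v
      using sc[of v "-1"] that assms(4) by (simp add: V.V.act_minus_left W.V.act_minus_left)
    show ?case using a_inv(2) h assms(4) by (simp add: i V.smult_l_minus W.smult_l_minus fm)
  next
    case (eng_add h1 h2)
    have h: "h1 \<in> carrier A_cal" "h2 \<in> carrier A_cal" using eng_add(1,3) by (simp_all add: carrier_A_cal)
    show ?case using eng_add(2,4) h add assms(4) V.smult_l_distr[OF h] W.smult_l_distr[OF h] by (simp add: A_cal_simps)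
  next
    case (eng_mult h1 h2)
    have h: "h1 \<in> carrier A_cal" "h2 \<in> carrier A_cal" using eng_mult(1,3) by (simp_all add: carrier_A_cal)
    show ?case using eng_mult(2,4) h assms(4) V.smult_assoc[OF h] W.smult_assoc[OF h] by (simp add: A_cal_simps)
  qed
  then show ?thesis using v by blast
qed

section \<open>The kernel of \<open>x\<close> as an \<open>\<A>\<close>-module\<close>

definition K_module :: "('k::field elt, 'v) module \<Rightarrow> ((nat \<times> 'k elt) set, 'v) module" where
  "K_module N = (loc_module A_alg elt_s N)\<lparr>carrier := {m \<in> carrier N. elt_x \<odot>\<^bsub>N\<^esub> m = \<zero>\<^bsub>N\<^esub>}\<rparr>"

locale s_bij_module = A_module N for N :: "('k::{alg_closed_field, field_char_0} elt, 'v) module" +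
  assumes s_bij: "bij_betw (\<lambda>m. elt_s \<odot>\<^bsub>N\<^esub> m) (carrier N) (carrier N)"
begin

sublocale B: bijective_rep N sm "\<lambda>m. elt_x \<odot>\<^bsub>N\<^esub> m" "\<lambda>m. elt_y \<odot>\<^bsub>N\<^esub> m" "\<lambda>m. elt_g \<odot>\<^bsub>N\<^esub> m" "\<lambda>m. elt_ginv \<odot>\<^bsub>N\<^esub> m"
proof
  show "bij_betw rep.S (carrier N) (carrier N)"
    using s_bij by (rule bij_betw_cong[THEN iffD1, rotated]) (simp add: s_smult)
qed

sublocale LO: localizable_module A_alg elt_s "A_shift 1" "A_shift (- 1)" N
  by (intro localizable_module.intro localizable_module_axioms.intro normal_element_s left_module_axioms s_bij)

abbreviation "LN \<equiv> loc_module A_alg elt_s N"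

lemma left_module_LN: "left_module A_loc LN"
  unfolding A_loc_def by (rule LO.left_module_LM)

text \<open>Since \<open>p = y s^-1 y s^-1\<close>, it acts as the Euler operator composed with
  \<open>s^-1\<close>.\<close>

lemma LN_smult:
  assumes "v \<in> carrier N"
  shows "cal_scalar c \<odot>\<^bsub>LN\<^esub> v = sm c v" "cal_s \<odot>\<^bsub>LN\<^esub> v = rep.S v" "cal_t \<odot>\<^bsub>LN\<^esub> v = B.si v"
    "cal_p \<odot>\<^bsub>LN\<^esub> v = B.E (B.si v)"
proof -
  interpret LM: left_module A_loc LN by (rule left_module_LN)
  show "cal_scalar c \<odot>\<^bsub>LN\<^esub> v = sm c v" "cal_s \<odot>\<^bsub>LN\<^esub> v = rep.S v"
    using assms by (simp_all add: LO.LM_fr0 s_smult)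
  have t: "cal_t \<odot>\<^bsub>LN\<^esub> w = B.si w" if "w \<in> carrier N" for w
    unfolding cal_t_def by (rule LO.LM_smult_eqI) (use that in \<open>simp_all add: s_smult smult_one\<close>)
  show "cal_t \<odot>\<^bsub>LN\<^esub> v = B.si v" by (rule t[OF assms])
  have y: "A_loc_y' \<odot>\<^bsub>LN\<^esub> w = elt_y \<odot>\<^bsub>N\<^esub> B.si w" if "w \<in> carrier N" for w
  proof -
    have "A_loc_y' \<odot>\<^bsub>LN\<^esub> w = fraction A_alg elt_s 0 elt_y \<odot>\<^bsub>LN\<^esub> (cal_t \<odot>\<^bsub>LN\<^esub> w)"
      unfolding A_loc_y'_def cal_t_def[symmetric] using that by (intro LM.smult_assoc) simp_all
    then show ?thesis using that by (simp add: t LO.LM_fr0)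
  qed
  have "cal_p \<odot>\<^bsub>LN\<^esub> v = A_loc_y' \<odot>\<^bsub>LN\<^esub> (A_loc_y' \<odot>\<^bsub>LN\<^esub> v)"
    using assms by (intro LM.smult_assoc) simp_all
  then show "cal_p \<odot>\<^bsub>LN\<^esub> v = B.E (B.si v)" using assms by (simp add: y B.E_def)
qed

lemma K_module_simps [simp]:
  "carrier (K_module N) = B.K" "\<zero>\<^bsub>K_module N\<^esub> = \<zero>\<^bsub>N\<^esub>" "add (K_module N) = add N"
  "a \<odot>\<^bsub>K_module N\<^esub> v = a \<odot>\<^bsub>LN\<^esub> v"
  by (simp_all add: K_module_def B.K_def)

text \<open>In general \<open>y\<close> leads out of the kernel of \<open>x\<close>, but
  \<open>E = y s^-1 y\<close> returns to it (\<open>K_E\<close>). So the kernel is stable under the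
  generators of \<open>A_cal\<close>, and only over this subring of \<open>A_loc\<close> is it a
  module.\<close>

lemma cal_module_K: "cal_module (K_module N)"
proof -
  interpret LM: left_module A_loc LN by (rule left_module_LN)
  have cal: "left_module A_cal LN"
    using LM.subring_left_module[OF subring_A_cal] by (subst A_cal_eq)
  interpret LC: left_module A_cal LN by (rule cal)
  have closed: "\<forall>v\<in>B.K. a \<odot>\<^bsub>LN\<^esub> v \<in> B.K" if "a \<in> carrier A_cal" for a
  proof -
    have "a \<in> generate_ring A_loc cal_gens" using that by (simp add: carrier_A_cal)
    then show ?thesis
    proof (induct a rule: generate_ring.induct)
      case one
      then show ?case using LM.smult_one B.K_carrier by simp
    next
      case (incl h)
      then show ?case using LN_smult B.K_carrier by (auto simp: B.K_closed B.K_E)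
    next
      case (a_inv h)
      then have h: "h \<in> carrier A_loc" using ring.generate_ring_in_carrier[OF ring_A_loc cal_gens_closed] by blast
      have "\<ominus>\<^bsub>LN\<^esub> w = \<ominus>\<^bsub>N\<^esub> w" if "w \<in> carrier N" for w
        by (rule LM.M.minus_equality) (use that in \<open>simp_all add: M.l_neg\<close>)
      then show ?case using a_inv(2) h B.K_carrier by (simp add: LM.smult_l_minus B.K_closed)
    next
      case (eng_add h1 h2)
      then have "h1 \<in> carrier A_loc" "h2 \<in> carrier A_loc" using ring.generate_ring_in_carrier[OF ring_A_loc cal_gens_closed] by blast+
      then show ?case using eng_add(2,4) B.K_carrier by (simp add: LM.smult_l_distr B.K_closed)
    next
      case (eng_mult h1 h2)
      then have "h1 \<in> carrier A_loc" "h2 \<in> carrier A_loc" using ring.generate_ring_in_carrier[OF ring_A_loc cal_gens_closed] by blast+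
      then show ?case using eng_mult(2,4) B.K_carrier by (simp add: LM.smult_assoc)
    qed
  qed
  have "submodule B.K A_cal LN"
    by (rule LC.submoduleI) (use closed B.K_carrier in \<open>auto simp: B.K_closed\<close>)
  then have "left_module A_cal (LN\<lparr>carrier := B.K\<rparr>)" by (rule LC.submodule_left_module)
  then show ?thesis by (simp add: cal_module_def K_module_def B.K_def)
qed

lemma K_smult:
  assumes "v \<in> B.K"
  shows "cal_scalar c \<odot>\<^bsub>K_module N\<^esub> v = sm c v" "cal_s \<odot>\<^bsub>K_module N\<^esub> v = elt_s \<odot>\<^bsub>N\<^esub> v"
    "cal_t \<odot>\<^bsub>K_module N\<^esub> v = B.si v" "cal_p \<odot>\<^bsub>K_module N\<^esub> v = B.E (B.si v)"
    "cal_p \<odot>\<^bsub>K_module N\<^esub> (cal_s \<odot>\<^bsub>K_module N\<^esub> (cal_s \<odot>\<^bsub>K_module N\<^esub> v)) = elt_y \<odot>\<^bsub>N\<^esub> (elt_y \<odot>\<^bsub>N\<^esub> v)"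
  using B.K_carrier[OF assms] B.yyK[OF assms] by (simp_all add: LN_smult s_smult)

end

text \<open>As \<open>f\<close> commutes with \<open>x\<close>, it maps kernel to kernel. It is
  known to respect only the action of \<open>A_alg\<close>, and this suffices because
  \<open>p s^2\<close> acts on the kernel as \<open>y^2\<close>.\<close>

lemma K_module_hom:
  assumes "s_bij_module N" "s_bij_module N'" "f \<in> mod_hom A_alg N N'"
  shows "restrict f (carrier (K_module N)) \<in> mod_hom A_cal (K_module N) (K_module N')"
proof -
  interpret N: s_bij_module N by fact
  interpret N': s_bij_module N' by fact
  interpret KN: cal_module "K_module N" by (rule N.cal_module_K)
  note f = mod_homD[OF assms(3)]
  have fK: "f v \<in> N'.B.K" if "v \<in> N.B.K" for v
    using that f(1)[of v] f(3)[of elt_x v] mod_hom_zero[OF N.left_module_axioms N'.left_module_axioms assms(3)]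
    by (simp add: N.B.K_def N'.B.K_def)
  show ?thesis
  proof (rule restrict_mod_hom[OF KN.left_module_axioms])
    show "f (a \<odot>\<^bsub>K_module N\<^esub> m) = a \<odot>\<^bsub>K_module N'\<^esub> f m" if "a \<in> carrier A_cal" "m \<in> carrier (K_module N)" for a m
    proof (rule cal_hom_eq[OF N.cal_module_K N'.cal_module_K that(1)])
      fix v assume "v \<in> carrier (K_module N)"
      then have v: "v \<in> N.B.K" "v \<in> carrier N" "f v \<in> N'.B.K" using N.B.K_carrier fK by simp_all
      show "f (cal_scalar c \<odot>\<^bsub>K_module N\<^esub> v) = cal_scalar c \<odot>\<^bsub>K_module N'\<^esub> f v" for c
        unfolding N.K_smult(1)[OF v(1)] N'.K_smult(1)[OF v(3)] by (rule f(3)) (use v in simp_all)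
      show "f (cal_s \<odot>\<^bsub>K_module N\<^esub> v) = cal_s \<odot>\<^bsub>K_module N'\<^esub> f v"
        unfolding N.K_smult(2)[OF v(1)] N'.K_smult(2)[OF v(3)] by (rule f(3)) (use v in simp_all)
      show "f (cal_p \<odot>\<^bsub>K_module N\<^esub> (cal_s \<odot>\<^bsub>K_module N\<^esub> (cal_s \<odot>\<^bsub>K_module N\<^esub> v))) =
          cal_p \<odot>\<^bsub>K_module N'\<^esub> (cal_s \<odot>\<^bsub>K_module N'\<^esub> (cal_s \<odot>\<^bsub>K_module N'\<^esub> f v))"
        unfolding N.K_smult(5)[OF v(1)] N'.K_smult(5)[OF v(3)] using v f(3) by simp
    qed (use that N.B.K_carrier fK f in auto)
  qed (use f fK N.B.K_carrier in auto)
qed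

section \<open>Two copies of an \<open>\<A>\<close>-module as an \<open>A\<close>-module\<close>

locale cal_pair = cal_module V for V :: "((nat \<times> 'k::{alg_closed_field, field_char_0} elt) set, 'v) module" +
  fixes \<mu> :: 'k
  assumes \<mu>: "\<mu> \<noteq> 0"
begin

definition VV :: "('v \<times> 'v) ring" where
  "VV = \<lparr>carrier = carrier V \<times> carrier V, monoid.mult = undefined, one = undefined, zero = (\<zero>\<^bsub>V\<^esub>, \<zero>\<^bsub>V\<^esub>),
     add = (\<lambda>u v. (fst u \<oplus>\<^bsub>V\<^esub> fst v, snd u \<oplus>\<^bsub>V\<^esub> snd v))\<rparr>"

text \<open>The pair \<open>(a, b)\<close> stands for \<open>a + y s^-1 b\<close> with
  \<open>a\<close> and \<open>b\<close> in the kernel of \<open>x\<close>. The formulas are what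
  \<open>x\<close>, \<open>y\<close>, \<open>g\<close> and \<open>g^-1\<close> do to such a sum:
  \<open>x y = s\<close> and \<open>y s^-1 y = p s\<close> on the kernel, while \<open>g\<close>
  acts there as \<open>- \<mu>^-1 s\<close>. On the second summand the sign of \<open>g\<close> is
  reversed, since \<open>g y = x g - y g\<close> and \<open>x g\<close> vanishes on the
  kernel.\<close>

fun px where "px (a, b) = (b, \<zero>\<^bsub>V\<^esub>)"
fun py where "py (a, b) = (pp (ss b), ss a)"
fun pg where "pg (a, b) = (sc (- inverse \<mu>) (ss a), sc (inverse \<mu>) (ss b))"
fun pgi where "pgi (a, b) = (sc (- \<mu>) (tt a), sc \<mu> (tt b))"
fun psm where "psm c (a, b) = (sc c a, sc c b)"

lemma VV_simps [simp]: "carrier VV = carrier V \<times> carrier V" "\<zero>\<^bsub>VV\<^esub> = (\<zero>\<^bsub>V\<^esub>, \<zero>\<^bsub>V\<^esub>)"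
  "(a, b) \<oplus>\<^bsub>VV\<^esub> (c, d) = (a \<oplus>\<^bsub>V\<^esub> c, b \<oplus>\<^bsub>V\<^esub> d)"
  by (simp_all add: VV_def)

lemma abelian_group_VV: "abelian_group VV"
proof (rule abelian_groupI)
  show "\<exists>v\<in>carrier VV. v \<oplus>\<^bsub>VV\<^esub> u = \<zero>\<^bsub>VV\<^esub>" if "u \<in> carrier VV" for u
    using that by (intro bexI[of _ "(\<ominus>\<^bsub>V\<^esub> fst u, \<ominus>\<^bsub>V\<^esub> snd u)"]) (auto simp: M.l_neg)
qed (auto simp: M.a_ac)

sublocale W: abelian_group VV by (rule abelian_group_VV)

lemma VV_minus [simp]: "\<lbrakk>a \<in> carrier V; b \<in> carrier V\<rbrakk> \<Longrightarrow> \<ominus>\<^bsub>VV\<^esub> (a, b) = (\<ominus>\<^bsub>V\<^esub> a, \<ominus>\<^bsub>V\<^esub> b)"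
  by (rule W.minus_equality) (simp_all add: M.l_neg)

text \<open>The Weyl relation enters in \<open>YYX\<close> and in \<open>GY\<close>, both times as
  \<open>p s (s b) = s p (s b) + s b\<close>.\<close>

lemma pair_rep: "sjp_rep VV psm px py pg pgi"
proof -
  have z: "\<ominus>\<^bsub>V\<^esub> \<zero>\<^bsub>V\<^esub> = \<zero>\<^bsub>V\<^esub>" by (rule M.minus_equality) simp_all
  show ?thesis
    by unfold_locales
      (use \<mu> in \<open>auto simp: additive_op_def V.act_add_left V.act_add_right V.act_mult smult_r_distr sc_commute
      V.act_minus_left V.act_minus_right weyl M.minus_eq W.minus_eq M.minus_add M.a_ac smult_r_minus
      M.l_neg M.r_neg M.r_neg1 M.r_neg2 z mult.commute simp flip: V.act_mult\<close>)
qed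

sublocale PR: sjp_rep VV psm px py pg pgi by (rule pair_rep)

abbreviation "Q \<equiv> PR.rep_module"

lemma left_module_Q: "left_module A_alg Q" by (rule PR.left_module_rep)

lemma Q_simps [simp]: "carrier Q = carrier V \<times> carrier V" "\<zero>\<^bsub>Q\<^esub> = (\<zero>\<^bsub>V\<^esub>, \<zero>\<^bsub>V\<^esub>)"
  "(a, b) \<oplus>\<^bsub>Q\<^esub> (c, d) = (a \<oplus>\<^bsub>V\<^esub> c, b \<oplus>\<^bsub>V\<^esub> d)"
  by simp_all

lemma Q_smult:
  assumes "a \<in> carrier V" "b \<in> carrier V"
  shows "A_scalar c \<odot>\<^bsub>Q\<^esub> (a, b) = (sc c a, sc c b)" "elt_x \<odot>\<^bsub>Q\<^esub> (a, b) = (b, \<zero>\<^bsub>V\<^esub>)"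
    "elt_y \<odot>\<^bsub>Q\<^esub> (a, b) = (pp (ss b), ss a)" "elt_g \<odot>\<^bsub>Q\<^esub> (a, b) = (sc (- inverse \<mu>) (ss a), sc (inverse \<mu>) (ss b))"
    "elt_ginv \<odot>\<^bsub>Q\<^esub> (a, b) = (sc (- \<mu>) (tt a), sc \<mu> (tt b))"
  using assms by (simp_all add: PR.rep_gens)

lemma Q_C: "m \<in> carrier Q \<Longrightarrow> elt_C \<odot>\<^bsub>Q\<^esub> m = A_scalar \<mu> \<odot>\<^bsub>Q\<^esub> m"
proof -
  assume m: "m \<in> carrier Q"
  interpret QA: A_module Q by (rule A_module.intro[OF left_module_Q])
  obtain a b where ab: "m = (a, b)" "a \<in> carrier V" "b \<in> carrier V" using m by auto
  have neg: "\<ominus>\<^bsub>Q\<^esub> (c, d) = (\<ominus>\<^bsub>V\<^esub> c, \<ominus>\<^bsub>V\<^esub> d)" if "c \<in> carrier V" "d \<in> carrier V" for c d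
    by (rule QA.M.minus_equality) (use that in \<open>simp_all add: M.l_neg\<close>)
  have "elt_C \<odot>\<^bsub>Q\<^esub> m = QA.rep.C m" by (rule QA.C_smult[OF m])
  also have "\<dots> = (sc \<mu> a, sc \<mu> b)"
    unfolding QA.rep.C_def ab(1) using ab(2,3)
    by (simp add: Q_smult QA.M.minus_eq neg sc_commute V.act_minus_left smult_r_minus)
  finally show ?thesis using ab by (simp add: Q_smult)
qed

lemma Q_s: "\<lbrakk>a \<in> carrier V; b \<in> carrier V\<rbrakk> \<Longrightarrow> elt_s \<odot>\<^bsub>Q\<^esub> (a, b) = (ss a, ss b)"
proof -
  assume ab: "a \<in> carrier V" "b \<in> carrier V"
  interpret QA: A_module Q by (rule A_module.intro[OF left_module_Q])
  have "elt_s \<odot>\<^bsub>Q\<^esub> (a, b) = elt_x \<odot>\<^bsub>Q\<^esub> (elt_y \<odot>\<^bsub>Q\<^esub> (a, b)) \<oplus>\<^bsub>Q\<^esub> elt_y \<odot>\<^bsub>Q\<^esub> (elt_x \<odot>\<^bsub>Q\<^esub> (a, b))"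
    using QA.s_smult[of "(a, b)"] ab by (simp add: QA.rep.S_def)
  also have "\<dots> = (ss a, ss b)" using ab by (simp only: Q_smult smult_closed cal_gens_in M.zero_closed Q_simps) simp
  finally show ?thesis .
qed

end

definition pair_module :: "'k::{alg_closed_field, field_char_0} \<Rightarrow> ((nat \<times> 'k elt) set, 'v) module \<Rightarrow> ('k elt, 'v \<times> 'v) module" where
  "pair_module \<mu> V = sjp_rep.rep_module (cal_pair.VV V) (cal_pair.psm V) (cal_pair.px V) (cal_pair.py V)
     (cal_pair.pg V \<mu>) (cal_pair.pgi V \<mu>)"

definition induced_module ::
  "('v \<times> 'v \<Rightarrow> 'v) \<Rightarrow> 'k::{alg_closed_field, field_char_0} \<Rightarrow> ((nat \<times> 'k elt) set, 'v) module \<Rightarrow> ('k elt set, 'v) module" where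
  "induced_module \<iota> \<mu> V = transport_module \<iota> (factor_module (pair_module \<mu> V))"

locale induced = cal_pair V \<mu> for V :: "((nat \<times> 'k::{alg_closed_field, field_char_0} elt) set, 'v) module" and \<mu> +
  fixes \<iota> :: "'v \<times> 'v \<Rightarrow> 'v"
  assumes \<iota>: "inj \<iota>"
begin

lemma pair_module_Q: "pair_module \<mu> V = Q" by (simp add: pair_module_def)

abbreviation "Ind \<equiv> induced_module \<iota> \<mu> V"

lemma left_module_Ind: "left_module (A_quot \<mu>) Ind"
  and Ind_carrier: "carrier Ind = \<iota> ` (carrier V \<times> carrier V)"
  and Ind_zero: "\<zero>\<^bsub>Ind\<^esub> = \<iota> (\<zero>\<^bsub>V\<^esub>, \<zero>\<^bsub>V\<^esub>)"
  and Ind_add: "\<lbrakk>m \<in> carrier V \<times> carrier V; n \<in> carrier V \<times> carrier V\<rbrakk> \<Longrightarrow> \<iota> m \<oplus>\<^bsub>Ind\<^esub> \<iota> n = \<iota> (m \<oplus>\<^bsub>Q\<^esub> n)"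
  and Ind_smult: "\<lbrakk>m \<in> carrier V \<times> carrier V; a \<in> carrier A_alg\<rbrakk> \<Longrightarrow> a \<odot>\<^bsub>pull \<mu> Ind\<^esub> \<iota> m = \<iota> (a \<odot>\<^bsub>Q\<^esub> m)"
proof -
  note fc = factor_central[OF A_module.intro[OF left_module_Q] Q_C]
  have i: "inj_on \<iota> (carrier (factor_module Q))" using \<iota> by (rule inj_on_subset) simp
  note t = transport_module[OF fc(1) i]
  have eq: "Ind = transport_module \<iota> (factor_module Q)" by (simp add: induced_module_def pair_module_Q)
  show "left_module (A_quot \<mu>) Ind" unfolding eq by (rule t(1))
  show "carrier Ind = \<iota> ` (carrier V \<times> carrier V)" using t(3) unfolding eq by (simp add: bij_betw_def)
  show "\<zero>\<^bsub>Ind\<^esub> = \<iota> (\<zero>\<^bsub>V\<^esub>, \<zero>\<^bsub>V\<^esub>)" unfolding eq transport_module_def by (simp add: Let_def)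
  show "\<lbrakk>m \<in> carrier V \<times> carrier V; n \<in> carrier V \<times> carrier V\<rbrakk> \<Longrightarrow> \<iota> m \<oplus>\<^bsub>Ind\<^esub> \<iota> n = \<iota> (m \<oplus>\<^bsub>Q\<^esub> n)"
    unfolding eq using t(4)[of m n] by simp
  show "\<lbrakk>m \<in> carrier V \<times> carrier V; a \<in> carrier A_alg\<rbrakk> \<Longrightarrow> a \<odot>\<^bsub>pull \<mu> Ind\<^esub> \<iota> m = \<iota> (a \<odot>\<^bsub>Q\<^esub> m)"
    unfolding eq using t(5)[of m] fc(2)[of a m] by simp
qed

lemma inv_\<iota> [simp]: "inv_into UNIV \<iota> (\<iota> u) = u" using \<iota> by simp

lemma s_bij_Ind: "s_bij_module (pull \<mu> Ind)"
  by (intro s_bij_module.intro s_bij_module_axioms.intro pull_A_module left_module_Ind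
      C_scalar_imp_s_bij[OF pull_A_module[OF left_module_Ind] \<mu>] pull_C) simp_all

lemma K_Ind: "carrier (K_module (pull \<mu> Ind)) = (\<lambda>v. \<iota> (v, \<zero>\<^bsub>V\<^esub>)) ` carrier V"
proof -
  have "{m \<in> carrier Ind. elt_x \<odot>\<^bsub>pull \<mu> Ind\<^esub> m = \<zero>\<^bsub>pull \<mu> Ind\<^esub>} = (\<lambda>v. \<iota> (v, \<zero>\<^bsub>V\<^esub>)) ` carrier V" (is "?L = ?R")
  proof (intro equalityI subsetI)
    fix u assume u: "u \<in> ?L"
    then obtain a b where ab: "u = \<iota> (a, b)" "a \<in> carrier V" "b \<in> carrier V" by (auto simp: Ind_carrier)
    then have "\<iota> (b, \<zero>\<^bsub>V\<^esub>) = \<iota> (\<zero>\<^bsub>V\<^esub>, \<zero>\<^bsub>V\<^esub>)" using u Ind_smult[of "(a, b)" elt_x] by (simp add: Q_smult Ind_zero)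
    then have "b = \<zero>\<^bsub>V\<^esub>" using \<iota> by (auto dest: injD)
    then show "u \<in> ?R" using ab by blast
  next
    fix u assume "u \<in> ?R"
    then obtain a where a: "u = \<iota> (a, \<zero>\<^bsub>V\<^esub>)" "a \<in> carrier V" by blast
    then show "u \<in> ?L" using Ind_smult[of "(a, \<zero>\<^bsub>V\<^esub>)" elt_x] by (simp add: Q_smult Ind_zero Ind_carrier)
  qed
  then show ?thesis by (simp add: K_module_def)
qed

definition counit :: "'v \<Rightarrow> 'v" where
  "counit = (\<lambda>u\<in>carrier (K_module (pull \<mu> Ind)). fst (inv_into UNIV \<iota> u))"

lemma counit_\<iota>: "v \<in> carrier V \<Longrightarrow> counit (\<iota> (v, \<zero>\<^bsub>V\<^esub>)) = v"
  by (simp add: counit_def K_Ind)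

lemma counit_hom: "counit \<in> mod_hom A_cal (K_module (pull \<mu> Ind)) V"
proof -
  interpret P: s_bij_module "pull \<mu> Ind" by (rule s_bij_Ind)
  interpret KP: cal_module "K_module (pull \<mu> Ind)" by (rule P.cal_module_K)
  let ?f = "\<lambda>u. fst (inv_into UNIV \<iota> u)"
  have K: "u \<in> P.B.K \<longleftrightarrow> (\<exists>v\<in>carrier V. u = \<iota> (v, \<zero>\<^bsub>V\<^esub>))" for u
    using K_Ind by auto
  have add: "?f (u \<oplus>\<^bsub>K_module (pull \<mu> Ind)\<^esub> w) = ?f u \<oplus>\<^bsub>V\<^esub> ?f w"
    if uw: "u \<in> carrier (K_module (pull \<mu> Ind))" "w \<in> carrier (K_module (pull \<mu> Ind))" for u w
  proof -
    obtain a b where "u = \<iota> (a, \<zero>\<^bsub>V\<^esub>)" "w = \<iota> (b, \<zero>\<^bsub>V\<^esub>)" "a \<in> carrier V" "b \<in> carrier V"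
      using uw unfolding K_Ind by blast
    then show ?thesis using Ind_add[of "(a, \<zero>\<^bsub>V\<^esub>)" "(b, \<zero>\<^bsub>V\<^esub>)"] by simp
  qed
  have cl: "?f u \<in> carrier V" if "u \<in> carrier (K_module (pull \<mu> Ind))" for u
    using that by (auto simp: K_Ind simp del: P.K_module_simps)
  show ?thesis
    unfolding counit_def
  proof (rule restrict_mod_hom[OF KP.left_module_axioms cl add])
    fix c :: "(nat \<times> 'k elt) set" and u assume c: "c \<in> carrier A_cal" and u: "u \<in> carrier (K_module (pull \<mu> Ind))"
    show "?f (c \<odot>\<^bsub>K_module (pull \<mu> Ind)\<^esub> u) = c \<odot>\<^bsub>V\<^esub> ?f u"
    proof (rule cal_hom_eq[OF P.cal_module_K cal_module_axioms c cl add])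
      fix w assume w: "w \<in> carrier (K_module (pull \<mu> Ind))"
      then obtain a where a: "w = \<iota> (a, \<zero>\<^bsub>V\<^esub>)" "a \<in> carrier V" unfolding K_Ind by blast
      have wK: "w \<in> P.B.K" using w by simp
      note sm = Ind_smult[of "(_, _)"]
      show "?f (cal_scalar d \<odot>\<^bsub>K_module (pull \<mu> Ind)\<^esub> w) = cal_scalar d \<odot>\<^bsub>V\<^esub> ?f w" for d
        unfolding P.K_smult(1)[OF wK] using a sm[of a "\<zero>\<^bsub>V\<^esub>" "A_scalar d"] by (simp only: Q_smult M.zero_closed) simp
      show "?f (cal_s \<odot>\<^bsub>K_module (pull \<mu> Ind)\<^esub> w) = cal_s \<odot>\<^bsub>V\<^esub> ?f w"
        unfolding P.K_smult(2)[OF wK] using a sm[of a "\<zero>\<^bsub>V\<^esub>" elt_s] by (simp only: Q_s M.zero_closed) simp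
      \<comment> \<open>On the first copy \<open>y^2\<close> is \<open>p s^2\<close>:
        \<open>y\<close> sends \<open>(a, 0)\<close> to \<open>(0, s a)\<close> and that to
        \<open>(p s (s a), 0)\<close>.\<close>
      have "elt_y \<odot>\<^bsub>pull \<mu> Ind\<^esub> (elt_y \<odot>\<^bsub>pull \<mu> Ind\<^esub> w) = \<iota> (elt_y \<odot>\<^bsub>Q\<^esub> (elt_y \<odot>\<^bsub>Q\<^esub> (a, \<zero>\<^bsub>V\<^esub>)))"
        using a sm[of a "\<zero>\<^bsub>V\<^esub>" elt_y] sm[of "pp (ss \<zero>\<^bsub>V\<^esub>)" "ss a" elt_y] by (simp only: Q_smult M.zero_closed) (simp add: Q_smult)
      then show "?f (cal_p \<odot>\<^bsub>K_module (pull \<mu> Ind)\<^esub> (cal_s \<odot>\<^bsub>K_module (pull \<mu> Ind)\<^esub> (cal_s \<odot>\<^bsub>K_module (pull \<mu> Ind)\<^esub> w))) =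
          cal_p \<odot>\<^bsub>V\<^esub> (cal_s \<odot>\<^bsub>V\<^esub> (cal_s \<odot>\<^bsub>V\<^esub> ?f w))"
        unfolding P.K_smult(5)[OF wK] using a by (simp add: Q_smult)
    qed (use u in auto)
  qed auto
qed

lemma counit_bij: "bij_betw counit (carrier (K_module (pull \<mu> Ind))) (carrier V)"
  unfolding bij_betw_def inj_on_def K_Ind by (force simp: counit_\<iota>)

end

text \<open>The operators on pairs are built from the action of \<open>A_cal\<close> on the
  coordinates, so applying \<open>f\<close> to both coordinates commutes with them.\<close>

lemma induced_hom:
  assumes V: "induced V \<mu> \<iota>" and W: "induced W \<mu> \<iota>" and f: "f \<in> mod_hom A_cal V W"
  shows "(\<lambda>u\<in>carrier (induced_module \<iota> \<mu> V). \<iota> (map_prod f f (inv_into UNIV \<iota> u))) \<in>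
    mod_hom (A_quot \<mu>) (induced_module \<iota> \<mu> V) (induced_module \<iota> \<mu> W)"
proof -
  interpret V: induced V \<mu> \<iota> by fact
  interpret W: induced W \<mu> \<iota> by fact
  note fD = mod_homD[OF f]
  note f0 = mod_hom_zero[OF V.left_module_axioms W.left_module_axioms f]
  let ?F = "\<lambda>u. \<iota> (map_prod f f (inv_into UNIV \<iota> u))"
  have PA: "A_module (pull \<mu> V.Ind)" "A_module (pull \<mu> W.Ind)"
    by (rule pull_A_module[OF V.left_module_Ind] pull_A_module[OF W.left_module_Ind])+
  interpret PV: A_module "pull \<mu> V.Ind" by (rule PA)
  have cl: "?F u \<in> carrier (pull \<mu> W.Ind)" if "u \<in> carrier (pull \<mu> V.Ind)" for u
    using that fD(1) by (auto simp: V.Ind_carrier W.Ind_carrier)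
  have add: "?F (u \<oplus>\<^bsub>pull \<mu> V.Ind\<^esub> w) = ?F u \<oplus>\<^bsub>pull \<mu> W.Ind\<^esub> ?F w"
    if "u \<in> carrier (pull \<mu> V.Ind)" "w \<in> carrier (pull \<mu> V.Ind)" for u w
    using that fD(1,2) by (auto simp: V.Ind_carrier V.Ind_add W.Ind_add)
  have act: "?F (a \<odot>\<^bsub>pull \<mu> V.Ind\<^esub> u) = a \<odot>\<^bsub>pull \<mu> W.Ind\<^esub> ?F u"
    if "a \<in> carrier A_alg" "u \<in> carrier (pull \<mu> V.Ind)" for a u
  proof (rule A_hom_eq[OF PA that(1) cl add])
    fix u assume "u \<in> carrier (pull \<mu> V.Ind)"
    then obtain p q where u: "u = \<iota> (p, q)" "p \<in> carrier V" "q \<in> carrier V" by (auto simp: V.Ind_carrier)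
    have cu: "(p, q) \<in> carrier V \<times> carrier V" "(f p, f q) \<in> carrier W \<times> carrier W" using u fD(1) by auto
    have step: "?F (a \<odot>\<^bsub>pull \<mu> V.Ind\<^esub> u) = a \<odot>\<^bsub>pull \<mu> W.Ind\<^esub> ?F u"
      if "a \<in> carrier A_alg" "map_prod f f (a \<odot>\<^bsub>V.Q\<^esub> (p, q)) = a \<odot>\<^bsub>W.Q\<^esub> (f p, f q)" for a
      using V.Ind_smult[OF cu(1) that(1)] W.Ind_smult[OF cu(2) that(1)] that(2) by (simp add: u)
    show "?F (A_scalar c \<odot>\<^bsub>pull \<mu> V.Ind\<^esub> u) = A_scalar c \<odot>\<^bsub>pull \<mu> W.Ind\<^esub> ?F u" for c
      by (rule step) (use u fD in \<open>simp_all add: V.Q_smult W.Q_smult\<close>)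
    show "?F (elt_x \<odot>\<^bsub>pull \<mu> V.Ind\<^esub> u) = elt_x \<odot>\<^bsub>pull \<mu> W.Ind\<^esub> ?F u"
      by (rule step) (use u fD f0 in \<open>simp_all add: V.Q_smult W.Q_smult\<close>)
    show "?F (elt_y \<odot>\<^bsub>pull \<mu> V.Ind\<^esub> u) = elt_y \<odot>\<^bsub>pull \<mu> W.Ind\<^esub> ?F u"
      by (rule step) (use u fD in \<open>simp_all add: V.Q_smult W.Q_smult\<close>)
    show "?F (elt_g \<odot>\<^bsub>pull \<mu> V.Ind\<^esub> u) = elt_g \<odot>\<^bsub>pull \<mu> W.Ind\<^esub> ?F u"
      by (rule step) (use u fD in \<open>simp_all add: V.Q_smult W.Q_smult\<close>)
    show "?F (elt_ginv \<odot>\<^bsub>pull \<mu> V.Ind\<^esub> u) = elt_ginv \<odot>\<^bsub>pull \<mu> W.Ind\<^esub> ?F u"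
      by (rule step) (use u fD in \<open>simp_all add: V.Q_smult W.Q_smult\<close>)
  qed (use that in auto)
  show ?thesis
    unfolding mod_hom_pull using restrict_mod_hom[OF PV.left_module_axioms cl add act] by simp
qed

section \<open>The unit of the equivalence\<close>

text \<open>On the kernel \<open>x y = s\<close>, so \<open>x\<close> sends
  \<open>y s^-1 x m\<close> to \<open>x m\<close>. Subtracting this vector from \<open>m\<close>
  lands in the kernel, which splits \<open>m\<close> along \<open>K\<close> and
  \<open>y K\<close>.\<close>

lemma (in s_bij_module) K_decomposition:
  assumes m: "m \<in> carrier N"
  shows "m \<ominus>\<^bsub>N\<^esub> elt_y \<odot>\<^bsub>N\<^esub> B.si (elt_x \<odot>\<^bsub>N\<^esub> m) \<in> B.K" "elt_x \<odot>\<^bsub>N\<^esub> m \<in> B.K"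
proof -
  show K: "elt_x \<odot>\<^bsub>N\<^esub> m \<in> B.K" using m rep.XX by (simp add: B.K_def)
  have "elt_x \<odot>\<^bsub>N\<^esub> (elt_y \<odot>\<^bsub>N\<^esub> B.si (elt_x \<odot>\<^bsub>N\<^esub> m)) = elt_x \<odot>\<^bsub>N\<^esub> m"
    using B.xyK[OF B.K_closed(6)[OF K]] m by simp
  then show "m \<ominus>\<^bsub>N\<^esub> elt_y \<odot>\<^bsub>N\<^esub> B.si (elt_x \<odot>\<^bsub>N\<^esub> m) \<in> B.K"
    using m by (simp add: B.K_def M.minus_eq smult_r_distr smult_r_minus M.r_neg)
qed

locale quot_module = left_module "A_quot \<mu>" N
  for \<mu> :: "'k::{alg_closed_field, field_char_0}" and N :: "('k elt set, 'v) module" +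
  fixes \<iota> :: "'v \<times> 'v \<Rightarrow> 'v"
  assumes \<mu>: "\<mu> \<noteq> 0" and \<iota>: "inj \<iota>"
begin

sublocale P: s_bij_module "pull \<mu> N"
  by (intro s_bij_module.intro s_bij_module_axioms.intro pull_A_module left_module_axioms
      C_scalar_imp_s_bij[OF pull_A_module[OF left_module_axioms] \<mu>] pull_C) simp_all

abbreviation "KN \<equiv> K_module (pull \<mu> N)"

sublocale I: induced KN \<mu> \<iota>
  by (intro induced.intro induced_axioms.intro cal_pair.intro cal_pair_axioms.intro P.cal_module_K \<mu> \<iota>)

text \<open>The reading of pairs that motivates the operators \<open>px\<close>, \<open>py\<close>,
  \<open>pg\<close> and \<open>pgi\<close>, now as an actual map.\<close>

definition unit_map :: "'v \<times> 'v \<Rightarrow> 'v" where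
  "unit_map u = fst u \<oplus>\<^bsub>N\<^esub> elt_y \<odot>\<^bsub>pull \<mu> N\<^esub> (cal_t \<odot>\<^bsub>KN\<^esub> snd u)"

definition unit :: "'v \<Rightarrow> 'v" where
  "unit = (\<lambda>u\<in>carrier (induced_module \<iota> \<mu> KN). unit_map (inv_into UNIV \<iota> u))"

lemma unit_map: "\<lbrakk>v \<in> P.B.K; w \<in> P.B.K\<rbrakk> \<Longrightarrow> unit_map (v, w) = v \<oplus>\<^bsub>N\<^esub> elt_y \<odot>\<^bsub>pull \<mu> N\<^esub> P.B.si w"
  unfolding unit_map_def using P.K_smult(3) by simp

lemma unit_\<iota>: "\<lbrakk>v \<in> P.B.K; w \<in> P.B.K\<rbrakk> \<Longrightarrow> unit (\<iota> (v, w)) = v \<oplus>\<^bsub>N\<^esub> elt_y \<odot>\<^bsub>pull \<mu> N\<^esub> P.B.si w"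
  by (simp add: unit_def I.Ind_carrier unit_map)

text \<open>Applying \<open>x\<close> to \<open>v + y s^-1 w\<close> returns \<open>w\<close>, and
  then \<open>v\<close> can be cancelled out. By \<open>K_decomposition\<close>, \<open>m\<close>
  comes from the pair of \<open>m - y s^-1 x m\<close> and \<open>x m\<close>.\<close>

lemma unit_bij: "bij_betw unit (carrier (induced_module \<iota> \<mu> KN)) (carrier N)"
proof -
  let ?y = "\<lambda>m. elt_y \<odot>\<^bsub>pull \<mu> N\<^esub> m" and ?x = "\<lambda>m. elt_x \<odot>\<^bsub>pull \<mu> N\<^esub> m"
  have xu: "?x (v \<oplus>\<^bsub>N\<^esub> ?y (P.B.si w)) = w" if "v \<in> P.B.K" "w \<in> P.B.K" for v w
    using that P.B.K_x[OF that(1)] P.B.K_carrier P.B.xyK[OF P.B.K_closed(6)[OF that(2)]]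
      P.smult_r_distr[of elt_x v "?y (P.B.si w)"] P.B.K_closed(6)[OF that(2)] P.rep.op_closed(2)[of "P.B.si w"]
    by (simp del: restrict_scalars_simps(4))
  have cl: "v \<oplus>\<^bsub>N\<^esub> ?y (P.B.si w) \<in> carrier N" if "v \<in> P.B.K" "w \<in> P.B.K" for v w
    using that P.B.K_carrier P.B.K_closed(6)[OF that(2)] P.rep.op_closed(2)[of "P.B.si w"] by (simp del: restrict_scalars_simps(4))
  show ?thesis
    unfolding bij_betw_def
  proof
    show "inj_on unit (carrier (induced_module \<iota> \<mu> KN))"
    proof (rule inj_onI)
      fix u u' assume uu: "u \<in> carrier (induced_module \<iota> \<mu> KN)" "u' \<in> carrier (induced_module \<iota> \<mu> KN)" "unit u = unit u'"
      then obtain v w v' w' where *: "u = \<iota> (v, w)" "u' = \<iota> (v', w')" "v \<in> P.B.K" "w \<in> P.B.K" "v' \<in> P.B.K" "w' \<in> P.B.K"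
        by (auto simp: I.Ind_carrier)
      have eq: "v \<oplus>\<^bsub>N\<^esub> ?y (P.B.si w) = v' \<oplus>\<^bsub>N\<^esub> ?y (P.B.si w')"
        using uu(3) unit_\<iota> * by simp
      then have "w = w'" using xu[OF *(3,4)] xu[OF *(5,6)] by simp
      moreover from this have "v = v'"
        using eq * P.B.K_carrier P.B.K_closed(6)[OF *(6)] P.rep.op_closed(2)[of "P.B.si w'"] by (simp del: restrict_scalars_simps(4))
      ultimately show "u = u'" using * by simp
    qed
    show "unit ` carrier (induced_module \<iota> \<mu> KN) = carrier N"
    proof
      show "unit ` carrier (induced_module \<iota> \<mu> KN) \<subseteq> carrier N"
        using cl by (auto simp: I.Ind_carrier unit_\<iota>)
      show "carrier N \<subseteq> unit ` carrier (induced_module \<iota> \<mu> KN)"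
      proof
        fix m assume "m \<in> carrier N"
        then have m: "m \<in> carrier (pull \<mu> N)" by simp
        note d = P.K_decomposition[OF m]
        let ?v = "m \<ominus>\<^bsub>pull \<mu> N\<^esub> ?y (P.B.si (?x m))"
        have "unit (\<iota> (?v, ?x m)) = ?v \<oplus>\<^bsub>N\<^esub> ?y (P.B.si (?x m))" by (rule unit_\<iota>[OF d])
        also have "\<dots> = ?v \<oplus>\<^bsub>pull \<mu> N\<^esub> ?y (P.B.si (?x m))" by simp
        also have "\<dots> = m"
          using m P.B.K_carrier[OF P.B.K_closed(6)[OF d(2)]] P.rep.op_closed(2)[of "P.B.si (?x m)"]
          by (simp add: P.M.minus_eq P.M.a_assoc P.M.l_neg del: restrict_scalars_simps)
        finally have "m = unit (\<iota> (?v, ?x m))" by simp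
        moreover have "\<iota> (?v, ?x m) \<in> carrier (induced_module \<iota> \<mu> KN)" using d by (simp add: I.Ind_carrier)
        ultimately show "m \<in> unit ` carrier (induced_module \<iota> \<mu> KN)" by (rule image_eqI)
      qed
    qed
  qed
qed

end

text \<open>The generators act on \<open>v + y s^-1 w\<close> by the formulas of the pair
  construction. The values of \<open>g\<close> and \<open>g^-1\<close> on \<open>K\<close> come from
  \<open>K_g\<close> with \<open>C = \<mu>\<close>, and commuting them past \<open>y\<close> costs a
  sign because \<open>x\<close> kills \<open>K\<close>.\<close>

lemma (in bijective_rep) K_pair:
  assumes C: "\<forall>m\<in>carrier M. C m = sm \<mu> m" and \<mu>: "\<mu> \<noteq> 0" and vw: "v \<in> K" "w \<in> K"
  shows "sm c (v \<oplus> yy (si w)) = sm c v \<oplus> yy (si (sm c w))"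
    "xx (v \<oplus> yy (si w)) = w"
    "yy (v \<oplus> yy (si w)) = E w \<oplus> yy (si (S v))"
    "gg (v \<oplus> yy (si w)) = sm (- inverse \<mu>) (S v) \<oplus> yy (si (sm (inverse \<mu>) (S w)))"
    "gi (v \<oplus> yy (si w)) = sm (- \<mu>) (si v) \<oplus> yy (si (sm \<mu> (si w)))"
proof -
  define n where "n = si w"
  have n: "n \<in> K" "S n = w" using vw(2) K_carrier by (simp_all add: n_def K_closed)
  note c [simp] = K_carrier[OF vw(1)] K_carrier[OF vw(2)] K_carrier[OF n(1)]
  have G: "gg k = sm (- inverse \<mu>) (S k)" if k: "k \<in> K" for k
  proof -
    note kc = K_carrier[OF k]
    have "sm \<mu> (gg k) = \<ominus> S k" using K_g(1)[OF k] C kc by simp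
    then have "sm (inverse \<mu>) (sm \<mu> (gg k)) = sm (inverse \<mu>) (\<ominus> S k)" by simp
    then show ?thesis using \<mu> kc by (simp add: act_minus_left act_minus_right flip: act_mult)
  qed
  have Gi: "gi k = sm (- \<mu>) (si k)" if k: "k \<in> K" for k
    using K_g(2)[OF k] bspec[OF C K_carrier[OF k]] K_carrier[OF k] by (simp add: act_minus_left flip: si_sm)
  show "sm c (v \<oplus> yy (si w)) = sm c v \<oplus> yy (si (sm c w))"
    by (simp add: act_add_right Y_sm flip: si_sm)
  show "xx (v \<oplus> yy (si w)) = w"
    using xyK[OF n(1)] by (simp add: op_add K_x[OF vw(1)] n(2) flip: n_def)
  show "yy (v \<oplus> yy (si w)) = E w \<oplus> yy (si (S v))"
    using yyK[OF n(1)] by (simp add: op_add n(2) a_comm flip: n_def)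
  have "gg (yy n) = \<ominus> yy (gg n)"
    unfolding GY[OF c(3)] K_x[OF K_g(3)[OF n(1)]] by (simp add: minus_eq)
  then have "gg (yy n) = yy (sm (inverse \<mu>) w)"
    by (simp add: G[OF n(1)] n(2) act_minus_left op_minus)
  then show "gg (v \<oplus> yy (si w)) = sm (- inverse \<mu>) (S v) \<oplus> yy (si (sm (inverse \<mu>) (S w)))"
    by (simp add: op_add G[OF vw(1)] flip: n_def S_sm)
  have "gi (yy n) = \<ominus> yy (gi n)"
    unfolding GiY[OF c(3)] K_x[OF K_g(4)[OF n(1)]] by (simp add: minus_eq)
  then have "gi (yy n) = yy (sm \<mu> (si n))"
    by (simp add: Gi[OF n(1)] act_minus_left op_minus)
  then show "gi (v \<oplus> yy (si w)) = sm (- \<mu>) (si v) \<oplus> yy (si (sm \<mu> (si w)))"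
    by (simp add: op_add Gi[OF vw(1)] si_sm flip: n_def)
qed

context quot_module
begin

lemma C_scalar_pull: "m \<in> carrier N \<Longrightarrow> P.rep.C m = P.sm \<mu> m"
  using P.C_smult[of m] pull_C[OF left_module_axioms, of m] by simp

lemma unit_hom: "unit \<in> mod_hom (A_quot \<mu>) (induced_module \<iota> \<mu> KN) N"
proof -
  let ?f = "\<lambda>u. unit_map (inv_into UNIV \<iota> u)"
  have PA: "A_module (pull \<mu> I.Ind)" by (rule pull_A_module[OF I.left_module_Ind])
  interpret PI: A_module "pull \<mu> I.Ind" by (rule PA)
  define U where "U v w = v \<oplus>\<^bsub>N\<^esub> elt_y \<odot>\<^bsub>pull \<mu> N\<^esub> P.B.si w" for v w
  have U: "?f (\<iota> (v, w)) = U v w" if "v \<in> P.B.K" "w \<in> P.B.K" for v w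
    using that by (simp add: unit_map U_def del: restrict_scalars_simps(4))
  note U' = U[unfolded I.inv_\<iota>]
  have y: "elt_y \<odot>\<^bsub>pull \<mu> N\<^esub> m \<in> carrier N" if "m \<in> carrier N" for m
    using that P.rep.op_closed(2)[of m] by (simp del: restrict_scalars_simps(4))
  have si: "P.B.si w \<in> carrier N" if "w \<in> P.B.K" for w
    using P.B.K_carrier[OF P.B.K_closed(6)[OF that]] by simp
  have kc: "w \<in> carrier N" if "w \<in> P.B.K" for w
    using P.B.K_carrier[OF that] by simp
  have cl: "?f u \<in> carrier (pull \<mu> N)" if "u \<in> carrier (pull \<mu> I.Ind)" for u
    using that y si kc by (auto simp: I.Ind_carrier U' U_def simp del: restrict_scalars_simps(4))
  have add: "?f (u \<oplus>\<^bsub>pull \<mu> I.Ind\<^esub> u') = ?f u \<oplus>\<^bsub>pull \<mu> N\<^esub> ?f u'"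
    if uu: "u \<in> carrier (pull \<mu> I.Ind)" "u' \<in> carrier (pull \<mu> I.Ind)" for u u'
  proof -
    obtain v w v' w' where *: "u = \<iota> (v, w)" "u' = \<iota> (v', w')" "v \<in> P.B.K" "w \<in> P.B.K" "v' \<in> P.B.K" "w' \<in> P.B.K"
      using uu unfolding restrict_scalars_simps(1) I.Ind_carrier P.K_module_simps(1) by blast
    have "u \<oplus>\<^bsub>pull \<mu> I.Ind\<^esub> u' = \<iota> (v \<oplus>\<^bsub>N\<^esub> v', w \<oplus>\<^bsub>N\<^esub> w')"
      using * I.Ind_add[of "(v, w)" "(v', w')"] by simp
    moreover have "v \<oplus>\<^bsub>N\<^esub> v' \<in> P.B.K" "w \<oplus>\<^bsub>N\<^esub> w' \<in> P.B.K"
      using * P.B.K_closed(2)[of v v'] P.B.K_closed(2)[of w w'] by simp_all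
    moreover have "elt_y \<odot>\<^bsub>pull \<mu> N\<^esub> P.B.si (w \<oplus>\<^bsub>N\<^esub> w') = elt_y \<odot>\<^bsub>pull \<mu> N\<^esub> P.B.si w \<oplus>\<^bsub>N\<^esub> elt_y \<odot>\<^bsub>pull \<mu> N\<^esub> P.B.si w'"
      using * kc si additive_opD(2)[OF P.B.SI.s'_add, of w w'] P.rep.op_add(2)[of "P.B.si w" "P.B.si w'"]
      by (simp del: restrict_scalars_simps(4))
    ultimately show ?thesis
      using * kc si y by (simp add: U' U_def M.a_ac del: restrict_scalars_simps(4))
  qed
  have act: "?f (a \<odot>\<^bsub>pull \<mu> I.Ind\<^esub> u) = a \<odot>\<^bsub>pull \<mu> N\<^esub> ?f u"
    if "a \<in> carrier A_alg" "u \<in> carrier (pull \<mu> I.Ind)" for a u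
  proof (rule A_hom_eq[OF PA P.A_module_axioms that(1) cl add])
    fix u assume "u \<in> carrier (pull \<mu> I.Ind)"
    then obtain v w where u: "u = \<iota> (v, w)" "v \<in> P.B.K" "w \<in> P.B.K"
      unfolding restrict_scalars_simps(1) I.Ind_carrier P.K_module_simps(1) by blast
    have C: "\<forall>m\<in>carrier (pull \<mu> N). P.rep.C m = P.sm \<mu> m" using C_scalar_pull by simp
    note KP = P.B.K_pair[OF C \<mu> u(2,3), unfolded restrict_scalars_simps(3), folded U_def]
    have vwc: "v \<in> carrier KN" "w \<in> carrier KN" using u by simp_all
    have sS: "cal_s \<odot>\<^bsub>KN\<^esub> k = P.rep.S k" if "k \<in> P.B.K" for k
      unfolding P.K_smult(2)[OF that] by (rule P.s_smult) (rule P.B.K_carrier[OF that])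
    \<comment> \<open>In the pair construction \<open>y\<close> contains \<open>p s\<close>, in
      \<open>K_pair\<close> it contains \<open>E\<close>; they agree because \<open>p\<close> acts
      as \<open>E s^-1\<close>.\<close>
    have pE: "cal_p \<odot>\<^bsub>KN\<^esub> (cal_s \<odot>\<^bsub>KN\<^esub> w) = P.B.E w"
      unfolding sS[OF u(3)] P.K_smult(4)[OF P.B.K_closed(5)[OF u(3)]]
      unfolding P.B.SI.s's[OF P.B.K_carrier[OF u(3)]] ..
    have step: "?f (a \<odot>\<^bsub>pull \<mu> I.Ind\<^esub> u) = a \<odot>\<^bsub>pull \<mu> N\<^esub> ?f u"
      if "a \<in> carrier A_alg" "a \<odot>\<^bsub>I.Q\<^esub> (v, w) = (v', w')" "v' \<in> P.B.K" "w' \<in> P.B.K" "a \<odot>\<^bsub>pull \<mu> N\<^esub> U v w = U v' w'" for a v' w'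
      unfolding u(1) U[OF u(2,3)] using I.Ind_smult[of "(v, w)" a] that(1,2) vwc U[OF that(3,4)] that(5)
      by (simp del: restrict_scalars_simps(4) P.K_module_simps)
    note Q = I.Q_smult[OF vwc] 
    note t = P.K_smult(3)[OF u(2)] P.K_smult(3)[OF u(3)]
    note s = sS[OF u(2)] sS[OF u(3)]
    note K = P.B.K_closed
    show "?f (A_scalar c \<odot>\<^bsub>pull \<mu> I.Ind\<^esub> u) = A_scalar c \<odot>\<^bsub>pull \<mu> N\<^esub> ?f u" for c
      by (rule step[OF _ Q(1)[unfolded P.K_smult(1)[OF u(2)] P.K_smult(1)[OF u(3)]] _ _ KP(1)]) (simp_all add: K u del: restrict_scalars_simps(4))
    show "?f (elt_x \<odot>\<^bsub>pull \<mu> I.Ind\<^esub> u) = elt_x \<odot>\<^bsub>pull \<mu> N\<^esub> ?f u"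
    proof (rule step[OF _ Q(2)[unfolded P.K_module_simps(2)]])
      have x: "elt_x \<odot>\<^bsub>pull \<mu> N\<^esub> U v w = w" by (rule KP(2))
      have z: "U w \<zero>\<^bsub>pull \<mu> N\<^esub> = w"
        unfolding U_def P.M.additive_op_zero[OF P.B.SI.s'_add] P.rep.op_zero(2) using kc[OF u(3)] by simp
      show "elt_x \<odot>\<^bsub>pull \<mu> N\<^esub> U v w = U w \<zero>\<^bsub>pull \<mu> N\<^esub>"
        unfolding x z ..
    qed (use K(1) u in auto)
    show "?f (elt_y \<odot>\<^bsub>pull \<mu> I.Ind\<^esub> u) = elt_y \<odot>\<^bsub>pull \<mu> N\<^esub> ?f u"
      by (rule step[OF _ Q(3)[unfolded pE s(1)]]) (simp_all add: K P.B.K_E u KP(3) del: restrict_scalars_simps(4))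
    show "?f (elt_g \<odot>\<^bsub>pull \<mu> I.Ind\<^esub> u) = elt_g \<odot>\<^bsub>pull \<mu> N\<^esub> ?f u"
      by (rule step[OF _ Q(4)[unfolded s P.K_smult(1)[OF K(5)[OF u(2)]] P.K_smult(1)[OF K(5)[OF u(3)]]]])
        (simp_all add: K u KP(4) del: restrict_scalars_simps(4))
    show "?f (elt_ginv \<odot>\<^bsub>pull \<mu> I.Ind\<^esub> u) = elt_ginv \<odot>\<^bsub>pull \<mu> N\<^esub> ?f u"
      by (rule step[OF _ Q(5)[unfolded t P.K_smult(1)[OF K(6)[OF u(2)]] P.K_smult(1)[OF K(6)[OF u(3)]]]])
        (simp_all add: K u KP(5) del: restrict_scalars_simps(4))
  qed (use that in auto)
  show ?thesis
    unfolding mod_hom_pull unit_def using restrict_mod_hom[OF PI.left_module_axioms cl add act] by simp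
qed

text \<open>A nonzero submodule of the kernel satisfies the assumptions of
  \<open>K_irreducible\<close>, where \<open>C\<close> is now the invertible scalar
  \<open>\<mu>\<close>. Conversely, a submodule \<open>H\<close> of \<open>N\<close> meets
  \<open>K\<close> in a submodule. If the intersection is zero, then \<open>x H\<close> is zero, so
  \<open>H\<close> lies in \<open>K\<close> and is zero; if it is \<open>K\<close>, then
  \<open>H\<close> contains \<open>K\<close> and \<open>y K\<close>, hence \<open>N\<close>.\<close>

lemma simple_K_module_iff: "simple_module A_cal KN \<longleftrightarrow> simple_module (A_quot \<mu>) N"
proof
  assume sN: "simple_module (A_quot \<mu>) N"
  then have sP: "simple_module A_alg (pull \<mu> N)" by (simp add: simple_pull[OF left_module_axioms])
  interpret SB: simple_bijective_rep "pull \<mu> N" P.sm "\<lambda>m. elt_x \<odot>\<^bsub>pull \<mu> N\<^esub> m" "\<lambda>m. elt_y \<odot>\<^bsub>pull \<mu> N\<^esub> m"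
    "\<lambda>m. elt_g \<odot>\<^bsub>pull \<mu> N\<^esub> m" "\<lambda>m. elt_ginv \<odot>\<^bsub>pull \<mu> N\<^esub> m"
    by (intro simple_bijective_rep.intro simple_rep_A[OF sP] P.B.bijective_rep_axioms)
  have KM: "left_module A_cal KN" using P.cal_module_K by (rule cal_module.axioms)
  show "simple_module A_cal KN"
    unfolding simple_module_def
  proof (intro conjI allI impI)
    show "left_module A_cal KN" by (rule KM)
    show "carrier KN \<noteq> {\<zero>\<^bsub>KN\<^esub>}" using SB.K_nonzero by auto
    fix H assume H: "submodule H A_cal KN"
    note HD = left_module.submoduleD[OF KM H]
    have HK: "m \<in> P.B.K" "m \<in> carrier (pull \<mu> N)" if "m \<in> H" for m using that HD(1) P.B.K_carrier by auto
    have S: "cal_s \<odot>\<^bsub>KN\<^esub> m = P.rep.S m" if "m \<in> H" for m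
      unfolding P.K_smult(2)[OF HK(1)[OF that]] by (rule P.s_smult[OF HK(2)[OF that]])
    have SH: "P.rep.S m \<in> H" if "m \<in> H" for m
      using HD(4)[OF cal_gens_in(3) that] by (simp only: S[OF that])
    have smH: "P.sm c m \<in> H" if "m \<in> H" for c m
      using HD(4)[OF cal_gens_in(1) that] by (simp only: P.K_smult(1)[OF HK(1)[OF that]])
    have C: "P.rep.C m = P.sm \<mu> m" if "m \<in> carrier (pull \<mu> N)" for m using that C_scalar_pull by simp
    have inv: "P.sm c (P.sm (inverse c) m) = m" "P.sm (inverse c) (P.sm c m) = m" if "m \<in> carrier (pull \<mu> N)" "c \<noteq> 0" for c m
      unfolding P.sc.act_mult[OF that(1), symmetric] using that P.sc.act_one by (simp_all del: restrict_scalars_simps(4))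
    show "H = {\<zero>\<^bsub>KN\<^esub>} \<or> H = carrier KN"
    proof (cases "\<exists>v\<in>H. v \<noteq> \<zero>\<^bsub>KN\<^esub>")
      case True
      then obtain v where v: "v \<in> H" "v \<noteq> \<zero>\<^bsub>pull \<mu> N\<^esub>" by auto
      have "H = P.B.K"
      proof (rule SB.K_irreducible[OF _ _ _ smH SH _ _ _ _ _ v])
        show "P.B.si m \<in> H" if "m \<in> H" for m
          using HD(4)[OF cal_gens_in(4) that] by (simp only: P.K_smult(3)[OF HK(1)[OF that]])
        show "P.B.E m \<in> H" if "m \<in> H" for m
          using HD(4)[OF cal_gens_in(2) SH[OF that]] P.B.SI.s's[OF HK(2)[OF that]]
          by (simp only: P.K_smult(4)[OF HK(1)[OF SH[OF that]]])
        show "P.rep.C m \<in> H" if "m \<in> H" for m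
          unfolding C[OF HK(2)[OF that]] by (rule smH[OF that])
        show "\<exists>n\<in>H. P.rep.C n = m" if "m \<in> H" for m
          using smH[OF that, of "inverse \<mu>"] HK(2)[OF smH[OF that]] C inv(1)[OF HK(2)[OF that] \<mu>] by metis
        show "inj_on P.rep.C (carrier (pull \<mu> N))"
          by (rule inj_on_inverseI[of _ "P.sm (inverse \<mu>)"]) (simp only: C inv(2)[OF _ \<mu>])
      qed (use HD(1-3) P.K_module_simps in \<open>simp_all only: restrict_scalars_simps\<close>)
      then show ?thesis by simp
    next
      case False
      then show ?thesis using HD(2) by blast
    qed
  qed
next
  assume sK: "simple_module A_cal KN"
  note inc = P.B.K_carrier
  show "simple_module (A_quot \<mu>) N"
    unfolding simple_module_def
  proof (intro conjI allI impI)
    show "left_module (A_quot \<mu>) N" by (rule left_module_axioms)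
    show "carrier N \<noteq> {\<zero>\<^bsub>N\<^esub>}"
    proof -
      obtain v where "v \<in> carrier KN" "v \<noteq> \<zero>\<^bsub>KN\<^esub>" using sK by (rule simple_module_nonzero)
      then show ?thesis using inc[of v] by auto
    qed
    fix H assume H: "submodule H (A_quot \<mu>) N"
    note HD = submoduleD[OF H]
    let ?H = "N\<lparr>carrier := H\<rparr>"
    interpret HM: quot_module \<mu> ?H \<iota>
      by (intro quot_module.intro quot_module_axioms.intro submodule_left_module[OF H] \<mu> \<iota>)
    \<comment> \<open>Passing to kernels of \<open>x\<close>, the inclusion of \<open>H\<close>
      becomes a homomorphism over \<open>A_cal\<close>. Its image is the intersection of
      \<open>H\<close> with \<open>K\<close>, which is thereby a submodule of
      \<open>K\<close>.\<close>
    have "restrict (\<lambda>m. m) (carrier (pull \<mu> ?H)) \<in> mod_hom A_alg (pull \<mu> ?H) (pull \<mu> N)"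
      by (rule restrict_mod_hom[OF HM.P.left_module_axioms]) (use HD(1) in auto)
    from K_module_hom[OF HM.P.s_bij_module_axioms P.s_bij_module_axioms this]
    have hom: "restrict (restrict (\<lambda>m. m) (carrier (pull \<mu> ?H))) (carrier HM.KN) \<in> mod_hom A_cal HM.KN KN" (is "?f \<in> _") .
    have HK: "carrier HM.KN = H \<inter> P.B.K"
      unfolding P.K_module_simps(1)[symmetric] K_module_def using HD(1) by auto
    have "submodule (?f ` carrier HM.KN) A_cal KN"
      by (rule mod_hom_image[OF _ _ hom]) (use cal_module.axioms HM.P.cal_module_K P.cal_module_K in blast)+
    moreover have "?f ` carrier HM.KN = H \<inter> P.B.K"
    proof -
      have "?f m = m" if m: "m \<in> carrier HM.KN" for m
      proof -
        have "m \<in> carrier (pull \<mu> ?H)" using m unfolding HK by simp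
        then show ?thesis using m by (simp only: restrict_apply if_True)
      qed
      then have "?f ` carrier HM.KN = (\<lambda>m. m) ` carrier HM.KN" by (rule image_cong[OF refl])
      then show ?thesis by (simp only: image_ident HK)
    qed
    ultimately have cases: "H \<inter> P.B.K = {\<zero>\<^bsub>N\<^esub>} \<or> H \<inter> P.B.K = P.B.K"
      using simple_moduleD(3)[OF sK] by simp
    have xH: "elt_x \<odot>\<^bsub>pull \<mu> N\<^esub> m \<in> H" and yH: "elt_y \<odot>\<^bsub>pull \<mu> N\<^esub> m \<in> H" if "m \<in> H" for m
      using P.submoduleD(4)[OF H[unfolded submodule_pull[OF left_module_axioms]] _ that] by (auto simp del: restrict_scalars_simps(4))
    show "H = {\<zero>\<^bsub>N\<^esub>} \<or> H = carrier N"
    proof (rule disjE[OF cases])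
      assume z: "H \<inter> P.B.K = {\<zero>\<^bsub>N\<^esub>}"
      have "m = \<zero>\<^bsub>N\<^esub>" if m: "m \<in> H" for m
      proof -
        have mc: "m \<in> carrier (pull \<mu> N)" using m HD(1) by auto
        have "elt_x \<odot>\<^bsub>pull \<mu> N\<^esub> m = \<zero>\<^bsub>N\<^esub>" using xH[OF m] P.K_decomposition(2)[OF mc] z by blast
        then have "m \<in> P.B.K" using mc by (simp only: P.B.K_def mem_Collect_eq restrict_scalars_simps(2))
        then show ?thesis using m z by blast
      qed
      then show ?thesis using HD(2) by blast
    next
      assume K: "H \<inter> P.B.K = P.B.K"
      have "m \<in> H" if "m \<in> carrier N" for m
      proof -
        from that have m: "m \<in> carrier (pull \<mu> N)" by simp
        note d = P.K_decomposition[OF m]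
        let ?n = "elt_y \<odot>\<^bsub>pull \<mu> N\<^esub> P.B.si (elt_x \<odot>\<^bsub>pull \<mu> N\<^esub> m)"
        have n: "?n \<in> H" using yH P.B.K_closed(6)[OF d(2)] K by blast
        have "(m \<ominus>\<^bsub>pull \<mu> N\<^esub> ?n) \<oplus>\<^bsub>pull \<mu> N\<^esub> ?n \<in> H" using HD(3)[OF _ n] d(1) K by auto
        moreover have "(m \<ominus>\<^bsub>pull \<mu> N\<^esub> ?n) \<oplus>\<^bsub>pull \<mu> N\<^esub> ?n = m"
        proof -
          have nc: "?n \<in> carrier (pull \<mu> N)" using n HD(1) by (auto simp del: restrict_scalars_simps(4))
          show ?thesis unfolding P.M.minus_eq P.M.a_assoc[OF m P.M.a_inv_closed[OF nc] nc] P.M.l_neg[OF nc] P.M.r_zero[OF m] ..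
        qed
        ultimately show ?thesis by simp
      qed
      then show ?thesis using HD(1) by blast
    qed
  qed
qed

end


section \<open>Equivalences of module categories\<close>

lemma module_cat_iso:
  assumes "left_module R M" "left_module R N" "f \<in> mod_hom R M N" "bij_betw f (carrier M) (carrier N)"
  shows "cat_iso (module_cat R) M N f"
proof -
  let ?g = "inv_into (carrier M) f"
  have "restrict ?g (carrier N) \<in> mod_hom R N M"
    by (rule restrict_mod_hom[OF assms(2)])
      (use inv_into_hom[OF assms(1,3,4)] bij_betw_inv_into[OF assms(4)] in \<open>auto simp: bij_betw_def\<close>)
  moreover have "compose (carrier M) (restrict ?g (carrier N)) f = (\<lambda>m\<in>carrier M. m)"
    "compose (carrier N) f (restrict ?g (carrier N)) = (\<lambda>m\<in>carrier N. m)"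
    using assms(4) mod_homD(1)[OF assms(3)]
    by (auto simp: compose_def fun_eq_iff bij_betw_inv_into_left bij_betw_inv_into_right)
  ultimately show ?thesis using assms(3) unfolding cat_iso_def module_cat_def by auto
qed

lemma cat_iso_module_catD:
  assumes "cat_iso (module_cat R) M N f"
  shows "mod_isomorphic R M N"
proof -
  obtain g where f: "f \<in> mod_hom R M N" and g: "g \<in> mod_hom R N M"
    and gf: "compose (carrier M) g f = (\<lambda>m\<in>carrier M. m)" and fg: "compose (carrier N) f g = (\<lambda>m\<in>carrier N. m)"
    using assms unfolding cat_iso_def module_cat_def by auto
  have "g (f m) = m" if "m \<in> carrier M" for m using fun_cong[OF gf, of m] that by (simp add: compose_def)
  moreover have "f (g n) = n" if "n \<in> carrier N" for n using fun_cong[OF fg, of n] that by (simp add: compose_def)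
  ultimately have "bij_betw f (carrier M) (carrier N)"
    using mod_homD(1)[OF f] mod_homD(1)[OF g] by (intro bij_betw_byWitness[of _ g]) auto
  then show ?thesis using f by (auto simp: mod_isomorphic_def)
qed

lemma mod_isomorphic_iff_cat_iso:
  assumes "left_module R M" "left_module R N"
  shows "mod_isomorphic R M N \<longleftrightarrow> (\<exists>f. cat_iso (module_cat R) M N f)"
  using module_cat_iso[OF assms] cat_iso_module_catD by (auto simp: mod_isomorphic_def)

lemma (in cat_functor) cat_iso_map:
  assumes "a \<in> Ob C" "b \<in> Ob C" "cat_iso C a b f"
  shows "cat_iso D (Fo a) (Fo b) (Fm a b f)"
proof -
  obtain g where f: "f \<in> Hom C a b" and g: "g \<in> Hom C b a"
    and gf: "Comp C a b a g f = Ident C a" and fg: "Comp C b a b f g = Ident C b"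
    using assms(3) by (auto simp: cat_iso_def)
  show ?thesis
    unfolding cat_iso_def
  proof (intro conjI bexI[of _ "Fm b a g"])
    show "Comp D (Fo a) (Fo b) (Fo a) (Fm b a g) (Fm a b f) = Ident D (Fo a)"
      using comp_map[OF assms(1,2,1) f g] ident_map[OF assms(1)] gf by simp
    show "Comp D (Fo b) (Fo a) (Fo b) (Fm a b f) (Fm b a g) = Ident D (Fo b)"
      using comp_map[OF assms(2,1,2) g f] ident_map[OF assms(2)] fg by simp
  qed (use hom_map assms f g in auto)
qed

lemma module_functor_iso:
  assumes "cat_functor (module_cat R) (module_cat S) Fo Fm" "left_module R M" "left_module R N" "mod_isomorphic R M N"
  shows "mod_isomorphic S (Fo M) (Fo N)"
proof -
  obtain f where "cat_iso (module_cat R) M N f" using assms mod_isomorphic_iff_cat_iso by blast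
  then have "cat_iso (module_cat S) (Fo M) (Fo N) (Fm M N f)"
    by (rule cat_functor.cat_iso_map[OF assms(1), rotated 2]) (use assms in \<open>simp_all add: module_cat_def\<close>)
  then show ?thesis by (rule cat_iso_module_catD)
qed

lemma module_functor_closed:
  assumes "cat_functor (module_cat R) (module_cat S) Fo Fm" "left_module R M"
  shows "left_module S (Fo M)"
  using cat_functor.ob_map[OF assms(1), of M] assms(2) by (simp add: module_cat_def)

text \<open>The union in \<open>class_map\<close> runs over isomorphic modules, and these have
  images with one and the same class.\<close>

lemma class_map_iso_class:
  fixes M :: "('r, 'v) module" and F :: "('r, 'v) module \<Rightarrow> ('s, 'v) module"
  assumes "left_module R M" "\<And>N. left_module R N \<Longrightarrow> left_module S (F N)"
    "\<And>N. \<lbrakk>left_module R N; mod_isomorphic R M N\<rbrakk> \<Longrightarrow> mod_isomorphic S (F M) (F N)"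
  shows "class_map S F (iso_class R M) = iso_class S (F M)"
proof -
  have "iso_class S (F N) = iso_class S (F M)" if "N \<in> iso_class R M" for N
    using that assms iso_class_eq[of S "F M" "F N"] by (auto simp: iso_class_def)
  moreover have "M \<in> iso_class R M" using assms(1) by (simp add: iso_class_def mod_isomorphic_refl)
  ultimately show ?thesis unfolding class_map_def by blast
qed

text \<open>Up to isomorphism \<open>Go\<close> undoes \<open>Fo\<close>, so \<open>Fo\<close>
  reflects isomorphism, and it reaches every class because \<open>Fo\<close> undoes
  \<open>Go\<close>. Simplicity is a separate assumption because it is defined through submodules,
  which do not appear in the data of the categories.\<close>

lemma class_map_bij:
  fixes Fo :: "('r, 'v) module \<Rightarrow> ('s, 'v) module"
  assumes F: "cat_functor (module_cat R) (module_cat S) Fo Fm" and G: "cat_functor (module_cat S) (module_cat R) Go Gm"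
    and unit: "\<And>M. left_module R M \<Longrightarrow> mod_isomorphic R (Go (Fo M)) M"
    and counit: "\<And>V. left_module S V \<Longrightarrow> mod_isomorphic S (Fo (Go V)) V"
    and simple: "\<And>M. left_module R M \<Longrightarrow> simple_module S (Fo M) \<longleftrightarrow> simple_module R M"
  shows "bij_betw (class_map S Fo) (simple_classes R) (simple_classes S)"
proof -
  note Fc = module_functor_closed[OF F] and Gc = module_functor_closed[OF G]
  have cm: "class_map S Fo (iso_class R M) = iso_class S (Fo M)" if "left_module R M" for M
    by (rule class_map_iso_class[where F = Fo, OF that Fc module_functor_iso[OF F that]])
  have refl: "mod_isomorphic R M M'" if "left_module R M" "left_module R M'" "mod_isomorphic S (Fo M) (Fo M')" for M M'
  proof -
    have "mod_isomorphic R (Go (Fo M)) (Go (Fo M'))"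
      by (rule module_functor_iso[OF G Fc[OF that(1)] Fc[OF that(2)] that(3)])
    then have "mod_isomorphic R (Go (Fo M)) M'" using mod_isomorphic_trans[OF Gc[OF Fc[OF that(1)]]] unit[OF that(2)] by blast
    moreover have "mod_isomorphic R M (Go (Fo M))"
      by (rule mod_isomorphic_sym[OF Gc[OF Fc[OF that(1)]] that(1) unit[OF that(1)]])
    ultimately show ?thesis using mod_isomorphic_trans[OF that(1)] by blast
  qed
  show ?thesis
    unfolding bij_betw_def
  proof
    show "inj_on (class_map S Fo) (simple_classes R)"
    proof (rule inj_onI)
      fix c d :: "('r, 'v) module set"
      assume cd: "c \<in> simple_classes R" "d \<in> simple_classes R" and eq: "class_map S Fo c = class_map S Fo d"
      obtain M N :: "('r, 'v) module" where "c = iso_class R M" "d = iso_class R N" "simple_module R M" "simple_module R N"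
        using cd by (auto simp: simple_classes_def)
      note MN = this(1,2) this(3,4)[THEN simple_moduleD(1)]
      then have "mod_isomorphic S (Fo M) (Fo N)"
        using eq cm iso_class_eq_iff[OF Fc[OF MN(3)] Fc[OF MN(4)]] by simp
      then show "c = d" using refl MN iso_class_eq_iff[OF MN(3,4)] by simp
    qed
    show "class_map S Fo ` simple_classes R = simple_classes S"
    proof (intro equalityI subsetI)
      fix c assume "c \<in> class_map S Fo ` simple_classes R"
      then obtain M :: "('r, 'v) module" where "c = class_map S Fo (iso_class R M)" "simple_module R M"
        unfolding simple_classes_def by blast
      then show "c \<in> simple_classes S" using cm simple simple_moduleD(1) unfolding simple_classes_def by blast
    next
      fix c :: "('s, 'v) module set" assume "c \<in> simple_classes S"
      then obtain V :: "('s, 'v) module" where V: "c = iso_class S V" "simple_module S V"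
        unfolding simple_classes_def by blast
      note VL = simple_moduleD(1)[OF V(2)]
      note iso = mod_isomorphic_sym[OF Fc[OF Gc[OF VL]] VL counit[OF VL]]
      have "simple_module R (Go V)"
        using simple_module_iso[OF V(2) Fc[OF Gc[OF VL]] iso] simple[OF Gc[OF VL]] by simp
      moreover have "c = class_map S Fo (iso_class R (Go V))"
        unfolding V(1) cm[OF Gc[OF VL]] by (rule iso_class_eq[OF VL Fc[OF Gc[OF VL]] iso])
      ultimately show "c \<in> class_map S Fo ` simple_classes R" unfolding simple_classes_def by blast
    qed
  qed
qed

locale quotient_equivalence =
  fixes \<mu> :: "'k::{alg_closed_field, field_char_0}" and \<iota> :: "'v \<times> 'v \<Rightarrow> 'v"
  assumes \<mu>: "\<mu> \<noteq> 0" and \<iota>: "inj \<iota>"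
begin

definition Fo :: "('k elt set, 'v) module \<Rightarrow> ((nat \<times> 'k elt) set, 'v) module" where
  "Fo M = K_module (pull \<mu> M)"
definition Fm :: "('k elt set, 'v) module \<Rightarrow> ('k elt set, 'v) module \<Rightarrow> ('v \<Rightarrow> 'v) \<Rightarrow> 'v \<Rightarrow> 'v" where
  "Fm M N f = restrict f (carrier (Fo M))"
definition Go :: "((nat \<times> 'k elt) set, 'v) module \<Rightarrow> ('k elt set, 'v) module" where
  "Go V = induced_module \<iota> \<mu> V"
definition Gm :: "((nat \<times> 'k elt) set, 'v) module \<Rightarrow> ((nat \<times> 'k elt) set, 'v) module \<Rightarrow> ('v \<Rightarrow> 'v) \<Rightarrow> 'v \<Rightarrow> 'v" where
  "Gm V W f = (\<lambda>u\<in>carrier (Go V). \<iota> (map_prod f f (inv_into UNIV \<iota> u)))"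

lemma quot_module: "left_module (A_quot \<mu>) M \<Longrightarrow> quot_module \<mu> M \<iota>"
  by (intro quot_module.intro quot_module_axioms.intro \<mu> \<iota>)

lemma induced: "left_module A_cal V \<Longrightarrow> induced V \<mu> \<iota>"
  by (intro induced.intro induced_axioms.intro cal_pair.intro cal_pair_axioms.intro cal_module.intro \<mu> \<iota>)

lemma Fo_sub: "v \<in> carrier (Fo M) \<Longrightarrow> v \<in> carrier M"
  by (simp add: Fo_def K_module_def)

lemma s_bij: "left_module (A_quot \<mu>) M \<Longrightarrow> s_bij_module (pull \<mu> M)"
  by (intro s_bij_module.intro s_bij_module_axioms.intro pull_A_module
      C_scalar_imp_s_bij[OF pull_A_module \<mu>] pull_C) simp_all

lemma Fo_closed: "left_module (A_quot \<mu>) M \<Longrightarrow> left_module A_cal (Fo M)"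
  unfolding Fo_def by (rule cal_module.axioms[OF s_bij_module.cal_module_K[OF s_bij]])

lemma Fm_hom:
  assumes "left_module (A_quot \<mu>) M" "left_module (A_quot \<mu>) N" "f \<in> mod_hom (A_quot \<mu>) M N"
  shows "Fm M N f \<in> mod_hom A_cal (Fo M) (Fo N)"
  unfolding Fm_def Fo_def
  by (rule K_module_hom[OF s_bij[OF assms(1)] s_bij[OF assms(2)] assms(3)[unfolded mod_hom_pull]])

lemma Go_closed: "left_module A_cal V \<Longrightarrow> left_module (A_quot \<mu>) (Go V)"
  unfolding Go_def by (rule induced.left_module_Ind[OF induced])

lemma Gm_hom:
  assumes "left_module A_cal V" "left_module A_cal W" "f \<in> mod_hom A_cal V W"
  shows "Gm V W f \<in> mod_hom (A_quot \<mu>) (Go V) (Go W)"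
  unfolding Gm_def Go_def by (rule induced_hom[OF induced[OF assms(1)] induced[OF assms(2)] assms(3)])

lemma carrier_Go: "left_module A_cal V \<Longrightarrow> carrier (Go V) = \<iota> ` (carrier V \<times> carrier V)"
  unfolding Go_def by (rule induced.Ind_carrier[OF induced])

lemma Gm_\<iota>: "\<lbrakk>left_module A_cal V; v \<in> carrier V; w \<in> carrier V\<rbrakk> \<Longrightarrow> Gm V W f (\<iota> (v, w)) = \<iota> (f v, f w)"
  using \<iota> by (simp add: Gm_def carrier_Go)

lemma carrier_Fo_Go: "left_module A_cal V \<Longrightarrow> carrier (Fo (Go V)) = (\<lambda>v. \<iota> (v, \<zero>\<^bsub>V\<^esub>)) ` carrier V"
  unfolding Go_def Fo_def by (rule induced.K_Ind[OF induced])

lemma functor_F: "cat_functor (module_cat (A_quot \<mu>)) (module_cat A_cal) Fo Fm"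
proof (intro cat_functor.intro cat_functor_axioms.intro category_module_cat)
  show "Fo M \<in> Ob (module_cat A_cal)" if "M \<in> Ob (module_cat (A_quot \<mu>))" for M
    using that Fo_closed by (simp add: module_cat_def)
  show "Fm M N f \<in> Hom (module_cat A_cal) (Fo M) (Fo N)"
    if "M \<in> Ob (module_cat (A_quot \<mu>))" "N \<in> Ob (module_cat (A_quot \<mu>))" "f \<in> Hom (module_cat (A_quot \<mu>)) M N" for M N f
    using that Fm_hom by (simp add: module_cat_def)
  show "Fm M M (Ident (module_cat (A_quot \<mu>)) M) = Ident (module_cat A_cal) (Fo M)" for M
    by (auto simp: module_cat_def Fm_def fun_eq_iff Fo_sub)
  fix L M N :: "('k elt set, 'v) module" and f g
  assume "L \<in> Ob (module_cat (A_quot \<mu>))" "M \<in> Ob (module_cat (A_quot \<mu>))" "N \<in> Ob (module_cat (A_quot \<mu>))"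
    "f \<in> Hom (module_cat (A_quot \<mu>)) L M" "g \<in> Hom (module_cat (A_quot \<mu>)) M N"
  then have *: "left_module (A_quot \<mu>) L" "left_module (A_quot \<mu>) M" "f \<in> mod_hom (A_quot \<mu>) L M"
    by (simp_all add: module_cat_def)
  have "f v \<in> carrier (Fo M)" if "v \<in> carrier (Fo L)" for v
    using mod_homD(1)[OF Fm_hom[OF *] that] that by (simp add: Fm_def)
  then show "Fm L N (Comp (module_cat (A_quot \<mu>)) L M N g f) =
      Comp (module_cat A_cal) (Fo L) (Fo M) (Fo N) (Fm M N g) (Fm L M f)"
    by (auto simp: module_cat_def Fm_def fun_eq_iff compose_def Fo_sub)
qed

lemma functor_G: "cat_functor (module_cat A_cal) (module_cat (A_quot \<mu>)) Go Gm"
proof (intro cat_functor.intro cat_functor_axioms.intro category_module_cat)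
  show "Go V \<in> Ob (module_cat (A_quot \<mu>))" if "V \<in> Ob (module_cat A_cal)" for V
    using that Go_closed by (simp add: module_cat_def)
  show "Gm V W f \<in> Hom (module_cat (A_quot \<mu>)) (Go V) (Go W)"
    if "V \<in> Ob (module_cat A_cal)" "W \<in> Ob (module_cat A_cal)" "f \<in> Hom (module_cat A_cal) V W" for V W f
    using that Gm_hom by (simp add: module_cat_def)
  show "Gm V V (Ident (module_cat A_cal) V) = Ident (module_cat (A_quot \<mu>)) (Go V)" if "V \<in> Ob (module_cat A_cal)" for V
    using that \<iota> by (auto simp: module_cat_def Gm_def fun_eq_iff carrier_Go restrict_def)
  fix U V W :: "((nat \<times> 'k elt) set, 'v) module" and f g
  assume "U \<in> Ob (module_cat A_cal)" "V \<in> Ob (module_cat A_cal)" "W \<in> Ob (module_cat A_cal)"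
    "f \<in> Hom (module_cat A_cal) U V" "g \<in> Hom (module_cat A_cal) V W"
  then have *: "left_module A_cal U" "left_module A_cal V" "f \<in> mod_hom A_cal U V"
    by (simp_all add: module_cat_def)
  show "Gm U W (Comp (module_cat A_cal) U V W g f) =
      Comp (module_cat (A_quot \<mu>)) (Go U) (Go V) (Go W) (Gm V W g) (Gm U V f)"
    using * \<iota> mod_homD(1)[OF *(3)] by (auto simp: module_cat_def Gm_def fun_eq_iff carrier_Go compose_def)
qed

lemma unit_natural:
  "naturally_isomorphic (module_cat (A_quot \<mu>)) (module_cat (A_quot \<mu>))
     (\<lambda>M. Go (Fo M)) (\<lambda>M N f. Gm (Fo M) (Fo N) (Fm M N f)) (\<lambda>M. M) (\<lambda>M N f. f)"
  unfolding naturally_isomorphic_def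
proof (intro exI conjI ballI)
  let ?\<eta> = "\<lambda>M. quot_module.unit \<mu> M \<iota>"
  fix M :: "('k elt set, 'v) module" assume "M \<in> Ob (module_cat (A_quot \<mu>))"
  then have M: "left_module (A_quot \<mu>) M" by (simp add: module_cat_def)
  interpret M: quot_module \<mu> M \<iota> by (rule quot_module[OF M])
  show "cat_iso (module_cat (A_quot \<mu>)) (Go (Fo M)) M (?\<eta> M)"
    using M.unit_hom M.unit_bij unfolding Go_def Fo_def by (intro module_cat_iso M.I.left_module_Ind M)
  fix N :: "('k elt set, 'v) module" and f assume "N \<in> Ob (module_cat (A_quot \<mu>))" "f \<in> Hom (module_cat (A_quot \<mu>)) M N"
  then have N: "left_module (A_quot \<mu>) N" and f: "f \<in> mod_hom (A_quot \<mu>) M N" by (simp_all add: module_cat_def)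
  interpret N: quot_module \<mu> N \<iota> by (rule quot_module[OF N])
  note h = mod_homD[OF Fm_hom[OF M N f], unfolded Fm_def Fo_def]
  note fp = mod_homD[OF f[unfolded mod_hom_pull]]
  have fK: "f v \<in> N.P.B.K" if "v \<in> M.P.B.K" for v
    using h(1)[of v] that by simp
  \<comment> \<open>A homomorphism of \<open>A_cal\<close>-modules commutes with
    \<open>cal_t\<close>, which acts on the kernels as the inverse of \<open>s\<close>.\<close>
  have fsi: "f (M.P.B.si w) = N.P.B.si (f w)" if w: "w \<in> M.P.B.K" for w
    using h(3)[OF cal_gens_in(4), of w, unfolded M.P.K_module_simps(1), OF w]
    unfolding M.P.K_smult(3)[OF w] restrict_apply' [OF M.P.B.K_closed(6)[OF w]] restrict_apply'[OF w] N.P.K_smult(3)[OF fK[OF w]] .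
  have "?\<eta> N (Gm (Fo M) (Fo N) (Fm M N f) u) = f (?\<eta> M u)" if u: "u \<in> carrier (Go (Fo M))" for u
  proof -
    obtain v w where vw: "u = \<iota> (v, w)" "v \<in> M.P.B.K" "w \<in> M.P.B.K"
      using u[unfolded carrier_Go[OF Fo_closed[OF M]]] unfolding Fo_def M.P.K_module_simps(1) by blast
    have Gu: "Gm (Fo M) (Fo N) (Fm M N f) u = \<iota> (f v, f w)"
      unfolding vw(1) using vw(2,3) by (subst Gm_\<iota>[OF Fo_closed[OF M]]) (simp_all add: Fo_def Fm_def)
    have sc: "M.P.B.si w \<in> carrier (pull \<mu> M)" by (rule M.P.B.K_carrier[OF M.P.B.K_closed(6)[OF vw(3)]])
    have "f (v \<oplus>\<^bsub>pull \<mu> M\<^esub> elt_y \<odot>\<^bsub>pull \<mu> M\<^esub> M.P.B.si w) = f v \<oplus>\<^bsub>pull \<mu> N\<^esub> elt_y \<odot>\<^bsub>pull \<mu> N\<^esub> N.P.B.si (f w)"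
      unfolding fp(2)[OF M.P.B.K_carrier[OF vw(2)] M.P.rep.op_closed(2)[OF sc]] fp(3)[OF elts_closed(2) sc] fsi[OF vw(3)] ..
    then show ?thesis
      unfolding Gu N.unit_\<iota>[OF fK[OF vw(2)] fK[OF vw(3)]]
      unfolding vw(1) M.unit_\<iota>[OF vw(2,3)] restrict_scalars_simps(3) by (rule sym)
  qed
  then show "Comp (module_cat (A_quot \<mu>)) (Go (Fo M)) (Go (Fo N)) N (?\<eta> N) (Gm (Fo M) (Fo N) (Fm M N f)) =
      Comp (module_cat (A_quot \<mu>)) (Go (Fo M)) M N f (?\<eta> M)"
    by (auto simp: module_cat_def compose_def fun_eq_iff)
qed

lemma counit_natural:
  "naturally_isomorphic (module_cat A_cal) (module_cat A_cal)
     (\<lambda>V. Fo (Go V)) (\<lambda>V W f. Fm (Go V) (Go W) (Gm V W f)) (\<lambda>V. V) (\<lambda>V W f. f)"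
  unfolding naturally_isomorphic_def
proof (intro exI conjI ballI)
  let ?\<epsilon> = "\<lambda>V. induced.counit V \<mu> \<iota>"
  fix V :: "((nat \<times> 'k elt) set, 'v) module" assume "V \<in> Ob (module_cat A_cal)"
  then have V: "left_module A_cal V" by (simp add: module_cat_def)
  interpret V: induced V \<mu> \<iota> by (rule induced[OF V])
  show "cat_iso (module_cat A_cal) (Fo (Go V)) V (?\<epsilon> V)"
    using V.counit_hom V.counit_bij Fo_closed[OF Go_closed[OF V]] unfolding Go_def Fo_def by (intro module_cat_iso V)
  fix W :: "((nat \<times> 'k elt) set, 'v) module" and f assume "W \<in> Ob (module_cat A_cal)" "f \<in> Hom (module_cat A_cal) V W"
  then have W: "left_module A_cal W" and f: "f \<in> mod_hom A_cal V W" by (simp_all add: module_cat_def)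
  interpret W: induced W \<mu> \<iota> by (rule induced[OF W])
  have "?\<epsilon> W (Fm (Go V) (Go W) (Gm V W f) u) = f (?\<epsilon> V u)" if u: "u \<in> carrier (Fo (Go V))" for u
  proof -
    obtain v where v: "u = \<iota> (v, \<zero>\<^bsub>V\<^esub>)" "v \<in> carrier V" using u carrier_Fo_Go[OF V] by blast
    have "Fm (Go V) (Go W) (Gm V W f) u = \<iota> (f v, \<zero>\<^bsub>W\<^esub>)"
      using u v Gm_\<iota>[OF V, of v "\<zero>\<^bsub>V\<^esub>"] mod_hom_zero[OF V W f] V.M.zero_closed by (simp add: Fm_def)
    then show ?thesis using v V.counit_\<iota> W.counit_\<iota> mod_homD(1)[OF f] by simp
  qed
  then show "Comp (module_cat A_cal) (Fo (Go V)) (Fo (Go W)) W (?\<epsilon> W) (Fm (Go V) (Go W) (Gm V W f)) =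
      Comp (module_cat A_cal) (Fo (Go V)) V W f (?\<epsilon> V)"
    by (auto simp: module_cat_def compose_def fun_eq_iff)
qed

lemma equivalence: "is_equivalence (module_cat (A_quot \<mu>)) (module_cat A_cal) Fo Fm"
  unfolding is_equivalence_def using functor_F functor_G unit_natural counit_natural by blast

lemma classes_bij: "bij_betw (class_map A_cal Fo) (simple_classes (A_quot \<mu>)) (simple_classes A_cal)"
proof (rule class_map_bij[OF functor_F functor_G])
  fix M :: "('k elt set, 'v) module" assume M: "left_module (A_quot \<mu>) M"
  then interpret M: quot_module \<mu> M \<iota> by (rule quot_module)
  show "mod_isomorphic (A_quot \<mu>) (Go (Fo M)) M"
    using M.unit_hom M.unit_bij unfolding Go_def Fo_def mod_isomorphic_def by blast
  show "simple_module A_cal (Fo M) \<longleftrightarrow> simple_module (A_quot \<mu>) M"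
    unfolding Fo_def by (rule M.simple_K_module_iff)
next
  fix V :: "((nat \<times> 'k elt) set, 'v) module" assume V: "left_module A_cal V"
  then interpret V: induced V \<mu> \<iota> by (rule induced)
  show "mod_isomorphic A_cal (Fo (Go V)) V"
    using V.counit_hom V.counit_bij unfolding Go_def Fo_def mod_isomorphic_def by blast
qed

end


section \<open>Infinite-dimensional simple modules\<close>

lemma inflate_iso_class:
  fixes M :: "('k::field elt set, 'v) module"
  assumes "left_module (A_quot \<mu>) M"
  shows "inflate \<mu> (iso_class (A_quot \<mu>) M :: ('k elt set, 'v) module set) = iso_class A_alg (pull \<mu> M)"
  unfolding inflate_def
  by (rule class_map_iso_class[where F = "pull \<mu>", OF assms])
    (auto simp: mod_isomorphic_pull intro: A_module.axioms pull_A_module)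

lemma scalar_faithful:
  assumes "A_module M" "m \<in> carrier M" "m \<noteq> \<zero>\<^bsub>M\<^esub>" "A_scalar c \<odot>\<^bsub>M\<^esub> m = A_scalar d \<odot>\<^bsub>M\<^esub> m"
  shows "c = (d :: 'k::field)"
proof (rule ccontr)
  interpret A_module M by fact
  assume "c \<noteq> d"
  have "sm (c - d) m \<oplus>\<^bsub>M\<^esub> sm d m = sm d m" using assms(2,4) by (simp flip: sc.act_add_left)
  then have "sm (c - d) m = \<zero>\<^bsub>M\<^esub>" using assms(2) by (simp add: M.add.r_cancel_one)
  then have "sm (inverse (c - d)) (sm (c - d) m) = \<zero>\<^bsub>M\<^esub>" by (simp only: sc.act_zero_right)
  then show False using assms(2,3) \<open>c \<noteq> d\<close> by (simp flip: sc.act_mult)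
qed

text \<open>On a module over \<open>A_quot \<mu>\<close> the element \<open>C\<close> acts as
  \<open>\<mu>\<close>, and a nonzero module determines this scalar up to isomorphism of modules
  over \<open>A_alg\<close>; hence the union is disjoint. An infinite-dimensional simple module has
  such a nonzero scalar by \<open>simple_infinite_iff\<close>, so it factors through the
  corresponding quotient.\<close>

lemma inflate_bij:
  "bij_betw (\<lambda>(\<mu>, c). inflate \<mu> c)
     (SIGMA \<mu>:{\<mu>::'k::{alg_closed_field, field_char_0}. \<mu> \<noteq> 0}. simple_classes (A_quot \<mu>))
     (inf_dim_simple_classes A_scalar A_alg :: ('k elt, 'v) module set set)" (is "bij_betw ?F ?D ?I")
  unfolding bij_betw_def
proof
  have D: "\<exists>\<mu> (M :: ('k elt set, 'v) module). p = (\<mu>, iso_class (A_quot \<mu>) M) \<and> \<mu> \<noteq> 0 \<and> simple_module (A_quot \<mu>) M"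
    if "p \<in> ?D" for p
    using that unfolding simple_classes_def by blast
  show "inj_on ?F ?D"
  proof (rule inj_onI)
    fix p q assume p: "p \<in> ?D" and q: "q \<in> ?D" and eq: "?F p = ?F q"
    obtain \<mu> and M :: "('k elt set, 'v) module" where M: "p = (\<mu>, iso_class (A_quot \<mu>) M)" "simple_module (A_quot \<mu>) M"
      using D[OF p] by blast
    obtain \<nu> and N :: "('k elt set, 'v) module" where N: "q = (\<nu>, iso_class (A_quot \<nu>) N)" "simple_module (A_quot \<nu>) N"
      using D[OF q] by blast
    note Ml = simple_moduleD(1)[OF M(2)] and Nl = simple_moduleD(1)[OF N(2)]
    note MA = pull_A_module[OF Ml] and NA = pull_A_module[OF Nl]
    note MA' = A_module.axioms[OF MA] and NA' = A_module.axioms[OF NA]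
    have iso: "mod_isomorphic A_alg (pull \<mu> M) (pull \<nu> N)"
      using eq unfolding M(1) N(1) prod.case inflate_iso_class[OF Ml] inflate_iso_class[OF Nl] iso_class_eq_iff[OF MA' NA'] .
    then obtain f where f: "f \<in> mod_hom A_alg (pull \<mu> M) (pull \<nu> N)" "bij_betw f (carrier (pull \<mu> M)) (carrier (pull \<nu> N))"
      by (auto simp: mod_isomorphic_def)
    interpret PM: A_module "pull \<mu> M" by (rule MA)
    obtain m where m: "m \<in> carrier M" "m \<noteq> \<zero>\<^bsub>M\<^esub>" using M(2) by (rule simple_module_nonzero)
    have mc: "m \<in> carrier (pull \<mu> M)" using m by simp
    note fm = mod_homD(1)[OF f(1) mc]
    have "f m \<noteq> \<zero>\<^bsub>pull \<nu> N\<^esub>"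
      using f(2) m mod_hom_zero[OF MA' NA' f(1)] PM.M.zero_closed unfolding bij_betw_def inj_on_def by auto
    moreover have "A_scalar \<mu> \<odot>\<^bsub>pull \<nu> N\<^esub> f m = A_scalar \<nu> \<odot>\<^bsub>pull \<nu> N\<^esub> f m"
    proof -
      have "A_scalar \<mu> \<odot>\<^bsub>pull \<nu> N\<^esub> f m = f (A_scalar \<mu> \<odot>\<^bsub>pull \<mu> M\<^esub> m)"
        by (rule mod_homD(3)[OF f(1) _ mc, symmetric]) simp
      also have "\<dots> = f (elt_C \<odot>\<^bsub>pull \<mu> M\<^esub> m)" by (simp only: pull_C[OF Ml m(1)])
      also have "\<dots> = elt_C \<odot>\<^bsub>pull \<nu> N\<^esub> f m" by (rule mod_homD(3)[OF f(1) _ mc]) simp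
      also have "\<dots> = A_scalar \<nu> \<odot>\<^bsub>pull \<nu> N\<^esub> f m" by (rule pull_C[OF Nl]) (use fm in simp)
      finally show ?thesis .
    qed
    ultimately have \<mu>\<nu>: "\<mu> = \<nu>" using scalar_faithful[OF NA fm] by blast
    have "mod_isomorphic (A_quot \<mu>) M N" using iso unfolding \<mu>\<nu> mod_isomorphic_pull .
    then show "p = q" using iso_class_eq[OF Ml] Nl unfolding M(1) N(1) \<mu>\<nu> by blast
  qed
  show "?F ` ?D = ?I"
  proof (intro equalityI subsetI)
    fix d assume "d \<in> ?F ` ?D"
    then obtain p where p: "d = ?F p" "p \<in> ?D" by blast
    obtain \<mu> and M :: "('k elt set, 'v) module" where M: "p = (\<mu>, iso_class (A_quot \<mu>) M)" "\<mu> \<noteq> 0" "simple_module (A_quot \<mu>) M"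
      using D[OF p(2)] by blast
    note Ml = simple_moduleD(1)[OF M(3)]
    have s: "simple_module A_alg (pull \<mu> M)" using M(3) unfolding simple_pull[OF Ml] .
    have "\<not> finite_dim A_scalar (pull \<mu> M)"
      unfolding simple_infinite_iff[OF s] using M(2) pull_C[OF Ml] by (auto simp del: restrict_scalars_simps(4))
    moreover have "d = iso_class A_alg (pull \<mu> M)" unfolding p(1) M(1) prod.case by (rule inflate_iso_class[OF Ml])
    ultimately show "d \<in> ?I" using s unfolding inf_dim_simple_classes_def by blast
  next
    fix d assume "d \<in> ?I"
    then obtain M :: "('k elt, 'v) module" where M: "d = iso_class A_alg M" "simple_module A_alg M" "\<not> finite_dim A_scalar M"
      unfolding inf_dim_simple_classes_def by blast
    note Ml = simple_moduleD(1)[OF M(2)]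
    obtain \<mu> where \<mu>: "\<mu> \<noteq> 0" "\<And>m. m \<in> carrier M \<Longrightarrow> elt_C \<odot>\<^bsub>M\<^esub> m = A_scalar \<mu> \<odot>\<^bsub>M\<^esub> m"
      using M(3) simple_infinite_iff[OF M(2)] by blast
    let ?N = "factor_module M"
    have fc: "left_module (A_quot \<mu>) ?N"
      by (rule factor_central(1)[OF A_module.intro[OF Ml] \<mu>(2)])
    note Nl = A_module.axioms[OF pull_A_module[OF fc]]
    have iso: "mod_isomorphic A_alg M (pull \<mu> ?N)"
      by (rule mod_isomorphicI[where f = "\<lambda>m. m", OF Ml]) (simp_all add: factor_central(2)[OF A_module.intro[OF Ml] \<mu>(2)] bij_betw_def)
    have "simple_module (A_quot \<mu>) ?N"
      using simple_module_iso[OF M(2) Nl iso] unfolding simple_pull[OF fc] .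
    moreover have "d = ?F (\<mu>, iso_class (A_quot \<mu>) ?N)"
      unfolding M(1) prod.case inflate_iso_class[OF fc] by (rule iso_class_eq[OF Ml Nl iso])
    ultimately show "d \<in> ?F ` ?D"
      using \<mu>(1) unfolding simple_classes_def by (intro image_eqI) auto
  qed
qed

theorem theorem3p6:
  fixes emb :: "'k::{alg_closed_field, field_char_0} \<Rightarrow> 'v"
  assumes "inj emb"
  shows "(\<forall>\<gamma>::'k. \<gamma> \<noteq> 0 \<longrightarrow> has_dimension A_scalar (S_module \<gamma>) 1) \<and>
         ((fin_dim_simple_classes A_scalar A_alg :: ('k elt, 'v) module set set) =
           {iso_class A_alg (S_module \<gamma>) | \<gamma>. \<gamma> \<noteq> 0} \<union>
           {iso_class A_alg (T_module \<alpha> \<beta>) | \<alpha> \<beta>. \<alpha> \<noteq> 0 \<and> \<beta> \<noteq> 0}) \<and>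
         (\<forall>M :: ('k elt, 'v) module. simple_module A_alg M \<longrightarrow>
           (\<not> finite_dim A_scalar M \<longleftrightarrow>
             (\<exists>\<mu>. \<mu> \<noteq> 0 \<and> (\<forall>m\<in>carrier M. elt_C \<odot>\<^bsub>M\<^esub> m = A_scalar \<mu> \<odot>\<^bsub>M\<^esub> m)))) \<and>
         (bij_betw (\<lambda>(\<mu>, c). inflate \<mu> c)
           (SIGMA \<mu>:{\<mu>::'k. \<mu> \<noteq> 0}. simple_classes (A_quot \<mu>))
           (inf_dim_simple_classes A_scalar A_alg :: ('k elt, 'v) module set set)) \<and>
         (\<forall>\<mu>::'k. \<mu> \<noteq> 0 \<longrightarrow>
           (\<exists>(Fo :: ('k elt set, 'v) module \<Rightarrow> ((nat \<times> 'k elt) set, 'v) module) Fm.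
              is_equivalence (module_cat (A_quot \<mu>)) (module_cat A_cal) Fo Fm \<and>
              bij_betw (class_map A_cal Fo) (simple_classes (A_quot \<mu>)) (simple_classes A_cal)))"
proof (intro conjI allI impI)
  show "has_dimension A_scalar (S_module \<gamma>) 1" if "\<gamma> \<noteq> 0" for \<gamma> :: 'k
    by (rule S_setup.dimension_S[OF S_setup.intro[OF that]])
  fix \<mu> :: 'k assume \<mu>: "\<mu> \<noteq> 0"
  \<comment> \<open>Since \<open>emb\<close> makes the universe infinite, pairs of its elements can
    be coded by single elements; the inverse functor needs this to stay inside the universe.\<close>
  obtain \<iota> :: "'v \<times> 'v \<Rightarrow> 'v" where "inj \<iota>" using exists_pairing[OF inj_infinite[OF assms]] by blast
  then interpret quotient_equivalence \<mu> \<iota> using \<mu> by unfold_locales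
  show "\<exists>(Fo :: ('k elt set, 'v) module \<Rightarrow> ((nat \<times> 'k elt) set, 'v) module) Fm.
      is_equivalence (module_cat (A_quot \<mu>)) (module_cat A_cal) Fo Fm \<and>
      bij_betw (class_map A_cal Fo) (simple_classes (A_quot \<mu>)) (simple_classes A_cal)"
    using equivalence classes_bij by blast
qed (rule fin_dim_simple_classes_A[OF assms] simple_infinite_iff inflate_bij; assumption?)+

end
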